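(* Let $k\ge 1$. There exists a positive constant $C$, independent of the mesh size $h$, such that $$\sup_{0\neq \tau_h\in\Sigma_{k,h}}\frac{(\operatorname{div}\tau_h,v_h)}{\|\tau_h\|_{H(\operatorname{div},\Omega)}}\ \ge\ C\,\|v_h\|_{0,\Omega}\qquad\text{for any } v_h\in V_{k,h}.$$
   Context: Domain and mesh. $\Omega=\Omega_{xy}\times\Omega_z\subset\mathbb{R}^3$, where $\Omega_{xy}$ is a polygon in the $(x,y)$-plane and $\Omega_z$ is an interval on the $z$-axis. $\mathcal{X}_h$ is a partition of $\Omega_{xy}$ into triangles $\Delta_{xy}$, $\mathcal{Z}_h$ is a partition of $\Omega_z$ into intervals $\Delta_z$, and $\mathcal{T}_h=\{K=\Delta_{xy}\times\Delta_z:\Delta_{xy}\in\mathcal{X}_h,\Delta_z\in\mathcal{Z}_h\}$ is the resulting partition of $\Omega$ into non-overlapping shape-regular triangular prisms, with mesh size $h$, such that the non-empty intersection of any two distinct elements is a single common vertex, edge or face. Constants "independent of $h$" may depend on $\Omega$, on $k$ and on the shape-regularity of the mesh family. Notation. $\mathbb{S}$ is the space of symmetric $3\times3$ real matrices and $\mathbb{S}_2$ the space of symmetric $2\times 2$ real matrices. $\operatorname{div}$ of a matrix field is taken row-wise; $\operatorname{div}_{xy}$ is the (row-wise) divergence in $x,y$ only. $(\cdot,\cdot)$ is the $L^2(\Omega)$ inner product, $\|\cdot\|_{m,\omega}$ the $H^m(\omega)$ norm, and $\|\tau\|^2_{H(\operatorname{div},\Omega)}=\|\tau\|_{0,\Omega}^2+\|\operatorname{div}\tau\|_{0,\Omega}^2$.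 $P_m(\omega;X)$ denotes polynomials of total degree at most $m$ on $\omega$ with values in $X$; $P_m(x,y)$ and $P_m(z)$ are the real polynomials of degree at most $m$ in $(x,y)$ and in $z$, respectively. A product "$A\times B$" of a space $A$ of functions of $(x,y)$ and a space $B$ of functions of $z$ means the tensor product, i.e. the span of all products $a(x,y)b(z)$, $a\in A$, $b\in B$. $H(\operatorname{div}_{xy},\Omega_{xy};X)$ is the space of square-integrable $X$-valued functions on $\Omega_{xy}$ with square-integrable $\operatorname{div}_{xy}$, for $X=\mathbb{S}_2$ or $\mathbb{R}^2$. Spaces in one and two dimensions. - For $s=0,1$ and $m\ge s$: $\mathcal{L}^s_m(\mathcal{Z}_h)=\{v\in H^s(\Omega_z;\mathbb{R}): v|_{\Delta_z}\in P_m(z)\ \forall \Delta_z\in\mathcal{Z}_h\}$ (with $H^0=L^2$). For $m\ge0$: $\mathcal{L}^0_m(\mathcal{X}_h)=\{v\in L^2(\Omega_{xy};\mathbb{R}): v|_{\Delta_{xy}}\in P_m(x,y)\ \forall\Delta_{xy}\in\mathcal{X}_h\}$. - For a triangle $\Delta_{xy}$ with vertices $\boldsymbol{x}_1,\boldsymbol{x}_2,\boldsymbol{x}_3$, barycentric coordinates $\lambda_1,\lambda_2,\lambda_3$ and $\boldsymbol{t}_{i,j}=\boldsymbol{x}_j-\boldsymbol{x}_i$, set $H_{\Delta_{xy},m,b}=\sum_{1\le i<j\le3}\lambda_i\lambda_jP_{m-2}(\Delta_{xy};\mathbb{R})\,\boldsymbol{t}_{i,j}\boldsymbol{t}_{i,j}^T$.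 For $m\ge3$, $H_{m,h}=\{\tau\in H(\operatorname{div}_{xy},\Omega_{xy};\mathbb{S}_2):\tau=\tau_c+\tau_b,\ \tau_c\in H^1(\Omega_{xy};\mathbb{S}_2),\ \tau_c|_{\Delta_{xy}}\in P_m(\Delta_{xy};\mathbb{S}_2),\ \tau_b|_{\Delta_{xy}}\in H_{\Delta_{xy},m,b}\ \forall\Delta_{xy}\in\mathcal{X}_h\}$. - For $m\ge1$: $\mathrm{BDM}_m=\{\tau\in H(\operatorname{div}_{xy},\Omega_{xy};\mathbb{R}^2):\tau|_{\Delta_{xy}}\in P_m(\Delta_{xy};\mathbb{R}^2)\ \forall\Delta_{xy}\in\mathcal{X}_h\}$. Discrete spaces on $\Omega$ ($k\ge1$). $\Sigma_{k,h}$ is the space of all $\tau=(\tau_{ij})_{i,j=1}^3\in L^2(\Omega;\mathbb{S})$ such that $\begin{pmatrix}\tau_{11}&\tau_{12}\\ \tau_{21}&\tau_{22}\end{pmatrix}\in H_{k+2,h}\times\mathcal{L}^0_k(\mathcal{Z}_h)$, $(\tau_{13},\tau_{23})^T\in\mathrm{BDM}_{k+1}\times\mathcal{L}^1_{k+1}(\mathcal{Z}_h)$, and $\tau_{33}\in\mathcal{L}^0_k(\mathcal{X}_h)\times\mathcal{L}^1_{k+2}(\mathcal{Z}_h)$. (One has $\Sigma_{k,h}\subset H(\operatorname{div},\Omega;\mathbb{S})$.) $V_{k,h}=\{v\in L^2(\Omega;\mathbb{R}^3): v|_K\in V_k(K)\ \forall K\in\mathcal{T}_h\}$, where $V_k(K)$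 consists of all $v=(v_1,v_2,v_3)^T$ on $K$ with $v_1,v_2\in P_{k+1}(x,y)\times P_k(z)$ and $v_3\in P_k(x,y)\times P_{k+1}(z)$. *)

theory Defs
  imports "HOL-Analysis.Analysis" "HOL-Computational_Algebra.Polynomial"
begin
text \<open>Elements of the function spaces below are functions on the whole space; only their values
  almost everywhere on the indicated domain matter.\<close>

definition L2 :: "'a::euclidean_space set \<Rightarrow> ('a \<Rightarrow> 'b::euclidean_space) set" where
  "L2 U = {f. f \<in> borel_measurable (lebesgue_on U) \<and>
              integrable (lebesgue_on U) (\<lambda>x. (norm (f x))\<^sup>2)}"

text \<open>For matrix-valued functions, inner product and norm are those of Frobenius.\<close>

definition L2_inner ::
    "'a::euclidean_space set \<Rightarrow> ('a \<Rightarrow> 'b::euclidean_space) \<Rightarrow> ('a \<Rightarrow> 'b) \<Rightarrow> real" where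
  "L2_inner U f g = (LINT x|lebesgue_on U. f x \<bullet> g x)"

definition L2_norm :: "'a::euclidean_space set \<Rightarrow> ('a \<Rightarrow> 'b::euclidean_space) \<Rightarrow> real" where
  "L2_norm U f = sqrt (LINT x|lebesgue_on U. (norm (f x))\<^sup>2)"

definition pd :: "'a::euclidean_space \<Rightarrow> ('a \<Rightarrow> real) \<Rightarrow> 'a \<Rightarrow> real" where
  "pd b f x = frechet_derivative f (at x) b"

definition grad :: "('a::euclidean_space \<Rightarrow> real) \<Rightarrow> 'a \<Rightarrow> 'a" where
  "grad f x = (\<Sum>b\<in>Basis. pd b f x *\<^sub>R b)"

primrec C_k :: "nat \<Rightarrow> ('a::euclidean_space \<Rightarrow> real) \<Rightarrow> bool" where
  "C_k 0 f \<longleftrightarrow> continuous_on UNIV f"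
| "C_k (Suc n) f \<longleftrightarrow> (\<forall>x. f differentiable (at x)) \<and> (\<forall>b\<in>Basis. C_k n (pd b f))"

definition test_functions :: "'a::euclidean_space set \<Rightarrow> ('a \<Rightarrow> real) set" where
  "test_functions U = {\<phi>. (\<forall>n. C_k n \<phi>) \<and>
     compact (closure {x. \<phi> x \<noteq> 0}) \<and> closure {x. \<phi> x \<noteq> 0} \<subseteq> U}"

definition is_weak_pd :: "'a::euclidean_space set \<Rightarrow> 'a \<Rightarrow>
    ('a \<Rightarrow> 'b::euclidean_space) \<Rightarrow> ('a \<Rightarrow> 'b) \<Rightarrow> bool" where
  "is_weak_pd U b f g \<longleftrightarrow> (\<forall>\<phi>\<in>test_functions U.
     (LINT x|lebesgue_on U. pd b \<phi> x *\<^sub>R f x) = - (LINT x|lebesgue_on U. \<phi> x *\<^sub>R g x))"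

definition H1 :: "'a::euclidean_space set \<Rightarrow> ('a \<Rightarrow> 'b::euclidean_space) set" where
  "H1 U = {f \<in> L2 U. \<forall>b\<in>Basis. \<exists>g\<in>L2 U. is_weak_pd U b f g}"

definition is_weak_div ::
    "'a::euclidean_space set \<Rightarrow> ('a \<Rightarrow> 'a) \<Rightarrow> ('a \<Rightarrow> real) \<Rightarrow> bool" where
  "is_weak_div U f g \<longleftrightarrow> (\<forall>\<phi>\<in>test_functions U.
     (LINT x|lebesgue_on U. f x \<bullet> grad \<phi> x) = - (LINT x|lebesgue_on U. g x * \<phi> x))"

definition Hdiv :: "'a::euclidean_space set \<Rightarrow> ('a \<Rightarrow> 'a) set" where
  "Hdiv U = {f \<in> L2 U. \<exists>g\<in>L2 U. is_weak_div U f g}"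

definition is_weak_row_div :: "(real^'n) set \<Rightarrow> (real^'n \<Rightarrow> real^'n^'n) \<Rightarrow>
    (real^'n \<Rightarrow> real^'n) \<Rightarrow> bool" where
  "is_weak_row_div U \<tau> g \<longleftrightarrow> (\<forall>i. is_weak_div U (\<lambda>x. \<tau> x $ i) (\<lambda>x. g x $ i))"

definition sym_valued :: "(real^'n) set \<Rightarrow> (real^'n \<Rightarrow> real^'m^'m) set" where
  "sym_valued U = {\<tau>. AE x in lebesgue_on U. transpose (\<tau> x) = \<tau> x}"

definition Hdiv_sym :: "(real^'n) set \<Rightarrow> (real^'n \<Rightarrow> real^'n^'n) set" where
  "Hdiv_sym U = {\<tau> \<in> L2 U \<inter> sym_valued U. \<exists>g\<in>L2 U. is_weak_row_div U \<tau> g}"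

text \<open>The square-integrable weak divergence is unique up to null sets, so that the choice below
  does not influence any integral.\<close>

definition row_div :: "(real^'n) set \<Rightarrow> (real^'n \<Rightarrow> real^'n^'n) \<Rightarrow> real^'n \<Rightarrow> real^'n" where
  "row_div U \<tau> = (SOME g. g \<in> L2 U \<and> is_weak_row_div U \<tau> g)"

definition Hdiv_norm :: "(real^'n) set \<Rightarrow> (real^'n \<Rightarrow> real^'n^'n) \<Rightarrow> real" where
  "Hdiv_norm U \<tau> = sqrt ((L2_norm U \<tau>)\<^sup>2 + (L2_norm U (row_div U \<tau>))\<^sup>2)"

fun polyline :: "(real^2) list \<Rightarrow> real \<Rightarrow> real^2" where
  "polyline [] = linepath 0 0"
| "polyline [p] = linepath p p"
| "polyline [p, q] = linepath p q"
| "polyline (p # q # r # vs) = linepath p q +++ polyline (q # r # vs)"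

text \<open>A polygon is the open region enclosed by a simple closed polygonal line.\<close>

definition polygon :: "(real^2) set \<Rightarrow> bool" where
  "polygon U \<longleftrightarrow> (\<exists>vs. simple_path (polyline (vs @ [hd vs])) \<and>
                       U = inside (path_image (polyline (vs @ [hd vs]))))"

definition xy :: "real^3 \<Rightarrow> real^2" where
  "xy p = vector [p $ 1, p $ 2]"

definition cyl :: "(real^2) set \<Rightarrow> real set \<Rightarrow> (real^3) set" where
  "cyl A I = {p. xy p \<in> A \<and> p $ 3 \<in> I}"

definition partition_into :: "'a::euclidean_space set \<Rightarrow> 'a set set \<Rightarrow> bool" where
  "partition_into U M \<longleftrightarrow> finite M \<and> \<Union>M = closure U \<and>
     pairwise (\<lambda>S T. interior S \<inter> interior T = {}) M"

definition prisms :: "(real^2) set set \<Rightarrow> real set set \<Rightarrow> (real^3) set set" where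
  "prisms X Z = {cyl T I |T I. T \<in> X \<and> I \<in> Z}"

text \<open>The nonempty proper faces of a prism are its vertices, edges and (two-dimensional) faces.\<close>

definition conforming :: "'a::euclidean_space set set \<Rightarrow> bool" where
  "conforming M \<longleftrightarrow> (\<forall>K\<in>M. \<forall>K'\<in>M. K \<noteq> K' \<and> K \<inter> K' \<noteq> {} \<longrightarrow>
     K \<inter> K' \<noteq> K \<and> K \<inter> K' \<noteq> K' \<and> (K \<inter> K') face_of K \<and> (K \<inter> K') face_of K')"

definition shape_regular :: "real \<Rightarrow> 'a::euclidean_space set set \<Rightarrow> bool" where
  "shape_regular \<gamma> M \<longleftrightarrow> (\<forall>K\<in>M. \<exists>c r. 0 < r \<and> cball c r \<subseteq> K \<and> diameter K \<le> \<gamma> * (2 * r))"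

definition prism_mesh ::
    "real \<Rightarrow> (real^2) set \<Rightarrow> real set \<Rightarrow> (real^2) set set \<Rightarrow> real set set \<Rightarrow> bool" where
  "prism_mesh \<gamma> Uxy Uz X Z \<longleftrightarrow>
     partition_into Uxy X \<and> (\<forall>T\<in>X. 2 simplex T) \<and>
     partition_into Uz Z \<and> (\<forall>I\<in>Z. \<exists>c d. c < d \<and> I = {c..d}) \<and>
     conforming (prisms X Z) \<and> shape_regular \<gamma> (prisms X Z)"

definition Pz :: "nat \<Rightarrow> (real \<Rightarrow> real) set" where
  "Pz m = {poly q |q. degree q \<le> m}"

definition Pxy :: "nat \<Rightarrow> (real^2 \<Rightarrow> real) set" where
  "Pxy m = {f. \<exists>c :: nat \<Rightarrow> nat \<Rightarrow> real.
     \<forall>p. f p = (\<Sum>(i, j)\<in>{(i, j). i + j \<le> m}. c i j * (p $ 1) ^ i * (p $ 2) ^ j)}"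

definition Pxy_vec :: "nat \<Rightarrow> (real^2 \<Rightarrow> real^2) set" where
  "Pxy_vec m = {f. \<forall>i. (\<lambda>p. f p $ i) \<in> Pxy m}"

definition Pxy_sym :: "nat \<Rightarrow> (real^2 \<Rightarrow> real^2^2) set" where
  "Pxy_sym m = {f. (\<forall>i j. (\<lambda>p. f p $ i $ j) \<in> Pxy m) \<and> (\<forall>p. transpose (f p) = f p)}"

definition restricts_into ::
    "('a::euclidean_space \<Rightarrow> 'b) \<Rightarrow> 'a set \<Rightarrow> ('a \<Rightarrow> 'b) set \<Rightarrow> bool" where
  "restricts_into f D F \<longleftrightarrow> (\<exists>g\<in>F. AE x in lebesgue_on D. f x = g x)"

definition piecewise ::
    "('a::euclidean_space \<Rightarrow> 'b) set \<Rightarrow> 'a set set \<Rightarrow> ('a \<Rightarrow> 'b) set \<Rightarrow> ('a \<Rightarrow> 'b) set" where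
  "piecewise S M F = {v \<in> S. \<forall>D\<in>M. restricts_into v D F}"

text \<open>Membership is up to null sets of \<open>D\<close>, as for all function spaces here.\<close>

definition tensor :: "(real^3) set \<Rightarrow> (real^2 \<Rightarrow> 'b::real_vector) set \<Rightarrow> (real \<Rightarrow> real) set \<Rightarrow>
    (real^3 \<Rightarrow> 'b) set" where
  "tensor D A B = {f. \<exists>(n::nat) a b. (\<forall>i<n. a i \<in> A \<and> b i \<in> B) \<and>
     (AE p in lebesgue_on D. f p = (\<Sum>i<n. b i (p $ 3) *\<^sub>R a i (xy p)))}"

definition barycentric :: "(nat \<Rightarrow> real^2) \<Rightarrow> (nat \<Rightarrow> real^2 \<Rightarrow> real) \<Rightarrow> bool" where
  "barycentric x \<mu> \<longleftrightarrow> (\<forall>p. (\<Sum>i=1..3. \<mu> i p) = 1 \<and> (\<Sum>i=1..3. \<mu> i p *\<^sub>R x i) = p)"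

definition outer :: "real^'n \<Rightarrow> real^'n^'n" where
  "outer t = (\<chi> i j. t $ i * t $ j)"

text \<open>Only \<open>m \<ge> 3\<close> occurs below, so that \<open>m - 2\<close> is not truncated. The vertices are numbered
  1, 2, 3; the space does not depend on the numbering.\<close>

definition bubbles :: "(real^2) set \<Rightarrow> nat \<Rightarrow> (real^2 \<Rightarrow> real^2^2) set" where
  "bubbles T m = {\<tau>. \<exists>x \<mu> q. T = convex hull (x ` {1..3}) \<and> barycentric x \<mu> \<and>
     (\<forall>i j. q i j \<in> Pxy (m - 2)) \<and>
     (\<forall>p. \<tau> p = (\<Sum>i=1..3. \<Sum>j\<in>{i<..3}. (\<mu> i p * \<mu> j p * q i j p) *\<^sub>R outer (x j - x i)))}"

definition H_h :: "nat \<Rightarrow> (real^2) set \<Rightarrow> (real^2) set set \<Rightarrow> (real^2 \<Rightarrow> real^2^2) set" where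
  "H_h m Uxy X = {\<tau> \<in> Hdiv_sym Uxy. \<exists>\<tau>c \<tau>b.
     (AE p in lebesgue_on Uxy. \<tau> p = \<tau>c p + \<tau>b p) \<and>
     \<tau>c \<in> H1 Uxy \<inter> sym_valued Uxy \<and>
     (\<forall>T\<in>X. restricts_into \<tau>c T (Pxy_sym m) \<and> restricts_into \<tau>b T (bubbles T m))}"

definition BDM :: "nat \<Rightarrow> (real^2) set \<Rightarrow> (real^2) set set \<Rightarrow> (real^2 \<Rightarrow> real^2) set" where
  "BDM m Uxy X = piecewise (Hdiv Uxy) X (Pxy_vec m)"

definition Sigma_h :: "nat \<Rightarrow> (real^2) set \<Rightarrow> real set \<Rightarrow> (real^2) set set \<Rightarrow> real set set \<Rightarrow>
    (real^3 \<Rightarrow> real^3^3) set" where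
  "Sigma_h k Uxy Uz X Z = {\<tau> \<in> L2 (cyl Uxy Uz) \<inter> sym_valued (cyl Uxy Uz).
     (\<lambda>p. vector [vector [\<tau> p $ 1 $ 1, \<tau> p $ 1 $ 2], vector [\<tau> p $ 2 $ 1, \<tau> p $ 2 $ 2]])
       \<in> tensor (cyl Uxy Uz) (H_h (k + 2) Uxy X) (piecewise (L2 Uz) Z (Pz k)) \<and>
     (\<lambda>p. vector [\<tau> p $ 1 $ 3, \<tau> p $ 2 $ 3])
       \<in> tensor (cyl Uxy Uz) (BDM (k + 1) Uxy X) (piecewise (H1 Uz) Z (Pz (k + 1))) \<and>
     (\<lambda>p. \<tau> p $ 3 $ 3)
       \<in> tensor (cyl Uxy Uz) (piecewise (L2 Uxy) X (Pxy k)) (piecewise (H1 Uz) Z (Pz (k + 2)))}"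

definition V_h :: "nat \<Rightarrow> (real^2) set \<Rightarrow> real set \<Rightarrow> (real^2) set set \<Rightarrow> real set set \<Rightarrow>
    (real^3 \<Rightarrow> real^3) set" where
  "V_h k Uxy Uz X Z = {v \<in> L2 (cyl Uxy Uz). \<forall>K\<in>prisms X Z.
     (\<lambda>p. v p $ 1) \<in> tensor K (Pxy (k + 1)) (Pz k) \<and>
     (\<lambda>p. v p $ 2) \<in> tensor K (Pxy (k + 1)) (Pz k) \<and>
     (\<lambda>p. v p $ 3) \<in> tensor K (Pxy k) (Pz (k + 1))}"

end

theory Submission
 imports Defs "HOL-Analysis.Analysis"
begin

text \<open>The condition follows once every \<open>v\<close> in \<open>V_h\<close> is the divergence of some \<open>\<tau>\<close> in \<open>Sigma_h\<close> with
  \<open>\<parallel>\<tau>\<parallel>\<^sup>2 \<le> K \<parallel>v\<parallel>\<^sup>2\<close>, where \<open>K\<close> depends on the domain, the degree and the shape regularity only: for this \<open>\<tau>\<close> the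
  quotient is at least \<open>\<parallel>v\<parallel> / sqrt (K + 1)\<close>. The lemma \<open>V_h_solution\<close> provides \<open>\<tau>\<close>. Its components \<open>(1,3)\<close> and
  \<open>(2,3)\<close> vanish, its component \<open>(3,3)\<close> is the antiderivative of \<open>v\<^sub>3\<close> in the vertical direction, and its plane block
  is obtained at every height by a linear operator \<open>S\<close> from the two horizontal components of \<open>v\<close>. Since \<open>S\<close> is linear and
  does not depend on the height, the block is again a sum of tensor products.

  The operator \<open>S\<close> is a bounded right inverse of the plane divergence, from discontinuous vector fields of degree
  \<open>k + 1\<close> to \<open>H_h (k + 2)\<close>. It has two parts. On a single triangle the divergences of bubble fields are exactly
  the polynomial fields orthogonal to the rigid motions (\<open>reference_right_inverse\<close>, \<open>bubble_inverse_exists\<close>). So it remains to find a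
  continuous field whose divergence has the same rigid motion moments as the data on each triangle. It is a combination of the
  fields \<open>\<phi>\<^sub>a\<^sup>2 \<phi>\<^sub>b A\<close> for the directed edges \<open>(a, b)\<close>, with hat functions \<open>\<phi>\<close> and symmetric matrices \<open>A\<close>; only the
  product of \<open>A\<close> with the normal of the edge matters (\<open>edge_moment\<close>). The moments over a triangle must be
  split into contributions of its edges that are opposite to those of the neighbours. An explicit splitting integrates the
  first component of the data over the part of a horizontal strip on one side of the edge, and the second component over a vertical
  strip (\<open>shadow_sum\<close>, \<open>tri_moment\<close>).

  The contribution of an edge is bounded by the norm of the data on a strip of width comparable to the mesh size \<open>h\<close>, and a
  point lies in at most a multiple of \<open>1/h\<close> strips (\<open>strip_sum\<close>, \<open>mT_sum_bound\<close>). This count requires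
  quasi-uniformity, which holds because each triangle forms a shape-regular prism with every interval
  (\<open>prism_mesh_mesh2\<close>).

  All fields are sums of fields \<open>f p *\<^sub>R t\<close> of constant direction \<open>t\<close> with \<open>f\<close>
  Lipschitz along \<open>t\<close> (\<open>dlip\<close>, \<open>flux\<close>), whose weak divergence is the derivative of \<open>f\<close>
  along \<open>t\<close>. Smooth bumps show that the square-integrable weak divergence is unique, so that
  \<open>row_div\<close> is the constructed one.\<close>

section \<open>Functions differentiable along one direction\<close>

lemma integral_lebesgue_on_borel:
 fixes f :: "'a::euclidean_space => 'b::euclidean_space"
 assumes "f \<in> borel_measurable borel" "U \<in> sets borel"
 shows "(LINT x|lebesgue_on U. f x) = (LINT x|lborel. indicator U x *\<^sub>R f x)"
  and "integrable (lebesgue_on U) f \<longleftrightarrow> integrable lborel (\<lambda>x. indicator U x *\<^sub>R f x)"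
proof -
 have m: "(\<lambda>x. indicator U x *\<^sub>R f x) \<in> borel_measurable lborel"
  using assms by simp
 have U: "U \<inter> space lebesgue \<in> sets lebesgue" using assms by auto
 show "(LINT x|lebesgue_on U. f x) = (LINT x|lborel. indicator U x *\<^sub>R f x)"
  using integral_restrict_space[OF U, of f] integral_completion[OF m] by simp
 show "integrable (lebesgue_on U) f \<longleftrightarrow> integrable lborel (\<lambda>x. indicator U x *\<^sub>R f x)"
  using integrable_restrict_space[OF U, of f] integrable_completion[OF m] by simp
qed

lemma AE_lebesgue_on_iff:
 assumes "U \<in> sets borel"
 shows "(AE x in lebesgue_on U. P x) \<longleftrightarrow> (AE x in lborel. x \<in> U --> P x)"
proof -
 have "(AE x in lebesgue_on U. P x) \<longleftrightarrow> (AE x in lebesgue. x \<in> U --> P x)"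
  using assms by (subst AE_restrict_space_iff) auto
 then show ?thesis by (simp add: AE_completion_iff)
qed

lemma bounded_borel_integrable:
 fixes f :: "'a::euclidean_space => 'b::euclidean_space"
 assumes f: "f \<in> borel_measurable borel" and U: "U \<in> sets borel" "bounded U"
  and B: "!!x. x \<in> U ==> norm (f x) <= B"
 shows "integrable lborel (\<lambda>x. indicator U x *\<^sub>R f x)"
proof -
 have fin: "emeasure lborel U < \<infinity>" using U(2) by (rule emeasure_bounded_finite)
 have "integrable lborel (\<lambda>x. B * indicator U x :: real)"
  using U(1) fin by simp
 then show ?thesis
 proof (rule Bochner_Integration.integrable_bound)
  show "(\<lambda>x. indicator U x *\<^sub>R f x) \<in> borel_measurable lborel" using f U by simp
  show "AE x in lborel. norm (indicator U x *\<^sub>R f x) <= norm (B * indicator U x :: real)"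
   by (rule AE_I2) (auto simp: indicator_def intro: order_trans[OF B])
 qed
qed

lemma bounded_borel_L2:
 fixes f :: "'a::euclidean_space => 'b::euclidean_space"
 assumes f: "f \<in> borel_measurable borel" and U: "U \<in> sets borel" "bounded U"
  and B: "!!x. x \<in> U ==> norm (f x) <= B"
 shows "f \<in> L2 U"
proof -
 have 1: "f \<in> borel_measurable (lebesgue_on U)"
  using f by (auto intro!: measurable_restrict_space1 borel_measurable_if_I
    measurable_completion)
 have "integrable lborel (\<lambda>x. indicator U x *\<^sub>R (norm (f x))\<^sup>2)"
  using f U by (intro bounded_borel_integrable[where B="B\<^sup>2"])
   (auto intro!: power_mono B)
 then show ?thesis
  using 1 f U by (simp add: L2_def integral_lebesgue_on_borel)
qed

text \<open>The difference quotients of \<open>\<psi>\<close> in a fixed direction have integral zero because Lebesgue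
  measure is invariant under translations, and the Lipschitz bound dominates them. This takes
  the place of boundary terms for functions that are glued from pieces.\<close>

lemma integral_directional_derivative_zero:
 fixes \<psi> :: "'a::euclidean_space => real"
 assumes m: "\<psi> \<in> borel_measurable borel" and mD: "D \<in> borel_measurable borel"
  and bd: "!!x. \<bar>\<psi> x\<bar> <= B"
  and supp: "!!x. norm x > R ==> \<psi> x = 0"
  and \<delta>: "\<delta> > 0" and L: "L \<ge> 0"
  and lip: "!!x h. \<bar>h\<bar> < \<delta> ==> \<bar>\<psi> (x + h *\<^sub>R t) - \<psi> x\<bar> <= L * \<bar>h\<bar>"
  and deriv: "AE x in lborel. ((\<lambda>h. \<psi> (x + h *\<^sub>R t)) has_real_derivative D x) (at 0)"
 shows "(LINT x|lborel. D x) = 0"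
proof -
 obtain N0 :: nat where N0: "1 / real (Suc N0) < \<delta>" using \<delta> by (meson nat_approx_posE)
 define h where "h n = 1 / real (Suc (n + N0))" for n
 have h0: "h n > 0" and hd: "h n < \<delta>" and h1: "h n <= 1" for n
 proof -
  show "h n > 0" by (simp add: h_def)
  have "h n <= 1 / real (Suc N0)" unfolding h_def by (rule divide_left_mono) auto
  then show "h n < \<delta>" using N0 by simp
  show "h n <= 1" by (simp add: h_def)
 qed
 define R' where "R' = \<bar>R\<bar> + norm t"
 define s where "s n x = (\<psi> (x + h n *\<^sub>R t) - \<psi> x) / h n" for n x
 have int\<psi>: "integrable lborel \<psi>"
 proof -
  have "integrable lborel (\<lambda>x. indicator (cball 0 \<bar>R\<bar>) x *\<^sub>R \<psi> x)"
   by (rule bounded_borel_integrable[where B=B]) (use m bd in auto)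
  moreover have "(\<lambda>x. indicator (cball 0 \<bar>R\<bar>) x *\<^sub>R \<psi> x) = \<psi>"
   using supp by (fastforce simp: indicator_def)
  ultimately show ?thesis by simp
 qed
 have int0: "(LINT x|lborel. s n x) = 0" for n
 proof -
  have d: "lborel = distr lborel borel (\<lambda>x::'a. h n *\<^sub>R t + x)"
   using lborel_distr_plus[of "h n *\<^sub>R t"] by simp
  have i: "integrable lborel (\<lambda>x. \<psi> (h n *\<^sub>R t + x))"
   using int\<psi> m by (subst (asm) d, subst (asm) integrable_distr_eq) auto
  have e: "(LINT x|lborel. \<psi> (h n *\<^sub>R t + x)) = (LINT x|lborel. \<psi> x)"
   using m by (subst (2) d, subst integral_distr) auto
  show ?thesis unfolding s_def using i e int\<psi> by (simp add: add.commute)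
 qed
 have "(\<lambda>n. LINT x|lborel. s n x) \<longlonglongrightarrow> (LINT x|lborel. D x)"
 proof (rule integral_dominated_convergence[where w="\<lambda>x. L * indicator (cball 0 R') x"])
  show "D \<in> borel_measurable lborel" using mD by simp
  show "s n \<in> borel_measurable lborel" for n unfolding s_def using m by measurable
  show "integrable lborel (\<lambda>x. L * indicator (cball (0::'a) R') x)"
   using bounded_borel_integrable[of "\<lambda>_. L" "cball (0::'a) R'" "\<bar>L\<bar>"] by (simp add: mult.commute)
  show "AE x in lborel. (\<lambda>n. s n x) \<longlonglongrightarrow> D x"
   using deriv
  proof eventually_elim
   case (elim x)
   have "((\<lambda>k. (\<psi> (x + (0 + k) *\<^sub>R t) - \<psi> (x + 0 *\<^sub>R t)) / k) \<longlongrightarrow> D x) (at 0)"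
    using elim unfolding DERIV_def by simp
   moreover have "filterlim h (at 0) sequentially"
    unfolding filterlim_at
   proof safe
    show "h \<longlonglongrightarrow> 0" unfolding h_def
     by (rule LIMSEQ_ignore_initial_segment[where k=N0]) (use LIMSEQ_inverse_real_of_nat in \<open>simp add: inverse_eq_divide\<close>)
    show "\<forall>\<^sub>F n in sequentially. h n \<in> UNIV \<and> h n ~= 0"
     using h0 by (intro always_eventually) (auto simp: less_le)
   qed
   ultimately have "((\<lambda>n. (\<psi> (x + (0 + h n) *\<^sub>R t) - \<psi> (x + 0 *\<^sub>R t)) / h n) \<longlongrightarrow> D x) sequentially"
    by (rule filterlim_compose)
   then show ?case by (simp add: s_def)
  qed
  show "AE x in lborel. norm (s n x) <= L * indicator (cball 0 R') x" for n
  proof (rule AE_I2)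
   fix x :: 'a
   show "norm (s n x) <= L * indicator (cball 0 R') x"
   proof (cases "norm x <= R'")
    case True
    have "\<bar>\<psi> (x + h n *\<^sub>R t) - \<psi> x\<bar> <= L * h n"
     using lip[of "h n" x] h0[of n] hd[of n] by simp
    then show ?thesis using True h0[of n]
     by (simp add: s_def abs_divide field_simps)
   next
    case False
    have "norm (h n *\<^sub>R t) <= norm t"
     using h0[of n] h1[of n] by (simp add: mult_left_le_one_le)
    then have "norm (x + h n *\<^sub>R t) > R"
     using False norm_diff_ineq[of x "h n *\<^sub>R t"] unfolding R'_def by linarith
    moreover have "norm x > R" using False norm_ge_zero[of t] unfolding R'_def by linarith
    ultimately show ?thesis using supp False L by (simp add: s_def)
   qed
  qed
 qed
 then show ?thesis using int0 by (simp add: LIMSEQ_const_iff)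
qed

text \<open>Functions that are Lipschitz along \<open>t\<close>, so that the weak derivative in this direction is the classical one;
  they may jump across.\<close>

definition dlip :: "'a::euclidean_space set => 'a => ('a => real) => ('a => real) => bool" where
 "dlip U t f D \<longleftrightarrow> f \<in> borel_measurable borel \<and> D \<in> borel_measurable borel \<and>
   (\<exists>B. \<forall>x\<in>U. \<bar>f x\<bar> <= B \<and> \<bar>D x\<bar> <= B) \<and>
   (\<exists>L\<ge>0. \<forall>x h. closed_segment x (x + h *\<^sub>R t) \<subseteq> U --> \<bar>f (x + h *\<^sub>R t) - f x\<bar> <= L * \<bar>h\<bar>) \<and>
   (AE x in lborel. x \<in> U --> ((\<lambda>h. f (x + h *\<^sub>R t)) has_real_derivative D x) (at 0))"

lemma dlipI:
 assumes "f \<in> borel_measurable borel" "D \<in> borel_measurable borel"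
  "!!x. x \<in> U ==> \<bar>f x\<bar> <= B" "!!x. x \<in> U ==> \<bar>D x\<bar> <= B'" "L \<ge> 0"
  "!!x h. closed_segment x (x + h *\<^sub>R t) \<subseteq> U ==> \<bar>f (x + h *\<^sub>R t) - f x\<bar> <= L * \<bar>h\<bar>"
  "AE x in lborel. x \<in> U --> ((\<lambda>h. f (x + h *\<^sub>R t)) has_real_derivative D x) (at 0)"
 shows "dlip U t f D"
proof -
 have "\<forall>x\<in>U. \<bar>f x\<bar> <= max B B' \<and> \<bar>D x\<bar> <= max B B'"
  using assms(3,4) by (auto simp: le_max_iff_disj)
 then show ?thesis unfolding dlip_def using assms by blast
qed

lemma dlipE:
 assumes "dlip U t f D"
 obtains B L where "f \<in> borel_measurable borel" "D \<in> borel_measurable borel" "B \<ge> 0"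
  "!!x. x \<in> U ==> \<bar>f x\<bar> <= B" "!!x. x \<in> U ==> \<bar>D x\<bar> <= B" "L \<ge> 0"
  "!!x h. closed_segment x (x + h *\<^sub>R t) \<subseteq> U ==> \<bar>f (x + h *\<^sub>R t) - f x\<bar> <= L * \<bar>h\<bar>"
  "AE x in lborel. x \<in> U --> ((\<lambda>h. f (x + h *\<^sub>R t)) has_real_derivative D x) (at 0)"
proof -
 from assms obtain B L where *: "f \<in> borel_measurable borel" "D \<in> borel_measurable borel"
  "\<forall>x\<in>U. \<bar>f x\<bar> <= B \<and> \<bar>D x\<bar> <= B" "L \<ge> 0"
  "\<forall>x h. closed_segment x (x + h *\<^sub>R t) \<subseteq> U --> \<bar>f (x + h *\<^sub>R t) - f x\<bar> <= L * \<bar>h\<bar>"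
  "AE x in lborel. x \<in> U --> ((\<lambda>h. f (x + h *\<^sub>R t)) has_real_derivative D x) (at 0)"
  unfolding dlip_def by blast
 show ?thesis
 proof (rule that[of "\<bar>B\<bar>" L])
  show "\<bar>f x\<bar> <= \<bar>B\<bar>" "\<bar>D x\<bar> <= \<bar>B\<bar>" if "x \<in> U" for x
   using *(3) that by fastforce+
 qed (use * in auto)
qed

lemma dlip_const: "dlip U t (\<lambda>x. c) (\<lambda>x. 0)"
 by (rule dlipI[of _ _ _ "\<bar>c\<bar>" 0 0]) auto

lemma dlip_add:
 assumes "dlip U t f D" "dlip U t g E"
 shows "dlip U t (\<lambda>x. f x + g x) (\<lambda>x. D x + E x)"
proof -
 obtain B L where f: "f \<in> borel_measurable borel" "D \<in> borel_measurable borel" "B \<ge> 0"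
  "!!x. x \<in> U ==> \<bar>f x\<bar> <= B" "!!x. x \<in> U ==> \<bar>D x\<bar> <= B" "L \<ge> 0"
  "!!x h. closed_segment x (x + h *\<^sub>R t) \<subseteq> U ==> \<bar>f (x + h *\<^sub>R t) - f x\<bar> <= L * \<bar>h\<bar>"
  "AE x in lborel. x \<in> U --> ((\<lambda>h. f (x + h *\<^sub>R t)) has_real_derivative D x) (at 0)"
  by (rule dlipE[OF assms(1)], rule that; assumption)
 obtain B' L' where g: "g \<in> borel_measurable borel" "E \<in> borel_measurable borel" "B' \<ge> 0"
  "!!x. x \<in> U ==> \<bar>g x\<bar> <= B'" "!!x. x \<in> U ==> \<bar>E x\<bar> <= B'" "L' \<ge> 0"
  "!!x h. closed_segment x (x + h *\<^sub>R t) \<subseteq> U ==> \<bar>g (x + h *\<^sub>R t) - g x\<bar> <= L' * \<bar>h\<bar>"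
  "AE x in lborel. x \<in> U --> ((\<lambda>h. g (x + h *\<^sub>R t)) has_real_derivative E x) (at 0)"
  by (rule dlipE[OF assms(2)], rule that; assumption)
 show ?thesis
 proof (rule dlipI[of _ _ _ "B + B'" "B + B'" "L + L'"])
  show "\<bar>f x + g x\<bar> <= B + B'" "\<bar>D x + E x\<bar> <= B + B'" if "x \<in> U" for x
   using f(4,5)[OF that] g(4,5)[OF that] by linarith+
  show "\<bar>f (x + h *\<^sub>R t) + g (x + h *\<^sub>R t) - (f x + g x)\<bar> <= (L + L') * \<bar>h\<bar>"
   if "closed_segment x (x + h *\<^sub>R t) \<subseteq> U" for x h
   using f(7)[OF that] g(7)[OF that] by (simp add: distrib_right)
  show "AE x in lborel. x \<in> U --> ((\<lambda>h. f (x + h *\<^sub>R t) + g (x + h *\<^sub>R t)) has_real_derivative D x + E x) (at 0)"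
   using f(8) g(8) by eventually_elim (auto intro: DERIV_add)
 qed (use f g in auto)
qed

lemma dlip_mult:
 assumes "dlip U t f D" "dlip U t g E"
 shows "dlip U t (\<lambda>x. f x * g x) (\<lambda>x. D x * g x + f x * E x)"
proof -
 obtain B L where f: "f \<in> borel_measurable borel" "D \<in> borel_measurable borel" "B \<ge> 0"
  "!!x. x \<in> U ==> \<bar>f x\<bar> <= B" "!!x. x \<in> U ==> \<bar>D x\<bar> <= B" "L \<ge> 0"
  "!!x h. closed_segment x (x + h *\<^sub>R t) \<subseteq> U ==> \<bar>f (x + h *\<^sub>R t) - f x\<bar> <= L * \<bar>h\<bar>"
  "AE x in lborel. x \<in> U --> ((\<lambda>h. f (x + h *\<^sub>R t)) has_real_derivative D x) (at 0)"
  by (rule dlipE[OF assms(1)], rule that; assumption)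
 obtain B' L' where g: "g \<in> borel_measurable borel" "E \<in> borel_measurable borel" "B' \<ge> 0"
  "!!x. x \<in> U ==> \<bar>g x\<bar> <= B'" "!!x. x \<in> U ==> \<bar>E x\<bar> <= B'" "L' \<ge> 0"
  "!!x h. closed_segment x (x + h *\<^sub>R t) \<subseteq> U ==> \<bar>g (x + h *\<^sub>R t) - g x\<bar> <= L' * \<bar>h\<bar>"
  "AE x in lborel. x \<in> U --> ((\<lambda>h. g (x + h *\<^sub>R t)) has_real_derivative E x) (at 0)"
  by (rule dlipE[OF assms(2)], rule that; assumption)
 show ?thesis
 proof (rule dlipI[of _ _ _ "B * B'" "B * B' + B * B'" "B * L' + L * B'"])
  show "\<bar>f x * g x\<bar> <= B * B'" if "x \<in> U" for x
   using f(3) f(4)[OF that] g(4)[OF that] by (auto simp: abs_mult intro!: mult_mono)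
  show "\<bar>D x * g x + f x * E x\<bar> <= B * B' + B * B'" if "x \<in> U" for x
  proof -
   have "\<bar>D x * g x\<bar> <= B * B'" "\<bar>f x * E x\<bar> <= B * B'"
    using f(3) f(4,5)[OF that] g(4,5)[OF that] by (auto simp: abs_mult intro!: mult_mono)
   then show ?thesis by linarith
  qed
  show "\<bar>f (x + h *\<^sub>R t) * g (x + h *\<^sub>R t) - f x * g x\<bar> <= (B * L' + L * B') * \<bar>h\<bar>"
   if s: "closed_segment x (x + h *\<^sub>R t) \<subseteq> U" for x h
  proof -
   let ?y = "x + h *\<^sub>R t"
   have U: "x \<in> U" "?y \<in> U" using s by auto
   have "\<bar>f ?y * (g ?y - g x)\<bar> <= B * (L' * \<bar>h\<bar>)"
    unfolding abs_mult using f(3) f(4)[OF U(2)] g(7)[OF s] by (intro mult_mono) auto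
   moreover have "\<bar>(f ?y - f x) * g x\<bar> <= (L * \<bar>h\<bar>) * B'"
    unfolding abs_mult using f(6) f(7)[OF s] g(4)[OF U(1)] by (intro mult_mono) auto
   moreover have "f ?y * g ?y - f x * g x = f ?y * (g ?y - g x) + (f ?y - f x) * g x"
    by (simp add: algebra_simps)
   ultimately show ?thesis by (simp add: algebra_simps)
  qed
  show "AE x in lborel. x \<in> U --> ((\<lambda>h. f (x + h *\<^sub>R t) * g (x + h *\<^sub>R t)) has_real_derivative D x * g x + f x * E x) (at 0)"
   using f(8) g(8)
  proof eventually_elim
   case (elim x)
   show ?case
   proof
    assume "x \<in> U"
    then show "((\<lambda>h. f (x + h *\<^sub>R t) * g (x + h *\<^sub>R t)) has_real_derivative D x * g x + f x * E x) (at 0)"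
     using elim DERIV_mult[of "\<lambda>h. f (x + h *\<^sub>R t)" "D x" 0 UNIV "\<lambda>h. g (x + h *\<^sub>R t)" "E x"]
     by (simp add: mult.commute add.commute)
   qed
  qed
 qed (use f g in auto)
qed

lemma dlip_cmul: "dlip U t f D ==> dlip U t (\<lambda>x. c * f x) (\<lambda>x. c * D x)"
 using dlip_mult[OF dlip_const[of U t c]] by simp

lemma dlip_sum:
 assumes "finite A" "!!a. a \<in> A ==> dlip U t (f a) (D a)"
 shows "dlip U t (\<lambda>x. \<Sum>a\<in>A. f a x) (\<lambda>x. \<Sum>a\<in>A. D a x)"
 using assms by (induction A rule: finite_induct) (auto intro: dlip_const dlip_add)

lemma dlip_cong_AE:
 assumes "dlip U t f D" "D' \<in> borel_measurable borel" "AE x in lborel. x \<in> U --> D x = D' x"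
  "!!x. x \<in> U ==> \<bar>D' x\<bar> <= B'"
 shows "dlip U t f D'"
proof -
 obtain B L where f: "f \<in> borel_measurable borel" "D \<in> borel_measurable borel" "B \<ge> 0"
  "!!x. x \<in> U ==> \<bar>f x\<bar> <= B" "!!x. x \<in> U ==> \<bar>D x\<bar> <= B" "L \<ge> 0"
  "!!x h. closed_segment x (x + h *\<^sub>R t) \<subseteq> U ==> \<bar>f (x + h *\<^sub>R t) - f x\<bar> <= L * \<bar>h\<bar>"
  "AE x in lborel. x \<in> U --> ((\<lambda>h. f (x + h *\<^sub>R t)) has_real_derivative D x) (at 0)"
  by (rule dlipE[OF assms(1)], rule that; assumption)
 have "AE x in lborel. x \<in> U --> ((\<lambda>h. f (x + h *\<^sub>R t)) has_real_derivative D' x) (at 0)"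
  using f(8) assms(3) by eventually_elim auto
 then show ?thesis using f assms by (intro dlipI[of _ _ _ B B' L]) auto
qed

lemma test_function_C1:
 assumes "\<phi> \<in> test_functions U"
 shows "\<phi> differentiable (at x)" "continuous_on UNIV (pd t \<phi>)"
  "pd t \<phi> x = grad \<phi> x \<bullet> t"
  "((\<lambda>h. \<phi> (x + h *\<^sub>R t)) has_real_derivative pd t \<phi> (x + s *\<^sub>R t)) (at s)"
proof -
 have C: "C_k (Suc 0) \<phi>" using assms by (auto simp: test_functions_def)
 then show d: "\<phi> differentiable (at x)" for x by simp
 have lin: "linear (frechet_derivative \<phi> (at x))" for x
  using d by (simp add: linear_frechet_derivative)
 have ex: "pd t \<phi> x = (\<Sum>b\<in>Basis. (t \<bullet> b) * pd b \<phi> x)" for x t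
 proof -
  have "frechet_derivative \<phi> (at x) t = frechet_derivative \<phi> (at x) (\<Sum>b\<in>Basis. (t \<bullet> b) *\<^sub>R b)"
   by (simp add: euclidean_representation)
  also have "... = (\<Sum>b\<in>Basis. (t \<bullet> b) * frechet_derivative \<phi> (at x) b)"
   by (simp add: linear_sum[OF lin] linear_scale[OF lin])
  finally show ?thesis by (simp add: pd_def)
 qed
 show "continuous_on UNIV (pd t \<phi>)"
 proof -
  have "pd t \<phi> = (\<lambda>x. \<Sum>b\<in>Basis. (t \<bullet> b) * pd b \<phi> x)" using ex by blast
  then show ?thesis using C by (auto intro!: continuous_intros)
 qed
 show "pd t \<phi> x = grad \<phi> x \<bullet> t"
  by (subst ex) (simp add: grad_def inner_sum_left inner_commute[of t] mult.commute)
 have "(\<phi> has_derivative frechet_derivative \<phi> (at (x + s *\<^sub>R t))) (at (x + s *\<^sub>R t))"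
  using d frechet_derivative_works by blast
 moreover have "((\<lambda>h. x + h *\<^sub>R t) has_derivative (\<lambda>h. h *\<^sub>R t)) (at s)"
  by (auto intro!: derivative_eq_intros)
 ultimately have "((\<lambda>h. \<phi> (x + h *\<^sub>R t)) has_derivative (\<lambda>h. frechet_derivative \<phi> (at (x + s *\<^sub>R t)) (h *\<^sub>R t))) (at s)"
  using has_derivative_compose[of "\<lambda>h. x + h *\<^sub>R t" "\<lambda>h. h *\<^sub>R t" s UNIV \<phi>] by blast
 then show "((\<lambda>h. \<phi> (x + h *\<^sub>R t)) has_real_derivative pd t \<phi> (x + s *\<^sub>R t)) (at s)"
  unfolding has_field_derivative_def pd_def linear_scale[OF lin] by (simp add: mult.commute[of _ "frechet_derivative _ _ _"])
qed

lemma test_function_supp: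
 assumes "\<phi> \<in> test_functions U" "x ~: closure {x. \<phi> x ~= 0}"
 shows "\<phi> x = 0" "pd t \<phi> x = 0"
proof -
 let ?K = "closure {x. \<phi> x ~= 0}"
 show "\<phi> x = 0" using assms(2) closure_subset[of "{x. \<phi> x ~= 0}"] by blast
 have "(\<phi> has_derivative (\<lambda>_. 0)) (at x)"
 proof (rule has_derivative_transform_within_open[of "\<lambda>_. 0" _ _ _ "- ?K"])
  show "open (- ?K)" by (simp only: open_Compl closed_closure)
  show "x \<in> - ?K" using assms by simp
  show "0 = \<phi> y" if "y \<in> - ?K" for y using that closure_subset[of "{x. \<phi> x ~= 0}"] by auto
 qed simp
 then show "pd t \<phi> x = 0" unfolding pd_def using frechet_derivative_at[of \<phi>] by metis
qed

lemma test_function_bounds: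
 assumes "\<phi> \<in> test_functions U"
 obtains B where "B \<ge> 0" "!!x. \<bar>\<phi> x\<bar> <= B" "!!x. \<bar>pd t \<phi> x\<bar> <= B"
  "!!x h. \<bar>\<phi> (x + h *\<^sub>R t) - \<phi> x\<bar> <= B * \<bar>h\<bar>"
proof -
 let ?K = "closure {x. \<phi> x ~= 0}"
 have K: "compact ?K" using assms by (simp add: test_functions_def)
 have c: "continuous_on UNIV \<phi>" "continuous_on UNIV (pd t \<phi>)"
  using assms test_function_C1[OF assms]
  by (auto simp: test_functions_def intro: differentiable_imp_continuous_on simp: differentiable_on_def)
 obtain B1 where B1: "!!x. x \<in> ?K ==> norm (\<phi> x) <= B1"
  using compact_imp_bounded[OF compact_continuous_image[OF continuous_on_subset[OF c(1)] K]]
  unfolding bounded_iff by blast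
 obtain B2 where B2: "!!x. x \<in> ?K ==> norm (pd t \<phi> x) <= B2"
  using compact_imp_bounded[OF compact_continuous_image[OF continuous_on_subset[OF c(2)] K]]
  unfolding bounded_iff by blast
 define B where "B = \<bar>B1\<bar> + \<bar>B2\<bar>"
 have b1: "\<bar>\<phi> x\<bar> <= B" for x
 proof (cases "x \<in> ?K")
  case True
  then show ?thesis using B1[OF True] by (simp add: B_def)
 next
  case False
  then show ?thesis using test_function_supp(1)[OF assms False] by (simp add: B_def)
 qed
 have b2: "\<bar>pd t \<phi> x\<bar> <= B" for x
 proof (cases "x \<in> ?K")
  case True
  then show ?thesis using B2[OF True] by (simp add: B_def)
 next
  case False
  then show ?thesis using test_function_supp(2)[OF assms False, of t] by (simp add: B_def)
 qed
 have "norm (\<phi> (x + h *\<^sub>R t) - \<phi> (x + 0 *\<^sub>R t)) <= B * norm (h - 0)" for x h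
 proof (rule field_differentiable_bound[of UNIV "\<lambda>h. \<phi> (x + h *\<^sub>R t)" "\<lambda>s. pd t \<phi> (x + s *\<^sub>R t)"])
  show "((\<lambda>h. \<phi> (x + h *\<^sub>R t)) has_field_derivative pd t \<phi> (x + s *\<^sub>R t)) (at s within UNIV)" for s
   using test_function_C1(4)[OF assms] by simp
 qed (use b2 in auto)
 then show ?thesis using that[of B] b1 b2 by (auto simp: B_def)
qed

lemma dlip_weak_derivative:
 assumes U: "open U" and d: "dlip U t f D" and \<phi>: "\<phi> \<in> test_functions U"
 shows "(LINT x|lborel. indicator U x * (f x * (grad \<phi> x \<bullet> t))) =
  - (LINT x|lborel. indicator U x * (D x * \<phi> x))"
  "integrable lborel (\<lambda>x. indicator U x * (f x * (grad \<phi> x \<bullet> t)))"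
  "integrable lborel (\<lambda>x. indicator U x * (D x * \<phi> x))"
proof -
 obtain B L where f: "f \<in> borel_measurable borel" "D \<in> borel_measurable borel" "B \<ge> 0"
  "!!x. x \<in> U ==> \<bar>f x\<bar> <= B" "!!x. x \<in> U ==> \<bar>D x\<bar> <= B" "L \<ge> 0"
  "!!x h. closed_segment x (x + h *\<^sub>R t) \<subseteq> U ==> \<bar>f (x + h *\<^sub>R t) - f x\<bar> <= L * \<bar>h\<bar>"
  "AE x in lborel. x \<in> U --> ((\<lambda>h. f (x + h *\<^sub>R t)) has_real_derivative D x) (at 0)"
  by (rule dlipE[OF d], rule that; assumption)
 obtain B' where p: "B' \<ge> 0" "!!x. \<bar>\<phi> x\<bar> <= B'" "!!x. \<bar>pd t \<phi> x\<bar> <= B'"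
  "!!x h. \<bar>\<phi> (x + h *\<^sub>R t) - \<phi> x\<bar> <= B' * \<bar>h\<bar>" by (rule test_function_bounds[OF \<phi>, of t], rule that; assumption)
 define K where "K = closure {x. \<phi> x ~= 0}"
 have K: "compact K" "K \<subseteq> U" using \<phi> by (auto simp: test_functions_def K_def)
 have K0: "\<phi> x = 0" "pd t \<phi> x = 0" if "x ~: K" for x
  using test_function_supp[OF \<phi>, of x] that unfolding K_def by blast+
 have "K \<inter> - U = {}" using K by auto
 then obtain r where r: "r > 0" "!!x y. x \<in> K ==> y ~: U ==> r <= dist x y"
  using separate_compact_closed[OF K(1), of "- U"] U by (auto simp: closed_def)
 define \<delta> where "\<delta> = r / (1 + norm t)"
 have \<delta>: "\<delta> > 0" using r(1) by (simp add: \<delta>_def add_pos_nonneg)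
 have seg: "closed_segment x (x + h *\<^sub>R t) \<subseteq> U"
  if "\<bar>h\<bar> < \<delta>" "x \<in> K \<or> x + h *\<^sub>R t \<in> K" for x h
 proof
  fix y assume y: "y \<in> closed_segment x (x + h *\<^sub>R t)"
  have "norm (h *\<^sub>R t) < r"
  proof -
   have "\<bar>h\<bar> * norm t <= \<bar>h\<bar> * (1 + norm t)" by (simp add: mult_left_mono)
   also have "... < r" using that(1) by (simp add: \<delta>_def pos_less_divide_eq add_pos_nonneg)
   finally show ?thesis by simp
  qed
  moreover have "dist x y <= dist x (x + h *\<^sub>R t)" "dist (x + h *\<^sub>R t) y <= dist x (x + h *\<^sub>R t)"
   using segment_bound(1,2)[OF y] by (auto simp: dist_norm norm_minus_commute)
  ultimately have "dist x y < r" "dist (x + h *\<^sub>R t) y < r" by (auto simp: dist_norm)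
  then show "y \<in> U" using r(2)[of x y] r(2)[of "x + h *\<^sub>R t" y] that(2) by force
 qed
 define \<psi> where "\<psi> x = (if x \<in> K then f x * \<phi> x else 0)" for x
 have \<psi>: "\<psi> x = f x * \<phi> x" for x by (simp add: \<psi>_def K0)
 have m\<phi>: "\<phi> \<in> borel_measurable borel" "pd t \<phi> \<in> borel_measurable borel"
  using test_function_C1(1)[OF \<phi>]
  by (auto intro!: borel_measurable_continuous_onI differentiable_imp_continuous_on
    test_function_C1(2)[OF \<phi>] simp: differentiable_on_def)
 have mU: "U \<in> sets borel" using U by simp
 define E where "E x = indicator U x * (D x * \<phi> x) + indicator U x * (f x * pd t \<phi> x)" for x
 obtain R where R: "!!x. x \<in> K ==> norm x <= R"
  using compact_imp_bounded[OF K(1)] by (auto simp: bounded_iff)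
 have zE: "(LINT x|lborel. E x) = 0"
 proof (rule integral_directional_derivative_zero[of \<psi> E "B * B'" R \<delta> "B * B' + L * B'" t])
  show "\<psi> x = 0" if "norm x > R" for x using that R by (force simp: \<psi>_def)
  show "\<psi> \<in> borel_measurable borel" unfolding \<psi> using f m\<phi> by simp
  show "E \<in> borel_measurable borel" unfolding E_def using f m\<phi> mU by measurable
  show "\<bar>\<psi> x\<bar> <= B * B'" for x
   using f(3,4) p K(2) by (auto simp: \<psi>_def abs_mult intro!: mult_mono)
  show "\<delta> > 0" by fact
  show "0 <= B * B' + L * B'" using f(3,6) p(1) by simp
  show "\<bar>\<psi> (x + h *\<^sub>R t) - \<psi> x\<bar> <= (B * B' + L * B') * \<bar>h\<bar>" if h: "\<bar>h\<bar> < \<delta>" for x h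
  proof (cases "x \<in> K \<or> x + h *\<^sub>R t \<in> K")
   case True
   let ?y = "x + h *\<^sub>R t"
   have s: "closed_segment x ?y \<subseteq> U" using seg[OF h True] .
   then have Uy: "?y \<in> U" by auto
   have "\<bar>f ?y * (\<phi> ?y - \<phi> x)\<bar> <= B * (B' * \<bar>h\<bar>)"
    unfolding abs_mult using f(3) f(4)[OF Uy] p(4) by (intro mult_mono) auto
   moreover have "\<bar>(f ?y - f x) * \<phi> x\<bar> <= (L * \<bar>h\<bar>) * B'"
    unfolding abs_mult using f(6) f(7)[OF s] p(2) by (intro mult_mono) auto
   moreover have "f ?y * \<phi> ?y - f x * \<phi> x = f ?y * (\<phi> ?y - \<phi> x) + (f ?y - f x) * \<phi> x"
    by (simp add: algebra_simps)
   ultimately show ?thesis unfolding \<psi> by (simp add: algebra_simps)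
  next
   case False
   then show ?thesis using f p by (simp add: \<psi>_def)
  qed
  show "AE x in lborel. ((\<lambda>h. \<psi> (x + h *\<^sub>R t)) has_real_derivative E x) (at 0)"
   using f(8)
  proof eventually_elim
   case (elim x)
   show ?case
   proof (cases "x \<in> U")
    case True
    then show ?thesis unfolding \<psi> E_def
     using DERIV_mult[OF elim[rule_format, OF True] test_function_C1(4)[OF \<phi>, of x t 0]]
     by (simp add: algebra_simps)
   next
    case False
    then have xK: "x ~: K" using K by auto
    have op: "open ((\<lambda>h. x + h *\<^sub>R t) -` (- K))"
     using K(1) by (intro open_vimage continuous_intros) (simp add: compact_imp_closed open_Compl)
    have "((\<lambda>h. \<psi> (x + h *\<^sub>R t)) has_real_derivative 0) (at 0)"
     by (rule has_field_derivative_transform_within_open[OF DERIV_const[of 0] op])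
      (use xK in \<open>auto simp: \<psi>_def\<close>)
    then show ?thesis using False by (simp add: E_def)
   qed
  qed
 qed
 have bK: "K \<in> sets borel" "bounded K" using K(1) by (auto simp: compact_imp_closed compact_imp_bounded)
 have "integrable lborel (\<lambda>x. indicator K x *\<^sub>R (D x * \<phi> x))"
  by (rule bounded_borel_integrable[OF _ bK, where B="B * B'"])
   (use f m\<phi> p K in \<open>auto simp: abs_mult intro!: mult_mono\<close>)
 then have i1: "integrable lborel (\<lambda>x. indicator U x * (D x * \<phi> x))"
  by (rule Bochner_Integration.integrable_cong[THEN iffD1, rotated -1]) (use K K0 in \<open>auto simp: indicator_def\<close>)
 have "integrable lborel (\<lambda>x. indicator K x *\<^sub>R (f x * pd t \<phi> x))"
  by (rule bounded_borel_integrable[OF _ bK, where B="B * B'"])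
   (use f m\<phi> p K in \<open>auto simp: abs_mult intro!: mult_mono\<close>)
 then have i2: "integrable lborel (\<lambda>x. indicator U x * (f x * pd t \<phi> x))"
  by (rule Bochner_Integration.integrable_cong[THEN iffD1, rotated -1]) (use K K0 in \<open>auto simp: indicator_def\<close>)
 have "(LINT x|lborel. indicator U x * (D x * \<phi> x)) + (LINT x|lborel. indicator U x * (f x * pd t \<phi> x)) = 0"
  using zE unfolding E_def Bochner_Integration.integral_add[OF i1 i2] .
 then show "(LINT x|lborel. indicator U x * (f x * (grad \<phi> x \<bullet> t))) =
  - (LINT x|lborel. indicator U x * (D x * \<phi> x))"
  "integrable lborel (\<lambda>x. indicator U x * (f x * (grad \<phi> x \<bullet> t)))"
  "integrable lborel (\<lambda>x. indicator U x * (D x * \<phi> x))"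
  using i1 i2 unfolding test_function_C1(3)[OF \<phi>] by auto
qed


lemma integrable_componentwiseI:
 fixes f :: "'a => 'b::euclidean_space"
 assumes "!!b. b \<in> Basis ==> integrable M (\<lambda>x. f x \<bullet> b)"
 shows "integrable M f"
proof -
 have "integrable M (\<lambda>x. \<Sum>b\<in>Basis. (f x \<bullet> b) *\<^sub>R b)"
  using assms by (intro Bochner_Integration.integrable_sum integrable_scaleR_left)
 then show ?thesis by (simp add: euclidean_representation)
qed

lemma dlip_weak_pd:
 fixes f g :: "'a::euclidean_space => 'b::euclidean_space"
 assumes U: "open U" and b: "b \<in> Basis"
  and m: "f \<in> borel_measurable borel" "g \<in> borel_measurable borel"
  and d: "!!c. c \<in> Basis ==> dlip U b (\<lambda>x. f x \<bullet> c) (\<lambda>x. g x \<bullet> c)"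
 shows "is_weak_pd U b f g"
 unfolding is_weak_pd_def
proof
 fix \<phi> assume \<phi>: "\<phi> \<in> test_functions U"
 have mU: "U \<in> sets borel" using U by simp
 have m\<phi>: "\<phi> \<in> borel_measurable borel" "pd b \<phi> \<in> borel_measurable borel"
  using test_function_C1(1)[OF \<phi>]
  by (auto intro!: borel_measurable_continuous_onI differentiable_imp_continuous_on
    test_function_C1(2)[OF \<phi>] simp: differentiable_on_def)
 note w = dlip_weak_derivative[OF U d \<phi>, unfolded test_function_C1(3)[OF \<phi>, symmetric]]
 have if1: "integrable lborel (\<lambda>x. indicator U x *\<^sub>R (pd b \<phi> x *\<^sub>R f x))"
  by (rule integrable_componentwiseI)
   (use w(2) in \<open>simp add: mult.commute mult.left_commute\<close>)
 have if2: "integrable lborel (\<lambda>x. indicator U x *\<^sub>R (\<phi> x *\<^sub>R g x))"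
  by (rule integrable_componentwiseI)
   (use w(3) in \<open>simp add: mult.commute mult.left_commute\<close>)
 have "(LINT x|lborel. indicator U x *\<^sub>R (pd b \<phi> x *\<^sub>R f x)) = - (LINT x|lborel. indicator U x *\<^sub>R (\<phi> x *\<^sub>R g x))"
 proof (rule euclidean_eqI)
  fix c :: 'b assume c: "c \<in> Basis"
  then have "c ~= 0" by auto
  then show "(LINT x|lborel. indicator U x *\<^sub>R (pd b \<phi> x *\<^sub>R f x)) \<bullet> c = - (LINT x|lborel. indicator U x *\<^sub>R (\<phi> x *\<^sub>R g x)) \<bullet> c"
   using if1 if2 w(1)[OF c]
   by (simp flip: integral_inner_left add: mult.commute mult.left_commute)
 qed
 then show "(LINT x|lebesgue_on U. pd b \<phi> x *\<^sub>R f x) = - (LINT x|lebesgue_on U. \<phi> x *\<^sub>R g x)"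
  using m m\<phi> mU by (subst (1 2) integral_lebesgue_on_borel) auto
qed

section \<open>Uniqueness of the weak divergence\<close>

lemma C_k_Suc_imp: "C_k (Suc n) f ==> C_k n f"
proof (induction n arbitrary: f)
 case 0
 then show ?case
  by (auto intro!: differentiable_imp_continuous_on simp: differentiable_on_def)
next
 case (Suc n)
 then show ?case by (metis C_k.simps(2))
qed

lemma C_k_const: "C_k n (\<lambda>x. c)"
proof (induction n arbitrary: c)
 case (Suc n)
 have "pd b (\<lambda>x. c) = (\<lambda>x. 0)" for b :: 'a
  by (auto simp: pd_def)
 then show ?case using Suc by simp
qed simp

lemma C_k_add: "C_k n f ==> C_k n g ==> C_k n (\<lambda>x. f x + g x)"
proof (induction n arbitrary: f g)
 case 0
 then show ?case by (auto intro: continuous_on_add)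
next
 case (Suc n)
 then have d: "!!x. f differentiable (at x)" "!!x. g differentiable (at x)" by auto
 have "pd b (\<lambda>x. f x + g x) = (\<lambda>x. pd b f x + pd b g x)" for b
 proof
  fix x
  have "((\<lambda>x. f x + g x) has_derivative (\<lambda>h. frechet_derivative f (at x) h + frechet_derivative g (at x) h)) (at x)"
   using d frechet_derivative_works has_derivative_add by blast
  then show "pd b (\<lambda>x. f x + g x) x = pd b f x + pd b g x"
   unfolding pd_def by (simp add: frechet_derivative_at[symmetric])
 qed
 then show ?case using Suc d by auto
qed

lemma C_k_mult: "C_k n f ==> C_k n g ==> C_k n (\<lambda>x. f x * g x)"
proof (induction n arbitrary: f g)
 case 0
 then show ?case by (auto intro: continuous_on_mult)
next
 case (Suc n)
 then have d: "!!x. f differentiable (at x)" "!!x. g differentiable (at x)" by auto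
 have p: "pd b (\<lambda>x. f x * g x) = (\<lambda>x. f x * pd b g x + pd b f x * g x)" for b
 proof
  fix x
  have "((\<lambda>x. f x * g x) has_derivative (\<lambda>h. f x * frechet_derivative g (at x) h + frechet_derivative f (at x) h * g x)) (at x)"
   using d frechet_derivative_works has_derivative_mult by blast
  then show "pd b (\<lambda>x. f x * g x) x = f x * pd b g x + pd b f x * g x"
   unfolding pd_def by (simp add: frechet_derivative_at[symmetric])
 qed
 have "C_k n f" "C_k n g" using Suc.prems C_k_Suc_imp by blast+
 then have "C_k n (\<lambda>x. f x * pd b g x + pd b f x * g x)" if "b \<in> Basis" for b
  using Suc that by (intro C_k_add Suc.IH) auto
 then show ?case using p d by auto
qed

lemma C_k_prod: "finite A ==> (!!a. a \<in> A ==> C_k n (f a)) ==> C_k n (\<lambda>x. \<Prod>a\<in>A. f a x)"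
 by (induction A rule: finite_induct) (auto intro: C_k_const C_k_mult)

lemma C_k_power: "C_k n f ==> C_k n (\<lambda>x. f x ^ m)"
 by (induction m) (auto intro: C_k_const C_k_mult)

lemma C_k_ridge:
 fixes \<beta> :: "nat => real => real"
 assumes "!!j x. (\<beta> j has_real_derivative \<beta> (Suc j) x) (at x)"
 shows "C_k n (\<lambda>x::'a::euclidean_space. \<beta> j (\<sigma> * (x \<bullet> v) + \<tau>))"
proof (induction n arbitrary: j)
 have hd: "((\<lambda>x::'a. \<beta> j (\<sigma> * (x \<bullet> v) + \<tau>)) has_derivative (\<lambda>h. (h \<bullet> v * \<sigma>) * \<beta> (Suc j) (\<sigma> * (x \<bullet> v) + \<tau>))) (at x)" for j x
 proof -
  have "((\<lambda>x::'a. \<sigma> * (x \<bullet> v) + \<tau>) has_derivative (\<lambda>h. \<sigma> * (h \<bullet> v))) (at x)"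
   by (auto intro!: derivative_eq_intros)
  from has_derivative_compose[OF this assms[of j, THEN has_field_derivative_imp_has_derivative]]
  show ?thesis by (simp add: mult.commute mult.left_commute)
 qed
 {
  case 0
  have "(\<lambda>x. \<beta> j (\<sigma> * (x \<bullet> v) + \<tau>)) differentiable (at x)" for x :: 'a
   using hd unfolding differentiable_def by blast
  then show ?case
   by (auto intro!: differentiable_imp_continuous_on simp: differentiable_on_def)
 next
  case (Suc n)
  have "pd b (\<lambda>x. \<beta> j (\<sigma> * (x \<bullet> v) + \<tau>)) = (\<lambda>x. (b \<bullet> v * \<sigma>) * \<beta> (Suc j) (\<sigma> * (x \<bullet> v) + \<tau>))" for b :: 'a
   unfolding pd_def by (rule ext) (simp add: frechet_derivative_at[OF hd, symmetric])
  moreover have "(\<lambda>x. \<beta> j (\<sigma> * (x \<bullet> v) + \<tau>)) differentiable (at x)" for x :: 'a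
   using hd unfolding differentiable_def by blast
  ultimately show ?case using Suc by (auto intro: C_k_mult C_k_const)
 }
qed

text \<open>The functions \<open>p(1/x) exp(-1/x)\<close>, extended by zero to \<open>x \<le> 0\<close>, are closed under
  differentiation.\<close>

definition flat :: "real poly => real => real" where
 "flat p x = (if x > 0 then poly p (1/x) * exp (- (1/x)) else 0)"

lemma poly_div_exp_tendsto_0: "((\<lambda>y::real. poly p y * exp (- y)) \<longlongrightarrow> 0) at_top"
proof -
 have "((\<lambda>y::real. \<Sum>i\<le>degree p. coeff p i * (y ^ i / exp y)) \<longlongrightarrow> (\<Sum>i\<le>degree p. coeff p i * 0)) at_top"
  by (intro tendsto_sum tendsto_mult tendsto_const tendsto_power_div_exp_0)
 then show ?thesis
  by (simp add: poly_altdef exp_minus divide_inverse sum_distrib_right mult.assoc)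
qed

lemma flat_has_derivative:
 "(flat p has_real_derivative flat ([:0, 0, 1:] * (p - pderiv p)) x) (at x)"
proof (cases x "0::real" rule: linorder_cases)
 case less
 have "(flat p has_real_derivative 0) (at x)"
  by (rule has_field_derivative_transform_within_open[OF DERIV_const[of 0], of "{..<0}"])
   (use less in \<open>auto simp: flat_def\<close>)
 then show ?thesis using less by (simp add: flat_def)
next
 case greater
 have "((\<lambda>x. poly p (1/x) * exp (- (1/x))) has_real_derivative
   poly (pderiv p) (1/x) * (- 1 / x\<^sup>2) * exp (- (1/x)) + poly p (1/x) * (exp (- (1/x)) * (1 / x\<^sup>2))) (at x)"
  using greater
  by (auto intro!: derivative_eq_intros DERIV_chain'[where g="poly p"] poly_DERIV simp: power2_eq_square divide_simps)
 moreover have "poly (pderiv p) (1/x) * (- 1 / x\<^sup>2) * exp (- (1/x)) + poly p (1/x) * (exp (- (1/x)) * (1 / x\<^sup>2))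
   = flat ([:0, 0, 1:] * (p - pderiv p)) x"
  using greater by (simp add: flat_def power2_eq_square field_simps)
 ultimately have "((\<lambda>x. poly p (1/x) * exp (- (1/x))) has_real_derivative flat ([:0, 0, 1:] * (p - pderiv p)) x) (at x)"
  by simp
 then show ?thesis
  by (rule has_field_derivative_transform_within_open[of _ _ _ "{0<..}"])
   (use greater in \<open>auto simp: flat_def\<close>)
next
 case equal
 have "((\<lambda>h. flat p h / h) \<longlongrightarrow> 0) (at 0)"
 proof (rule filterlim_split_at_real)
  have "\<forall>\<^sub>F h in at_left (0::real). 0 = flat p h / h"
   by (auto simp: eventually_at_filter flat_def)
  then show "((\<lambda>h. flat p h / h) \<longlongrightarrow> 0) (at_left 0)"
   by (rule Lim_transform_eventually[OF tendsto_const])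
  have "((\<lambda>h. poly ([:0, 1:] * p) (inverse h) * exp (- inverse h)) \<longlongrightarrow> 0) (at_right (0::real))"
   using poly_div_exp_tendsto_0 filterlim_inverse_at_top_right by (rule filterlim_compose)
  moreover have "\<forall>\<^sub>F h in at_right (0::real). poly ([:0, 1:] * p) (inverse h) * exp (- inverse h) = flat p h / h"
   by (auto simp: eventually_at_filter flat_def divide_inverse)
  ultimately show "((\<lambda>h. flat p h / h) \<longlongrightarrow> 0) (at_right 0)"
   by (rule Lim_transform_eventually)
 qed
 then show ?thesis using equal by (simp add: DERIV_def flat_def)
qed

text \<open>The powers \<open>1 - (1 - B) ^ n\<close> of a bump \<open>B\<close> that is positive exactly on the box.\<close>

lemma box_bump_test_functions:
 fixes l u :: "'a::euclidean_space"
 assumes "cbox l u \<subseteq> U"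
 obtains \<phi> where "!!n::nat. \<phi> n \<in> test_functions U" "!!n x. 0 <= \<phi> n x \<and> \<phi> n x <= 1"
  "!!x. (\<lambda>n. \<phi> n x) \<longlonglongrightarrow> indicator (box l u) x"
proof -
 define p :: "nat => real poly" where "p = rec_nat 1 (\<lambda>_ p. [:0, 0, 1:] * (p - pderiv p))"
 define \<beta> where "\<beta> j = flat (p j)" for j
 have \<beta>: "(\<beta> j has_real_derivative \<beta> (Suc j) x) (at x)" for j x
  unfolding \<beta>_def by (simp only: p_def nat.rec flat_has_derivative)
 have \<beta>0: "\<beta> 0 x = (if x > 0 then exp (- (1/x)) else 0)" for x
  by (simp add: \<beta>_def p_def flat_def)
 then have \<beta>0b: "0 <= \<beta> 0 x" "\<beta> 0 x <= 1" "\<beta> 0 x > 0 \<longleftrightarrow> x > 0" "\<beta> 0 x = 0 \<longleftrightarrow> x <= 0" for x by auto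
 define B :: "'a => real" where "B x = (\<Prod>b\<in>Basis. \<beta> 0 (1 * (x \<bullet> b) + - (l \<bullet> b)) * \<beta> 0 ((-1) * (x \<bullet> b) + u \<bullet> b))" for x
 have CB: "C_k n B" for n
  unfolding B_def by (intro C_k_prod C_k_mult C_k_ridge \<beta>) auto
 have B01: "0 <= B x" "B x <= 1" for x
  unfolding B_def using \<beta>0b by (auto intro!: prod_nonneg prod_le_1 mult_le_one)
 have Bbox: "B x ~= 0 \<longleftrightarrow> x \<in> box l u" for x
  unfolding B_def by (auto simp: \<beta>0b mem_box not_le)
 define \<phi> where "\<phi> n x = 1 + (-1) * (1 + (-1) * B x) ^ n" for n :: nat and x
 have C\<phi>: "C_k m (\<phi> n)" for m n
  unfolding \<phi>_def by (intro C_k_add C_k_mult C_k_power C_k_const CB)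
 have supp: "{x. \<phi> n x ~= 0} \<subseteq> box l u" for n
 proof
  fix x assume "x \<in> {x. \<phi> n x ~= 0}"
  then have "B x ~= 0" by (cases "B x = 0") (simp_all add: \<phi>_def)
  then show "x \<in> box l u" using Bbox by blast
 qed
 have clo: "closure {x. \<phi> n x ~= 0} \<subseteq> cbox l u" for n
  using supp[of n] box_subset_cbox[of l u] by (intro closure_minimal) auto
 have "\<phi> n \<in> test_functions U" for n
 proof -
  have "bounded (closure {x. \<phi> n x ~= 0})" using clo[of n] bounded_subset[OF bounded_cbox] by blast
  then show ?thesis
   unfolding test_functions_def mem_Collect_eq compact_eq_bounded_closed
   using C\<phi> subset_trans[OF clo[of n] assms] by blast
 qed
 moreover have "0 <= \<phi> n x \<and> \<phi> n x <= 1" for n x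
  using B01[of x] by (auto simp: \<phi>_def power_le_one)
 moreover have "(\<lambda>n. \<phi> n x) \<longlonglongrightarrow> indicator (box l u) x" for x
 proof (cases "x \<in> box l u")
  case True
  then have "0 < B x" using Bbox[of x] B01[of x] by auto
  then have "norm (1 - B x) < 1"
   using B01(2)[of x] unfolding real_norm_def abs_less_iff by linarith
  then have "(\<lambda>n. (1 - B x) ^ n) \<longlonglongrightarrow> 0" by (rule LIMSEQ_power_zero)
  then have "(\<lambda>n. 1 - (1 - B x) ^ n) \<longlonglongrightarrow> 1 - 0" by (rule tendsto_diff[OF tendsto_const])
  then show ?thesis using True by (simp add: \<phi>_def)
 next
  case False
  then have "B x = 0" using Bbox[of x] by auto
  then show ?thesis using False by (simp add: \<phi>_def)
 qed
 ultimately show ?thesis using that by blast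
qed

text \<open>The positive and negative parts are densities of measures that agree on all boxes, hence on all
  Borel sets.\<close>

lemma AE_zero_if_box_integrals_zero:
 fixes f :: "'a::euclidean_space => real"
 assumes f: "integrable lborel f"
  and z: "!!a b. (LINT x|lborel. indicator (box a b) x * f x) = 0"
 shows "AE x in lborel. f x = 0"
proof -
 define P where "P x = ennreal (f x)" for x
 define N where "N x = ennreal (- f x)" for x
 have m: "f \<in> borel_measurable borel" using f by auto
 then have mPN: "P \<in> borel_measurable lborel" "N \<in> borel_measurable lborel"
  unfolding P_def N_def by auto
 have finPN: "(\<integral>\<^sup>+x. P x \<partial>lborel) < \<infinity>" "(\<integral>\<^sup>+x. N x \<partial>lborel) < \<infinity>"
  using real_integrable_def[THEN iffD1, OF f] by (auto simp: P_def N_def less_top)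
 have eq: "density lborel P = density lborel N"
 proof (rule measure_eqI_generator_eq[where E="range (\<lambda>(a, b). box a b)" and \<Omega>=UNIV
    and A="\<lambda>n::nat. box (- (real n *\<^sub>R One)) (real n *\<^sub>R One)"])
  show "Int_stable (range (\<lambda>(a, b::'a). box a b))"
  proof (rule Int_stableI)
   fix S T :: "'a set"
   assume "S \<in> range (\<lambda>(a, b). box a b)" "T \<in> range (\<lambda>(a, b). box a b)"
   then obtain a b c d where "S = box a b" "T = box c d" by auto
   then have "S \<inter> T = (\<lambda>(a, b). box a b) (\<Sum>i\<in>Basis. max (a\<bullet>i) (c\<bullet>i) *\<^sub>R i, \<Sum>i\<in>Basis. min (b\<bullet>i) (d\<bullet>i) *\<^sub>R i)"
    by (simp add: box_Int_box)
   then show "S \<inter> T \<in> range (\<lambda>(a, b). box a b)" by blast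
  qed
  show "sets (density lborel P) = sigma_sets UNIV (range (\<lambda>(a, b). box a b))"
   "sets (density lborel N) = sigma_sets UNIV (range (\<lambda>(a, b). box a b))"
   by (simp_all add: borel_eq_box)
  show "(\<Union>n::nat. box (- (real n *\<^sub>R One)) (real n *\<^sub>R One)) = (UNIV::'a set)"
   by (rule UN_box_eq_UNIV)
  show "range (\<lambda>n::nat. box (- (real n *\<^sub>R One)) (real n *\<^sub>R One :: 'a)) \<subseteq> range (\<lambda>(a, b). box a b)"
   by auto
  show "emeasure (density lborel P) (box (- (real n *\<^sub>R One)) (real n *\<^sub>R One)) ~= \<infinity>" for n
  proof -
   have "emeasure (density lborel P) (box (- (real n *\<^sub>R One)) (real n *\<^sub>R One)) <= (\<integral>\<^sup>+x. P x \<partial>lborel)"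
    using mPN by (subst emeasure_density) (auto intro!: nn_integral_mono simp: indicator_def)
   then show ?thesis using finPN by (auto simp: top_unique)
  qed
  show "emeasure (density lborel P) X = emeasure (density lborel N) X"
   if X0: "X \<in> range (\<lambda>(a, b). box a b)" for X
  proof -
   obtain a b where X: "X = box a b" using X0 by auto
   define g where "g x = indicator X x * f x" for x
   have g: "integrable lborel g"
    unfolding g_def X using integrable_real_mult_indicator[OF _ f, of "box a b"] by (simp add: mult.commute)
   have 0: "(LINT x|lborel. g x) = 0" using z[of a b] by (simp add: g_def X)
   have "(\<integral>\<^sup>+x. ennreal (g x) \<partial>lborel) = (\<integral>\<^sup>+x. ennreal (- g x) \<partial>lborel)"
   proof -
    have fin: "(\<integral>\<^sup>+x. ennreal (g x) \<partial>lborel) ~= \<infinity>" "(\<integral>\<^sup>+x. ennreal (- g x) \<partial>lborel) ~= \<infinity>"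
     using real_integrable_def[THEN iffD1, OF g] by auto
    have "enn2real (\<integral>\<^sup>+x. ennreal (g x) \<partial>lborel) = enn2real (\<integral>\<^sup>+x. ennreal (- g x) \<partial>lborel)"
     using real_lebesgue_integral_def[OF g] 0 by simp
    then show ?thesis using fin by (metis ennreal_enn2real_if infinity_ennreal_def)
   qed
   moreover have "ennreal (g x) = P x * indicator X x" "ennreal (- g x) = N x * indicator X x" for x
    by (auto simp: g_def P_def N_def indicator_def)
   ultimately show ?thesis using mPN by (simp add: emeasure_density X)
  qed
 qed auto
 have "AE x in lborel. P x = N x"
  using sigma_finite_measure.density_unique_iff[OF sigma_finite_lborel mPN] eq by blast
 then show ?thesis
 proof eventually_elim
  case (elim x)
  then show ?case unfolding P_def N_def
   by (cases "f x \<ge> 0") (auto simp: ennreal_neg ennreal_eq_0_iff)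
 qed
qed

text \<open>Bounded convergence of bumps to the indicator function of a box carries orthogonality over to boxes.\<close>

lemma AE_zero_if_orthogonal_test_functions:
 fixes d :: "'a::euclidean_space => real"
 assumes U: "open U" and d: "integrable (lebesgue_on U) d"
  and z: "!!\<phi>. \<phi> \<in> test_functions U ==> (LINT x|lebesgue_on U. d x * \<phi> x) = 0"
 shows "AE x in lebesgue_on U. d x = 0"
proof -
 have Us: "U \<inter> space lebesgue \<in> sets lebesgue" using U by auto
 have "integrable lebesgue (\<lambda>x. indicator U x *\<^sub>R d x)"
  using d integrable_restrict_space[OF Us, of d] by blast
 then have "(\<lambda>x. indicator U x *\<^sub>R d x) \<in> borel_measurable (completion lborel)" by auto
 then obtain e where e: "e \<in> borel_measurable lborel" "AE x in lborel. indicator U x *\<^sub>R d x = e x"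
  using completion_ex_borel_measurable_real by blast
 have AEl: "AE x in lebesgue. indicator U x *\<^sub>R d x = e x" using e(2) by (rule AE_completion)
 have "integrable lebesgue e"
  using \<open>integrable lebesgue (\<lambda>x. indicator U x *\<^sub>R d x)\<close>
   integrable_cong_AE[OF _ measurable_completion[OF e(1)] AEl] by blast
 then have ie: "integrable lborel e" using e(1) integrable_completion by blast
 have ze: "(LINT x|lborel. e x * \<phi> x) = 0" if \<phi>: "\<phi> \<in> test_functions U" for \<phi>
 proof -
  have m\<phi>: "\<phi> \<in> borel_measurable borel"
   using test_function_C1(1)[OF \<phi>]
   by (auto intro!: borel_measurable_continuous_onI differentiable_imp_continuous_on
     simp: differentiable_on_def)
  have "(LINT x|lborel. e x * \<phi> x) = (LINT x|lebesgue. e x * \<phi> x)"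
   using e m\<phi> by (subst integral_completion) auto
  also have "... = (LINT x|lebesgue. indicator U x *\<^sub>R (d x * \<phi> x))"
  proof (rule integral_cong_AE)
   show "(\<lambda>x. e x * \<phi> x) \<in> borel_measurable lebesgue"
    using e m\<phi> by (intro measurable_completion) auto
   have "(\<lambda>x. indicator U x *\<^sub>R d x * \<phi> x) \<in> borel_measurable lebesgue"
    using borel_measurable_times[OF borel_measurable_integrable[OF \<open>integrable lebesgue (\<lambda>x. indicator U x *\<^sub>R d x)\<close>]
      measurable_completion[of \<phi> lborel]] m\<phi> by simp
   then show "(\<lambda>x. indicator U x *\<^sub>R (d x * \<phi> x)) \<in> borel_measurable lebesgue"
    by (simp add: mult.assoc)
   show "AE x in lebesgue. e x * \<phi> x = indicator U x *\<^sub>R (d x * \<phi> x)"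
    using AEl by eventually_elim auto
  qed
  also have "... = (LINT x|lebesgue_on U. d x * \<phi> x)"
   using integral_restrict_space[OF Us] by metis
  finally show ?thesis using z[OF \<phi>] by simp
 qed
 have box0: "(LINT x|lborel. indicator (box a b) x * e x) = 0" if ab: "cbox a b \<subseteq> U" for a b
 proof -
  obtain \<phi> where \<phi>: "!!n::nat. \<phi> n \<in> test_functions U" "!!n x. 0 <= \<phi> n x \<and> \<phi> n x <= 1"
   "!!x. (\<lambda>n. \<phi> n x) \<longlonglongrightarrow> indicator (box a b) x"
   using box_bump_test_functions[OF ab] by metis
  have m\<phi>: "\<phi> n \<in> borel_measurable borel" for n
   using test_function_C1(1)[OF \<phi>(1)]
   by (auto intro!: borel_measurable_continuous_onI differentiable_imp_continuous_on
     simp: differentiable_on_def)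
  have "(\<lambda>n. LINT x|lborel. e x * \<phi> n x) \<longlonglongrightarrow> (LINT x|lborel. e x * indicator (box a b) x)"
  proof (rule integral_dominated_convergence[where w="\<lambda>x. \<bar>e x\<bar>"])
   show "integrable lborel (\<lambda>x. \<bar>e x\<bar>)" using ie by simp
   show "AE x in lborel. (\<lambda>n. e x * \<phi> n x) \<longlonglongrightarrow> e x * indicator (box a b) x"
    by (intro AE_I2 tendsto_mult tendsto_const \<phi>)
   show "AE x in lborel. norm (e x * \<phi> n x) <= \<bar>e x\<bar>" for n
    using \<phi>(2) by (intro AE_I2) (auto simp: abs_mult intro!: mult_left_le)
  qed (use e m\<phi> in auto)
  then show ?thesis by (simp add: ze[OF \<phi>(1)] LIMSEQ_const_iff mult.commute)
 qed
 have zbox: "AE x in lborel. x \<in> cbox l u --> e x = 0" if lu: "cbox l u \<subseteq> U" for l u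
 proof -
  have "AE x in lborel. indicator (box l u) x * e x = 0"
  proof (rule AE_zero_if_box_integrals_zero)
   show "integrable lborel (\<lambda>x. indicator (box l u) x * e x)"
    using integrable_real_mult_indicator[OF _ ie, of "box l u"] by (simp add: mult.commute)
   show "(LINT x|lborel. indicator (box a b) x * (indicator (box l u) x * e x)) = 0" for a b
   proof -
    obtain a' b' where ab: "box a b \<inter> box l u = box a' b'" using box_Int_box by blast
    have "(LINT x|lborel. indicator (box a' b') x * e x) = 0"
    proof (cases "box a' b' = {}")
     case False
     then have "cbox a' b' = closure (box a' b')" by simp
     also have "... \<subseteq> cbox l u"
      using ab box_subset_cbox[of l u] by (intro closure_minimal) auto
     finally show ?thesis using lu by (intro box0) auto
    qed simp
    then show ?thesis by (simp add: ab[symmetric] indicator_inter_arith mult.assoc)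
   qed
  qed
  moreover have "AE x in lborel. x ~: cbox l u - box l u"
   by (rule AE_not_in) (auto simp: null_sets_def emeasure_lborel_cbox_eq emeasure_lborel_box_eq
     emeasure_Diff box_subset_cbox)
  ultimately show ?thesis by eventually_elim (auto simp: indicator_def split: if_splits)
 qed
 obtain \<D> where \<D>: "countable \<D>" "!!X. X \<in> \<D> ==> X \<subseteq> U" "!!X. X \<in> \<D> ==> \<exists>a b. X = cbox a b" "\<Union>\<D> = U"
  using open_countable_Union_open_cbox[OF U] by (metis Pow_iff subsetD)
 have "AE x in lborel. \<forall>X\<in>\<D>. x \<in> X --> e x = 0"
  unfolding AE_ball_countable[OF \<D>(1)]
 proof
  fix X assume X: "X \<in> \<D>"
  then obtain l u where "X = cbox l u" using \<D>(3) by blast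
  then show "AE x in lborel. x \<in> X --> e x = 0" using zbox \<D>(2)[OF X] by blast
 qed
 then have "AE x in lborel. x \<in> U --> d x = 0"
  using e(2)
 proof eventually_elim
  case (elim x)
  show ?case
  proof
   assume x: "x \<in> U"
   then have "e x = 0" using elim(1) \<D>(4) by blast
   then show "d x = 0" using elim(2) x by simp
  qed
 qed
 then show ?thesis using U by (subst AE_lebesgue_on_iff) auto
qed

section \<open>Polynomials, triangles and edge bubbles\<close>

lemma finite_idx: "finite {(i::nat, j::nat). i + j <= m}"
 by (rule finite_subset[of _ "{..m} \<times> {..m}"]) auto

lemma Pxy_zero: "(\<lambda>p. 0) \<in> Pxy m"
 unfolding Pxy_def by (auto intro!: exI[of _ "\<lambda>_ _. 0"])

lemma Pxy_add: "f \<in> Pxy m ==> g \<in> Pxy m ==> (\<lambda>p. f p + g p) \<in> Pxy m"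
proof -
 assume "f \<in> Pxy m" "g \<in> Pxy m"
 then obtain c d where "!!p. f p = (\<Sum>(i, j)\<in>{(i, j). i + j <= m}. c i j * (p $ 1) ^ i * (p $ 2) ^ j)"
  "!!p. g p = (\<Sum>(i, j)\<in>{(i, j). i + j <= m}. d i j * (p $ 1) ^ i * (p $ 2) ^ j)"
  unfolding Pxy_def by blast
 then have "f p + g p = (\<Sum>(i, j)\<in>{(i, j). i + j <= m}. (c i j + d i j) * (p $ 1) ^ i * (p $ 2) ^ j)" for p
  by (simp add: sum.distrib[symmetric] case_prod_unfold algebra_simps)
 then show ?thesis unfolding Pxy_def by (auto intro!: exI[of _ "\<lambda>i j. c i j + d i j"])
qed

lemma Pxy_cmul: "f \<in> Pxy m ==> (\<lambda>p. a * f p) \<in> Pxy m"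
proof -
 assume "f \<in> Pxy m"
 then obtain c where "!!p. f p = (\<Sum>(i, j)\<in>{(i, j). i + j <= m}. c i j * (p $ 1) ^ i * (p $ 2) ^ j)"
  unfolding Pxy_def by blast
 then have "a * f p = (\<Sum>(i, j)\<in>{(i, j). i + j <= m}. (a * c i j) * (p $ 1) ^ i * (p $ 2) ^ j)" for p
  by (simp add: sum_distrib_left case_prod_unfold algebra_simps)
 then show ?thesis unfolding Pxy_def by (auto intro!: exI[of _ "\<lambda>i j. a * c i j"])
qed

lemma Pxy_sum: "finite A ==> (!!a. a \<in> A ==> f a \<in> Pxy m) ==> (\<lambda>p. \<Sum>a\<in>A. f a p) \<in> Pxy m"
 by (induction A rule: finite_induct) (auto intro: Pxy_zero Pxy_add)

lemma Pxy_monom: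
 assumes "i + j <= m"
 shows "(\<lambda>p. a * (p $ 1) ^ i * (p $ 2) ^ j) \<in> Pxy m"
proof -
 have "a * (p $ 1) ^ i * (p $ 2) ^ j = (\<Sum>(i', j')\<in>{(i', j'). i' + j' <= m}.
   (if i' = i \<and> j' = j then a else 0) * (p $ 1) ^ i' * (p $ 2) ^ j')" for p :: "real^2"
 proof -
  have "(\<Sum>(i', j')\<in>{(i', j'). i' + j' <= m}. (if i' = i \<and> j' = j then a else 0) * (p $ 1) ^ i' * (p $ 2) ^ j')
   = (\<Sum>x\<in>{(i', j'). i' + j' <= m}. if x = (i, j) then a * (p $ 1) ^ i * (p $ 2) ^ j else 0)"
   by (intro sum.cong) (auto split: if_splits)
  then show ?thesis using assms finite_idx[of m] by simp
 qed
 then show ?thesis unfolding Pxy_def by (auto intro!: exI[of _ "\<lambda>i' j'. if i' = i \<and> j' = j then a else 0"])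
qed

lemma Pxy_induct [consumes 1, case_names monom add]:
 assumes f: "f \<in> Pxy m"
  and mon: "!!a i j. i + j <= m ==> P (\<lambda>p. a * (p $ 1) ^ i * (p $ 2) ^ j)"
  and add: "!!f g. P f ==> P g ==> P (\<lambda>p. f p + g p)"
 shows "P f"
proof -
 obtain c where c: "!!p. f p = (\<Sum>x\<in>{(i, j). i + j <= m}. c (fst x) (snd x) * (p $ 1) ^ fst x * (p $ 2) ^ snd x)"
  using f unfolding Pxy_def by (auto simp: case_prod_unfold)
 have 0: "P (\<lambda>p. 0)" using mon[of 0 0 0] by simp
 have "P (\<lambda>p. \<Sum>x\<in>A. c (fst x) (snd x) * (p $ 1) ^ fst x * (p $ 2) ^ snd x)"
  if "finite A" "A \<subseteq> {(i, j). i + j <= m}" for A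
  using that by (induction A rule: finite_induct) (auto intro!: 0 add mon)
 from this[OF finite_idx subset_refl] show ?thesis unfolding c[symmetric] by simp
qed

lemma Pxy_mono: "f \<in> Pxy m ==> m <= n ==> f \<in> Pxy n"
 by (induction rule: Pxy_induct) (auto intro: Pxy_monom Pxy_add)

lemma Pxy_const: "(\<lambda>p. a) \<in> Pxy m"
 using Pxy_monom[of 0 0 m a] by simp

lemma Pxy_coord: "(\<lambda>p. p $ i) \<in> Pxy (Suc m)"
 using Pxy_monom[of 1 0 "Suc m" 1] Pxy_monom[of 0 1 "Suc m" 1] exhaust_2[of i] by auto

lemma Pxy_mult:
 assumes "f \<in> Pxy m" "g \<in> Pxy n"
 shows "(\<lambda>p. f p * g p) \<in> Pxy (m + n)"
 using assms(1)
proof (induction rule: Pxy_induct)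
 case (monom a i j)
 show ?case using assms(2)
 proof (induction rule: Pxy_induct)
  case (monom b i' j')
  have "(\<lambda>p. a * p $ 1 ^ i * p $ 2 ^ j * (b * p $ 1 ^ i' * p $ 2 ^ j')) =
   (\<lambda>p::real^2. (a * b) * (p $ 1) ^ (i + i') * (p $ 2) ^ (j + j'))"
   by (auto simp: power_add mult_ac)
  then show ?case using monom \<open>i + j <= m\<close> Pxy_monom[of "i + i'" "j + j'" "m + n" "a * b"] by simp
 next
  case (add f g)
  then show ?case using Pxy_add by (simp add: distrib_left)
 qed
next
 case (add f g)
 then show ?case using Pxy_add by (simp add: distrib_right)
qed

lemma Pxy_power: "f \<in> Pxy m ==> (\<lambda>p. f p ^ n) \<in> Pxy (n * m)"
 by (induction n) (auto intro: Pxy_const Pxy_mult)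

lemma Pxy_compose:
 assumes f: "f \<in> Pxy m" and u: "u \<in> Pxy 1" and w: "w \<in> Pxy 1"
 shows "(\<lambda>p. f (vector [u p, w p])) \<in> Pxy m"
 using f
proof (induction rule: Pxy_induct)
 case (monom a i j)
 have "(\<lambda>p. a * (u p ^ i * w p ^ j)) \<in> Pxy m"
  using Pxy_mult[OF Pxy_power[OF u, of i] Pxy_power[OF w, of j]] monom
  by (intro Pxy_cmul) (auto intro: Pxy_mono)
 then show ?case by (simp add: mult.assoc)
qed (auto intro: Pxy_add)

lemma Pxy_has_derivative:
 assumes "f \<in> Pxy m"
 shows "(f has_derivative (\<lambda>t. pd t f p)) (at p)" "pd t f \<in> Pxy (m - 1)"
proof -
 have "\<exists>D. (\<forall>p. (f has_derivative D p) (at p)) \<and> (\<forall>t. (\<lambda>p. D p t) \<in> Pxy (m - 1))"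
  using assms
 proof (induction rule: Pxy_induct)
  case (monom a i j)
  define D :: "real^2 => real^2 => real" where
   "D p h = a * real i * p $ 1 ^ (i - 1) * p $ 2 ^ j * h $ 1 + a * real j * p $ 1 ^ i * p $ 2 ^ (j - 1) * h $ 2" for p h
  have "((\<lambda>p. a * p $ 1 ^ i * p $ 2 ^ j) has_derivative D p) (at p)" for p
   unfolding D_def
   by (auto intro!: derivative_eq_intros bounded_linear_imp_has_derivative bounded_linear_vec_nth simp: algebra_simps)
  moreover have "(\<lambda>p. D p t) \<in> Pxy (m - 1)" for t
  proof -
   have 1: "(\<lambda>p. (a * real i * t $ 1) * p $ 1 ^ (i - 1) * p $ 2 ^ j) \<in> Pxy (m - 1)"
    using monom Pxy_monom[of "i - 1" j "m - 1" "a * real i * t $ 1"] Pxy_zero by (cases i) auto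
   have 2: "(\<lambda>p. (a * real j * t $ 2) * p $ 1 ^ i * p $ 2 ^ (j - 1)) \<in> Pxy (m - 1)"
    using monom Pxy_monom[of i "j - 1" "m - 1" "a * real j * t $ 2"] Pxy_zero by (cases j) auto
   show ?thesis using Pxy_add[OF 1 2] by (simp add: D_def mult_ac)
  qed
  ultimately show ?case by blast
 next
  case (add f g)
  then obtain D E where "!!p. (f has_derivative D p) (at p)" "!!t. (\<lambda>p. D p t) \<in> Pxy (m - 1)"
   "!!p. (g has_derivative E p) (at p)" "!!t. (\<lambda>p. E p t) \<in> Pxy (m - 1)" by blast
  then show ?case
   by (intro exI[of _ "\<lambda>p t. D p t + E p t"]) (auto intro: has_derivative_add Pxy_add)
 qed
 then obtain D where D: "!!p. (f has_derivative D p) (at p)" "!!t. (\<lambda>p. D p t) \<in> Pxy (m - 1)" by blast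
 have "pd t f = (\<lambda>p. D p t)" for t
  unfolding pd_def using frechet_derivative_at[OF D(1)] by metis
 then show "(f has_derivative (\<lambda>t. pd t f p)) (at p)" "pd t f \<in> Pxy (m - 1)"
  using D by (simp_all add: fun_eq_iff[THEN iffD2])
qed

lemma pd_unique: "(f has_derivative D) (at p) ==> pd t f p = D t"
 unfolding pd_def by (metis frechet_derivative_at)

lemma Pxy_cont: "f \<in> Pxy m ==> continuous_on S f"
 using Pxy_has_derivative(1) has_derivative_continuous continuous_at_imp_continuous_on by metis

lemma Pxy_borel: "f \<in> Pxy m ==> f \<in> borel_measurable borel"
 using Pxy_cont borel_measurable_continuous_onI by blast

lemma Pxy_linear_pd:
 assumes "f \<in> Pxy m"
 shows "pd (s + t) f p = pd s f p + pd t f p" "pd (s - t) f p = pd s f p - pd t f p" "pd (a *\<^sub>R t) f p = a * pd t f p"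
 using has_derivative_linear[OF Pxy_has_derivative(1)[OF assms, of p]]
 by (auto dest: linear_add linear_diff linear_scale)

lemma Pxy_along:
 assumes "f \<in> Pxy m"
 shows "((\<lambda>h. f (p + h *\<^sub>R t)) has_real_derivative pd t f (p + s *\<^sub>R t)) (at s)"
proof -
 have 1: "((\<lambda>h. p + h *\<^sub>R t) has_derivative (\<lambda>h. h *\<^sub>R t)) (at s)"
  by (auto intro!: derivative_eq_intros)
 have "((\<lambda>h. f (p + h *\<^sub>R t)) has_derivative (\<lambda>h. pd (h *\<^sub>R t) f (p + s *\<^sub>R t))) (at s)"
  using has_derivative_compose[OF 1 Pxy_has_derivative(1)[OF assms]] .
 moreover have "(\<lambda>h. pd (h *\<^sub>R t) f (p + s *\<^sub>R t)) = (*) (pd t f (p + s *\<^sub>R t))"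
  using Pxy_linear_pd(3)[OF assms] by (auto simp: fun_eq_iff mult.commute)
 ultimately show ?thesis unfolding has_field_derivative_def by simp
qed

lemma dlip_Pxy:
 assumes f: "f \<in> Pxy m" and U: "bounded U"
 shows "dlip U t f (pd t f)"
proof -
 obtain R where "!!x. x \<in> U ==> norm x <= R" using U unfolding bounded_iff by blast
 then have R: "U \<subseteq> cball 0 R" by auto
 have b: "\<exists>B. \<forall>x\<in>cball 0 R. \<bar>g x\<bar> <= B" if "g \<in> Pxy n" for g n
  using compact_imp_bounded[OF compact_continuous_image[OF Pxy_cont[OF that] compact_cball]]
  unfolding bounded_iff by (metis image_eqI real_norm_def)
 obtain B where B: "!!x. x \<in> cball 0 R ==> \<bar>f x\<bar> <= B" using b[OF f] by blast
 obtain L where L: "!!x. x \<in> cball 0 R ==> \<bar>pd t f x\<bar> <= L" using b[OF Pxy_has_derivative(2)[OF f]] by blast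
 show ?thesis
 proof (rule dlipI[of _ _ _ B L "\<bar>L\<bar>"])
  show "f \<in> borel_measurable borel" "pd t f \<in> borel_measurable borel"
   using Pxy_borel f Pxy_has_derivative(2)[OF f] by blast+
  show "\<bar>f x\<bar> <= B" "\<bar>pd t f x\<bar> <= L" if "x \<in> U" for x using B L R that by auto
  show "\<bar>f (x + h *\<^sub>R t) - f x\<bar> <= \<bar>L\<bar> * \<bar>h\<bar>" if s: "closed_segment x (x + h *\<^sub>R t) \<subseteq> U" for x h
  proof -
   have "norm (f (x + h *\<^sub>R t) - f (x + 0 *\<^sub>R t)) <= \<bar>L\<bar> * norm (h - 0)"
   proof (rule field_differentiable_bound[of "closed_segment 0 h" _ "\<lambda>s. pd t f (x + s *\<^sub>R t)"])
    show "((\<lambda>h. f (x + h *\<^sub>R t)) has_field_derivative pd t f (x + s *\<^sub>R t)) (at s within closed_segment 0 h)" for s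
     using Pxy_along[OF f] by (rule has_field_derivative_at_within)
    fix s assume "s \<in> closed_segment 0 h"
    then obtain u where "0 <= u" "u <= 1" "s = u * h" by (auto simp: in_segment)
    then have "x + s *\<^sub>R t \<in> closed_segment x (x + h *\<^sub>R t)"
     unfolding in_segment by (intro exI[of _ u]) (auto simp: algebra_simps)
    then have "x + s *\<^sub>R t \<in> cball 0 R" using s R by blast
    then show "norm (pd t f (x + s *\<^sub>R t)) <= \<bar>L\<bar>" using L by fastforce
   qed auto
   then show ?thesis by simp
  qed
  show "AE x in lborel. x \<in> U --> ((\<lambda>h. f (x + h *\<^sub>R t)) has_real_derivative pd t f x) (at 0)"
   using Pxy_along[OF f, of _ t 0] by simp
 qed simp
qed

definition cr :: "real^2 => real^2 => real" where "cr u w = u $ 1 * w $ 2 - u $ 2 * w $ 1"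

definition area2 :: "real^2 => real^2 => real^2 => real" where "area2 a b c = cr (b - a) (c - a)"

definition lam :: "real^2 => real^2 => real^2 => real^2 => real" where
 "lam a b c p = area2 p b c / area2 a b c"

definition dlam :: "real^2 => real^2 => real^2 => real^2 => real" where
 "dlam a b c t = cr (c - b) t / area2 a b c"

lemmas cr_simps = area2_def cr_def

lemma area2_rot: "area2 b c a = area2 a b c" "area2 c a b = area2 a b c" "area2 b a c = - area2 a b c" "area2 a c b = - area2 a b c"
 by (simp_all add: cr_simps algebra_simps)

lemma lam_swap: "lam a c b p = lam a b c p"
 unfolding lam_def area2_rot(4)[of a b c] area2_rot(4)[of p b c] by simp

lemma lam_affine: "lam a b c (p + h *\<^sub>R t) = lam a b c p + h * dlam a b c t"
 by (simp add: lam_def dlam_def cr_simps add_divide_distrib[symmetric] diff_divide_distrib[symmetric] algebra_simps)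

lemma lam_Pxy: "lam a b c \<in> Pxy (Suc m)"
proof -
 have "lam a b c = (\<lambda>p. cr b c / area2 a b c + ((b $ 2 - c $ 2) / area2 a b c) * p $ 1 + ((c $ 1 - b $ 1) / area2 a b c) * p $ 2)"
  by (rule ext) (simp add: lam_def cr_simps add_divide_distrib[symmetric] diff_divide_distrib[symmetric] algebra_simps)
 also have "... \<in> Pxy (Suc m)" by (intro Pxy_add Pxy_cmul Pxy_const Pxy_coord)
 finally show ?thesis .
qed

lemma pd_lam: "pd t (lam a b c) p = dlam a b c t"
proof -
 have "((\<lambda>h. lam a b c (p + h *\<^sub>R t)) has_real_derivative dlam a b c t) (at 0)"
  unfolding lam_affine by (auto intro!: derivative_eq_intros)
 then show ?thesis using Pxy_along[OF lam_Pxy, of a b c p t 0] DERIV_unique by fastforce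
qed

lemma lam_sum: "area2 a b c ~= 0 ==> lam a b c p + lam b c a p + lam c a b p = 1"
 unfolding lam_def area2_rot(1,2)[where a=a and b=b and c=c]
 by (simp add: add_divide_distrib[symmetric] divide_simps) (simp add: cr_simps algebra_simps)

lemma lam_rep: "area2 a b c ~= 0 ==> lam a b c p *\<^sub>R a + lam b c a p *\<^sub>R b + lam c a b p *\<^sub>R c = p"
 unfolding lam_def area2_rot(1,2)[where a=a and b=b and c=c]
 by (simp add: vec_eq_iff forall_2 divide_simps) (simp add: cr_simps algebra_simps)

lemma lam_comb:
 assumes "area2 a b c ~= 0" "u + v + w = 1"
 shows "lam a b c (u *\<^sub>R a + v *\<^sub>R b + w *\<^sub>R c) = u"
proof -
 have u: "u = 1 - v - w" using assms by simp
 show ?thesis using assms(1) unfolding u lam_def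
  by (simp add: divide_simps) (simp add: cr_simps algebra_simps)
qed

lemma dlam_edge: "area2 a b c ~= 0 ==> dlam a b c (b - a) = -1" "area2 a b c ~= 0 ==> dlam b c a (b - a) = 1" "dlam c a b (b - a) = 0"
 unfolding dlam_def area2_rot(1,2)[where a=a and b=b and c=c]
 by (simp_all add: divide_simps) (simp_all add: cr_simps algebra_simps)

definition tri :: "real^2 => real^2 => real^2 => (real^2) set" where
 "tri a b c = {p. 0 <= lam a b c p \<and> 0 <= lam b c a p \<and> 0 <= lam c a b p}"

lemma tri_hull:
 assumes "area2 a b c ~= 0"
 shows "convex hull {a, b, c} = tri a b c"
proof (intro equalityI subsetI)
 fix p assume "p \<in> convex hull {a, b, c}"
 then obtain u v w where "0 <= u" "0 <= v" "0 <= w" "u + v + w = 1" and p: "p = u *\<^sub>R a + v *\<^sub>R b + w *\<^sub>R c"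
  unfolding convex_hull_3 by blast
 then show "p \<in> tri a b c"
  using lam_comb[of a b c u v w] lam_comb[of b c a v w u] lam_comb[of c a b w u v] assms
  unfolding tri_def p area2_rot(1,2)[where a=a and b=b and c=c] by (auto simp: add_ac)
next
 fix p assume "p \<in> tri a b c"
 then show "p \<in> convex hull {a, b, c}"
  unfolding convex_hull_3 tri_def using lam_sum[OF assms, of p] lam_rep[OF assms, of p] by force
qed

lemma tri_rot: "tri b c a = tri a b c" "tri a c b = tri a b c" "tri b a c = tri a b c"
 by (auto simp: tri_def lam_swap)

lemma negligible_AE_lborel: "negligible S ==> AE x in lborel. x ~: S"
proof -
 assume "negligible S"
 then have "AE x in lebesgue. x ~: S" using AE_not_in negligible_iff_null_sets by blast
 then show ?thesis by (simp add: AE_completion_iff)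
qed

lemma AE_lam_nonzero:
 assumes "area2 a b c ~= 0"
 shows "AE p in lborel. lam a b c p ~= 0"
proof -
 let ?v = "vector [(c - b) $ 2, - ((c - b) $ 1)] :: real^2"
 have "?v ~= 0" using assms by (auto simp: vec_eq_iff forall_2 cr_simps)
 then have "negligible {p. ?v \<bullet> p = cr b c}" by (intro negligible_hyperplane) auto
 moreover have "lam a b c p = 0 \<longleftrightarrow> ?v \<bullet> p = cr b c" for p
  using assms by (auto simp: lam_def inner_vec_def sum_2 cr_simps algebra_simps)
 ultimately show ?thesis using negligible_AE_lborel[of "{p. ?v \<bullet> p = cr b c}"] by auto
qed

lemma dlip_lam_pos:
 assumes "area2 a b c ~= 0" "bounded U"
 shows "dlip U t (\<lambda>p. max (lam a b c p) 0) (\<lambda>p. if lam a b c p > 0 then dlam a b c t else 0)"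
proof -
 let ?l = "lam a b c"
 obtain B where B: "!!x. x \<in> U ==> \<bar>?l x\<bar> <= B"
  using dlip_Pxy[OF lam_Pxy[of a b c 0] assms(2), of t] by (auto simp: dlip_def)
 have m: "?l \<in> borel_measurable borel" using lam_Pxy Pxy_borel by blast
 show ?thesis
 proof (rule dlipI[of _ _ _ "\<bar>B\<bar>" "\<bar>dlam a b c t\<bar>" "\<bar>dlam a b c t\<bar>"])
  show "\<bar>max (?l x) 0\<bar> <= \<bar>B\<bar>" if "x \<in> U" for x using B[OF that] by auto
  show "\<bar>max (?l (x + h *\<^sub>R t)) 0 - max (?l x) 0\<bar> <= \<bar>dlam a b c t\<bar> * \<bar>h\<bar>" for x h
  proof -
   have "\<bar>max (?l (x + h *\<^sub>R t)) 0 - max (?l x) 0\<bar> <= \<bar>h * dlam a b c t\<bar>"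
    unfolding lam_affine by linarith
   then show ?thesis by (simp add: abs_mult mult.commute)
  qed
  show "AE x in lborel. x \<in> U --> ((\<lambda>h. max (?l (x + h *\<^sub>R t)) 0) has_real_derivative (if ?l x > 0 then dlam a b c t else 0)) (at 0)"
   using AE_lam_nonzero[OF assms(1)]
  proof eventually_elim
   case (elim x)
   have op: "open {h. ?l x + h * dlam a b c t > 0}" "open {h. ?l x + h * dlam a b c t < 0}"
    by (auto intro!: open_Collect_less continuous_intros)
   show ?case
   proof (intro impI, cases "?l x > 0")
    case True
    have "((\<lambda>h. max (?l (x + h *\<^sub>R t)) 0) has_real_derivative dlam a b c t) (at 0)"
     by (rule has_field_derivative_transform_within_open[OF _ op(1), of "\<lambda>h. ?l x + h * dlam a b c t"])
      (use True in \<open>auto intro!: derivative_eq_intros simp: lam_affine\<close>)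
    then show "((\<lambda>h. max (?l (x + h *\<^sub>R t)) 0) has_real_derivative (if ?l x > 0 then dlam a b c t else 0)) (at 0)"
     using True by simp
   next
    case False
    have "((\<lambda>h. max (?l (x + h *\<^sub>R t)) 0) has_real_derivative 0) (at 0)"
     by (rule has_field_derivative_transform_within_open[OF _ op(2), of "\<lambda>h. 0"])
      (use False elim in \<open>auto simp: lam_affine\<close>)
    then show "((\<lambda>h. max (?l (x + h *\<^sub>R t)) 0) has_real_derivative (if ?l x > 0 then dlam a b c t else 0)) (at 0)"
     using False by simp
   qed
  qed
 qed (use m in auto)
qed

text \<open>A bubble: in direction \<open>b - a\<close> the third barycentric coordinate is constant while the other
  two vanish where a line in this direction leaves the triangle. Extended by zero, the bubble is
  therefore Lipschitz in this direction, although it jumps across the other two edges.\<close>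

definition bub :: "real^2 => real^2 => real^2 => (real^2 => real) => real^2 => real" where
 "bub a b c g p = indicator (tri a b c) p * (lam a b c p * lam b c a p * g p)"

definition dbub :: "real^2 => real^2 => real^2 => (real^2 => real) => real^2 => real" where
 "dbub a b c g p = (lam a b c p - lam b c a p) * g p + lam a b c p * lam b c a p * pd (b - a) g p"

lemma tri_compact: "area2 a b c ~= 0 ==> compact (tri a b c)"
 using tri_hull[of a b c] finite_imp_compact_convex_hull[of "{a,b,c}"] by simp

lemma tri_borel: "tri a b c \<in> sets borel"
proof -
 have [measurable]: "lam a b c \<in> borel_measurable borel" for a b c using lam_Pxy Pxy_borel by blast
 show ?thesis unfolding tri_def by measurable
qed

lemma dbub_Pxy: "g \<in> Pxy m ==> dbub a b c g \<in> Pxy (m + 1)"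
proof -
 assume g: "g \<in> Pxy m"
 have 1: "(\<lambda>p. lam a b c p - lam b c a p) \<in> Pxy 1"
  using Pxy_add[OF lam_Pxy[of a b c 0] Pxy_cmul[OF lam_Pxy[of b c a 0], of "-1"]] by simp
 have 2: "(\<lambda>p. lam a b c p * lam b c a p) \<in> Pxy (1 + 1)"
  using lam_Pxy[of _ _ _ 0] by (intro Pxy_mult) simp_all
 have 3: "(\<lambda>p. lam a b c p * lam b c a p * pd (b - a) g p) \<in> Pxy (m + 1)"
 proof (cases m)
  case 0
  have "pd (b - a) g p = 0" for p
  proof -
   obtain k where "g = (\<lambda>_. k)" using g 0 unfolding Pxy_def by (auto simp: fun_eq_iff)
   then show ?thesis by (simp add: pd_def)
  qed
  then show ?thesis by (simp add: Pxy_zero)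
 next
  case (Suc n)
  then show ?thesis using Pxy_mult[OF 2 Pxy_has_derivative(2)[OF g]] by (auto intro: Pxy_mono)
 qed
 show ?thesis unfolding dbub_def using Pxy_add[OF _ 3] Pxy_mult[OF 1 g] by (simp add: add.commute)
qed

lemma dlip_bub:
 assumes "area2 a b c ~= 0" "g \<in> Pxy m" "bounded U"
 shows "dlip U (b - a) (bub a b c g) (\<lambda>p. indicator (tri a b c) p * dbub a b c g p)"
proof -
 have nz: "area2 b c a ~= 0" "area2 c a b ~= 0" using assms(1) area2_rot by metis+
 have mc: "lam c a b \<in> borel_measurable borel" using lam_Pxy Pxy_borel by blast
 have 3: "dlip U (b - a) (\<lambda>p. if lam c a b p \<ge> 0 then 1 else 0) (\<lambda>p. 0)"
  by (rule dlipI[of _ _ _ 1 0 0]) (use mc in \<open>auto simp: lam_affine dlam_edge\<close>)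
 have "dlip U (b - a)
  (\<lambda>p. (max (lam a b c p) 0 * max (lam b c a p) 0) * ((if lam c a b p \<ge> 0 then 1 else 0) * g p))
  (\<lambda>p. ((if lam a b c p > 0 then dlam a b c (b - a) else 0) * max (lam b c a p) 0
    + max (lam a b c p) 0 * (if lam b c a p > 0 then dlam b c a (b - a) else 0))
     * ((if lam c a b p \<ge> 0 then 1 else 0) * g p)
   + max (lam a b c p) 0 * max (lam b c a p) 0 *
     (0 * g p + (if lam c a b p \<ge> 0 then 1 else 0) * pd (b - a) g p))"
  by (intro dlip_mult dlip_lam_pos dlip_Pxy[OF assms(2)] 3 assms nz)
 moreover have "(\<lambda>p. (max (lam a b c p) 0 * max (lam b c a p) 0) * ((if lam c a b p \<ge> 0 then 1 else 0) * g p)) = bub a b c g"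
  by (auto simp: bub_def tri_def indicator_def fun_eq_iff max_def)
 ultimately have d: "dlip U (b - a) (bub a b c g)
  (\<lambda>p. ((if lam a b c p > 0 then dlam a b c (b - a) else 0) * max (lam b c a p) 0
    + max (lam a b c p) 0 * (if lam b c a p > 0 then dlam b c a (b - a) else 0))
     * ((if lam c a b p \<ge> 0 then 1 else 0) * g p)
   + max (lam a b c p) 0 * max (lam b c a p) 0 *
     (0 * g p + (if lam c a b p \<ge> 0 then 1 else 0) * pd (b - a) g p))" by simp
 have P: "dbub a b c g \<in> Pxy (m + 1)" by (rule dbub_Pxy[OF assms(2)])
 obtain B where B: "!!x. x \<in> tri a b c ==> norm (dbub a b c g x) <= B"
  using compact_imp_bounded[OF compact_continuous_image[OF Pxy_cont[OF P] tri_compact[OF assms(1)]]]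
  unfolding bounded_iff by blast
 show ?thesis
 proof (rule dlip_cong_AE[OF d, where B'="\<bar>B\<bar>"])
  show "(\<lambda>p. indicator (tri a b c) p * dbub a b c g p) \<in> borel_measurable borel"
   using Pxy_borel[OF P] tri_borel by measurable
  show "\<bar>indicator (tri a b c) x * dbub a b c g x\<bar> <= \<bar>B\<bar>" for x
   using B[of x] by (auto simp: indicator_def)
  show "AE p in lborel. p \<in> U --> ((if lam a b c p > 0 then dlam a b c (b - a) else 0) * max (lam b c a p) 0
    + max (lam a b c p) 0 * (if lam b c a p > 0 then dlam b c a (b - a) else 0))
     * ((if lam c a b p \<ge> 0 then 1 else 0) * g p)
   + max (lam a b c p) 0 * max (lam b c a p) 0 *
     (0 * g p + (if lam c a b p \<ge> 0 then 1 else 0) * pd (b - a) g p) = indicator (tri a b c) p * dbub a b c g p"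
   using AE_lam_nonzero[OF assms(1)] AE_lam_nonzero[OF nz(1)]
  proof eventually_elim
   case (elim p)
   then show ?case
    using dlam_edge(1,2)[OF assms(1)]
    by (cases "lam a b c p > 0"; cases "lam b c a p > 0"; cases "lam c a b p \<ge> 0")
     (auto simp: tri_def dbub_def max_def algebra_simps)
  qed
 qed
qed

lemma integral_dbub:
 assumes "area2 a b c ~= 0" "g \<in> Pxy m"
 shows "(LINT p|lborel. indicator (tri a b c) p * dbub a b c g p) = 0"
proof -
 obtain R where R: "R > 0" "!!x. x \<in> tri a b c ==> norm x <= R"
  using compact_imp_bounded[OF tri_compact[OF assms(1)]] unfolding bounded_pos by blast
 let ?t = "b - a"
 define U where "U = ball (0::real^2) (R + 3 + 3 * norm ?t)"
 have "bounded U" by (simp add: U_def)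
 have d: "dlip U ?t (bub a b c g) (\<lambda>p. indicator (tri a b c) p * dbub a b c g p)"
  by (rule dlip_bub[OF assms]) (simp add: U_def)
 obtain B L where f: "bub a b c g \<in> borel_measurable borel" "(\<lambda>p. indicator (tri a b c) p * dbub a b c g p) \<in> borel_measurable borel" "B \<ge> 0"
  "!!x. x \<in> U ==> \<bar>bub a b c g x\<bar> <= B" "!!x. x \<in> U ==> \<bar>indicator (tri a b c) x * dbub a b c g x\<bar> <= B" "L \<ge> 0"
  "!!x h. closed_segment x (x + h *\<^sub>R ?t) \<subseteq> U ==> \<bar>bub a b c g (x + h *\<^sub>R ?t) - bub a b c g x\<bar> <= L * \<bar>h\<bar>"
  "AE x in lborel. x \<in> U --> ((\<lambda>h. bub a b c g (x + h *\<^sub>R ?t)) has_real_derivative indicator (tri a b c) x * dbub a b c g x) (at 0)"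
  by (rule dlipE[OF d], rule that; assumption)
 have z: "bub a b c g x = 0" "indicator (tri a b c) x * dbub a b c g x = 0" if "norm x > R" for x
  using R(2)[of x] that by (auto simp: bub_def indicator_def)
 have TU: "x \<in> U" if "norm x <= R + 2 + 2 * norm ?t" for x 
  using that norm_ge_zero[of ?t] unfolding U_def mem_ball_0 by linarith
 show ?thesis
 proof (rule integral_directional_derivative_zero[of "bub a b c g" _ B R 1 L ?t])
  show "\<bar>bub a b c g x\<bar> <= B" for x
  proof (cases "norm x > R")
   case True
   then show ?thesis using z f(3) by simp
  next
   case False
   then show ?thesis using norm_ge_zero[of ?t] by (intro f(4) TU) linarith
  qed
  show "\<bar>bub a b c g (x + h *\<^sub>R ?t) - bub a b c g x\<bar> <= L * \<bar>h\<bar>" if h: "\<bar>h\<bar> < 1" for x h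
  proof (cases "norm x <= R + 1 + norm ?t")
   case True
   have "norm (h *\<^sub>R ?t) <= norm ?t" using h by (simp add: mult_left_le_one_le)
   then have y: "norm (x + h *\<^sub>R ?t) <= R + 1 + 2 * norm ?t" using True norm_triangle_ineq[of x "h *\<^sub>R ?t"] by linarith
   have "closed_segment x (x + h *\<^sub>R ?t) \<subseteq> cball 0 (R + 1 + 2 * norm ?t)"
    using True y norm_ge_zero[of ?t] by (intro closed_segment_subset) (auto simp del: norm_ge_zero)
   also have "... \<subseteq> U" using norm_ge_zero[of ?t] by (auto simp: U_def simp del: norm_ge_zero)
   finally show ?thesis by (rule f(7))
  next
   case False
   have "norm (h *\<^sub>R ?t) <= norm ?t" using h by (simp add: mult_left_le_one_le)
   then have "norm (x + h *\<^sub>R ?t) > R" using False norm_diff_ineq[of x "h *\<^sub>R ?t"] by linarith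
   moreover have "norm x > R" using False norm_ge_zero[of ?t] by linarith
   ultimately show ?thesis using z f(6) by simp
  qed
  show "AE x in lborel. ((\<lambda>h. bub a b c g (x + h *\<^sub>R ?t)) has_real_derivative indicator (tri a b c) x * dbub a b c g x) (at 0)"
   using f(8)
  proof eventually_elim
   case (elim x)
   show ?case
   proof (cases "norm x > R")
    case True
    have op: "open ((\<lambda>h. x + h *\<^sub>R ?t) -` {y. norm y > R})"
     by (intro open_vimage continuous_intros open_Collect_less)
    have "((\<lambda>h. bub a b c g (x + h *\<^sub>R ?t)) has_real_derivative 0) (at 0)"
     by (rule has_field_derivative_transform_within_open[OF DERIV_const[of 0] op])
      (use True z in auto)
    then show ?thesis unfolding z(2)[OF True] .
   next
    case False
    then have "x \<in> U" using norm_ge_zero[of ?t] by (intro TU) linarith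
    then show ?thesis using elim by blast
   qed
  qed
 qed (use f z in auto)
qed

section \<open>Integrals over triangles\<close>

lemma Pxy_pd_mult:
 assumes "f \<in> Pxy m" "g \<in> Pxy n"
 shows "pd t (\<lambda>p. f p * g p) p = f p * pd t g p + pd t f p * g p"
 by (rule pd_unique[OF has_derivative_mult]) (rule Pxy_has_derivative assms)+

lemma Pxy_pd_add:
 assumes "f \<in> Pxy m" "g \<in> Pxy n"
 shows "pd t (\<lambda>p. f p + g p) p = pd t f p + pd t g p"
 by (rule pd_unique[OF has_derivative_add]) (rule Pxy_has_derivative assms)+

lemma pd_const: "pd t (\<lambda>p. c) p = 0"
 by (rule pd_unique) simp

lemma Pxy_pd_cmul:
 assumes "f \<in> Pxy m"
 shows "pd t (\<lambda>p. c * f p) p = c * pd t f p"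
 using Pxy_pd_mult[OF Pxy_const[of c 0] assms] by (simp add: pd_const)

definition tint :: "real^2 => real^2 => real^2 => (real^2 => real) => real" where
 "tint a b c g = (LINT p|lborel. indicator (tri a b c) p * g p)"

lemma tint_integrable:
 assumes "area2 a b c ~= 0" "continuous_on UNIV g"
 shows "integrable lborel (\<lambda>p. indicator (tri a b c) p * g p :: real)"
proof -
 obtain B where "!!x. x \<in> tri a b c ==> norm (g x) <= B"
  using compact_imp_bounded[OF compact_continuous_image[OF continuous_on_subset[OF assms(2) subset_UNIV] tri_compact[OF assms(1)]]]
  unfolding bounded_iff by blast
 then show ?thesis
  using bounded_borel_integrable[of g "tri a b c" B] assms tri_borel compact_imp_bounded[OF tri_compact[OF assms(1)]]
  by (simp add: borel_measurable_continuous_onI)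
qed

lemma tint_rot: "tint b c a = tint a b c" "tint a c b = tint a b c" "tint b a c = tint a b c"
 unfolding tint_def tri_rot[where a=a and b=b and c=c] by simp_all

lemma tint_add:
 assumes "area2 a b c ~= 0" "continuous_on UNIV f" "continuous_on UNIV g"
 shows "tint a b c (\<lambda>p. f p + g p) = tint a b c f + tint a b c g"
 using tint_integrable[OF assms(1)] assms by (simp add: tint_def distrib_left)

lemma tint_cmul: "tint a b c (\<lambda>p. k * g p) = k * tint a b c g"
 by (simp add: tint_def mult.left_commute)

lemma tint_diff_cmul:
 assumes "area2 a b c ~= 0" "continuous_on UNIV f" "continuous_on UNIV g"
 shows "tint a b c (\<lambda>p. f p - k * g p) = tint a b c f - k * tint a b c g"
 using tint_integrable[OF assms(1)] assms
 by (simp add: tint_def right_diff_distrib mult.left_commute[of _ k])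

lemma tint_sum:
 assumes "area2 a b c ~= 0" "finite A" "!!i. i \<in> A ==> continuous_on UNIV (f i)"
 shows "tint a b c (\<lambda>p. \<Sum>i\<in>A. f i p) = (\<Sum>i\<in>A. tint a b c (f i))"
 using tint_integrable[OF assms(1)] assms(3) by (simp add: tint_def sum_distrib_left)

text \<open>Integrating the derivative of a bubble relates the integrals of the cubic monomials in
  the barycentric coordinates to one of them.\<close>

lemma tint_cubic:
 assumes "area2 a b c ~= 0"
 shows "tint a b c (\<lambda>p. lam a b c p ^ 2 * lam b c a p) = 2 * tint a b c (\<lambda>p. lam a b c p * lam b c a p * lam c a b p)"
  and "tint a b c (\<lambda>p. lam a b c p ^ 3) = 6 * tint a b c (\<lambda>p. lam a b c p * lam b c a p * lam c a b p)"
proof -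
 note cont = Pxy_cont[OF lam_Pxy[of _ _ _ 0]]
 have key: "tint a b c (\<lambda>p. lam a b c p ^ 2 * lam c a b p) = 2 * tint a b c (\<lambda>p. lam a b c p * lam b c a p * lam c a b p)"
  "tint a b c (\<lambda>p. lam a b c p ^ 3) = 3 * tint a b c (\<lambda>p. lam a b c p ^ 2 * lam b c a p)"
  if nz: "area2 a b c ~= 0" for a b c
 proof -
  have "dbub a b c (\<lambda>p. lam a b c p * lam c a b p) p =
    lam a b c p ^ 2 * lam c a b p - 2 * (lam a b c p * lam b c a p * lam c a b p)" for p
   unfolding dbub_def Pxy_pd_mult[OF lam_Pxy[of _ _ _ 0] lam_Pxy[of _ _ _ 0]] pd_lam dlam_edge(1,2)[OF nz] dlam_edge(3)[where a=a and b=b and c=c]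
   by (simp add: power2_eq_square algebra_simps)
  then have "tint a b c (\<lambda>p. lam a b c p ^ 2 * lam c a b p - 2 * (lam a b c p * lam b c a p * lam c a b p)) = 0"
   using integral_dbub[OF nz Pxy_mult[OF lam_Pxy[of a b c 0] lam_Pxy[of c a b 0]]] by (simp add: tint_def)
  then show "tint a b c (\<lambda>p. lam a b c p ^ 2 * lam c a b p) = 2 * tint a b c (\<lambda>p. lam a b c p * lam b c a p * lam c a b p)"
   by (subst (asm) tint_diff_cmul[OF nz]) (auto intro!: continuous_intros cont)
  have "dbub a b c (\<lambda>p. lam a b c p * lam a b c p) p =
    lam a b c p ^ 3 - 3 * (lam a b c p ^ 2 * lam b c a p)" for p
   unfolding dbub_def Pxy_pd_mult[OF lam_Pxy[of _ _ _ 0] lam_Pxy[of _ _ _ 0]] pd_lam dlam_edge(1,2)[OF nz]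
   by (simp add: power2_eq_square power3_eq_cube algebra_simps)
  then have "tint a b c (\<lambda>p. lam a b c p ^ 3 - 3 * (lam a b c p ^ 2 * lam b c a p)) = 0"
   using integral_dbub[OF nz Pxy_mult[OF lam_Pxy[of a b c 0] lam_Pxy[of a b c 0]]] by (simp add: tint_def)
  then show "tint a b c (\<lambda>p. lam a b c p ^ 3) = 3 * tint a b c (\<lambda>p. lam a b c p ^ 2 * lam b c a p)"
   by (subst (asm) tint_diff_cmul[OF nz]) (auto intro!: continuous_intros cont)
 qed
 have "area2 a c b ~= 0" using assms area2_rot(4)[of a b c] by simp
 from key(1)[OF this] show 1: "tint a b c (\<lambda>p. lam a b c p ^ 2 * lam b c a p) = 2 * tint a b c (\<lambda>p. lam a b c p * lam b c a p * lam c a b p)"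
  unfolding tint_rot(2)[of a b c] lam_swap[of a b c] lam_swap[of b c a] lam_swap[of c a b] by (simp add: mult_ac)
 show "tint a b c (\<lambda>p. lam a b c p ^ 3) = 6 * tint a b c (\<lambda>p. lam a b c p * lam b c a p * lam c a b p)"
  using key(2)[OF assms] 1 by simp
qed

text \<open>The affine map from the reference triangle.\<close>

definition aff :: "real^2 => real^2 => real^2 => real^2 => real^2" where
 "aff a b c q = a + q $ 1 *\<^sub>R (b - a) + q $ 2 *\<^sub>R (c - a)"

definition bary :: "real^2 => real^2 => real^2 => real^2 => real^2" where
 "bary a b c p = vector [lam b c a p, lam c a b p]"

lemma lam_aff:
 assumes "area2 a b c ~= 0"
 shows "lam a b c (aff a b c q) = 1 - q $ 1 - q $ 2" "lam b c a (aff a b c q) = q $ 1" "lam c a b (aff a b c q) = q $ 2"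
proof -
 have e: "aff a b c q = (1 - q $ 1 - q $ 2) *\<^sub>R a + q $ 1 *\<^sub>R b + q $ 2 *\<^sub>R c"
  by (simp add: aff_def algebra_simps)
 note nz = assms area2_rot(1,2)[where a=a and b=b and c=c]
 show "lam a b c (aff a b c q) = 1 - q $ 1 - q $ 2"
  unfolding e using nz by (intro lam_comb) auto
 show "lam b c a (aff a b c q) = q $ 1"
  using lam_comb[of b c a "q $ 1" "q $ 2" "1 - q $ 1 - q $ 2"] nz unfolding e by (simp add: add_ac)
 show "lam c a b (aff a b c q) = q $ 2"
  using lam_comb[of c a b "q $ 2" "1 - q $ 1 - q $ 2" "q $ 1"] nz unfolding e by (simp add: add_ac)
qed

lemma bary_aff: "area2 a b c ~= 0 ==> bary a b c (aff a b c q) = q"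
 by (simp add: bary_def lam_aff vec_eq_iff forall_2)

lemma aff_bary:
 assumes "area2 a b c ~= 0"
 shows "aff a b c (bary a b c p) = p"
proof -
 have "p = lam a b c p *\<^sub>R a + lam b c a p *\<^sub>R b + lam c a b p *\<^sub>R c" using lam_rep[OF assms] by simp
 also have "lam a b c p = 1 - lam b c a p - lam c a b p" using lam_sum[OF assms, of p] by simp
 finally show ?thesis by (simp add: bary_def aff_def algebra_simps)
qed

lemma lborel_aff:
 assumes nz: "area2 a b c ~= 0"
 shows "lborel = density (distr lborel borel (aff a b c)) (\<lambda>_. ennreal \<bar>area2 a b c\<bar>)"
proof (rule lborel_eqI)
 have maff: "aff a b c \<in> borel_measurable borel"
  unfolding aff_def by (intro borel_measurable_continuous_onI continuous_intros)
 show "sets (density (distr lborel borel (aff a b c)) (\<lambda>_. ennreal \<bar>area2 a b c\<bar>)) = sets borel" by simp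
 fix l u :: "real^2" assume lu: "!!b. b \<in> Basis ==> l \<bullet> b <= u \<bullet> b"
 define G :: "real^2 => real^2" where "G p = vector [dlam b c a p, dlam c a b p]" for p
 have G: "linear G"
  by (rule linearI) (auto simp: G_def dlam_def cr_def vec_eq_iff forall_2 add_divide_distrib diff_divide_distrib algebra_simps)
 have bG: "bary a b c p = bary a b c 0 + G p" for p
  using lam_affine[of b c a 0 1 p] lam_affine[of c a b 0 1 p]
  by (simp add: bary_def G_def vec_eq_iff forall_2)
 have "aff a b c -` box l u = bary a b c ` box l u"
 proof (intro equalityI subsetI)
  fix q assume "q \<in> aff a b c -` box l u"
  then show "q \<in> bary a b c ` box l u" using bary_aff[OF nz, of q] by (metis image_eqI vimageE)
 next
  fix q assume "q \<in> bary a b c ` box l u"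
  then show "q \<in> aff a b c -` box l u" using aff_bary[OF nz] by auto
 qed
 also have "... = (+) (bary a b c 0) ` (G ` box l u)"
  unfolding image_image by (rule image_cong[OF refl bG])
 finally have e: "aff a b c -` box l u = (+) (bary a b c 0) ` (G ` box l u)" .
 have "det (matrix G) = 1 / area2 a b c"
 proof -
  have "det (matrix G) = dlam b c a (axis 1 1) * dlam c a b (axis 2 1) - dlam b c a (axis 2 1) * dlam c a b (axis 1 1)"
   by (simp add: det_2 matrix_def G_def)
  also have "... = area2 a b c / (area2 a b c * area2 a b c)"
   unfolding dlam_def area2_rot(1,2)[where a=a and b=b and c=c] times_divide_times_eq diff_divide_distrib[symmetric]
   by (rule arg_cong2[of _ _ _ _ "(/)"]) (simp_all add: cr_simps axis_def algebra_simps)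
  finally show ?thesis using nz by simp
 qed
 then have "measure lebesgue (aff a b c -` box l u) = measure lebesgue (box l u) / \<bar>area2 a b c\<bar>"
  unfolding e measure_translation using measure_linear_image[OF G, of "box l u"] by simp
 moreover have bd: "aff a b c -` box l u \<in> sets borel" "bounded (aff a b c -` box l u)"
 proof -
  show "aff a b c -` box l u \<in> sets borel" using measurable_sets[OF maff, of "box l u"] by simp
  show "bounded (aff a b c -` box l u)"
   unfolding e using G by (intro bounded_translation bounded_linear_image bounded_box linear_conv_bounded_linear[THEN iffD1])
 qed
 ultimately have "measure lborel (aff a b c -` box l u) = measure lborel (box l u) / \<bar>area2 a b c\<bar>"
  by simp
 moreover have "emeasure lborel (aff a b c -` box l u) = ennreal (measure lborel (aff a b c -` box l u))"
  using emeasure_bounded_finite[OF bd(2)] by (simp add: emeasure_eq_ennreal_measure)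
 ultimately have "emeasure lborel (aff a b c -` box l u) = ennreal (measure lborel (box l u) / \<bar>area2 a b c\<bar>)" by simp
 then have "emeasure (density (distr lborel borel (aff a b c)) (\<lambda>_. ennreal \<bar>area2 a b c\<bar>)) (box l u)
   = ennreal \<bar>area2 a b c\<bar> * ennreal (measure lborel (box l u) / \<bar>area2 a b c\<bar>)"
  using maff by (simp add: emeasure_density_const emeasure_distr)
 also have "... = ennreal (measure lborel (box l u))"
  using nz by (simp flip: ennreal_mult)
 also have "... = ennreal (prod ((\<bullet>) (u - l)) Basis)"
  using lu by (simp add: measure_lborel_box_eq inner_diff_left)
 finally show "emeasure (density (distr lborel borel (aff a b c)) (\<lambda>_. ennreal \<bar>area2 a b c\<bar>)) (box l u) = ennreal (prod ((\<bullet>) (u - l)) Basis)" .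
qed

abbreviation ref_tint :: "(real^2 => real) => real" where
 "ref_tint \<equiv> tint 0 (axis 1 1) (axis 2 1)"

lemma area2_ref: "area2 0 (axis 1 1) (axis 2 1) = 1"
 by (simp add: cr_simps axis_def)

lemma lam_ref: "lam 0 (axis 1 1) (axis 2 1) q = 1 - q $ 1 - q $ 2"
 "lam (axis 1 1) (axis 2 1) 0 q = q $ 1" "lam (axis 2 1) 0 (axis 1 1) q = q $ 2"
 by (simp_all add: lam_def cr_simps axis_def algebra_simps)

lemma tint_aff:
 assumes nz: "area2 a b c ~= 0" and g: "g \<in> borel_measurable borel"
 shows "tint a b c g = \<bar>area2 a b c\<bar> * ref_tint (\<lambda>q. g (aff a b c q))"
proof -
 have maff: "aff a b c \<in> borel_measurable borel"
  unfolding aff_def by (intro borel_measurable_continuous_onI continuous_intros)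
 have m: "(\<lambda>p. indicator (tri a b c) p * g p) \<in> borel_measurable borel" using g tri_borel by measurable
 have "tint a b c g = (LINT p|density (distr lborel borel (aff a b c)) (\<lambda>_. ennreal \<bar>area2 a b c\<bar>). indicator (tri a b c) p * g p)"
  unfolding tint_def using lborel_aff[OF nz] by simp
 also have "... = (LINT p|distr lborel borel (aff a b c). \<bar>area2 a b c\<bar> *\<^sub>R (indicator (tri a b c) p * g p))"
  using m by (subst integral_density) auto
 also have "... = (LINT q|lborel. \<bar>area2 a b c\<bar> *\<^sub>R (indicator (tri a b c) (aff a b c q) * g (aff a b c q)))"
  using m maff by (subst integral_distr) auto
 also have "... = \<bar>area2 a b c\<bar> * ref_tint (\<lambda>q. g (aff a b c q))"
 proof -
  have "indicator (tri a b c) (aff a b c q) = (indicator (tri 0 (axis 1 1) (axis 2 1)) q :: real)" for q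
   by (simp add: indicator_def tri_def lam_aff[OF nz] lam_ref)
  then show ?thesis by (simp add: tint_def)
 qed
 finally show ?thesis .
qed

lemma tint_1: 
 assumes nz: "area2 a b c ~= 0"
 shows "tint a b c (\<lambda>_. 1) = \<bar>area2 a b c\<bar> / 2"
  "tint a b c (\<lambda>_. 1) = 60 * tint a b c (\<lambda>p. lam a b c p * lam b c a p * lam c a b p)"
proof -
 have "insert 0 Basis = {0, axis 1 1, axis 2 1 :: real^2}"
  by (auto simp: Basis_vec_def UNIV_2)
 then have "ref_tint (\<lambda>_. 1) = measure lborel (convex hull (insert 0 Basis) :: (real^2) set)"
  using tri_hull[of 0 "axis 1 1" "axis 2 1"] area2_ref tri_borel[of 0 "axis 1 1" "axis 2 1"] by (simp add: tint_def)
 also have "... = 1 / 2" using content_std_simplex[where 'a="real^2"] by simp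
 finally show "tint a b c (\<lambda>_. 1) = \<bar>area2 a b c\<bar> / 2"
  using tint_aff[OF nz, of "\<lambda>_. 1"] by simp
 let ?x = "lam a b c" and ?y = "lam b c a" and ?z = "lam c a b"
 let ?k = "tint a b c (\<lambda>p. ?x p * ?y p * ?z p)"
 note cont = Pxy_cont[OF lam_Pxy[of _ _ _ 0]]
 have nz': "area2 b c a ~= 0" "area2 c a b ~= 0" "area2 b a c ~= 0" "area2 c b a ~= 0" "area2 a c b ~= 0"
  using nz by (auto simp: cr_simps algebra_simps)
 have s: "lam a c b = ?x" "lam b a c = ?y" "lam c b a = ?z" by (auto simp: lam_swap)
 have r: "tint b c a = tint a b c" "tint c a b = tint a b c" "tint a c b = tint a b c" "tint b a c = tint a b c" "tint c b a = tint a b c"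
  by (metis tint_rot)+
 have 1: "(\<lambda>_. 1) = (\<lambda>p. ?x p ^ 3 + ?y p ^ 3 + ?z p ^ 3 + 3 * (?x p ^ 2 * ?y p) + 3 * (?x p ^ 2 * ?z p) + 3 * (?y p ^ 2 * ?x p)
   + 3 * (?y p ^ 2 * ?z p) + 3 * (?z p ^ 2 * ?x p) + 3 * (?z p ^ 2 * ?y p) + 6 * (?x p * ?y p * ?z p))"
 proof
  fix p
  have "1 = (?x p + ?y p + ?z p) ^ 3" using lam_sum[OF nz] by simp
  then show "1 = ?x p ^ 3 + ?y p ^ 3 + ?z p ^ 3 + 3 * (?x p ^ 2 * ?y p) + 3 * (?x p ^ 2 * ?z p) + 3 * (?y p ^ 2 * ?x p)
   + 3 * (?y p ^ 2 * ?z p) + 3 * (?z p ^ 2 * ?x p) + 3 * (?z p ^ 2 * ?y p) + 6 * (?x p * ?y p * ?z p)"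
   by (simp add: power3_eq_cube power2_eq_square algebra_simps)
 qed
 have "tint a b c (\<lambda>_. 1) = 6 * ?k + 6 * ?k + 6 * ?k + 3 * (2 * ?k) + 3 * (2 * ?k) + 3 * (2 * ?k)
  + 3 * (2 * ?k) + 3 * (2 * ?k) + 3 * (2 * ?k) + 6 * ?k"
  unfolding 1
  apply (simp only: tint_add[OF nz] tint_cmul continuous_on_add continuous_on_mult continuous_on_power continuous_on_const cont)
  using tint_cubic[OF nz] tint_cubic[OF nz'(1)] tint_cubic[OF nz'(2)] tint_cubic[OF nz'(3)] tint_cubic[OF nz'(4)] tint_cubic[OF nz'(5)]
  unfolding r s by (simp add: mult_ac)
 then show "tint a b c (\<lambda>_. 1) = 60 * ?k" by simp
qed

section \<open>Orthogonal projection and rigid motions\<close>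

definition ip :: "(real^2 => real^2) => (real^2 => real^2) => real" where
 "ip f g = ref_tint (\<lambda>q. f q \<bullet> g q)"

abbreviation cont :: "(real^2 => 'b::topological_space) => bool" where
 "cont f \<equiv> continuous_on UNIV f"

lemma nz_ref: "area2 0 (axis 1 1) (axis 2 1) ~= 0"
 by (simp add: area2_ref)

lemma ip_add: "cont f ==> cont g ==> cont h ==> ip (\<lambda>q. f q + g q) h = ip f h + ip g h"
 unfolding ip_def inner_add_left by (rule tint_add[OF nz_ref]) (auto intro: continuous_on_inner)

lemma ip_diff: "cont f ==> cont g ==> cont h ==> ip (\<lambda>q. f q - g q) h = ip f h - ip g h"
 using tint_diff_cmul[OF nz_ref, of "\<lambda>q. f q \<bullet> h q" "\<lambda>q. g q \<bullet> h q" 1]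
 unfolding ip_def inner_diff_left by (simp add: continuous_on_inner)

lemma ip_scale: "ip (\<lambda>q. k *\<^sub>R f q) h = k * ip f h"
 unfolding ip_def inner_scaleR_left by (rule tint_cmul)

lemma ip_commute: "ip f g = ip g f"
 by (simp add: ip_def inner_commute)

lemma ip_zero: "ip (\<lambda>q. 0) g = 0"
 by (simp add: ip_def tint_def)

lemma ip_sum:
 "finite A ==> (!!i. i \<in> A ==> cont (f i)) ==> cont h ==> ip (\<lambda>q. \<Sum>i\<in>A. f i q) h = (\<Sum>i\<in>A. ip (f i) h)"
 by (induction A rule: finite_induct) (auto simp: ip_zero ip_add continuous_on_sum)

lemma ip_nonneg: "0 <= ip f f"
 unfolding ip_def tint_def by (rule Bochner_Integration.integral_nonneg) simp

lemma ip_Cauchy_Schwarz: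
 assumes "cont f" "cont g"
 shows "(ip f g)\<^sup>2 <= ip f f * ip g g"
proof -
 have q: "0 <= ip f f - 2 * s * ip f g + s\<^sup>2 * ip g g" for s
 proof -
  have c: "cont (\<lambda>q. s *\<^sub>R g q)" using assms by (intro continuous_intros)
  have "0 <= ip (\<lambda>q. f q - s *\<^sub>R g q) (\<lambda>q. f q - s *\<^sub>R g q)" by (rule ip_nonneg)
  also have "... = ip f (\<lambda>q. f q - s *\<^sub>R g q) - s * ip g (\<lambda>q. f q - s *\<^sub>R g q)"
   using assms c by (simp add: ip_diff ip_scale continuous_on_diff)
  also have "ip f (\<lambda>q. f q - s *\<^sub>R g q) = ip f f - s * ip f g"
   using assms c by (subst ip_commute) (simp add: ip_diff ip_scale ip_commute[of g])
  also have "ip g (\<lambda>q. f q - s *\<^sub>R g q) = ip f g - s * ip g g"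
   using assms c by (subst ip_commute) (simp add: ip_diff ip_scale)
  finally show ?thesis by (simp add: power2_eq_square algebra_simps)
 qed
 show ?thesis
 proof (cases "ip g g = 0")
  case True
  have "ip f g = 0"
  proof (rule ccontr)
   assume n: "ip f g ~= 0"
   show False using q[of "(ip f f + 1) / (2 * ip f g)"] True n by simp
  qed
  then show ?thesis using True by simp
 next
  case False
  then have p: "ip g g > 0" using ip_nonneg[of g] by simp
  have "0 <= ip g g * (ip f f - 2 * (ip f g / ip g g) * ip f g + (ip f g / ip g g)\<^sup>2 * ip g g)"
   using q[of "ip f g / ip g g"] p by simp
  also have "... = ip f f * ip g g - (ip f g)\<^sup>2"
   using False by (simp add: power2_eq_square field_simps)
  finally show ?thesis by simp
 qed
qed

text \<open>Gram--Schmidt orthogonalisation, phrased so that the projection onto the span of the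
  \<open>B\<close> is an explicit linear combination of moments.\<close>

lemma Gram_Schmidt:
 assumes "finite \<A>" "\<A> \<subseteq> S"
  and S: "!!f. f \<in> S ==> cont f" "!!f g. f \<in> S ==> g \<in> S ==> (\<lambda>q. f q + g q) \<in> S"
   "!!f k. f \<in> S ==> (\<lambda>q. k *\<^sub>R f q) \<in> S"
 shows "\<exists>(n::nat) e. (\<forall>j<n. e j \<in> S) \<and>
  (\<forall>f. cont f --> (\<forall>B\<in>\<A> \<union> e ` {..<n}. ip (\<lambda>q. f q - (\<Sum>j<n. ip f (e j) *\<^sub>R e j q)) B = 0))"
 using assms(1,2)
proof (induction \<A> rule: finite_induct)
 case empty
 show ?case by (intro exI[of _ "0::nat"]) simp
next
 case (insert b \<A>)
 then obtain n :: nat and e where e': "\<forall>j<n. e j \<in> S"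
  and orth': "\<forall>f. cont f --> (\<forall>B\<in>\<A> \<union> e ` {..<n}. ip (\<lambda>q. f q - (\<Sum>j<n. ip f (e j) *\<^sub>R e j q)) B = 0)"
  by auto
 from e' have e: "!!j. j < n ==> e j \<in> S" by blast
 from orth' have orth: "!!f B. cont f ==> B \<in> \<A> \<union> e ` {..<n} ==> ip (\<lambda>q. f q - (\<Sum>j<n. ip f (e j) *\<^sub>R e j q)) B = 0" by blast
 have bS: "b \<in> S" "\<A> \<subseteq> S" using insert by auto
 define P where "P f q = (\<Sum>j<n. ip f (e j) *\<^sub>R e j q)" for f q
 have zS: "(\<lambda>q. 0) \<in> S" using S(3)[OF bS(1), of 0] by simp
 have ce: "cont (e j)" if "j < n" for j using S(1)[OF e[OF that]] .
 have PS: "P f \<in> S" for f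
 proof -
  have "(\<lambda>q. \<Sum>j\<in>J. ip f (e j) *\<^sub>R e j q) \<in> S" if "finite J" "J \<subseteq> {..<n}" for J
   using that by (induction J rule: finite_induct) (auto intro!: zS S(2) S(3) e)
  from this[of "{..<n}"] show ?thesis by (simp add: P_def[abs_def])
 qed
 have cP: "cont (P f)" for f using S(1)[OF PS] .
 have cb: "cont b" using S(1)[OF bS(1)] .
 have Porth: "ip g (P f) = 0" if "cont g" "!!j. j < n ==> ip g (e j) = 0" for g f
 proof -
  have "ip (P f) g = (\<Sum>j<n. ip (\<lambda>q. ip f (e j) *\<^sub>R e j q) g)"
   unfolding P_def using that ce by (subst ip_sum) (auto intro!: continuous_intros)
  also have "... = 0" using that by (simp add: ip_scale ip_commute)
  finally show ?thesis by (simp add: ip_commute)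
 qed
 define b' where "b' q = b q - P b q" for q
 have b'S: "b' \<in> S"
  using S(2)[OF bS(1) S(3)[OF PS[of b], of "-1"]] by (simp add: b'_def[abs_def])
 have cb': "cont b'" using S(1)[OF b'S] .
 have b'0: "ip b' B = 0" if "B \<in> \<A> \<union> e ` {..<n}" for B using orth[OF cb that] by (simp add: b'_def[abs_def] P_def)
 have b_eq: "b = (\<lambda>q. b' q + P b q)" by (simp add: b'_def)
 have ipb: "ip g b = ip g b'" if "cont g" "!!j. j < n ==> ip g (e j) = 0" for g
 proof -
  have "ip b g = ip b' g + ip (P b) g"
   by (subst b_eq) (rule ip_add[OF cb' cP that(1)])
  then show ?thesis using Porth[OF that] by (simp add: ip_commute)
 qed
 define c where "c = (if ip b' b' = 0 then 0 else 1 / sqrt (ip b' b'))"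
 define e' where "e' j = (if j < n then e j else (\<lambda>q. c *\<^sub>R b' q))" for j
 have c2: "c\<^sup>2 * ip f b' * ip b' b' = ip f b'" if "cont f" for f
 proof (cases "ip b' b' = 0")
  case True
  then have "ip f b' = 0" using ip_Cauchy_Schwarz[OF that cb'] by simp
  then show ?thesis by simp
 next
  case False
  then show ?thesis using ip_nonneg[of b'] by (simp add: c_def power_divide)
 qed
 have sum': "(\<Sum>j<Suc n. ip f (e' j) *\<^sub>R e' j q) = P f q + (c\<^sup>2 * ip f b') *\<^sub>R b' q" for f q
 proof -
  have "ip f (\<lambda>q. c *\<^sub>R b' q) = c * ip f b'" using ip_scale[of c b' f] by (simp add: ip_commute)
  then show ?thesis by (simp add: e'_def P_def power2_eq_square mult_ac)
 qed
 have main: "ip (\<lambda>q. f q - (\<Sum>j<Suc n. ip f (e' j) *\<^sub>R e' j q)) B = 0"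
  if f: "cont f" and B: "B \<in> insert b \<A> \<union> e' ` {..<Suc n}" for f B
 proof -
  define g where "g q = f q - P f q" for q
  have cg: "cont g" unfolding g_def using f cP by (intro continuous_intros)
  have g0: "ip g B = 0" if "B \<in> \<A> \<union> e ` {..<n}" for B using orth[OF f that] by (simp add: g_def[abs_def] P_def)
  have cs: "cont (\<lambda>q. (c\<^sup>2 * ip f b') *\<^sub>R b' q)" using cb' by (intro continuous_intros)
  have split: "ip (\<lambda>q. f q - (\<Sum>j<Suc n. ip f (e' j) *\<^sub>R e' j q)) B = ip g B - (c\<^sup>2 * ip f b') * ip b' B"
   if "cont B" for B
  proof -
   have "(\<lambda>q. f q - (\<Sum>j<Suc n. ip f (e' j) *\<^sub>R e' j q)) = (\<lambda>q. g q - (c\<^sup>2 * ip f b') *\<^sub>R b' q)"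
    unfolding sum' g_def by (simp add: algebra_simps)
   then show ?thesis using ip_diff[OF cg cs that] by (simp add: ip_scale)
  qed
  have gb': "ip g b' = ip f b'"
  proof -
   have "ip (P f) b' = 0" using Porth[OF cb', of f] b'0 by (simp add: ip_commute)
   then show ?thesis unfolding g_def using ip_diff[OF f cP cb'] by simp
  qed
  have r0: "ip (\<lambda>q. f q - (\<Sum>j<Suc n. ip f (e' j) *\<^sub>R e' j q)) b' = 0"
   unfolding split[OF cb'] gb' c2[OF f] by simp
  consider "B \<in> \<A> \<union> e ` {..<n}" | "B = b" | "B = (\<lambda>q. c *\<^sub>R b' q)"
   using B by (auto simp: e'_def less_Suc_eq)
  then show ?thesis
  proof cases
   case 1
   then have "cont B" using bS(2) S(1) ce by auto
   then show ?thesis using split g0[OF 1] b'0[OF 1] by simp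
  next
   case 2
   have "ip g b = ip g b'" "ip b' b = ip b' b'" using g0 b'0 cg cb' by (auto intro!: ipb)
   then show ?thesis unfolding 2 split[OF cb] gb' using c2[OF f] by simp
  next
   case 3
   have "ip (\<lambda>q. f q - (\<Sum>j<Suc n. ip f (e' j) *\<^sub>R e' j q)) (\<lambda>q. c *\<^sub>R b' q) = 0"
    using r0 ip_scale[of c b' "\<lambda>q. f q - (\<Sum>j<Suc n. ip f (e' j) *\<^sub>R e' j q)"] by (simp add: ip_commute)
   then show ?thesis unfolding 3 .
  qed
 qed
 have "e' j \<in> S" if "j < Suc n" for j using e b'S S(3) by (simp add: e'_def)
 then show ?case using main by (intro exI[of _ "Suc n"] exI[of _ e']) blast
qed

text \<open>The divergence of a bubble field on the reference triangle, in components.\<close>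

definition dv :: "(real^2 => real) => (real^2 => real) => (real^2 => real) => real^2 => real^2" where
 "dv q1 q2 q3 p = vector [dbub 0 (axis 1 1) (axis 2 1) q1 p - dbub (axis 1 1) (axis 2 1) 0 q3 p,
   dbub 0 (axis 2 1) (axis 1 1) q2 p + dbub (axis 1 1) (axis 2 1) 0 q3 p]"

lemma dbub_add:
 assumes "f \<in> Pxy m" "g \<in> Pxy n"
 shows "dbub a b c (\<lambda>p. f p + g p) p = dbub a b c f p + dbub a b c g p"
 unfolding dbub_def Pxy_pd_add[OF assms] by (simp add: algebra_simps)

lemma dbub_cmul:
 assumes "f \<in> Pxy m"
 shows "dbub a b c (\<lambda>p. k * f p) p = k * dbub a b c f p"
 unfolding dbub_def Pxy_pd_cmul[OF assms] by (simp add: algebra_simps)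

lemma dbub_mult:
 assumes "f \<in> Pxy m" "g \<in> Pxy n"
 shows "dbub a b c (\<lambda>p. f p * g p) p = dbub a b c f p * g p + lam a b c p * lam b c a p * f p * pd (b - a) g p"
 unfolding dbub_def Pxy_pd_mult[OF assms] by (simp add: algebra_simps)

text \<open>Integration by parts: the boundary terms vanish with the bubble.\<close>

lemma tint_dbub_parts:
 assumes nz: "area2 a b c ~= 0" and f: "f \<in> Pxy m" and g: "g \<in> Pxy n"
 shows "tint a b c (\<lambda>p. dbub a b c f p * g p) = - tint a b c (\<lambda>p. lam a b c p * lam b c a p * f p * pd (b - a) g p)"
proof -
 note c = Pxy_cont[OF lam_Pxy[of _ _ _ 0]] Pxy_cont[OF dbub_Pxy[OF f]] Pxy_cont[OF f] Pxy_cont[OF g] Pxy_cont[OF Pxy_has_derivative(2)[OF g]]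
 have "tint a b c (\<lambda>p. dbub a b c f p * g p + lam a b c p * lam b c a p * f p * pd (b - a) g p) = 0"
  using integral_dbub[OF nz Pxy_mult[OF f g]] unfolding dbub_mult[OF f g] tint_def .
 then show ?thesis by (subst (asm) tint_add[OF nz]) (auto intro!: continuous_intros c)
qed

definition itri :: "real^2 => real^2 => real^2 => (real^2) set" where
 "itri a b c = {p. 0 < lam a b c p \<and> 0 < lam b c a p \<and> 0 < lam c a b p}"

lemma itri_open: "open (itri a b c)"
 unfolding itri_def by (intro open_Collect_conj open_Collect_less Pxy_cont[OF lam_Pxy[of _ _ _ 0]] continuous_intros)

lemma itri_sub: "itri a b c \<subseteq> tri a b c" by (auto simp: itri_def tri_def)

lemma AE_itri:
 assumes nz: "area2 a b c ~= 0"
 shows "AE p in lborel. p \<in> tri a b c --> p \<in> itri a b c"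
proof -
 have nz': "area2 b c a ~= 0" "area2 c a b ~= 0" using nz area2_rot by metis+
 show ?thesis
  using AE_lam_nonzero[OF nz] AE_lam_nonzero[OF nz'(1)] AE_lam_nonzero[OF nz'(2)]
  by eventually_elim (auto simp: tri_def itri_def)
qed

lemma tint_nonneg_zero:
 assumes nz: "area2 a b c ~= 0" and f: "cont f" "!!p. p \<in> tri a b c ==> 0 <= f p"
  and z: "tint a b c f = 0" and p: "p \<in> itri a b c"
 shows "f p = 0"
proof (rule ccontr)
 assume "f p ~= 0"
 let ?S = "itri a b c \<inter> {p. f p ~= 0}"
 have op: "open ?S"
  by (intro open_Int itri_open open_Collect_neq f continuous_intros)
 have "AE p in lborel. indicator (tri a b c) p * f p = 0"
  using z f(2) tint_integrable[OF nz f(1)] unfolding tint_def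
  by (subst (asm) integral_nonneg_eq_0_iff_AE) (auto simp: indicator_def)
 then have "AE p in lborel. p ~: ?S"
  by eventually_elim (use itri_sub in \<open>auto simp: indicator_def\<close>)
 then have "AE p in lebesgue. p ~: ?S" by (rule AE_completion)
 then have "negligible ?S"
  unfolding negligible_iff_null_sets using op
  by (subst (asm) AE_iff_null_sets[symmetric]) auto
 then show False using open_not_negligible[OF op] p \<open>f p ~= 0\<close> by blast
qed

lemma symmetric_gradient_zero:
 assumes nz: "area2 a b c ~= 0" and G: "G \<in> Pxy m"
  and z: "tint a b c (\<lambda>p. dbub a b c (pd (b - a) G) p * G p) = 0" and p: "p \<in> itri a b c"
 shows "pd (b - a) G p = 0"
proof -
 note G' = Pxy_has_derivative(2)[OF G, of "b - a"]
 note c = Pxy_cont[OF lam_Pxy[of _ _ _ 0]] Pxy_cont[OF G']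
 have "tint a b c (\<lambda>p. lam a b c p * lam b c a p * pd (b - a) G p * pd (b - a) G p) = 0"
  using tint_dbub_parts[OF nz G' G] z by simp
 then have "lam a b c p * lam b c a p * pd (b - a) G p * pd (b - a) G p = 0"
  by (rule tint_nonneg_zero[OF nz _ _ _ p, rotated 2])
   (auto intro!: continuous_intros c simp: tri_def mult.assoc)
 then show ?thesis using p by (auto simp: itri_def)
qed

lemma Pxy_const_along:
 assumes f: "f \<in> Pxy m" and z: "!!s. s \<in> closed_segment 0 h ==> pd t f (p + s *\<^sub>R t) = 0"
 shows "f (p + h *\<^sub>R t) = f p"
proof -
 have "norm (f (p + h *\<^sub>R t) - f (p + 0 *\<^sub>R t)) <= 0 * norm (h - 0)"
 proof (rule field_differentiable_bound[of "closed_segment 0 h" "\<lambda>s. f (p + s *\<^sub>R t)" "\<lambda>s. pd t f (p + s *\<^sub>R t)"])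
  show "((\<lambda>s. f (p + s *\<^sub>R t)) has_field_derivative pd t f (p + s *\<^sub>R t)) (at s within closed_segment 0 h)" for s
   using Pxy_along[OF f] by (rule has_field_derivative_at_within)
  show "norm (pd t f (p + s *\<^sub>R t)) <= 0" if "s \<in> closed_segment 0 h" for s using z[OF that] by simp
 qed auto
 then show ?thesis by simp
qed

abbreviation Ti :: "(real^2) set" where "Ti \<equiv> itri 0 (axis 1 1) (axis 2 1)"

lemma Ti_iff: "p \<in> Ti \<longleftrightarrow> 0 < p $ 1 \<and> 0 < p $ 2 \<and> p $ 1 + p $ 2 < 1"
 unfolding itri_def lam_ref mem_Collect_eq by linarith

lemma staircase:
 assumes h: "!!x x' y. vector [x, y] \<in> Ti ==> vector [x', y] \<in> Ti ==> f (vector [x, y]) = f (vector [x', y] :: real^2)"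
  and v: "!!x y y'. vector [x, y] \<in> Ti ==> vector [x, y'] \<in> Ti ==> f (vector [x, y]) = f (vector [x, y'] :: real^2)"
  and p: "p \<in> Ti" "q \<in> Ti"
 shows "f p = f q"
proof -
 define x y x' y' where xy: "x = p $ 1" "y = p $ 2" "x' = q $ 1" "y' = q $ 2"
 have px: "p = vector [x, y]" and qx: "q = vector [x', y']" by (simp_all add: xy vec_eq_iff forall_2)
 let ?m = "min x x'"
 have "f (vector [x, y]) = f (vector [?m, y] :: real^2)" using p by (intro h) (auto simp: Ti_iff px qx)
 also have "... = f (vector [?m, y'])" using p by (intro v) (auto simp: Ti_iff px qx)
 also have "... = f (vector [x', y'])" using p by (intro h) (auto simp: Ti_iff px qx)
 finally show ?thesis by (simp add: px qx)
qed

lemma const_horizontal: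
 assumes f: "f \<in> Pxy m" and z: "!!p. p \<in> Ti ==> pd (axis 1 1) f p = 0"
  and "vector [x, y] \<in> Ti" "vector [x', y] \<in> Ti"
 shows "f (vector [x, y]) = f (vector [x', y])"
proof -
 have e: "vector [x, y] + s *\<^sub>R axis 1 1 = (vector [x + s, y] :: real^2)" for s
  by (simp add: vec_eq_iff forall_2 axis_def)
 have "f (vector [x, y] + (x' - x) *\<^sub>R axis 1 1) = f (vector [x, y])"
 proof (rule Pxy_const_along[OF f])
  fix s assume "s \<in> closed_segment 0 (x' - x)"
  then show "pd (axis 1 1) f (vector [x, y] + s *\<^sub>R axis 1 1) = 0"
   using assms(3,4) unfolding e by (intro z) (auto simp: Ti_iff closed_segment_eq_real_ivl split: if_splits)
 qed
 then show ?thesis unfolding e by simp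
qed

lemma const_vertical:
 assumes f: "f \<in> Pxy m" and z: "!!p. p \<in> Ti ==> pd (axis 2 1) f p = 0"
  and "vector [x, y] \<in> Ti" "vector [x, y'] \<in> Ti"
 shows "f (vector [x, y]) = f (vector [x, y'])"
proof -
 have e: "vector [x, y] + s *\<^sub>R axis 2 1 = (vector [x, y + s] :: real^2)" for s
  by (simp add: vec_eq_iff forall_2 axis_def)
 have "f (vector [x, y] + (y' - y) *\<^sub>R axis 2 1) = f (vector [x, y])"
 proof (rule Pxy_const_along[OF f])
  fix s assume "s \<in> closed_segment 0 (y' - y)"
  then show "pd (axis 2 1) f (vector [x, y] + s *\<^sub>R axis 2 1) = 0"
   using assms(3,4) unfolding e by (intro z) (auto simp: Ti_iff closed_segment_eq_real_ivl split: if_splits)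
 qed
 then show ?thesis unfolding e by simp
qed

lemma DERIV_eq_if_eventually_eq:
 assumes "(f has_real_derivative D) (at 0)" "(g has_real_derivative E) (at 0)" "open S" "0 \<in> S"
  "!!h. h \<in> S ==> f h = g h"
 shows "D = (E::real)"
 using has_field_derivative_transform_within_open[OF assms(1,3,4)] assms(2,5) DERIV_unique by blast

text \<open>Identifies the fields that are orthogonal to all divergences of bubble fields.\<close>

lemma rigid_motion:
 assumes g: "g1 \<in> Pxy m" "g2 \<in> Pxy m"
  and z1: "!!p. p \<in> Ti ==> pd (axis 1 1) g1 p = 0"
  and z2: "!!p. p \<in> Ti ==> pd (axis 2 1) g2 p = 0"
  and z3: "!!p. p \<in> Ti ==> pd (axis 2 1) g1 p + pd (axis 1 1) g2 p = 0"
 obtains \<alpha> \<beta> \<kappa> where "!!p. p \<in> Ti ==> g1 p = \<alpha> - \<kappa> * p $ 2" "!!p. p \<in> Ti ==> g2 p = \<beta> + \<kappa> * p $ 1"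
proof -
 define P where "P = pd (axis 2 1) g1"
 have P2: "P p = - pd (axis 1 1) g2 p" if "p \<in> Ti" for p using z3[OF that] by (simp add: P_def)
 have opv: "open {h. vector [x, y + h] \<in> Ti}" "open {h. vector [x + h, y] \<in> Ti}" for x y
  unfolding Ti_iff vector_2 by (auto intro!: open_Collect_conj open_Collect_less continuous_intros)
 have e: "vector [x, y] + s *\<^sub>R axis 1 1 = (vector [x + s, y] :: real^2)"
  "vector [x, y] + s *\<^sub>R axis 2 1 = (vector [x, y + s] :: real^2)" for s x y
  by (simp_all add: vec_eq_iff forall_2 axis_def)
 have Ph: "P (vector [x, y]) = P (vector [x', y])" if T: "vector [x, y] \<in> Ti" "vector [x', y] \<in> Ti" for x x' y
 proof (rule DERIV_eq_if_eventually_eq[where S="{h. vector [x, y + h] \<in> Ti} \<inter> {h. vector [x', y + h] \<in> Ti}"])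
  show "((\<lambda>h. g1 (vector [x, y + h])) has_real_derivative P (vector [x, y])) (at 0)"
   "((\<lambda>h. g1 (vector [x', y + h])) has_real_derivative P (vector [x', y])) (at 0)"
   using Pxy_along[OF g(1), of _ "axis 2 1" 0] unfolding P_def by (simp_all flip: e)
  show "g1 (vector [x, y + h]) = g1 (vector [x', y + h])"
   if "h \<in> {h. vector [x, y + h] \<in> Ti} \<inter> {h. vector [x', y + h] \<in> Ti}" for h
   using that by (intro const_horizontal[OF g(1) z1]) auto
 qed (use T opv in auto)
 have Pv: "P (vector [x, y]) = P (vector [x, y'])" if T: "vector [x, y] \<in> Ti" "vector [x, y'] \<in> Ti" for x y y'
 proof -
  have "pd (axis 1 1) g2 (vector [x, y]) = pd (axis 1 1) g2 (vector [x, y'])"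
  proof (rule DERIV_eq_if_eventually_eq[where S="{h. vector [x + h, y] \<in> Ti} \<inter> {h. vector [x + h, y'] \<in> Ti}"])
   show "((\<lambda>h. g2 (vector [x + h, y])) has_real_derivative pd (axis 1 1) g2 (vector [x, y])) (at 0)"
    "((\<lambda>h. g2 (vector [x + h, y'])) has_real_derivative pd (axis 1 1) g2 (vector [x, y'])) (at 0)"
    using Pxy_along[OF g(2), of _ "axis 1 1" 0] by (simp_all flip: e)
   show "g2 (vector [x + h, y]) = g2 (vector [x + h, y'])"
    if "h \<in> {h. vector [x + h, y] \<in> Ti} \<inter> {h. vector [x + h, y'] \<in> Ti}" for h
    using that by (intro const_vertical[OF g(2) z2]) auto
  qed (use T opv in auto)
  then show ?thesis using P2[OF T(1)] P2[OF T(2)] by simp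
 qed
 define o' where "o' = (vector [1/3, 1/3] :: real^2)"
 have o': "o' \<in> Ti" by (simp add: o'_def Ti_iff)
 define \<kappa> where "\<kappa> = - P o'"
 have P: "P p = - \<kappa>" if "p \<in> Ti" for p
  using staircase[of P, OF Ph Pv that o'] by (simp add: \<kappa>_def)
 have coordpd: "pd t (\<lambda>p. p $ i) p = t $ i" for t p :: "real^2" and i
  by (rule pd_unique) (auto intro!: bounded_linear_imp_has_derivative bounded_linear_vec_nth)
 define f1 where "f1 p = g1 p + \<kappa> * p $ 2" for p
 define f2 where "f2 p = g2 p + (- \<kappa>) * p $ 1" for p
 have F: "f1 \<in> Pxy (Suc m)" "f2 \<in> Pxy (Suc m)" unfolding f1_def f2_def
  by (intro Pxy_add Pxy_cmul Pxy_coord; use g Pxy_mono in force)+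
 have pdf: "pd t f1 p = pd t g1 p + \<kappa> * t $ 2" "pd t f2 p = pd t g2 p + (- \<kappa>) * t $ 1" for t p
  unfolding f1_def[abs_def] f2_def[abs_def] Pxy_pd_add[OF g(1) Pxy_cmul[OF Pxy_coord]] Pxy_pd_add[OF g(2) Pxy_cmul[OF Pxy_coord]]
   Pxy_pd_cmul[OF Pxy_coord] coordpd by simp_all
 have "f1 p = f1 o'" if "p \<in> Ti" for p
 proof (rule staircase[of f1, OF const_horizontal[OF F(1)] const_vertical[OF F(1)] that o'])
  fix p :: "real^2" assume p: "p \<in> Ti"
  show "pd (axis 1 1) f1 p = 0" using z1[OF p] by (simp add: pdf axis_def)
  show "pd (axis 2 1) f1 p = 0" using P[OF p] by (simp add: pdf axis_def P_def)
 qed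
 moreover have "f2 p = f2 o'" if "p \<in> Ti" for p
 proof (rule staircase[of f2, OF const_horizontal[OF F(2)] const_vertical[OF F(2)] that o'])
  fix p :: "real^2" assume p: "p \<in> Ti"
  show "pd (axis 1 1) f2 p = 0" using P[OF p] P2[OF p] by (simp add: pdf axis_def)
  show "pd (axis 2 1) f2 p = 0" using z2[OF p] by (simp add: pdf axis_def)
 qed
 ultimately show ?thesis
  using that[of "f1 o'" \<kappa> "f2 o'"] unfolding f1_def f2_def by (simp add: algebra_simps)
qed

section \<open>Bubble fields on the reference triangle\<close>

definition mono :: "nat \<times> nat => real^2 => real" where "mono x p = p $ 1 ^ fst x * p $ 2 ^ snd x"

lemma mono_Pxy: "fst x + snd x <= k ==> mono x \<in> Pxy k"
 using Pxy_monom[of "fst x" "snd x" k 1] by (simp add: mono_def[abs_def])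

lemma dbub_zero: "dbub a b c (\<lambda>_. 0) p = 0"
 by (simp add: dbub_def pd_const)

lemma tint_dbub_all:
 assumes nz: "area2 a b c ~= 0" and G: "G \<in> Pxy m" and q: "q \<in> Pxy k"
  and z: "!!x. fst x + snd x <= k ==> tint a b c (\<lambda>p. dbub a b c (mono x) p * G p) = 0"
 shows "tint a b c (\<lambda>p. dbub a b c q p * G p) = 0"
proof -
 have "q \<in> Pxy k \<and> tint a b c (\<lambda>p. dbub a b c q p * G p) = 0"
  using q
 proof (induction rule: Pxy_induct)
  case (monom r i j)
  have e: "(\<lambda>p. r * p $ 1 ^ i * p $ 2 ^ j) = (\<lambda>p. r * mono (i, j) p)" by (simp add: mono_def mult.assoc)
  have P: "mono (i, j) \<in> Pxy k" using monom by (simp add: mono_Pxy)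
  have "tint a b c (\<lambda>p. dbub a b c (\<lambda>p. r * mono (i, j) p) p * G p) = r * tint a b c (\<lambda>p. dbub a b c (mono (i, j)) p * G p)"
   unfolding dbub_cmul[OF P] mult.assoc by (rule tint_cmul)
  then show ?case unfolding e using z[of "(i, j)"] monom Pxy_cmul[OF P] by simp
 next
  case (add f g)
  then have P: "f \<in> Pxy k" "g \<in> Pxy k" by auto
  note c = Pxy_cont[OF dbub_Pxy[OF P(1)]] Pxy_cont[OF dbub_Pxy[OF P(2)]] Pxy_cont[OF G]
  have "tint a b c (\<lambda>p. dbub a b c f p * G p + dbub a b c g p * G p) = 0"
   using add by (subst tint_add[OF nz]) (auto intro!: continuous_intros c)
  then show ?case unfolding dbub_add[OF P] distrib_right using Pxy_add[OF P] by simp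
 qed
 then show ?thesis by simp
qed

lemma tint_parts_zero:
 assumes "area2 a b c ~= 0" "f \<in> Pxy m" "g \<in> Pxy n" "!!p. pd (b - a) g p = 0"
 shows "tint a b c (\<lambda>p. dbub a b c f p * g p) = 0"
 using tint_dbub_parts[OF assms(1-3)] by (simp add: assms(4) tint_def)

lemma pd_coord: "pd t (\<lambda>p. p $ i) p = t $ i" for t p :: "real^2"
 by (rule pd_unique) (auto intro!: bounded_linear_imp_has_derivative bounded_linear_vec_nth)

lemma ref_tint_rot: "tint (axis 1 1) (axis 2 1) 0 = ref_tint" "tint 0 (axis 2 1) (axis 1 1) = ref_tint"
 using tint_rot(1)[of "axis 1 1" "axis 2 1" 0] tint_rot(2)[of 0 "axis 2 1" "axis 1 1"] by auto

lemma ref_area2_rot: "area2 (axis 1 1) (axis 2 1) 0 ~= 0" "area2 0 (axis 2 1) (axis 1 1) ~= 0"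
 by (simp_all add: cr_simps axis_def)

lemma ref_itri_rot: "itri (axis 1 1) (axis 2 1) 0 = Ti" "itri 0 (axis 2 1) (axis 1 1) = Ti"
 by (auto simp: itri_def lam_swap)

lemma dv_Pxy: "q1 \<in> Pxy k ==> q2 \<in> Pxy k ==> q3 \<in> Pxy k ==> (\<lambda>p. dv q1 q2 q3 p $ i) \<in> Pxy (k + 1)"
proof -
 assume q: "q1 \<in> Pxy k" "q2 \<in> Pxy k" "q3 \<in> Pxy k"
 show ?thesis
  using exhaust_2[of i] Pxy_add[OF dbub_Pxy[OF q(1)] Pxy_cmul[OF dbub_Pxy[OF q(3)], of "-1"]]
   Pxy_add[OF dbub_Pxy[OF q(2)] dbub_Pxy[OF q(3)]]
  by (auto simp: dv_def)
qed

lemma vec2_cont: 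
 fixes f :: "real^2 => real^2"
 shows "(!!i. (\<lambda>p. f p $ i) \<in> Pxy m) ==> cont f"
proof -
 assume "!!i. (\<lambda>p. f p $ i) \<in> Pxy m"
 then have "cont (\<lambda>p. f p $ i)" for i by (rule Pxy_cont)
 then have "cont (\<lambda>p. \<chi> i. f p $ i)" by (intro continuous_on_vec_lambda)
 then show ?thesis by simp
qed

text \<open>Subtracting from a field its projection onto the divergences of bubble fields leaves a remainder orthogonal to
  all of them. Integrating by parts, the derivative of the remainder in each edge direction, taken of its component in that direction,
  is orthogonal to all polynomials of degree \<open>k\<close> with respect to a positive weight. It has degree \<open>k\<close> itself and thus vanishes.
  So the symmetric gradient vanishes and the remainder is a rigid motion, which is zero as the given field is orthogonal to those.\<close>

lemma reference_right_inverse: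
 "\<exists>(n::nat) e q1 q2 q3. (\<forall>j<n. q1 j \<in> Pxy k \<and> q2 j \<in> Pxy k \<and> q3 j \<in> Pxy k \<and> e j = dv (q1 j) (q2 j) (q3 j)) \<and>
  (\<forall>f. (\<forall>i. (\<lambda>p. f p $ i) \<in> Pxy (k + 1)) --> ref_tint (\<lambda>p. f p $ 1) = 0 --> ref_tint (\<lambda>p. f p $ 2) = 0 -->
   ref_tint (\<lambda>p. p $ 2 * f p $ 1 - p $ 1 * f p $ 2) = 0 -->
   (\<forall>p\<in>Ti. f p = (\<Sum>j<n. ip f (e j) *\<^sub>R e j p)))"
proof -
 let ?O = "0 :: real^2" and ?E1 = "axis 1 1 :: real^2" and ?E2 = "axis 2 1 :: real^2"
 let ?Zr = "\<lambda>_::real^2. 0 :: real"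
 define S where "S = {dv q1 q2 q3 |q1 q2 q3. q1 \<in> Pxy k \<and> q2 \<in> Pxy k \<and> q3 \<in> Pxy k}"
 define I where "I = {(i::nat, j::nat). i + j <= k}"
 define \<A> where "\<A> = (\<lambda>x. dv (mono x) ?Zr ?Zr) ` I \<union> (\<lambda>x. dv ?Zr (mono x) ?Zr) ` I \<union> (\<lambda>x. dv ?Zr ?Zr (mono x)) ` I"
 have finA: "finite \<A>" using finite_idx[of k] by (simp add: \<A>_def I_def)
 have AS: "\<A> \<subseteq> S"
  unfolding \<A>_def S_def using mono_Pxy[of _ k] Pxy_zero[of k] by (fastforce simp: I_def)
 have S1: "cont f" if fS: "f \<in> S" for f
 proof -
  obtain q1 q2 q3 where "f = dv q1 q2 q3" and q: "q1 \<in> Pxy k" "q2 \<in> Pxy k" "q3 \<in> Pxy k"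
   using fS unfolding S_def by blast
  then show ?thesis using vec2_cont[of f "k + 1"] dv_Pxy[OF q] by auto
 qed
 have S2: "(\<lambda>q. f q + g q) \<in> S" if fg: "f \<in> S" "g \<in> S" for f g
 proof -
  obtain q1 q2 q3 where f: "f = dv q1 q2 q3" and q: "q1 \<in> Pxy k" "q2 \<in> Pxy k" "q3 \<in> Pxy k"
   using fg unfolding S_def by blast
  obtain r1 r2 r3 where g: "g = dv r1 r2 r3" and r: "r1 \<in> Pxy k" "r2 \<in> Pxy k" "r3 \<in> Pxy k"
   using fg unfolding S_def by blast
  have "(\<lambda>p. f p + g p) = dv (\<lambda>p. q1 p + r1 p) (\<lambda>p. q2 p + r2 p) (\<lambda>p. q3 p + r3 p)"
   unfolding f g dv_def dbub_add[OF q(1) r(1)] dbub_add[OF q(2) r(2)] dbub_add[OF q(3) r(3)]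
   by (auto simp: vec_eq_iff forall_2)
  then show ?thesis unfolding S_def using Pxy_add q r by blast
 qed
 have S3: "(\<lambda>q. s *\<^sub>R f q) \<in> S" if fS: "f \<in> S" for f s
 proof -
  obtain q1 q2 q3 where f: "f = dv q1 q2 q3" and q: "q1 \<in> Pxy k" "q2 \<in> Pxy k" "q3 \<in> Pxy k"
   using fS unfolding S_def by blast
  have "(\<lambda>p. s *\<^sub>R f p) = dv (\<lambda>p. s * q1 p) (\<lambda>p. s * q2 p) (\<lambda>p. s * q3 p)"
   unfolding f dv_def dbub_cmul[OF q(1)] dbub_cmul[OF q(2)] dbub_cmul[OF q(3)]
   by (auto simp: vec_eq_iff forall_2 algebra_simps)
  then show ?thesis unfolding S_def using Pxy_cmul q by blast
 qed
 obtain n :: nat and e where e: "!!j. j < n ==> e j \<in> S"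
  and orth: "!!f B. cont f ==> B \<in> \<A> ==> ip (\<lambda>q. f q - (\<Sum>j<n. ip f (e j) *\<^sub>R e j q)) B = 0"
  using Gram_Schmidt[OF finA AS S1 S2 S3] by blast
 have "\<exists>q1 q2 q3. q1 \<in> Pxy k \<and> q2 \<in> Pxy k \<and> q3 \<in> Pxy k \<and> e j = dv q1 q2 q3" if "j < n" for j
  using e[OF that] unfolding S_def by blast
 then obtain q1 q2 q3 where q: "!!j. j < n ==> q1 j \<in> Pxy k \<and> q2 j \<in> Pxy k \<and> q3 j \<in> Pxy k \<and> e j = dv (q1 j) (q2 j) (q3 j)"
  by metis
 have ecomp: "(\<lambda>p. e j p $ i) \<in> Pxy (k + 1)" if "j < n" for i j
  using q[OF that] dv_Pxy by auto
 have main: "f p = (\<Sum>j<n. ip f (e j) *\<^sub>R e j p)"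
  if f: "!!i. (\<lambda>p. f p $ i) \<in> Pxy (k + 1)" and m1: "ref_tint (\<lambda>p. f p $ 1) = 0" and m2: "ref_tint (\<lambda>p. f p $ 2) = 0"
   and m3: "ref_tint (\<lambda>p. p $ 2 * f p $ 1 - p $ 1 * f p $ 2) = 0" and p: "p \<in> Ti" for f p
 proof -
  have cf: "cont f" using vec2_cont f by blast
  define u where "u q = f q - (\<Sum>j<n. ip f (e j) *\<^sub>R e j q)" for q
  have uc: "(\<lambda>p. u p $ i) \<in> Pxy (k + 1)" for i
  proof -
   have "(\<lambda>p. \<Sum>j<n. ip f (e j) * e j p $ i) \<in> Pxy (k + 1)"
    using ecomp by (intro Pxy_sum Pxy_cmul) auto
   then have "(\<lambda>p. f p $ i + (-1) * (\<Sum>j<n. ip f (e j) * e j p $ i)) \<in> Pxy (k + 1)"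
    by (intro Pxy_add[OF f] Pxy_cmul)
   then show ?thesis by (simp add: u_def)
  qed
  have cu: "cont u" using vec2_cont uc by blast
  have uB: "ip u B = 0" if "B \<in> \<A>" for B using orth[OF cf that] by (simp add: u_def[abs_def])
  have i1: "ref_tint (\<lambda>p. dbub ?O ?E1 ?E2 (mono x) p * u p $ 1) = 0" if x: "fst x + snd x <= k" for x
  proof -
   have "dv (mono x) ?Zr ?Zr \<in> \<A>" using x by (auto simp: \<A>_def I_def)
   from uB[OF this] show ?thesis by (simp add: ip_def inner_vec_def sum_2 dv_def dbub_zero mult.commute)
  qed
  have i2: "ref_tint (\<lambda>p. dbub ?O ?E2 ?E1 (mono x) p * u p $ 2) = 0" if x: "fst x + snd x <= k" for x
  proof -
   have "dv ?Zr (mono x) ?Zr \<in> \<A>" using x by (auto simp: \<A>_def I_def)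
   from uB[OF this] show ?thesis by (simp add: ip_def inner_vec_def sum_2 dv_def dbub_zero mult.commute)
  qed
  have i3: "ref_tint (\<lambda>p. dbub ?E1 ?E2 ?O (mono x) p * (u p $ 2 + (-1) * u p $ 1)) = 0" if x: "fst x + snd x <= k" for x
  proof -
   have "dv ?Zr ?Zr (mono x) \<in> \<A>" using x by (auto simp: \<A>_def I_def)
   from uB[OF this] show ?thesis by (simp add: ip_def inner_vec_def sum_2 dv_def dbub_zero algebra_simps)
  qed
  have u21: "(\<lambda>p. u p $ 2 + (-1) * u p $ 1) \<in> Pxy (k + 1)" by (intro Pxy_add Pxy_cmul uc)
  have pdk: "pd t g \<in> Pxy k" if "g \<in> Pxy (k + 1)" for t g using Pxy_has_derivative(2)[OF that] by simp
  have g1: "pd ?E1 (\<lambda>p. u p $ 1) p = 0" if "p \<in> Ti" for p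
   using symmetric_gradient_zero[OF nz_ref uc _ that, of 1] tint_dbub_all[OF nz_ref uc pdk[OF uc] i1] by simp
  have g2: "pd ?E2 (\<lambda>p. u p $ 2) p = 0" if "p \<in> Ti" for p
   using symmetric_gradient_zero[OF ref_area2_rot(2) uc, of 2 p] that
    tint_dbub_all[OF ref_area2_rot(2) uc pdk[OF uc[of 2], of ?E2], unfolded ref_tint_rot, OF i2] by (simp add: ref_tint_rot ref_itri_rot)
  have g3: "pd ?E2 (\<lambda>p. u p $ 1) p + pd ?E1 (\<lambda>p. u p $ 2) p = 0" if t: "p \<in> Ti" for p
  proof -
   have "pd (?E2 - ?E1) (\<lambda>p. u p $ 2 + (-1) * u p $ 1) p = 0"
    using symmetric_gradient_zero[OF ref_area2_rot(1) u21, of p] t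
     tint_dbub_all[OF ref_area2_rot(1) u21 pdk[OF u21], unfolded ref_tint_rot, OF i3] by (simp add: ref_tint_rot ref_itri_rot)
   then show ?thesis
    unfolding Pxy_pd_add[OF uc Pxy_cmul[OF uc]] Pxy_pd_cmul[OF uc] Pxy_linear_pd(2)[OF uc]
    using g1[OF t] g2[OF t] by simp
  qed
  obtain \<alpha> \<beta> \<kappa> where rm: "!!p. p \<in> Ti ==> u p $ 1 = \<alpha> - \<kappa> * p $ 2" "!!p. p \<in> Ti ==> u p $ 2 = \<beta> + \<kappa> * p $ 1"
   using rigid_motion[OF uc uc g1 g2 g3] by metis
  define r :: "real^2 => real^2" where "r p = vector [\<alpha> - \<kappa> * p $ 2, \<beta> + \<kappa> * p $ 1]" for p
  have rP1: "(\<lambda>p::real^2. \<alpha> + (-\<kappa>) * p $ 2) \<in> Pxy 1" "(\<lambda>p::real^2. \<beta> + \<kappa> * p $ 1) \<in> Pxy 1"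
   by (intro Pxy_add Pxy_const Pxy_cmul; use Pxy_coord[of _ 0] in simp)+
  have "(\<lambda>p. r p $ i) \<in> Pxy 1" for i :: 2
   using exhaust_2[of i] rP1 by (auto simp: r_def)
  then have cr': "cont r" by (rule vec2_cont)
  have er: "ip (e j) r = 0" if j: "j < n" for j
  proof -
   note Q = q[OF j, THEN conjunct1] q[OF j, THEN conjunct2, THEN conjunct1] q[OF j, THEN conjunct2, THEN conjunct2, THEN conjunct1]
   have P1: "(\<lambda>p::real^2. \<alpha> + (-\<kappa>) * p $ 2) \<in> Pxy 1" and P2: "(\<lambda>p::real^2. \<beta> + \<kappa> * p $ 1) \<in> Pxy 1" using rP1 .
   have P3: "(\<lambda>p::real^2. (\<beta> + \<kappa> * p $ 1) + (-1) * (\<alpha> + (-\<kappa>) * p $ 2)) \<in> Pxy 1"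
    by (intro Pxy_add[OF P2 Pxy_cmul[OF P1]])
   have pdr: "pd t (\<lambda>p::real^2. \<alpha> + (-\<kappa>) * p $ 2) p = - \<kappa> * t $ 2" "pd t (\<lambda>p::real^2. \<beta> + \<kappa> * p $ 1) p = \<kappa> * t $ 1" for t p
    unfolding Pxy_pd_add[OF Pxy_const[of _ 0] Pxy_cmul[OF Pxy_coord[of _ 0]]] Pxy_pd_cmul[OF Pxy_coord[of _ 0]] pd_coord pd_const by simp_all
   have 1: "ref_tint (\<lambda>p. dbub ?O ?E1 ?E2 (q1 j) p * (\<alpha> + (-\<kappa>) * p $ 2)) = 0"
    by (rule tint_parts_zero[OF nz_ref Q(1) P1]) (simp add: pdr[simplified] axis_def)
   have 2: "ref_tint (\<lambda>p. dbub ?O ?E2 ?E1 (q2 j) p * (\<beta> + \<kappa> * p $ 1)) = 0"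
   proof -
    have "pd (?E2 - ?O) (\<lambda>p::real^2. \<beta> + \<kappa> * p $ 1) p = 0" for p
     unfolding pdr by (simp add: axis_def)
    from tint_parts_zero[OF ref_area2_rot(2) Q(2) P2 this] show ?thesis unfolding ref_tint_rot .
   qed
   have 3: "ref_tint (\<lambda>p. dbub ?E1 ?E2 ?O (q3 j) p * ((\<beta> + \<kappa> * p $ 1) + (-1) * (\<alpha> + (-\<kappa>) * p $ 2))) = 0"
   proof -
    have "pd (?E2 - ?E1) (\<lambda>p::real^2. (\<beta> + \<kappa> * p $ 1) + (-1) * (\<alpha> + (-\<kappa>) * p $ 2)) p = 0" for p
     unfolding Pxy_pd_add[OF P2 Pxy_cmul[OF P1]] Pxy_pd_cmul[OF P1] pdr by (simp add: axis_def)
    from tint_parts_zero[OF ref_area2_rot(1) Q(3) P3 this] show ?thesis unfolding ref_tint_rot .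
   qed
   note cc = Pxy_cont[OF dbub_Pxy[OF Q(1)]] Pxy_cont[OF dbub_Pxy[OF Q(2)]] Pxy_cont[OF dbub_Pxy[OF Q(3)]] Pxy_cont[OF P1] Pxy_cont[OF P2] Pxy_cont[OF P3]
   have "ip (e j) r = ref_tint (\<lambda>p. (dbub ?O ?E1 ?E2 (q1 j) p * (\<alpha> + (-\<kappa>) * p $ 2) + dbub ?O ?E2 ?E1 (q2 j) p * (\<beta> + \<kappa> * p $ 1))
     + dbub ?E1 ?E2 ?O (q3 j) p * ((\<beta> + \<kappa> * p $ 1) + (-1) * (\<alpha> + (-\<kappa>) * p $ 2)))"
    using q[OF j] by (simp add: ip_def inner_vec_def sum_2 dv_def r_def algebra_simps)
   also have "... = 0"
    using tint_add[OF nz_ref continuous_on_add[OF continuous_on_mult[OF cc(1,4)] continuous_on_mult[OF cc(2,5)]] continuous_on_mult[OF cc(3,6)]]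
     tint_add[OF nz_ref continuous_on_mult[OF cc(1,4)] continuous_on_mult[OF cc(2,5)]] 1 2 3 by simp
   finally show ?thesis .
  qed
  have ce: "cont (e j)" if "j < n" for j using S1 e that by blast
  have "ip f r = 0"
  proof -
   note cf' = Pxy_cont[OF f[of 1]] Pxy_cont[OF f[of 2]] Pxy_cont[OF Pxy_coord[of 1 0]] Pxy_cont[OF Pxy_coord[of 2 0]]
   have "ip f r = ref_tint (\<lambda>p. (\<alpha> * f p $ 1 + \<beta> * f p $ 2) + (-\<kappa>) * (p $ 2 * f p $ 1 - p $ 1 * f p $ 2))"
    by (simp add: ip_def inner_vec_def sum_2 r_def algebra_simps)
   also have "... = (\<alpha> * ref_tint (\<lambda>p. f p $ 1) + \<beta> * ref_tint (\<lambda>p. f p $ 2)) + (-\<kappa>) * ref_tint (\<lambda>p. p $ 2 * f p $ 1 - p $ 1 * f p $ 2)"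
    by (subst tint_add[OF nz_ref], (intro continuous_intros cf')+, subst tint_add[OF nz_ref], (intro continuous_intros cf')+)
     (simp only: tint_cmul)
   finally show ?thesis using m1 m2 m3 by simp
  qed
  have "ip (\<lambda>q. \<Sum>j<n. ip f (e j) *\<^sub>R e j q) r = 0"
   using ce cr' er by (subst ip_sum) (auto simp: ip_scale intro!: continuous_intros)
  then have ur: "ip u r = 0"
   unfolding u_def using \<open>ip f r = 0\<close> cf cr' ce by (subst ip_diff) (auto intro!: continuous_intros)
  have "ip u u = ip u r"
   unfolding ip_def tint_def
  proof (rule integral_cong_AE)
   have mu: "u \<in> borel_measurable borel" "r \<in> borel_measurable borel" using cu cr' by (auto intro: borel_measurable_continuous_onI)
   show "(\<lambda>p. indicator (tri ?O ?E1 ?E2) p * (u p \<bullet> u p)) \<in> borel_measurable lborel"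
    "(\<lambda>p. indicator (tri ?O ?E1 ?E2) p * (u p \<bullet> r p)) \<in> borel_measurable lborel"
    using mu tri_borel[of ?O ?E1 ?E2] by measurable
   show "AE p in lborel. indicator (tri ?O ?E1 ?E2) p * (u p \<bullet> u p) = indicator (tri ?O ?E1 ?E2) p * (u p \<bullet> r p)"
    using AE_itri[OF nz_ref]
   proof eventually_elim
    case (elim p)
    have "u p = r p" if "p \<in> Ti" using rm[OF that] by (simp add: r_def vec_eq_iff forall_2)
    then show ?case using elim by (auto simp: indicator_def)
   qed
  qed
  then have "ip u u = 0" using ur by simp
  then have "u p \<bullet> u p = 0"
   unfolding ip_def by (rule tint_nonneg_zero[OF nz_ref _ _ _ p, rotated 2]) (auto intro!: continuous_intros cu)
  then show ?thesis by (simp add: u_def)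
 qed
 show ?thesis
 proof (rule exI[of _ n], rule exI[of _ e], rule exI[of _ q1], rule exI[of _ q2], rule exI[of _ q3],
   intro conjI allI impI ballI)
  fix f :: "real^2 => real^2" and p
  assume "\<forall>i. (\<lambda>p. f p $ i) \<in> Pxy (k + 1)" "ref_tint (\<lambda>p. f p $ 1) = 0" "ref_tint (\<lambda>p. f p $ 2) = 0"
   "ref_tint (\<lambda>p. p $ 2 * f p $ 1 - p $ 1 * f p $ 2) = 0" "p \<in> Ti"
  then show "f p = (\<Sum>j<n. ip f (e j) *\<^sub>R e j p)" using main[of f p] by simp
 qed (use q in simp_all)
qed

lemma lam_bary:
 assumes nz: "area2 a b c ~= 0"
 shows "lam 0 (axis 1 1) (axis 2 1) (bary a b c p) = lam a b c p"
  "lam (axis 1 1) (axis 2 1) 0 (bary a b c p) = lam b c a p"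
  "lam (axis 2 1) 0 (axis 1 1) (bary a b c p) = lam c a b p"
 unfolding lam_ref using lam_sum[OF nz, of p] by (auto simp: bary_def)

lemma bary_along:
 assumes nz: "area2 a b c ~= 0"
 shows "bary a b c (p + h *\<^sub>R (b - a)) = bary a b c p + h *\<^sub>R axis 1 1"
  "bary a b c (p + h *\<^sub>R (c - a)) = bary a b c p + h *\<^sub>R axis 2 1"
  "bary a b c (p + h *\<^sub>R (c - b)) = bary a b c p + h *\<^sub>R (axis 2 1 - axis 1 1)"
proof -
 have d: "dlam b c a (b - a) = 1" "dlam c a b (b - a) = 0" "dlam b c a (c - a) = 0" "dlam c a b (c - a) = 1"
   "dlam b c a (c - b) = -1" "dlam c a b (c - b) = 1"
  using nz unfolding dlam_def area2_rot(1,2)[where a=a and b=b and c=c]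
  by (simp_all add: divide_simps) (simp_all add: cr_simps algebra_simps)
 show "bary a b c (p + h *\<^sub>R (b - a)) = bary a b c p + h *\<^sub>R axis 1 1"
  "bary a b c (p + h *\<^sub>R (c - a)) = bary a b c p + h *\<^sub>R axis 2 1"
  "bary a b c (p + h *\<^sub>R (c - b)) = bary a b c p + h *\<^sub>R (axis 2 1 - axis 1 1)"
  by (simp_all add: bary_def lam_affine d vec_eq_iff forall_2 axis_def)
qed

lemma bary_Pxy:
 assumes "q \<in> Pxy k"
 shows "(\<lambda>p. q (bary a b c p)) \<in> Pxy k"
 unfolding bary_def using assms lam_Pxy[of _ _ _ 0] by (intro Pxy_compose) auto

lemma aff_Pxy:
 assumes "q \<in> Pxy k"
 shows "(\<lambda>p. q (aff a b c p)) \<in> Pxy k"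
proof -
 have "(\<lambda>p. a $ i + (b - a) $ i * p $ 1 + (c - a) $ i * p $ 2) \<in> Pxy 1" for i
  by (intro Pxy_add Pxy_const Pxy_cmul; use Pxy_coord[of _ 0] in simp)
 then have "(\<lambda>p. q (vector [a $ 1 + (b - a) $ 1 * p $ 1 + (c - a) $ 1 * p $ 2, a $ 2 + (b - a) $ 2 * p $ 1 + (c - a) $ 2 * p $ 2])) \<in> Pxy k"
  by (intro Pxy_compose[OF assms])
 moreover have "vector [a $ 1 + (b - a) $ 1 * p $ 1 + (c - a) $ 1 * p $ 2, a $ 2 + (b - a) $ 2 * p $ 1 + (c - a) $ 2 * p $ 2] = aff a b c p" for p
  by (simp add: aff_def vec_eq_iff forall_2 mult.commute)
 ultimately show ?thesis by simp
qed

lemma pd_bary: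
 assumes nz: "area2 a b c ~= 0" and q: "q \<in> Pxy k"
  and t: "!!h. bary a b c (p + h *\<^sub>R t) = bary a b c p + h *\<^sub>R t'"
 shows "pd t (\<lambda>p. q (bary a b c p)) p = pd t' q (bary a b c p)"
proof -
 have "((\<lambda>h. q (bary a b c (p + h *\<^sub>R t))) has_real_derivative pd t (\<lambda>p. q (bary a b c p)) p) (at 0)"
  using Pxy_along[OF bary_Pxy[OF q], of a b c p t 0] by simp
 moreover have "((\<lambda>h. q (bary a b c (p + h *\<^sub>R t))) has_real_derivative pd t' q (bary a b c p)) (at 0)"
  unfolding t using Pxy_along[OF q, of "bary a b c p" t' 0] by simp
 ultimately show ?thesis by (rule DERIV_unique)
qed

lemma dbub_bary:
 assumes nz: "area2 a b c ~= 0" and q: "q \<in> Pxy k"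
 shows "dbub a b c (\<lambda>p. q (bary a b c p)) p = dbub 0 (axis 1 1) (axis 2 1) q (bary a b c p)"
  "dbub a c b (\<lambda>p. q (bary a b c p)) p = dbub 0 (axis 2 1) (axis 1 1) q (bary a b c p)"
  "dbub b c a (\<lambda>p. q (bary a b c p)) p = dbub (axis 1 1) (axis 2 1) 0 q (bary a b c p)"
 unfolding dbub_def pd_bary[OF nz q bary_along(1)[OF nz]] pd_bary[OF nz q bary_along(2)[OF nz]] pd_bary[OF nz q bary_along(3)[OF nz]]
 using lam_bary[OF nz, of p] by (simp_all add: lam_swap)

definition rm :: "real => real => real => real^2 => real^2" where
 "rm \<alpha> \<beta> \<kappa> p = vector [\<alpha> - \<kappa> * p $ 2, \<beta> + \<kappa> * p $ 1]"

section \<open>Bubble correction on an arbitrary triangle\<close>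

text \<open>The coordinates of a field with respect to two edges of the triangle, as a field on the reference triangle.\<close>

definition hat :: "real^2 => real^2 => real^2 => (real^2 => real^2) => real^2 => real^2" where
 "hat a b c f q = vector [cr (f (aff a b c q)) (c - a) / area2 a b c, cr (b - a) (f (aff a b c q)) / area2 a b c]"

lemma aff_cont: "cont (aff a b c)"
 unfolding aff_def by (intro continuous_intros)

lemma vec2_contI: "cont f ==> cont g ==> cont (\<lambda>p. vector [f p, g p] :: real^2)"
proof -
 assume "cont f" "cont g"
 then have "cont (\<lambda>x. if i = 1 then f x else g x)" for i :: 2 by (cases "i = 1") simp_all
 then have "cont (\<lambda>p. \<chi> i. if i = 1 then f p else g p :: real^2)"
  by (intro continuous_on_vec_lambda)
 moreover have "(\<chi> i. if i = 1 then f p else g p) = (vector [f p, g p] :: real^2)" for p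
  by (simp add: vec_eq_iff forall_2)
 ultimately show ?thesis by simp
qed

lemma hat_cont: "cont f ==> cont (hat a b c f)"
proof -
 assume "cont f"
 then have c: "cont (\<lambda>q. f (aff a b c q))" using aff_cont continuous_on_compose2[of UNIV f UNIV] by blast
 show ?thesis unfolding hat_def cr_def divide_inverse
  by (intro vec2_contI continuous_intros c)
qed

lemma cr_expand: "cr u w ~= 0 ==> f = (cr f w / cr u w) *\<^sub>R u + (cr u f / cr u w) *\<^sub>R w"
proof -
 assume n: "cr u w ~= 0"
 have "cr u w *\<^sub>R f = cr f w *\<^sub>R u + cr u f *\<^sub>R w"
  by (simp add: vec_eq_iff forall_2 cr_def algebra_simps)
 then have "(1 / cr u w) *\<^sub>R (cr u w *\<^sub>R f) = (1 / cr u w) *\<^sub>R (cr f w *\<^sub>R u + cr u f *\<^sub>R w)" by simp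
 then show ?thesis using n by (simp add: scaleR_add_right)
qed

lemma cr_bound: "(cr u w)\<^sup>2 <= (norm u)\<^sup>2 * (norm w)\<^sup>2"
proof -
 have "(cr u w)\<^sup>2 + (u \<bullet> w)\<^sup>2 = (u \<bullet> u) * (w \<bullet> w)"
  by (simp add: cr_def inner_vec_def sum_2 power2_eq_square algebra_simps)
 then show ?thesis by (simp add: power2_norm_eq_inner) (metis le_add_same_cancel1 zero_le_power2)
qed

text \<open>The bubble correction on an arbitrary triangle is transported from the reference triangle.
  The dependence of its bound on the triangle is explicit.\<close>

text \<open>\<open>Q a b c f\<close> are the three coefficient functions of the bubble fields on the edges of the triangle, and \<open>C\<close> is the constant
  of the scaled bound. They come from an explicit projection, which makes them linear in \<open>f\<close>.\<close>

definition bubble_inverse :: "nat => real => (real^2 => real^2 => real^2 => (real^2 => real^2) => nat => real^2 => real) => bool" where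
 "bubble_inverse k C Q \<longleftrightarrow> (\<forall>a b c. area2 a b c ~= 0 -->
   (\<forall>f i. Q a b c f i \<in> Pxy k) \<and>
   (\<forall>f. (\<forall>i. (\<lambda>p. f p $ i) \<in> Pxy (k + 1)) --> (\<forall>\<alpha> \<beta> \<kappa>. tint a b c (\<lambda>p. f p \<bullet> rm \<alpha> \<beta> \<kappa> p) = 0) -->
    (\<forall>p\<in>itri a b c. f p = dbub a b c (Q a b c f 1) p *\<^sub>R (b - a) + dbub a c b (Q a b c f 2) p *\<^sub>R (c - a)
      + dbub b c a (Q a b c f 3) p *\<^sub>R (c - b))) \<and>
   (\<forall>(J::nat set) x f i p. finite J --> (\<forall>j\<in>J. cont (f j)) -->
    Q a b c (\<lambda>p. \<Sum>j\<in>J. x j *\<^sub>R f j p) i p = (\<Sum>j\<in>J. x j * Q a b c (f j) i p)) \<and>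
   (\<forall>f d i. \<forall>p\<in>tri a b c. cont f --> norm (b - a) <= d --> norm (c - a) <= d -->
    (Q a b c f i p)\<^sup>2 <= C * (d\<^sup>2 / \<bar>area2 a b c\<bar> ^ 3 * tint a b c (\<lambda>p. (norm (f p))\<^sup>2))))"

lemma bubble_inverse_exists: "\<exists>C\<ge>0. \<exists>Q. bubble_inverse k C Q"
proof -
 let ?O = "0 :: real^2" and ?E1 = "axis 1 1 :: real^2" and ?E2 = "axis 2 1 :: real^2"
 obtain n :: nat and e q1 q2 q3 where
  q: "!!j. j < n ==> q1 j \<in> Pxy k \<and> q2 j \<in> Pxy k \<and> q3 j \<in> Pxy k \<and> e j = dv (q1 j) (q2 j) (q3 j)"
  and inv: "!!f p. (!!i. (\<lambda>p. f p $ i) \<in> Pxy (k + 1)) ==> ref_tint (\<lambda>p. f p $ 1) = 0 ==> ref_tint (\<lambda>p. f p $ 2) = 0 ==>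
   ref_tint (\<lambda>p. p $ 2 * f p $ 1 - p $ 1 * f p $ 2) = 0 ==> p \<in> Ti ==> f p = (\<Sum>j<n. ip f (e j) *\<^sub>R e j p)"
  using reference_right_inverse[of k] by blast
 define qq where "qq i j = (if i = (1::nat) then q1 j else if i = 2 then q2 j else q3 j)" for i j
 have qqP: "qq i j \<in> Pxy k" if "j < n" for i j using q[OF that] by (simp add: qq_def)
 have ce: "cont (e j)" if "j < n" for j
  using q[OF that] vec2_cont[of "e j" "k + 1"] dv_Pxy[of "q1 j" k "q2 j" "q3 j"] by auto
 define Q where "Q a b c f i p = (\<Sum>j<n. ip (hat a b c f) (e j) * qq i j (bary a b c p))" for a b c f i p
 have exM: "\<exists>M. M \<ge> 0 \<and> (\<forall>q\<in>tri ?O ?E1 ?E2. \<bar>qq i j q\<bar> <= M)" if jn: "j < n" for i j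
 proof -
  obtain M where "!!x. x \<in> tri ?O ?E1 ?E2 ==> norm (qq i j x) <= M"
   using compact_imp_bounded[OF compact_continuous_image[OF Pxy_cont[OF qqP[OF jn]] tri_compact[OF nz_ref]]]
   unfolding bounded_iff by blast
  then show ?thesis by (intro exI[of _ "\<bar>M\<bar>"]) fastforce
 qed
 define M where "M i j = (SOME M. M \<ge> 0 \<and> (\<forall>q\<in>tri ?O ?E1 ?E2. \<bar>qq i j q\<bar> <= M))" for i j
 have M: "M i j \<ge> 0 \<and> (\<forall>q\<in>tri ?O ?E1 ?E2. \<bar>qq i j q\<bar> <= M i j)" if "j < n" for i j
  unfolding M_def by (rule someI_ex[OF exM[OF that]])
 define K where "K = (\<Sum>j<n. sqrt (ip (e j) (e j)) * (M 1 j + M 2 j + M 3 j))"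
 have K0: "K \<ge> 0" unfolding K_def using M ip_nonneg by (intro sum_nonneg mult_nonneg_nonneg add_nonneg_nonneg) auto
 have main: "(\<forall>f i. Q a b c f i \<in> Pxy k) \<and>
   (\<forall>f. (\<forall>i. (\<lambda>p. f p $ i) \<in> Pxy (k + 1)) --> (\<forall>\<alpha> \<beta> \<kappa>. tint a b c (\<lambda>p. f p \<bullet> rm \<alpha> \<beta> \<kappa> p) = 0) -->
    (\<forall>p\<in>itri a b c. f p = dbub a b c (Q a b c f 1) p *\<^sub>R (b - a) + dbub a c b (Q a b c f 2) p *\<^sub>R (c - a)
      + dbub b c a (Q a b c f 3) p *\<^sub>R (c - b))) \<and>
   (\<forall>(J::nat set) x f i p. finite J --> (\<forall>j\<in>J. cont (f j)) -->
    Q a b c (\<lambda>p. \<Sum>j\<in>J. x j *\<^sub>R f j p) i p = (\<Sum>j\<in>J. x j * Q a b c (f j) i p)) \<and>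
   (\<forall>f d i. \<forall>p\<in>tri a b c. cont f --> norm (b - a) <= d --> norm (c - a) <= d -->
    (Q a b c f i p)\<^sup>2 <= (K\<^sup>2 * 2) * (d\<^sup>2 / \<bar>area2 a b c\<bar> ^ 3 * tint a b c (\<lambda>p. (norm (f p))\<^sup>2)))"
  if nz: "area2 a b c ~= 0" for a b c
 proof (intro conjI allI impI ballI)
  let ?D = "area2 a b c"
  show "Q a b c f i \<in> Pxy k" for f i
   unfolding Q_def[abs_def] using qqP by (intro Pxy_sum Pxy_cmul bary_Pxy) auto
  {
   fix f p assume f: "\<forall>i. (\<lambda>p. f p $ i) \<in> Pxy (k + 1)" and orth: "\<forall>\<alpha> \<beta> \<kappa>. tint a b c (\<lambda>p. f p \<bullet> rm \<alpha> \<beta> \<kappa> p) = 0"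
    and p: "p \<in> itri a b c"
   have fP: "(\<lambda>p. f p $ i) \<in> Pxy (k + 1)" for i using f by blast
   have cf: "cont f" using vec2_cont fP by blast
   have mf: "(\<lambda>p. f p $ i) \<in> borel_measurable borel" for i using Pxy_borel[OF fP] .
   have faP: "(\<lambda>q. f (aff a b c q) $ i) \<in> Pxy (k + 1)" for i using aff_Pxy[OF fP] .
   have "(\<lambda>q. hat a b c f q $ i) \<in> Pxy (k + 1)" for i
   proof -
    have "(\<lambda>q. ((c - a) $ 2 / ?D) * f (aff a b c q) $ 1 + (- ((c - a) $ 1) / ?D) * f (aff a b c q) $ 2) \<in> Pxy (k + 1)"
     "(\<lambda>q. ((b - a) $ 1 / ?D) * f (aff a b c q) $ 2 + (- ((b - a) $ 2) / ?D) * f (aff a b c q) $ 1) \<in> Pxy (k + 1)"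
     by (intro Pxy_add Pxy_cmul faP)+
    moreover have "hat a b c f q $ 1 = ((c - a) $ 2 / ?D) * f (aff a b c q) $ 1 + (- ((c - a) $ 1) / ?D) * f (aff a b c q) $ 2"
     "hat a b c f q $ 2 = ((b - a) $ 1 / ?D) * f (aff a b c q) $ 2 + (- ((b - a) $ 2) / ?D) * f (aff a b c q) $ 1" for q
     using nz by (simp_all add: hat_def cr_def field_simps)
    ultimately show ?thesis using exhaust_2[of i] by auto
   qed
   moreover have "ref_tint (\<lambda>q. hat a b c f q $ 1) = 0"
   proof -
    have "0 = tint a b c (\<lambda>p. cr (f p) (c - a))"
     using orth[rule_format, of "(c - a) $ 2" "- ((c - a) $ 1)" 0] by (simp add: rm_def inner_vec_def sum_2 cr_def algebra_simps)
    also have "... = \<bar>?D\<bar> * ref_tint (\<lambda>q. cr (f (aff a b c q)) (c - a))"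
     using mf by (intro tint_aff[OF nz]) (simp add: cr_def)
    finally have "ref_tint (\<lambda>q. cr (f (aff a b c q)) (c - a)) = 0" using nz by simp
    then show ?thesis using tint_cmul[of ?O ?E1 ?E2 "1 / ?D" "\<lambda>q. cr (f (aff a b c q)) (c - a)"] by (simp add: hat_def)
   qed
   moreover have "ref_tint (\<lambda>q. hat a b c f q $ 2) = 0"
   proof -
    have "0 = tint a b c (\<lambda>p. cr (b - a) (f p))"
     using orth[rule_format, of "- ((b - a) $ 2)" "(b - a) $ 1" 0] by (simp add: rm_def inner_vec_def sum_2 cr_def algebra_simps)
    also have "... = \<bar>?D\<bar> * ref_tint (\<lambda>q. cr (b - a) (f (aff a b c q)))"
     using mf by (intro tint_aff[OF nz]) (simp add: cr_def)
    finally have "ref_tint (\<lambda>q. cr (b - a) (f (aff a b c q))) = 0" using nz by simp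
    then show ?thesis using tint_cmul[of ?O ?E1 ?E2 "1 / ?D" "\<lambda>q. cr (b - a) (f (aff a b c q))"] by (simp add: hat_def)
   qed
   moreover have "ref_tint (\<lambda>q. q $ 2 * hat a b c f q $ 1 - q $ 1 * hat a b c f q $ 2) = 0"
   proof -
    have "0 = tint a b c (\<lambda>p. f p \<bullet> rm (a $ 2) (- (a $ 1)) 1 p)" using orth by simp
    also have "... = \<bar>?D\<bar> * ref_tint (\<lambda>q. f (aff a b c q) \<bullet> rm (a $ 2) (- (a $ 1)) 1 (aff a b c q))"
     using mf by (intro tint_aff[OF nz]) (simp add: rm_def inner_vec_def sum_2)
    finally have "ref_tint (\<lambda>q. f (aff a b c q) \<bullet> rm (a $ 2) (- (a $ 1)) 1 (aff a b c q)) = 0" using nz by simp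
    moreover have "q $ 2 * hat a b c f q $ 1 - q $ 1 * hat a b c f q $ 2 =
     (- 1 / ?D) * (f (aff a b c q) \<bullet> rm (a $ 2) (- (a $ 1)) 1 (aff a b c q))" for q
    proof -
     have "q $ 2 * cr (f (aff a b c q)) (c - a) - q $ 1 * cr (b - a) (f (aff a b c q)) =
      - (f (aff a b c q) \<bullet> rm (a $ 2) (- (a $ 1)) 1 (aff a b c q))"
      by (simp add: rm_def inner_vec_def sum_2 cr_def) (simp add: aff_def algebra_simps)
     then show ?thesis unfolding hat_def by (simp add: diff_divide_distrib[symmetric])
    qed
    ultimately show ?thesis using tint_cmul[of ?O ?E1 ?E2 "- 1 / ?D"] by simp
   qed
   moreover have pT: "bary a b c p \<in> Ti" using p by (simp add: itri_def lam_bary[OF nz])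
   ultimately have h: "hat a b c f (bary a b c p) = (\<Sum>j<n. ip (hat a b c f) (e j) *\<^sub>R e j (bary a b c p))"
    by (rule inv)
   have f_eq: "f p = hat a b c f (bary a b c p) $ 1 *\<^sub>R (b - a) + hat a b c f (bary a b c p) $ 2 *\<^sub>R (c - a)"
    using cr_expand[of "b - a" "c - a" "f p"] nz by (simp add: hat_def aff_bary[OF nz] area2_def)
   have dsum: "dbub x y z (\<lambda>p. \<Sum>j<n. s j * (qq i j (bary a b c p))) p = (\<Sum>j<n. s j * dbub x y z (\<lambda>p. qq i j (bary a b c p)) p)" for x y z i s
   proof -
    have "(\<lambda>p. \<Sum>j\<in>J. s j * (qq i j (bary a b c p))) \<in> Pxy k \<and> dbub x y z (\<lambda>p. \<Sum>j\<in>J. s j * (qq i j (bary a b c p))) p = (\<Sum>j\<in>J. s j * dbub x y z (\<lambda>p. qq i j (bary a b c p)) p)"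
     if "finite J" "J \<subseteq> {..<n}" for J
     using that
    proof (induction J rule: finite_induct)
     case empty
     then show ?case by (simp add: dbub_zero Pxy_zero)
    next
     case (insert j J)
     have P: "(\<lambda>p. qq i j (bary a b c p)) \<in> Pxy k" using insert qqP bary_Pxy by auto
     have P2: "(\<lambda>p. \<Sum>j\<in>J. s j * (qq i j (bary a b c p))) \<in> Pxy k"
      and eq: "dbub x y z (\<lambda>p. \<Sum>j\<in>J. s j * (qq i j (bary a b c p))) p = (\<Sum>j\<in>J. s j * dbub x y z (\<lambda>p. qq i j (bary a b c p)) p)"
      using insert by auto
     show ?case
      unfolding sum.insert[OF insert(1,2)] dbub_add[OF Pxy_cmul[OF P] P2] dbub_cmul[OF P] eq
      using Pxy_add[OF Pxy_cmul[OF P] P2] by simp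
    qed
    then show ?thesis by blast
   qed
   have qP: "q1 j \<in> Pxy k" "q2 j \<in> Pxy k" "q3 j \<in> Pxy k" if "j < n" for j using q[OF that] by auto
   let ?b = "bary a b c p" and ?s = "\<lambda>j. ip (hat a b c f) (e j)"
   have d1: "dbub a b c (Q a b c f 1) p = (\<Sum>j<n. ?s j * dbub ?O ?E1 ?E2 (q1 j) ?b)"
    unfolding Q_def[abs_def] dsum by (intro sum.cong refl) (simp add: dbub_bary(1)[OF nz qP(1)] qq_def)
   have d2: "dbub a c b (Q a b c f 2) p = (\<Sum>j<n. ?s j * dbub ?O ?E2 ?E1 (q2 j) ?b)"
    unfolding Q_def[abs_def] dsum by (intro sum.cong refl) (simp add: dbub_bary(2)[OF nz qP(2)] qq_def)
   have d3: "dbub b c a (Q a b c f 3) p = (\<Sum>j<n. ?s j * dbub ?E1 ?E2 ?O (q3 j) ?b)"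
    unfolding Q_def[abs_def] dsum by (intro sum.cong refl) (simp add: dbub_bary(3)[OF nz qP(3)] qq_def)
   have h1: "hat a b c f ?b $ 1 = dbub a b c (Q a b c f 1) p - dbub b c a (Q a b c f 3) p"
    unfolding h d1 d3 using q by (simp add: dv_def sum_subtractf[symmetric] right_diff_distrib)
   have h2: "hat a b c f ?b $ 2 = dbub a c b (Q a b c f 2) p + dbub b c a (Q a b c f 3) p"
    unfolding h d2 d3 using q by (simp add: dv_def sum.distrib[symmetric] distrib_left)
   show "f p = dbub a b c (Q a b c f 1) p *\<^sub>R (b - a) + dbub a c b (Q a b c f 2) p *\<^sub>R (c - a)
      + dbub b c a (Q a b c f 3) p *\<^sub>R (c - b)"
    unfolding f_eq h1 h2 by (simp add: algebra_simps)
  }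
  {
   fix J :: "nat set" and x :: "nat => real" and f :: "nat => real^2 => real^2" and i p assume J: "finite J" and cf: "\<forall>j\<in>J. cont (f j)"
   have "hat a b c (\<lambda>p. \<Sum>j\<in>J. x j *\<^sub>R f j p) = (\<lambda>q. \<Sum>j\<in>J. x j *\<^sub>R hat a b c (f j) q)"
    using J
   proof (induction J rule: finite_induct)
    case empty
    show ?case by (rule ext) (simp add: hat_def cr_def vec_eq_iff forall_2)
   next
    case (insert l J)
    have "hat a b c (\<lambda>p. x l *\<^sub>R f l p + g p) q = x l *\<^sub>R hat a b c (f l) q + hat a b c g q" for g q
     using nz by (simp add: hat_def cr_def vec_eq_iff forall_2 field_simps)
    then show ?case using insert by (simp add: fun_eq_iff)
   qed
   then have "ip (hat a b c (\<lambda>p. \<Sum>j\<in>J. x j *\<^sub>R f j p)) (e l) = (\<Sum>j\<in>J. x j * ip (hat a b c (f j)) (e l))" if "l < n" for l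
    using J cf ce[OF that] hat_cont by (simp add: ip_sum ip_scale continuous_on_scaleR)
   then show "Q a b c (\<lambda>p. \<Sum>j\<in>J. x j *\<^sub>R f j p) i p = (\<Sum>j\<in>J. x j * Q a b c (f j) i p)"
    unfolding Q_def by (simp add: sum_distrib_left sum_distrib_right mult.assoc) (rule sum.swap)
  }
  {
   fix f :: "real^2 => real^2" and d i p assume p: "p \<in> tri a b c" and cf: "cont f" and d: "norm (b - a) <= d" "norm (c - a) <= d"
   let ?h = "ip (hat a b c f) (hat a b c f)"
   have pT: "bary a b c p \<in> tri ?O ?E1 ?E2" using p by (simp add: tri_def lam_bary[OF nz])
   have "\<bar>Q a b c f i p\<bar> <= (\<Sum>j<n. \<bar>ip (hat a b c f) (e j) * qq i j (bary a b c p)\<bar>)"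
    unfolding Q_def by (rule sum_abs)
   also have "... <= (\<Sum>j<n. sqrt ?h * (sqrt (ip (e j) (e j)) * (M 1 j + M 2 j + M 3 j)))"
   proof (rule sum_mono)
    fix j assume j: "j \<in> {..<n}"
    have "\<bar>ip (hat a b c f) (e j)\<bar> <= sqrt ?h * sqrt (ip (e j) (e j))"
     using ip_Cauchy_Schwarz[OF hat_cont[OF cf] ce, of j a b c] j
     by (simp add: real_le_rsqrt abs_le_square_iff flip: real_sqrt_mult real_sqrt_abs)
    moreover have "\<bar>qq i j (bary a b c p)\<bar> <= M 1 j + M 2 j + M 3 j"
    proof -
     have "qq i j = qq 1 j \<or> qq i j = qq 2 j \<or> qq i j = qq 3 j" by (simp add: qq_def)
     then show ?thesis using M[of j 1] M[of j 2] M[of j 3] pT j by fastforce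
    qed
    ultimately have "\<bar>ip (hat a b c f) (e j)\<bar> * \<bar>qq i j (bary a b c p)\<bar> <= (sqrt ?h * sqrt (ip (e j) (e j))) * (M 1 j + M 2 j + M 3 j)"
     using ip_nonneg by (intro mult_mono) auto
    then show "\<bar>ip (hat a b c f) (e j) * qq i j (bary a b c p)\<bar> <= sqrt ?h * (sqrt (ip (e j) (e j)) * (M 1 j + M 2 j + M 3 j))"
     by (simp add: abs_mult mult.assoc)
   qed
   also have "... = sqrt ?h * K" by (simp add: K_def sum_distrib_left)
   finally have "(Q a b c f i p)\<^sup>2 <= (sqrt ?h * K)\<^sup>2" by (metis abs_ge_zero power2_abs power_mono)
   then have 1: "(Q a b c f i p)\<^sup>2 <= K\<^sup>2 * ?h" using ip_nonneg by (simp add: power_mult_distrib mult.commute)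
   have cfa: "cont (\<lambda>q. f (aff a b c q))" using cf aff_cont continuous_on_compose2[of UNIV f UNIV] by blast
   have d0: "d \<ge> 0" using d norm_ge_zero order_trans by blast
   have pw: "hat a b c f q \<bullet> hat a b c f q <= (2 * d\<^sup>2 / ?D\<^sup>2) * (norm (f (aff a b c q)))\<^sup>2" for q
   proof -
    let ?y = "f (aff a b c q)"
    have "(cr ?y (c - a))\<^sup>2 <= (norm ?y)\<^sup>2 * d\<^sup>2" "(cr (b - a) ?y)\<^sup>2 <= d\<^sup>2 * (norm ?y)\<^sup>2"
     using d by (auto intro!: order_trans[OF cr_bound] mult_mono power_mono)
    then have "(cr ?y (c - a))\<^sup>2 + (cr (b - a) ?y)\<^sup>2 <= 2 * d\<^sup>2 * (norm ?y)\<^sup>2"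
     by (simp add: algebra_simps)
    then have "((cr ?y (c - a))\<^sup>2 + (cr (b - a) ?y)\<^sup>2) / ?D\<^sup>2 <= (2 * d\<^sup>2 * (norm ?y)\<^sup>2) / ?D\<^sup>2"
     by (intro divide_right_mono) auto
    moreover have "hat a b c f q \<bullet> hat a b c f q = ((cr ?y (c - a))\<^sup>2 + (cr (b - a) ?y)\<^sup>2) / ?D\<^sup>2"
     by (simp add: hat_def inner_vec_def sum_2 power2_eq_square add_divide_distrib)
    ultimately show ?thesis by simp
   qed
   have "?h <= ref_tint (\<lambda>q. (2 * d\<^sup>2 / ?D\<^sup>2) * (norm (f (aff a b c q)))\<^sup>2)"
    unfolding ip_def tint_def
   proof (rule integral_mono)
    show "integrable lborel (\<lambda>p. indicator (tri ?O ?E1 ?E2) p * (hat a b c f p \<bullet> hat a b c f p))"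
     using hat_cont[OF cf] by (intro tint_integrable[OF nz_ref] continuous_intros)
    show "integrable lborel (\<lambda>p. indicator (tri ?O ?E1 ?E2) p * (2 * d\<^sup>2 / ?D\<^sup>2 * (norm (f (aff a b c p)))\<^sup>2))"
     using cfa by (intro tint_integrable[OF nz_ref] continuous_intros)
   qed (use pw in \<open>auto simp: indicator_def\<close>)
   also have "... = (2 * d\<^sup>2 / ?D\<^sup>2) * ref_tint (\<lambda>q. (norm (f (aff a b c q)))\<^sup>2)" by (rule tint_cmul)
   also have "ref_tint (\<lambda>q. (norm (f (aff a b c q)))\<^sup>2) = tint a b c (\<lambda>p. (norm (f p))\<^sup>2) / \<bar>?D\<bar>"
    using tint_aff[OF nz, of "\<lambda>p. (norm (f p))\<^sup>2"] cf nz
    by (simp add: borel_measurable_continuous_onI continuous_on_power continuous_on_norm)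
   finally have "?h <= 2 * (d\<^sup>2 / \<bar>?D\<bar> ^ 3 * tint a b c (\<lambda>p. (norm (f p))\<^sup>2))"
    by (simp add: power2_eq_square power3_eq_cube)
   then have "K\<^sup>2 * ?h <= K\<^sup>2 * (2 * (d\<^sup>2 / \<bar>?D\<bar> ^ 3 * tint a b c (\<lambda>p. (norm (f p))\<^sup>2)))"
    by (intro mult_left_mono) auto
   then show "(Q a b c f i p)\<^sup>2 <= (K\<^sup>2 * 2) * (d\<^sup>2 / \<bar>?D\<bar> ^ 3 * tint a b c (\<lambda>p. (norm (f p))\<^sup>2))"
    using 1 by (simp add: mult.assoc)
  }
 qed
 show ?thesis unfolding bubble_inverse_def
 proof (rule exI[of _ "K\<^sup>2 * 2"], rule conjI, goal_cases)
  case 1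
  show ?case by simp
 next
  case 2
  show ?case by (rule exI[of _ Q], rule allI, rule allI, rule allI, rule impI, rule main)
 qed
qed

section \<open>Edge fields and shadows of edges\<close>

definition glam :: "real^2 => real^2 => real^2 => real^2" where
 "glam a b c = vector [(b $ 2 - c $ 2) / area2 a b c, (c $ 1 - b $ 1) / area2 a b c]"

lemma dlam_glam: "dlam a b c t = glam a b c \<bullet> t"
 unfolding dlam_def glam_def cr_def inner_vec_def
 by (cases "area2 a b c = 0") (simp_all add: sum_2 field_simps)

lemma glam_swap: "glam a c b = glam a b c"
 unfolding glam_def area2_rot(4)[where a=a and b=b and c=c]
 by (cases "area2 a b c = 0") (simp_all add: vec_eq_iff forall_2 field_simps)

lemma rm_affine:
 assumes "u + v + w = 1"
 shows "rm \<alpha> \<beta> \<kappa> (u *\<^sub>R a + v *\<^sub>R b + w *\<^sub>R c) = u *\<^sub>R rm \<alpha> \<beta> \<kappa> a + v *\<^sub>R rm \<alpha> \<beta> \<kappa> b + w *\<^sub>R rm \<alpha> \<beta> \<kappa> c"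
proof -
 have u: "u = 1 - v - w" using assms by simp
 show ?thesis unfolding u by (simp add: rm_def vec_eq_iff forall_2 algebra_simps)
qed

lemma rm_lam:
 assumes "area2 a b c ~= 0"
 shows "rm \<alpha> \<beta> \<kappa> p = lam a b c p *\<^sub>R rm \<alpha> \<beta> \<kappa> a + lam b c a p *\<^sub>R rm \<alpha> \<beta> \<kappa> b + lam c a b p *\<^sub>R rm \<alpha> \<beta> \<kappa> c"
 using rm_affine[OF lam_sum[OF assms, of p], of \<alpha> \<beta> \<kappa> a b c] lam_rep[OF assms, of p] by simp

lemma glam_sum: "glam c a b = - glam a b c - glam b c a"
proof -
 have "(vector [(a $ 2 - b $ 2) / D, (b $ 1 - a $ 1) / D] :: real^2) =
  - vector [(b $ 2 - c $ 2) / D, (c $ 1 - b $ 1) / D] - vector [(c $ 2 - a $ 2) / D, (a $ 1 - c $ 1) / D]" for D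
  by (simp add: vec_eq_iff forall_2 diff_divide_distrib)
 then show ?thesis
  by (simp only: glam_def area2_rot(1)[where a=a and b=b and c=c] area2_rot(2)[where a=a and b=b and c=c])
qed

text \<open>A constant symmetric matrix is orthogonal to the skew gradient of a rigid motion.\<close>

lemma rigid_skew:
 assumes nz: "area2 a b c ~= 0" and A: "transpose A = A"
 shows "(A *v glam a b c) \<bullet> rm \<alpha> \<beta> \<kappa> a + (A *v glam b c a) \<bullet> rm \<alpha> \<beta> \<kappa> b + (A *v glam c a b) \<bullet> rm \<alpha> \<beta> \<kappa> c = 0"
proof -
 have A12: "A $ 2 $ 1 = A $ 1 $ 2" using arg_cong[OF A, of "\<lambda>M. M $ 1 $ 2"] by (simp add: transpose_def)
 let ?g = "\<lambda>b c. (vector [b $ 2 - c $ 2, c $ 1 - b $ 1] :: real^2)"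
 have e: "glam a b c = (1 / area2 a b c) *\<^sub>R ?g b c" "glam b c a = (1 / area2 a b c) *\<^sub>R ?g c a" "glam c a b = (1 / area2 a b c) *\<^sub>R ?g a b"
 proof -
  have "vector [x / D, y / D] = (1 / D) *\<^sub>R (vector [x, y] :: real^2)" for x y D
   by (simp add: vec_eq_iff forall_2)
  then show "glam a b c = (1 / area2 a b c) *\<^sub>R ?g b c" "glam b c a = (1 / area2 a b c) *\<^sub>R ?g c a" "glam c a b = (1 / area2 a b c) *\<^sub>R ?g a b"
   by (simp_all only: glam_def area2_rot(1)[where a=a and b=b and c=c] area2_rot(2)[where a=a and b=b and c=c])
 qed
 have "(A *v ?g b c) \<bullet> rm \<alpha> \<beta> \<kappa> a + (A *v ?g c a) \<bullet> rm \<alpha> \<beta> \<kappa> b + (A *v ?g a b) \<bullet> rm \<alpha> \<beta> \<kappa> c = 0"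
  by (simp add: matrix_vector_mult_def inner_vec_def sum_2 rm_def A12 algebra_simps)
 then have "(1 / area2 a b c) * ((A *v ?g b c) \<bullet> rm \<alpha> \<beta> \<kappa> a + (A *v ?g c a) \<bullet> rm \<alpha> \<beta> \<kappa> b + (A *v ?g a b) \<bullet> rm \<alpha> \<beta> \<kappa> c) = 0" by simp
 then show ?thesis unfolding e by (simp add: matrix_vector_mult_scaleR algebra_simps)
qed

text \<open>The divergence of an edge field acts on a rigid motion only through the values of the motion at the two ends of the edge.
  Written in barycentric coordinates, all terms are cubic integrals, related by \<open>tint_cubic\<close>; the value at the third vertex cancels by
  \<open>rigid_skew\<close>.\<close>

lemma edge_moment:
 assumes nz: "area2 a b c ~= 0" and A: "transpose A = A"
 shows "tint a b c (\<lambda>p. (A *v ((2 * lam a b c p * lam b c a p) *\<^sub>R glam a b c + (lam a b c p ^ 2) *\<^sub>R glam b c a)) \<bullet> rm \<alpha> \<beta> \<kappa> p)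
  = \<bar>area2 a b c\<bar> / 2 * (- ((A *v glam c a b) \<bullet> ((1/10) *\<^sub>R rm \<alpha> \<beta> \<kappa> a + (1/15) *\<^sub>R rm \<alpha> \<beta> \<kappa> b)))"
proof -
 let ?x = "lam a b c" and ?y = "lam b c a" and ?z = "lam c a b"
 let ?r = "rm \<alpha> \<beta> \<kappa>"
 let ?k = "tint a b c (\<lambda>p. ?x p * ?y p * ?z p)"
 let ?G = "\<lambda>u v. (A *v u) \<bullet> ?r v"
 let ?ga = "glam a b c" and ?gb = "glam b c a" and ?gc = "glam c a b"
 note cnt = Pxy_cont[OF lam_Pxy[of _ _ _ 0]]
 have nz': "area2 b c a ~= 0" "area2 b a c ~= 0" "area2 a c b ~= 0"
  using nz by (auto simp: cr_simps algebra_simps)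
 have i1: "tint a b c (\<lambda>p. ?x p ^ 2 * ?y p) = 2 * ?k" "tint a b c (\<lambda>p. ?x p ^ 3) = 6 * ?k"
  using tint_cubic[OF nz] by auto
 have i2: "tint a b c (\<lambda>p. ?y p ^ 2 * ?x p) = 2 * ?k"
  using tint_cubic(1)[OF nz'(2)] unfolding tint_rot[where a=a and b=b and c=c] lam_swap[where b=a and c=c] lam_swap[of a b c] lam_swap[of c a b]
  by (simp add: mult_ac lam_swap)
 have i3: "tint a b c (\<lambda>p. ?x p ^ 2 * ?z p) = 2 * ?k"
  using tint_cubic(1)[OF nz'(3)] unfolding tint_rot[where a=a and b=b and c=c] lam_swap[where b=b and c=c] lam_swap[of c a b] lam_swap[of b c a]
  by (simp add: mult_ac lam_swap)
 have "(\<lambda>p. (A *v ((2 * ?x p * ?y p) *\<^sub>R ?ga + (?x p ^ 2) *\<^sub>R ?gb)) \<bullet> ?r p) =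
   (\<lambda>p. (2 * ?G ?ga a + ?G ?gb b) * (?x p ^ 2 * ?y p) + ((2 * ?G ?ga b) * (?y p ^ 2 * ?x p) + ((2 * ?G ?ga c) * (?x p * ?y p * ?z p)
    + (?G ?gb a * ?x p ^ 3 + ?G ?gb c * (?x p ^ 2 * ?z p)))))"
 proof
  fix p
  have "(A *v ((2 * ?x p * ?y p) *\<^sub>R ?ga + (?x p ^ 2) *\<^sub>R ?gb)) \<bullet> ?r p = (2 * ?x p * ?y p) * ((A *v ?ga) \<bullet> ?r p) + (?x p ^ 2) * ((A *v ?gb) \<bullet> ?r p)"
   by (simp add: matrix_vector_right_distrib matrix_vector_mult_scaleR inner_add_left)
  moreover have "(A *v g) \<bullet> ?r p = ?x p * ?G g a + ?y p * ?G g b + ?z p * ?G g c" for g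
   unfolding rm_lam[OF nz, of \<alpha> \<beta> \<kappa> p] by (simp add: inner_add_right)
  ultimately show "(A *v ((2 * ?x p * ?y p) *\<^sub>R ?ga + (?x p ^ 2) *\<^sub>R ?gb)) \<bullet> ?r p =
   (2 * ?G ?ga a + ?G ?gb b) * (?x p ^ 2 * ?y p) + ((2 * ?G ?ga b) * (?y p ^ 2 * ?x p) + ((2 * ?G ?ga c) * (?x p * ?y p * ?z p)
    + (?G ?gb a * ?x p ^ 3 + ?G ?gb c * (?x p ^ 2 * ?z p))))"
   by (simp add: power2_eq_square power3_eq_cube algebra_simps)
 qed
 then have "tint a b c (\<lambda>p. (A *v ((2 * ?x p * ?y p) *\<^sub>R ?ga + (?x p ^ 2) *\<^sub>R ?gb)) \<bullet> ?r p) =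
  (2 * ?G ?ga a + ?G ?gb b) * (2 * ?k) + ((2 * ?G ?ga b) * (2 * ?k) + ((2 * ?G ?ga c) * ?k + (?G ?gb a * (6 * ?k) + ?G ?gb c * (2 * ?k))))"
  by (simp only: tint_add[OF nz] tint_cmul continuous_on_add continuous_on_mult continuous_on_power continuous_on_const cnt i1 i2 i3)
 also have "... = 60 * ?k * (- ((A *v ?gc) \<bullet> ((1/10) *\<^sub>R ?r a + (1/15) *\<^sub>R ?r b)))
   - 2 * ?k * (?G ?ga a + ?G ?gb b + ?G ?gc c)"
 proof -
  have gc: "A *v ?gc = - (A *v ?ga) - (A *v ?gb)"
   using linear_neg[OF matrix_vector_mul_linear[of A], of "glam a b c"]
   unfolding glam_sum[of c a b] by (simp add: matrix_vector_mult_diff_distrib)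
  show ?thesis unfolding gc by (simp add: inner_diff_left inner_add_right algebra_simps)
 qed
 also have "?G ?ga a + ?G ?gb b + ?G ?gc c = 0" by (rule rigid_skew[OF nz A])
 also have "60 * ?k = \<bar>area2 a b c\<bar> / 2" using tint_1[OF nz] by simp
 finally show ?thesis by simp
qed

text \<open>The signed shadow of an edge: \<open>\<eta>\<close> is a coordinate function, and a point lies in the
  shadow if the line \<open>\<eta> = const\<close> through it meets the edge on a prescribed side.\<close>

definition shadow :: "(real^2 => real) => real^2 => real^2 => real^2 => real" where
 "shadow \<eta> a b p = (if \<eta> a < \<eta> p \<and> \<eta> p < \<eta> b \<and> area2 a b p > 0 then 1 else 0)
  - (if \<eta> b < \<eta> p \<and> \<eta> p < \<eta> a \<and> area2 a b p < 0 then 1 else 0)"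

lemma shadow_antisym: "shadow \<eta> b a p = - shadow \<eta> a b p"
 unfolding shadow_def area2_rot(3)[of b a p] by auto

lemma shadow_abs: "\<bar>shadow \<eta> a b p\<bar> <= (if min (\<eta> a) (\<eta> b) < \<eta> p \<and> \<eta> p < max (\<eta> a) (\<eta> b) then 1 else 0)"
 by (auto simp: shadow_def)

lemma sign_core:
 fixes x y z d1 d2 d3 :: real
 assumes "d1 * z + d2 * x + d3 * y = 0" "(x < 0 \<and> 0 < y \<and> 0 < z) \<or> (0 < x \<and> y < 0 \<and> z < 0)" "d2 ~= 0"
 shows "(0 < d1 \<and> 0 < d3 --> 0 < d2) \<and> (d1 < 0 \<and> d3 < 0 --> d2 < 0)"
proof -
 have main: "(0 < d1 \<and> 0 < d3 --> 0 < d2) \<and> (d1 < 0 \<and> d3 < 0 --> d2 < 0)"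
  if e: "d1 * z + d2 * x + d3 * y = 0" and s: "x < 0" "0 < y" "0 < z" for x y z :: real
 proof (intro conjI impI)
  assume "0 < d1 \<and> 0 < d3"
  then have "0 < d1 * z" "0 < d3 * y" using s by auto
  then have "d2 * x < 0" using e by linarith
  then show "0 < d2" using s by (simp add: mult_less_0_iff)
 next
  assume "d1 < 0 \<and> d3 < 0"
  then have "d1 * z < 0" "d3 * y < 0" using s by (auto simp: mult_neg_pos)
  then have "0 < d2 * x" using e by linarith
  then show "d2 < 0" using s by (simp add: zero_less_mult_iff)
 qed
 show ?thesis
 proof (cases "x < 0")
  case True
  then have "0 < y" "0 < z" using assms(2) by auto
  then show ?thesis by (rule main[OF assms(1) True])
 next
  case False
  then have "- x < 0" "0 < - y" "0 < - z" "d1 * (- z) + d2 * (- x) + d3 * (- y) = 0" using assms by auto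
  then show ?thesis by (intro main[of "-z" "-x" "-y"])
 qed
qed

lemma shadow_sum_aux:
 fixes x y z d1 d2 d3 :: real
 assumes "d1 + d2 + d3 > 0" "d1 * z + d2 * x + d3 * y = 0"
  "d1 ~= 0" "d2 ~= 0" "d3 ~= 0" "x ~= 0" "y ~= 0" "z ~= 0"
 shows "((if x < 0 \<and> 0 < y \<and> d1 > 0 then 1 else 0) - (if y < 0 \<and> 0 < x \<and> d1 < 0 then 1 else (0::real)))
  + ((if y < 0 \<and> 0 < z \<and> d2 > 0 then 1 else 0) - (if z < 0 \<and> 0 < y \<and> d2 < 0 then 1 else 0))
  + ((if z < 0 \<and> 0 < x \<and> d3 > 0 then 1 else 0) - (if x < 0 \<and> 0 < z \<and> d3 < 0 then 1 else 0))
  = (if 0 < d1 \<and> 0 < d2 \<and> 0 < d3 then 1 else 0)"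
proof -
 have r: "d1 * z + d3 * y + d2 * x = 0" "d2 * x + d1 * z + d3 * y = 0" using assms(2) by simp_all
 note c = sign_core[OF assms(2)] sign_core[OF r(1)] sign_core[OF r(2)]
 consider "x < 0" "y < 0" "z < 0" | "x < 0" "y < 0" "z > 0" | "x < 0" "y > 0" "z < 0" | "x < 0" "y > 0" "z > 0"
  | "x > 0" "y < 0" "z < 0" | "x > 0" "y < 0" "z > 0" | "x > 0" "y > 0" "z < 0" | "x > 0" "y > 0" "z > 0"
  using assms(6-8) by linarith
 then show ?thesis
 proof cases
  case 1
  have "\<not> (0 < d1 \<and> 0 < d2 \<and> 0 < d3)"
   using mult_pos_neg[of d1 z] mult_pos_neg[of d2 x] mult_pos_neg[of d3 y] 1 assms(2) by linarith
  then show ?thesis using 1 by simp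
 next
  case 2
  then show ?thesis using c(3)[OF _ assms(3)] assms(1,3,4,5) by auto
 next
  case 3
  then show ?thesis using c(2)[OF _ assms(5)] assms(1,3,4,5) by auto
 next
  case 4
  then show ?thesis using c(1)[OF _ assms(4)] assms(1,3,4,5) by auto
 next
  case 5
  then show ?thesis using c(1)[OF _ assms(4)] assms(1,3,4,5) by auto
 next
  case 6
  then show ?thesis using c(2)[OF _ assms(5)] assms(1,3,4,5) by auto
 next
  case 7
  then show ?thesis using c(3)[OF _ assms(3)] assms(1,3,4,5) by auto
 next
  case 8
  have "\<not> (0 < d1 \<and> 0 < d2 \<and> 0 < d3)"
   using mult_pos_pos[of d1 z] mult_pos_pos[of d2 x] mult_pos_pos[of d3 y] 8 assms(2) by linarith
  then show ?thesis using 8 by simp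
 qed
qed

text \<open>A discrete divergence theorem: the ray on the prescribed side of a point inside the triangle meets a single edge,
  while from outside it meets either none or two, which have opposite signs.\<close>

lemma shadow_sum:
 assumes pos: "area2 a b c > 0"
  and \<eta>: "!!u v w. u + v + w = 1 ==> \<eta> (u *\<^sub>R a + v *\<^sub>R b + w *\<^sub>R c) = u * \<eta> a + v * \<eta> b + w * \<eta> c"
  and gen: "lam a b c p ~= 0" "lam b c a p ~= 0" "lam c a b p ~= 0" "\<eta> p ~= \<eta> a" "\<eta> p ~= \<eta> b" "\<eta> p ~= \<eta> c"
 shows "shadow \<eta> a b p + shadow \<eta> b c p + shadow \<eta> c a p = indicator (itri a b c) p"
proof -
 have nz: "area2 a b c ~= 0" using pos by simp
 let ?D = "area2 a b c"
 have d: "area2 b c p = ?D * lam a b c p" "area2 c a p = ?D * lam b c a p" "area2 a b p = ?D * lam c a b p"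
  using pos area2_rot(1)[of b c p] area2_rot(1)[of c a p] area2_rot(1)[of a b p]
  by (simp_all add: lam_def area2_rot(1,2)[where a=a and b=b and c=c])
 have s: "lam a b c p + lam b c a p + lam c a b p = 1" using lam_sum[OF nz] .
 have e: "lam a b c p * \<eta> a + lam b c a p * \<eta> b + lam c a b p * \<eta> c = \<eta> p"
  using \<eta>[OF s] lam_rep[OF nz, of p] by simp
 have "lam c a b p * (\<eta> c - \<eta> p) + lam a b c p * (\<eta> a - \<eta> p) + lam b c a p * (\<eta> b - \<eta> p)
   = (lam a b c p * \<eta> a + lam b c a p * \<eta> b + lam c a b p * \<eta> c) - (lam a b c p + lam b c a p + lam c a b p) * \<eta> p"
  by (simp add: algebra_simps)
 then have 2: "lam c a b p * (\<eta> c - \<eta> p) + lam a b c p * (\<eta> a - \<eta> p) + lam b c a p * (\<eta> b - \<eta> p) = 0"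
  unfolding e s by simp
 have "area2 a b p > 0 \<longleftrightarrow> lam c a b p > 0" "area2 b c p > 0 \<longleftrightarrow> lam a b c p > 0" "area2 c a p > 0 \<longleftrightarrow> lam b c a p > 0"
  "area2 a b p < 0 \<longleftrightarrow> lam c a b p < 0" "area2 b c p < 0 \<longleftrightarrow> lam a b c p < 0" "area2 c a p < 0 \<longleftrightarrow> lam b c a p < 0"
  unfolding d using pos by (simp_all add: zero_less_mult_iff mult_less_0_iff)
 then show ?thesis
  using shadow_sum_aux[of "lam c a b p" "lam a b c p" "lam b c a p" "\<eta> c - \<eta> p" "\<eta> a - \<eta> p" "\<eta> b - \<eta> p"] s 2 gen
  unfolding shadow_def itri_def indicator_def by (auto split: if_splits)
qed

text \<open>A symmetric matrix with prescribed action on one vector.\<close>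

definition symm :: "real^2 => real^2 => real^2^2" where
 "symm \<nu> w = (\<chi> i j. (w $ i * \<nu> $ j + \<nu> $ i * w $ j) / (\<nu> \<bullet> \<nu>) - (w \<bullet> \<nu>) * \<nu> $ i * \<nu> $ j / (\<nu> \<bullet> \<nu>)\<^sup>2)"

lemma symm_transpose: "transpose (symm \<nu> w) = symm \<nu> w"
 by (simp add: symm_def transpose_def vec_eq_iff algebra_simps)

lemma symm_mult: "\<nu> ~= 0 ==> symm \<nu> w *v \<nu> = w"
proof -
 assume "\<nu> ~= 0"
 then have n: "\<nu> \<bullet> \<nu> ~= 0" by simp
 have "(\<nu> \<bullet> \<nu>)\<^sup>2 * (symm \<nu> w *v \<nu>) $ i = (\<nu> \<bullet> \<nu>)\<^sup>2 * w $ i" for i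
 proof -
  have "(\<nu> \<bullet> \<nu>)\<^sup>2 * (symm \<nu> w *v \<nu>) $ i = (\<Sum>j\<in>UNIV. ((\<nu> \<bullet> \<nu>)\<^sup>2 * symm \<nu> w $ i $ j) * \<nu> $ j)"
   by (simp add: matrix_vector_mult_def sum_distrib_left mult.assoc)
  also have "... = (\<Sum>j\<in>UNIV. ((\<nu> \<bullet> \<nu>) * (w $ i * \<nu> $ j + \<nu> $ i * w $ j) - (w \<bullet> \<nu>) * \<nu> $ i * \<nu> $ j) * \<nu> $ j)"
   using n by (intro sum.cong refl arg_cong2[of _ _ _ _ "(*)"]) (simp_all add: symm_def power2_eq_square right_diff_distrib)
  also have "... = (\<nu> \<bullet> \<nu>)\<^sup>2 * w $ i"
   by (simp add: inner_vec_def sum_2 power2_eq_square algebra_simps)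
  finally show ?thesis .
 qed
 then have "(symm \<nu> w *v \<nu>) $ i = w $ i" for i using n by simp
 then show ?thesis by (simp add: vec_eq_iff)
qed

lemma matrix_norm2: "(norm (A::real^2^2))\<^sup>2 = (A$1$1)\<^sup>2 + (A$1$2)\<^sup>2 + (A$2$1)\<^sup>2 + (A$2$2)\<^sup>2"
 unfolding power2_norm_eq_inner by (simp add: inner_vec_def sum_2 power2_eq_square)

lemma outer_norm: "norm (outer t) = (norm (t::real^2))\<^sup>2"
proof -
 have "(norm (outer t))\<^sup>2 = ((norm t)\<^sup>2)\<^sup>2"
  unfolding matrix_norm2 power2_norm_eq_inner
  by (simp add: outer_def inner_vec_def sum_2 power2_eq_square algebra_simps)
 then show ?thesis by (rule power2_eq_imp_eq) auto
qed

lemma outer2_norm: "norm ((\<chi> i j. u $ i * w $ j) :: real^2^2) = norm u * norm w"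
proof -
 have "(norm ((\<chi> i j. u $ i * w $ j) :: real^2^2))\<^sup>2 = (norm u * norm w)\<^sup>2"
  unfolding power_mult_distrib matrix_norm2 power2_norm_eq_inner
  by (simp add: inner_vec_def sum_2 power2_eq_square algebra_simps)
 then show ?thesis by (rule power2_eq_imp_eq) auto
qed

lemma symm_norm: "\<nu> ~= 0 ==> norm (symm \<nu> w) <= 3 * norm w / norm \<nu>"
proof -
 assume n: "\<nu> ~= 0"
 let ?o = "\<lambda>u w. (\<chi> i j. u $ i * w $ j) :: real^2^2"
 define A1 where "A1 = (1 / (\<nu> \<bullet> \<nu>)) *\<^sub>R ?o w \<nu>"
 define A2 where "A2 = (1 / (\<nu> \<bullet> \<nu>)) *\<^sub>R ?o \<nu> w"
 define A3 where "A3 = ((w \<bullet> \<nu>) / (\<nu> \<bullet> \<nu>)\<^sup>2) *\<^sub>R ?o \<nu> \<nu>"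
 have eq: "symm \<nu> w = A1 + A2 - A3"
  by (simp add: symm_def A1_def A2_def A3_def vec_eq_iff add_divide_distrib)
 have N: "norm \<nu> ~= 0" "norm \<nu> > 0" using n by auto
 have e: "\<nu> \<bullet> \<nu> = norm \<nu> * norm \<nu>" by (simp add: dot_square_norm power2_eq_square)
 have o1: "norm (?o w \<nu>) = norm w * norm \<nu>" "norm (?o \<nu> w) = norm \<nu> * norm w" "norm (?o \<nu> \<nu>) = norm \<nu> * norm \<nu>"
  by (rule outer2_norm)+
 have 1: "norm A1 <= norm w / norm \<nu>" and 2: "norm A2 <= norm w / norm \<nu>"
  unfolding A1_def A2_def norm_scaleR o1 e using N by (simp_all add: field_simps)
 have "\<bar>w \<bullet> \<nu>\<bar> <= norm w * norm \<nu>" by (rule Cauchy_Schwarz_ineq2)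
 then have "\<bar>w \<bullet> \<nu>\<bar> / (norm \<nu> * norm \<nu>) <= (norm w * norm \<nu>) / (norm \<nu> * norm \<nu>)"
  by (rule divide_right_mono) simp
 moreover have "\<bar>(w \<bullet> \<nu>) / (norm \<nu> * norm \<nu>)\<^sup>2\<bar> * (norm \<nu> * norm \<nu>) = \<bar>w \<bullet> \<nu>\<bar> / (norm \<nu> * norm \<nu>)"
  using N by (simp add: power2_eq_square abs_divide)
 moreover have "(norm w * norm \<nu>) / (norm \<nu> * norm \<nu>) = norm w / norm \<nu>" using N by simp
 ultimately have 3: "norm A3 <= norm w / norm \<nu>"
  unfolding A3_def norm_scaleR o1 e by linarith
 have "norm (A1 + A2 - A3) <= norm A1 + norm A2 + norm A3"
  using norm_triangle_ineq4[of "A1 + A2" A3] norm_triangle_ineq[of A1 A2] by linarith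
 then have "norm (symm \<nu> w) <= norm w / norm \<nu> + norm w / norm \<nu> + norm w / norm \<nu>"
  using 1 2 3 unfolding eq by linarith
 then show ?thesis by simp
qed

section \<open>Triangular meshes and hat functions\<close>

lemma area2_distinct: "area2 a b c ~= 0 ==> a ~= b" "area2 a b c ~= 0 ==> b ~= c" "area2 a b c ~= 0 ==> a ~= c"
 by (auto simp: cr_simps)

lemma area2_affine_independent:
 assumes nz: "area2 a b c ~= 0"
 shows "\<not> affine_dependent {a, b, c}"
proof
 assume "affine_dependent {a, b, c}"
 then obtain u where u: "sum u {a, b, c} = 0" "\<exists>v\<in>{a, b, c}. u v ~= 0" "(\<Sum>v\<in>{a, b, c}. u v *\<^sub>R v) = 0"
  by (subst (asm) affine_dependent_explicit_finite) auto
 note d = area2_distinct[OF nz]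
 have s: "u a + u b + u c = 0" "u a *\<^sub>R a + u b *\<^sub>R b + u c *\<^sub>R c = 0"
  using u(1,3) d by (simp_all add: add.assoc)
 have "lam a b c ((1 + u a) *\<^sub>R a + u b *\<^sub>R b + u c *\<^sub>R c) = 1 + u a"
  using s by (intro lam_comb[OF nz]) simp
 moreover have "(1 + u a) *\<^sub>R a + u b *\<^sub>R b + u c *\<^sub>R c = 1 *\<^sub>R a + 0 *\<^sub>R b + 0 *\<^sub>R c"
  using s(2) by (simp add: scaleR_add_left add.assoc)
 ultimately have "u a = 0" using lam_comb[OF nz, of 1 0 0] by simp
 then have ub: "u b = - u c" using s(1) by simp
 have "u c *\<^sub>R (c - b) = 0" using s(2) \<open>u a = 0\<close> unfolding ub by (simp add: scaleR_diff_right)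
 then have "u c = 0" "u b = 0" using d ub by auto
 then show False using u(2) \<open>u a = 0\<close> by auto
qed

lemma parallel_if_cr_zero:
 fixes u w :: "real^2"
 assumes "u ~= 0" and e: "u $ 1 * w $ 2 = u $ 2 * w $ 1"
 shows "\<exists>k. w = k *\<^sub>R u"
proof (cases "u $ 1 = 0")
 case True
 then have "u $ 2 ~= 0" using assms(1) by (auto simp: vec_eq_iff forall_2)
 then show ?thesis using e True
  by (intro exI[of _ "w $ 2 / u $ 2"]) (auto simp: vec_eq_iff forall_2)
next
 case False
 have "w $ 2 = w $ 1 / u $ 1 * u $ 2" using False e by (simp add: field_simps)
 then show ?thesis using False
  by (intro exI[of _ "w $ 1 / u $ 1"]) (simp add: vec_eq_iff forall_2)
qed

lemma simplex_triangle:
 assumes "2 simplex (T :: (real^2) set)"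
 shows "\<exists>a b c. area2 a b c > 0 \<and> T = tri a b c"
proof -
 obtain C where C: "\<not> affine_dependent C" "int (card C) = 2 + 1" "T = convex hull C"
  using assms unfolding simplex_def by blast
 then have "card C = 3" by linarith
 then obtain a b c where abc: "C = {a, b, c}" "a ~= b" "b ~= c" "a ~= c" by (auto simp: card_3_iff)
 have nz: "area2 a b c ~= 0"
 proof
  assume 0: "area2 a b c = 0"
  let ?u = "b - a" and ?w = "c - a"
  have u: "?u ~= 0" "?w ~= 0" using abc by auto
  have e: "?u $ 1 * ?w $ 2 = ?u $ 2 * ?w $ 1" using 0 by (simp add: cr_simps)
  have "\<exists>k. ?w = k *\<^sub>R ?u" by (rule parallel_if_cr_zero[OF u(1) e])
  then obtain k where "?w = k *\<^sub>R ?u" by blast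
  then have c: "c = (1 - k) *\<^sub>R a + k *\<^sub>R b" by (simp add: algebra_simps)
  have "c \<in> affine hull {a, b}" unfolding affine_hull_2
   by (rule CollectI, rule exI[of _ "1 - k"], rule exI[of _ k]) (simp add: c)
  then have "affine_dependent C"
   unfolding affine_dependent_def abc(1) using abc(2-4)
   by (intro bexI[of _ c]) (auto simp: insert_Diff_if insert_commute)
  then show False using C by simp
 qed
 have T: "T = tri a b c" using tri_hull[OF nz] C abc by simp
 show ?thesis
 proof (cases "area2 a b c > 0")
  case True
  then show ?thesis using T by blast
 next
  case False
  then have "area2 a c b > 0" using nz area2_rot(4)[where a=a and b=b and c=c] by simp
  moreover have "T = tri a c b" using T tri_rot(2)[where a=a and b=b and c=c] by simp
  ultimately show ?thesis by blast
 qed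
qed

definition tv :: "(real^2) set => (real^2) \<times> (real^2) \<times> (real^2)" where
 "tv T = (SOME (a, b, c). area2 a b c > 0 \<and> T = tri a b c)"

definition "vA T = fst (tv T)"
definition "vB T = fst (snd (tv T))"
definition "vC T = snd (snd (tv T))"

lemma tv:
 assumes "2 simplex T"
 shows "area2 (vA T) (vB T) (vC T) > 0" "T = tri (vA T) (vB T) (vC T)"
proof -
 have "\<exists>x. case x of (a, b, c) => area2 a b c > 0 \<and> T = tri a b c"
  using simplex_triangle[OF assms] by auto
 then have "case tv T of (a, b, c) => area2 a b c > 0 \<and> T = tri a b c"
  unfolding tv_def by (rule someI_ex)
 then show "area2 (vA T) (vB T) (vC T) > 0" "T = tri (vA T) (vB T) (vC T)"
  by (auto simp: vA_def vB_def vC_def split: prod.splits)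
qed

definition verts :: "(real^2) set => (real^2) set" where "verts T = {vA T, vB T, vC T}"

definition lamT :: "(real^2) set => real^2 => real^2 => real" where
 "lamT T x = (if x = vA T then lam (vA T) (vB T) (vC T) else if x = vB T then lam (vB T) (vC T) (vA T)
   else if x = vC T then lam (vC T) (vA T) (vB T) else (\<lambda>_. 0))"

definition gT :: "(real^2) set => real^2 => real^2" where
 "gT T x = (if x = vA T then glam (vA T) (vB T) (vC T) else if x = vB T then glam (vB T) (vC T) (vA T)
   else if x = vC T then glam (vC T) (vA T) (vB T) else 0)"

abbreviation "iT T \<equiv> itri (vA T) (vB T) (vC T)"

lemma lamT_affine: "lamT T x (p + s *\<^sub>R t) = lamT T x p + s * (gT T x \<bullet> t)"
 by (simp add: lamT_def gT_def lam_affine dlam_glam)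

lemma lamT_Pxy: "lamT T x \<in> Pxy (Suc m)"
 by (simp add: lamT_def lam_Pxy Pxy_zero)

context
 fixes T :: "(real^2) set"
 assumes T: "2 simplex T"
begin

lemma tv_nz: "area2 (vA T) (vB T) (vC T) ~= 0" using tv(1)[OF T] by simp

lemmas tv_distinct = area2_distinct[OF tv_nz]

lemma lamT_simps: "lamT T (vA T) = lam (vA T) (vB T) (vC T)" "lamT T (vB T) = lam (vB T) (vC T) (vA T)"
 "lamT T (vC T) = lam (vC T) (vA T) (vB T)" "gT T (vA T) = glam (vA T) (vB T) (vC T)"
 "gT T (vB T) = glam (vB T) (vC T) (vA T)" "gT T (vC T) = glam (vC T) (vA T) (vB T)"
 using tv_distinct by (auto simp: lamT_def gT_def)

lemma lamT_zero: "x ~: verts T ==> lamT T x p = 0"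
 by (auto simp: lamT_def verts_def)

lemma sum_verts: "(\<Sum>x\<in>verts T. f x) = f (vA T) + f (vB T) + f (vC T)" for f :: "_ => 'b::comm_monoid_add"
 using tv_distinct by (simp add: verts_def add.assoc)

lemma sum_verts_pairs: "(\<Sum>x\<in>verts T. \<Sum>y\<in>verts T - {x}. f x y) =
  f (vA T) (vB T) + f (vA T) (vC T) + (f (vB T) (vC T) + f (vB T) (vA T)) + (f (vC T) (vA T) + f (vC T) (vB T))"
 for f :: "_ => _ => 'b::comm_monoid_add"
proof -
 have "verts T - {vA T} = {vB T, vC T}" "verts T - {vB T} = {vC T, vA T}" "verts T - {vC T} = {vA T, vB T}"
  using tv_distinct by (auto simp: verts_def)
 then show ?thesis unfolding sum_verts using tv_distinct by simp
qed

lemma verts_hull: "T = convex hull (verts T)"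
 using tri_hull[OF tv_nz] tv(2)[OF T] by (simp add: verts_def)

lemma verts_indep: "\<not> affine_dependent (verts T)"
 unfolding verts_def by (rule area2_affine_independent[OF tv_nz])

lemma lamT_nonneg: "p \<in> T ==> 0 <= lamT T x p"
 using tv(2)[OF T] by (auto simp: lamT_def tri_def)

lemma lamT_le1: "p \<in> T ==> lamT T x p <= 1"
proof -
 assume p: "p \<in> T"
 then have "0 <= lam (vA T) (vB T) (vC T) p" "0 <= lam (vB T) (vC T) (vA T) p" "0 <= lam (vC T) (vA T) (vB T) p"
  using tv(2)[OF T] by (auto simp: tri_def)
 then show ?thesis using lam_sum[OF tv_nz, of p] by (auto simp: lamT_def)
qed

lemma lamT_unique:
 assumes u: "(\<Sum>x\<in>verts T. u x) = 1" "(\<Sum>x\<in>verts T. u x *\<^sub>R x) = p" and x: "x \<in> verts T"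
 shows "lamT T x p = u x"
proof -
 note r = area2_rot(1)[where a="vA T" and b="vB T" and c="vC T"] area2_rot(2)[where a="vA T" and b="vB T" and c="vC T"]
 have s: "u (vA T) + u (vB T) + u (vC T) = 1" "u (vA T) *\<^sub>R vA T + u (vB T) *\<^sub>R vB T + u (vC T) *\<^sub>R vC T = p"
  using u unfolding sum_verts by auto
 have "lam (vA T) (vB T) (vC T) p = u (vA T)" unfolding s(2)[symmetric] using s(1) by (intro lam_comb tv_nz)
 moreover have "lam (vB T) (vC T) (vA T) p = u (vB T)"
  using lam_comb[of "vB T" "vC T" "vA T" "u (vB T)" "u (vC T)" "u (vA T)"] s tv_nz r by (simp add: add_ac)
 moreover have "lam (vC T) (vA T) (vB T) p = u (vC T)"
  using lam_comb[of "vC T" "vA T" "vB T" "u (vC T)" "u (vA T)" "u (vB T)"] s tv_nz r by (simp add: add_ac)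
 ultimately show ?thesis using x by (auto simp: verts_def lamT_simps)
qed

lemma T_compact: "compact T" "T \<in> sets borel" "convex T" "closed T"
 using compact_simplex[OF T] convex_simplex[OF T] by (auto intro: compact_imp_closed borel_closed)

lemma iT_sub: "iT T \<subseteq> T" using itri_sub tv(2)[OF T] by blast

lemma iT_interior: "iT T \<subseteq> interior T" using iT_sub itri_open interior_maximal by metis

lemma AE_iT1: "AE p in lborel. p \<in> T --> p \<in> iT T"
 using AE_itri[OF tv_nz] tv(2)[OF T] by simp

end

text \<open>The intersection of two triangles is a face of both, hence the hull of common vertices. The barycentric coordinates of a
  point in it are those within the face and do not depend on the triangle.\<close>

lemma lamT_consistent:
 assumes T: "2 simplex T" "2 simplex T'" and F: "(T \<inter> T') face_of T" "(T \<inter> T') face_of T'" and p: "p \<in> T" "p \<in> T'"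
 shows "lamT T x p = lamT T' x p"
proof -
 obtain c where c: "c \<subseteq> verts T" "T \<inter> T' = convex hull c"
  using face_of_convex_hull_affine_independent[OF verts_indep[OF T(1)], of "T \<inter> T'"] F(1) verts_hull[OF T(1)] by metis
 obtain c' where c': "c' \<subseteq> verts T'" "T \<inter> T' = convex hull c'"
  using face_of_convex_hull_affine_independent[OF verts_indep[OF T(2)], of "T \<inter> T'"] F(2) verts_hull[OF T(2)] by metis
 have i: "\<not> affine_dependent c" "\<not> affine_dependent c'"
  using affine_independent_subset[OF verts_indep[OF T(1)] c(1)] affine_independent_subset[OF verts_indep[OF T(2)] c'(1)] by simp_all
 have cc: "c = c'"
 proof -
  have "x \<in> c \<longleftrightarrow> x extreme_point_of (T \<inter> T')" for x
   unfolding c(2) using extreme_point_of_convex_hull_affine_independent[OF i(1)] by simp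
  moreover have "x \<in> c' \<longleftrightarrow> x extreme_point_of (T \<inter> T')" for x
   unfolding c'(2) using extreme_point_of_convex_hull_affine_independent[OF i(2)] by simp
  ultimately show ?thesis by blast
 qed
 have fc: "finite c" using c(1) finite_subset[of c "verts T"] by (simp add: verts_def)
 obtain u where u: "sum u c = 1" "(\<Sum>x\<in>c. u x *\<^sub>R x) = p"
 proof -
  have "p \<in> convex hull c" using p c(2) by blast
  then show ?thesis using that unfolding convex_hull_finite[OF fc] by blast
 qed
 define w where "w x = (if x \<in> c then u x else 0)" for x
 have "lamT S y p = w y" if S: "2 simplex S" "c \<subseteq> verts S" for S y
 proof (cases "y \<in> verts S")
  case True
  have fS: "finite (verts S)" by (simp add: verts_def)
  have "(\<Sum>x\<in>verts S. w x) = 1" "(\<Sum>x\<in>verts S. w x *\<^sub>R x) = p"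
   unfolding w_def using u S(2) fS by (simp_all add: if_distrib[of "\<lambda>r. r *\<^sub>R _"] sum.If_cases Int_absorb1 cong: if_cong)
  then show ?thesis by (rule lamT_unique[OF S(1) _ _ True])
 next
  case False
  then show ?thesis using lamT_zero[OF S(1) False] S(2) by (auto simp: w_def)
 qed
 then show ?thesis using T c(1) c'(1) cc by simp
qed

lemma vec_nth_borel:
 fixes f :: "_ => ('b::euclidean_space)^'n"
 shows "f \<in> borel_measurable M ==> (\<lambda>x. f x $ i) \<in> borel_measurable M"
 by (rule borel_measurable_continuous_on[of "\<lambda>v. v $ i"]) (auto intro: continuous_intros)

type_synonym cell_field = "(real^2) set => real^2 => real^2"

text \<open>A conforming and quasi-uniform triangulation of a plane domain: all diameters are bounded by a multiple of \<open>h\<close>, and all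
  triangles contain a disc whose radius is comparable to \<open>h\<close>. The domain lies in the square of half-width \<open>L\<close>.\<close>

locale mesh2 =
 fixes X :: "(real^2) set set" and U :: "(real^2) set" and h \<gamma> L :: real
 assumes fin: "finite X" and smp: "!!T. T \<in> X ==> 2 simplex T"
  and U: "open U" "bounded U" and cov: "\<Union>X = closure U" and fr: "negligible (frontier U)"
  and disj: "!!T T'. T \<in> X ==> T' \<in> X ==> T ~= T' ==> interior T \<inter> interior T' = {}"
  and conf: "!!T T'. T \<in> X ==> T' \<in> X ==> T ~= T' ==> T \<inter> T' ~= {} ==> (T \<inter> T') face_of T \<and> (T \<inter> T') face_of T'"
  and h0: "h > 0" and \<gamma>0: "\<gamma> > 0" and L0: "L > 0"
  and dm: "!!T p q. T \<in> X ==> p \<in> T ==> q \<in> T ==> norm (p - q) <= \<gamma> * h"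
  and bl: "!!T. T \<in> X ==> \<exists>c. cball c (h / (2 * \<gamma>)) \<subseteq> T"
  and box: "!!T p i. T \<in> X ==> p \<in> T ==> \<bar>p $ i\<bar> <= L"
begin

lemma consistent: "T \<in> X ==> T' \<in> X ==> p \<in> T ==> p \<in> T' ==> lamT T x p = lamT T' x p"
 using lamT_consistent[of T T' p x] smp conf by (cases "T = T'") auto

text \<open>The hat function of the vertex \<open>x\<close>; where triangles overlap, \<open>consistent\<close> makes the choice of the triangle irrelevant.\<close>

definition phi :: "real^2 => real^2 => real" where
 "phi x p = (if \<exists>T\<in>X. p \<in> T then lamT (SOME T. T \<in> X \<and> p \<in> T) x p else 0)"

definition dphi :: "real^2 => real^2 => real^2 => real" where
 "dphi t x p = (\<Sum>T\<in>X. indicator (iT T) p * (gT T x \<bullet> t))"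

definition Vs :: "(real^2) set" where "Vs = (\<Union>T\<in>X. verts T)"

lemma finVs: "finite Vs" using fin by (simp add: Vs_def verts_def)

lemma phi_eq: "T \<in> X ==> p \<in> T ==> phi x p = lamT T x p"
proof -
 assume T: "T \<in> X" "p \<in> T"
 then have "\<exists>T. T \<in> X \<and> p \<in> T" by blast
 then have "(SOME T. T \<in> X \<and> p \<in> T) \<in> X \<and> p \<in> (SOME T. T \<in> X \<and> p \<in> T)" by (rule someI_ex)
 then have "lamT (SOME T. T \<in> X \<and> p \<in> T) x p = lamT T x p" using consistent T by blast
 moreover have "\<exists>T\<in>X. p \<in> T" using T by blast
 ultimately show ?thesis unfolding phi_def by presburger
qed

lemma iT_disj: "T \<in> X ==> T' \<in> X ==> T ~= T' ==> p \<in> iT T ==> p ~: iT T'"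
 using disj[of T T'] iT_interior[OF smp, of T] iT_interior[OF smp, of T'] by blast

lemma sum_iT:
 fixes f :: "(real^2) set => 'b::real_vector"
 assumes "T \<in> X" "p \<in> iT T"
 shows "(\<Sum>T\<in>X. indicator (iT T) p *\<^sub>R f T) = f T"
proof -
 have "(\<Sum>T\<in>X. indicator (iT T) p *\<^sub>R f T) = (\<Sum>S\<in>X. if S = T then f T else 0)"
  using assms iT_disj by (intro sum.cong) (auto simp: indicator_def)
 then show ?thesis using assms fin by simp
qed

lemma AE_iT: "AE p in lborel. \<forall>T\<in>X. p \<in> T --> p \<in> iT T"
 using fin AE_iT1 smp by (simp add: AE_finite_all)

lemma phi01: "0 <= phi x p" "phi x p <= 1"
proof -
 have "0 <= phi x p \<and> phi x p <= 1"
 proof (cases "\<exists>T\<in>X. p \<in> T")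
  case True
  then obtain T where T: "T \<in> X" "p \<in> T" by blast
  then show ?thesis using phi_eq[OF T] lamT_nonneg[OF smp[OF T(1)] T(2)] lamT_le1[OF smp[OF T(1)] T(2)] by simp
 next
  case False
  then show ?thesis by (simp add: phi_def)
 qed
 then show "0 <= phi x p" "phi x p <= 1" by auto
qed

lemma piecewise_borel:
 fixes f :: "real^2 => real"
 assumes "!!T p. T \<in> X ==> p \<in> T ==> f p = g T p" "!!T. T \<in> X ==> continuous_on T (g T)" "!!p. p ~: \<Union>X ==> f p = 0"
 shows "f \<in> borel_measurable borel"
proof -
 have "continuous_on (\<Union>T\<in>X. T) f"
  using fin smp assms(1,2) by (intro continuous_on_closed_Union) (auto simp: T_compact(4) cong: continuous_on_cong)
 then have "(\<lambda>p. indicator (\<Union>X) p *\<^sub>R f p) \<in> borel_measurable borel"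
  using fin smp T_compact(2) by (intro borel_measurable_continuous_on_indicator) auto
 moreover have "(\<lambda>p. indicator (\<Union>X) p *\<^sub>R f p) = f" using assms(3) by (auto simp: indicator_def fun_eq_iff)
 ultimately show ?thesis by simp
qed

lemma phi_borel: "phi x \<in> borel_measurable borel"
proof (rule piecewise_borel)
 show "phi x p = lamT T x p" if "T \<in> X" "p \<in> T" for T p by (rule phi_eq[OF that])
 show "continuous_on T (lamT T x)" for T using Pxy_cont[OF lamT_Pxy[of _ _ 0]] .
 show "phi x p = 0" if "p ~: \<Union>X" for p using that by (auto simp: phi_def)
qed

lemma U_sub: "U \<subseteq> \<Union>X" using cov closure_subset by auto

lemma dlip_phi: "dlip U t (phi x) (dphi t x)"
proof (rule dlipI)
 let ?L = "\<Sum>T\<in>X. \<bar>gT T x \<bullet> t\<bar>"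
 have gL: "\<bar>gT T x \<bullet> t\<bar> <= ?L" if "T \<in> X" for T
  using fin that by (intro member_le_sum) auto
 show "phi x \<in> borel_measurable borel" by (rule phi_borel)
 show "dphi t x \<in> borel_measurable borel" unfolding dphi_def[abs_def]
  by (intro borel_measurable_sum borel_measurable_times borel_measurable_indicator borel_measurable_const borel_open itri_open)
 show "\<bar>phi x p\<bar> <= 1" for p using phi01[of x p] by auto
 show "\<bar>dphi t x p\<bar> <= ?L" for p unfolding dphi_def
  by (rule order_trans[OF sum_abs]) (auto intro!: sum_mono simp: indicator_def)
 show "0 <= ?L" by (intro sum_nonneg) auto
 show "\<bar>phi x (p + s *\<^sub>R t) - phi x p\<bar> <= ?L * \<bar>s\<bar>" if seg: "closed_segment p (p + s *\<^sub>R t) \<subseteq> U" for p s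
 proof -
  let ?g = "\<lambda>r. phi x (p + r *\<^sub>R (s *\<^sub>R t))"
  let ?V = "\<lambda>T. (\<lambda>r. p + r *\<^sub>R (s *\<^sub>R t)) -` T"
  have "(?L * \<bar>s\<bar>)-lipschitz_on {0..1} ?g"
  proof (rule lipschitz_on_closed_Union[where I=X and U="?V"])
   show "(?L * \<bar>s\<bar>)-lipschitz_on (?V T) ?g" if T: "T \<in> X" for T
   proof (rule lipschitz_onI)
    fix r r' assume r: "r \<in> ?V T" "r' \<in> ?V T"
    have "?g r - ?g r' = (r - r') * (s * (gT T x \<bullet> t))"
     using r phi_eq[OF T] by (simp add: lamT_affine algebra_simps)
    then show "dist (?g r) (?g r') <= ?L * \<bar>s\<bar> * dist r r'"
     using mult_right_mono[OF gL[OF T], of "\<bar>s\<bar> * \<bar>r - r'\<bar>"] by (simp add: dist_real_def abs_mult mult_ac)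
   qed (auto intro!: mult_nonneg_nonneg sum_nonneg)
   show "closed (?V T)" if "T \<in> X" for T
    using T_compact(4)[OF smp[OF that]] by (intro closed_vimage continuous_intros)
   have "p + r *\<^sub>R (s *\<^sub>R t) \<in> closed_segment p (p + s *\<^sub>R t)" if "0 <= r" "r <= 1" for r
    unfolding in_segment using that by (intro exI[of _ r]) (auto simp: algebra_simps)
   then show "{0..1} \<subseteq> (\<Union>T\<in>X. ?V T)" using seg U_sub by (auto simp: subset_iff)
  qed (use fin in \<open>auto intro!: mult_nonneg_nonneg sum_nonneg\<close>)
  from lipschitz_onD[OF this, of 1 0] show ?thesis by (simp add: dist_real_def)
 qed
 show "AE p in lborel. p \<in> U --> ((\<lambda>s. phi x (p + s *\<^sub>R t)) has_real_derivative dphi t x p) (at 0)"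
  using AE_iT
 proof eventually_elim
  case (elim p)
  show ?case
  proof
   assume "p \<in> U"
   then obtain T where T: "T \<in> X" "p \<in> T" using U_sub by blast
   then have pi: "p \<in> iT T" using elim by blast
   have op: "open ((\<lambda>s. p + s *\<^sub>R t) -` iT T)" by (intro open_vimage itri_open continuous_intros)
   have "((\<lambda>s. lamT T x (p + s *\<^sub>R t)) has_real_derivative gT T x \<bullet> t) (at 0)"
    unfolding lamT_affine by (auto intro!: derivative_eq_intros)
   then have "((\<lambda>s. phi x (p + s *\<^sub>R t)) has_real_derivative gT T x \<bullet> t) (at 0)"
    by (rule has_field_derivative_transform_within_open[OF _ op])
     (use pi iT_sub[OF smp[OF T(1)]] phi_eq[OF T(1)] in auto)
   moreover have "dphi t x p = gT T x \<bullet> t"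
    using sum_iT[OF T(1) pi, of "\<lambda>T. gT T x \<bullet> t"] by (simp add: dphi_def)
   ultimately show "((\<lambda>s. phi x (p + s *\<^sub>R t)) has_real_derivative dphi t x p) (at 0)" by simp
  qed
 qed
qed

definition pw :: "cell_field => real^2 => real^2" where
 "pw W p = (\<Sum>T\<in>X. indicator (iT T) p *\<^sub>R W T p)"

definition poly_family :: "nat => cell_field => bool" where
 "poly_family m W \<longleftrightarrow> (\<forall>T\<in>X. \<forall>i. (\<lambda>p. W T p $ i) \<in> Pxy m)"

lemma pw_eq: "T \<in> X ==> p \<in> iT T ==> pw W p = W T p"
 unfolding pw_def by (rule sum_iT)

lemma poly_family_cont: "poly_family m W ==> T \<in> X ==> cont (W T)"
 unfolding poly_family_def using vec2_cont by blast

lemma pw_borel: "poly_family m W ==> pw W \<in> borel_measurable borel"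
 unfolding pw_def[abs_def] using poly_family_cont
 by (intro borel_measurable_sum borel_measurable_scaleR borel_measurable_indicator borel_open itri_open)
  (auto intro: borel_measurable_continuous_onI)

lemma pw_zero: "p ~: \<Union>X ==> pw W p = 0"
 unfolding pw_def using iT_sub smp by (intro sum.neutral) (auto simp: indicator_def)

lemma pw_bounded:
 assumes "poly_family m W"
 obtains B where "!!p. norm (pw W p) <= B" "B \<ge> 0"
proof -
 have "\<exists>B\<ge>0. \<forall>p\<in>T. norm (W T p) <= B" if T: "T \<in> X" for T
 proof -
  obtain B where "!!p. p \<in> T ==> norm (W T p) <= B"
   using compact_imp_bounded[OF compact_continuous_image[OF continuous_on_subset[OF poly_family_cont[OF assms T] subset_UNIV] T_compact(1)[OF smp[OF T]]]]
   unfolding bounded_iff by blast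
  then show ?thesis by (intro exI[of _ "\<bar>B\<bar>"]) force
 qed
 then obtain B where B: "!!T. T \<in> X ==> B T \<ge> 0 \<and> (\<forall>p\<in>T. norm (W T p) <= B T)" by metis
 have "norm (pw W p) <= (\<Sum>T\<in>X. B T)" for p
  unfolding pw_def using B iT_sub smp
  by (intro order_trans[OF norm_sum] sum_mono) (fastforce simp: indicator_def)
 moreover have "(\<Sum>T\<in>X. B T) \<ge> 0" using B by (intro sum_nonneg) auto
 ultimately show ?thesis using that by blast
qed

lemma UX: "\<Union>X \<in> sets borel" "bounded (\<Union>X)"
 using U cov by (auto simp: bounded_closure)

lemma integrable_pw:
 fixes f :: "real^2 => real"
 assumes "poly_family m W" "f \<in> borel_measurable borel" "!!p. \<bar>f p\<bar> <= B"
 shows "integrable lborel (\<lambda>p. pw W p $ i * f p)"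
proof -
 obtain B' where B': "!!p. norm (pw W p) <= B'" "B' \<ge> 0" using pw_bounded[OF assms(1)] by blast
 have "integrable lborel (\<lambda>p. indicator (\<Union>X) p *\<^sub>R (pw W p $ i * f p))"
 proof (rule bounded_borel_integrable[OF _ UX, where B="B' * B"])
  show "(\<lambda>p. pw W p $ i * f p) \<in> borel_measurable borel" using vec_nth_borel[OF pw_borel[OF assms(1)]] assms(2) by (intro borel_measurable_times)
  show "norm (pw W x $ i * f x) <= B' * B" for x
   using assms(3)[of x] B'(2) order_trans[OF component_le_norm_cart[of "pw W x" i] B'(1)] by (auto simp: abs_mult intro!: mult_mono)
 qed
 moreover have "(\<lambda>p. indicator (\<Union>X) p *\<^sub>R (pw W p $ i * f p)) = (\<lambda>p. pw W p $ i * f p)"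
  using pw_zero by (fastforce simp: indicator_def)
 ultimately show ?thesis by simp
qed

end

section \<open>Matching the rigid motion moments\<close>

definition oth :: "2 => real^2 => real" where "oth i p = (if i = 1 then p $ 2 else p $ 1)"

text \<open>Restricted to the shadow, a rigid motion component is affine in the coordinate \<open>oth i\<close>. The second factor and its counterpart
  with \<open>a\<close> and \<open>b\<close> exchanged interpolate it between its values at the two ends of the edge, see \<open>weight_rm\<close>.\<close>

definition weight :: "2 => real^2 => real^2 => real^2 => real" where
 "weight i a b p = shadow (oth i) a b p * ((oth i b - oth i p) / (oth i b - oth i a))"

definition strip :: "2 => real^2 => real^2 => (real^2) set" where
 "strip i a b = {p. min (oth i a) (oth i b) < oth i p \<and> oth i p < max (oth i a) (oth i b)}"

text \<open>A normal vector of the edge, with the length of the edge.\<close>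

definition nu :: "real^2 => real^2 => real^2" where
 "nu a b = vector [(b - a) $ 2, - ((b - a) $ 1)]"

lemma oth_cont: "cont (oth i)"
 unfolding oth_def[abs_def] by (cases "i = 1") (auto intro!: continuous_intros)

lemma oth_borel: "oth i \<in> borel_measurable borel"
 using oth_cont borel_measurable_continuous_onI by blast

lemma shadow_borel: "shadow (oth i) a b \<in> borel_measurable borel"
proof -
 have "cont (\<lambda>p. area2 a b p)" unfolding cr_simps by (intro continuous_intros)
 then have [measurable]: "(\<lambda>p. area2 a b p) \<in> borel_measurable borel" by (rule borel_measurable_continuous_onI)
 note [measurable] = oth_borel
 show ?thesis unfolding shadow_def[abs_def] by measurable
qed

lemma strip_borel: "strip i a b \<in> sets borel"
proof -
 note [measurable] = oth_borel
 show ?thesis unfolding strip_def by measurable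
qed

lemma weight_borel: "weight i a b \<in> borel_measurable borel"
 unfolding weight_def[abs_def] using shadow_borel oth_borel
 by (intro borel_measurable_times borel_measurable_divide borel_measurable_diff borel_measurable_const)

lemma weight_abs: "\<bar>weight i a b p\<bar> <= indicator (strip i a b) p"
proof (cases "p \<in> strip i a b")
 case True
 then have "\<bar>(oth i b - oth i p) / (oth i b - oth i a)\<bar> <= 1"
  by (auto simp: strip_def abs_divide divide_le_eq_1 min_def max_def split: if_splits)
 moreover have "\<bar>shadow (oth i) a b p\<bar> <= 1" using shadow_abs[of "oth i" a b p] by (auto split: if_splits)
 ultimately have "\<bar>weight i a b p\<bar> <= 1 * 1" unfolding weight_def abs_mult by (intro mult_mono) auto
 then show ?thesis using True by simp
next
 case False
 then have "shadow (oth i) a b p = 0" using shadow_abs[of "oth i" a b p] by (auto simp: strip_def)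
 then show ?thesis by (simp add: weight_def)
qed

lemma weight_le1: "\<bar>weight i a b p\<bar> <= 1"
 by (rule order_trans[OF weight_abs]) (auto simp: indicator_def)

lemma weight_rm:
 "weight i a b p * rm \<alpha> \<beta> \<kappa> a $ i - weight i b a p * rm \<alpha> \<beta> \<kappa> b $ i = shadow (oth i) a b p * rm \<alpha> \<beta> \<kappa> p $ i"
proof (cases "oth i a = oth i b")
 case True
 then have "shadow (oth i) a b p = 0" "shadow (oth i) b a p = 0" by (auto simp: shadow_def)
 then show ?thesis by (simp add: weight_def)
next
 case False
 obtain \<rho> \<sigma> where r: "!!p. rm \<alpha> \<beta> \<kappa> p $ i = \<rho> + \<sigma> * oth i p"
 proof (cases "i = 1")
  case True
  then show ?thesis using that[of \<alpha> "- \<kappa>"] by (simp add: rm_def oth_def)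
 next
  case False
  then have "i = 2" using exhaust_2[of i] by auto
  then show ?thesis using that[of \<beta> \<kappa>] by (simp add: rm_def oth_def)
 qed
 let ?A = "oth i a" and ?B = "oth i b" and ?P = "oth i p"
 have "(?B - ?P) / (?B - ?A) * (\<rho> + \<sigma> * ?A) + (?A - ?P) / (?A - ?B) * (\<rho> + \<sigma> * ?B) = \<rho> + \<sigma> * ?P"
 proof -
  have "(?A - ?P) / (?A - ?B) = (?P - ?A) / (?B - ?A)" by (metis minus_diff_eq minus_divide_divide)
  then have "(?B - ?P) / (?B - ?A) * (\<rho> + \<sigma> * ?A) + (?A - ?P) / (?A - ?B) * (\<rho> + \<sigma> * ?B)
   = ((?B - ?P) * (\<rho> + \<sigma> * ?A) + (?P - ?A) * (\<rho> + \<sigma> * ?B)) / (?B - ?A)" by (simp add: add_divide_distrib)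
  also have "... = ((?B - ?A) * (\<rho> + \<sigma> * ?P)) / (?B - ?A)" by (rule arg_cong2[of _ _ _ _ "(/)"]) (simp_all add: algebra_simps)
  finally show ?thesis using False by simp
 qed
 then have "shadow (oth i) a b p * ((?B - ?P) / (?B - ?A) * (\<rho> + \<sigma> * ?A) + (?A - ?P) / (?A - ?B) * (\<rho> + \<sigma> * ?B)) = shadow (oth i) a b p * (\<rho> + \<sigma> * ?P)" by simp
 then show ?thesis unfolding weight_def r shadow_antisym[of "oth i" b a p] by (simp add: distrib_left mult.assoc)
qed

lemma AE_oth: "AE p in lborel. oth i p ~= k"
proof -
 have "negligible {p::real^2. axis j 1 \<bullet> p = k}" for j :: 2
  by (rule negligible_hyperplane) (simp add: axis_eq_0_iff)
 from negligible_AE_lborel[OF this] show ?thesis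
  unfolding oth_def by (cases "i = 1") (auto simp: inner_axis')
qed

context mesh2
begin

text \<open>The contribution of the directed edge \<open>(a, b)\<close> to the rigid motion moments that is attached to its end \<open>a\<close>.\<close>

definition Mom :: "cell_field => real^2 => real^2 => real^2" where
 "Mom W a b = (\<chi> i. LINT p|lborel. pw W p $ i * weight i a b p)"

text \<open>The numbers 36 and 24 solve the system given by the fractions in \<open>edge_moment\<close>, halved because the area is half the
  determinant: \<open>36/20 - 24/30 = 1\<close> and \<open>24/20 - 36/30 = 0\<close>.\<close>

definition Am :: "cell_field => real^2 => real^2 => real^2^2" where
 "Am W a b = symm (nu a b) (36 *\<^sub>R Mom W a b + 24 *\<^sub>R Mom W b a)"

text \<open>The gradient of \<open>\<lambda>\<^sub>x\<^sup>2 \<lambda>\<^sub>y\<close>.\<close>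

definition gq :: "(real^2) set => real^2 => real^2 => real^2 => real^2" where
 "gq T x y p = (2 * lamT T x p * lamT T y p) *\<^sub>R gT T x + (lamT T x p ^ 2) *\<^sub>R gT T y"

definition divc :: "cell_field => (real^2) set => real^2 => real^2" where
 "divc W T p = (\<Sum>x\<in>verts T. \<Sum>y\<in>verts T - {x}. Am W x y *v gq T x y p)"

definition resT :: "cell_field => (real^2) set => real^2 => real^2" where
 "resT W T p = W T p - divc W T p"

lemma gq_Pxy: "(\<lambda>p. (A *v gq T x y p) $ i) \<in> Pxy 2"
proof -
 have 1: "lamT T x \<in> Pxy 1" for x using lamT_Pxy[of T x 0] by simp
 have "(\<lambda>p. (2 * (A *v gT T x) $ i) * (lamT T x p * lamT T y p) + ((A *v gT T y) $ i) * (lamT T x p * lamT T x p)) \<in> Pxy (1 + 1)"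
  by (intro Pxy_add Pxy_cmul Pxy_mult 1)
 moreover have "(A *v gq T x y p) $ i = (2 * (A *v gT T x) $ i) * (lamT T x p * lamT T y p) + ((A *v gT T y) $ i) * (lamT T x p * lamT T x p)" for p
  by (simp add: gq_def matrix_vector_right_distrib matrix_vector_mult_scaleR power2_eq_square)
 ultimately show ?thesis by (simp add: numeral_2_eq_2)
qed

lemma divc_Pxy: "m \<ge> 2 ==> (\<lambda>p. divc W T p $ i) \<in> Pxy m"
 unfolding divc_def sum_component
 by (intro Pxy_sum Pxy_mono[OF gq_Pxy]) (simp_all add: verts_def)

lemma resT_Pxy: "poly_family m W ==> m \<ge> 2 ==> T \<in> X ==> (\<lambda>p. resT W T p $ i) \<in> Pxy m"
proof -
 assume *: "poly_family m W" "m \<ge> 2" "T \<in> X"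
 have "(\<lambda>p. W T p $ i + (-1) * divc W T p $ i) \<in> Pxy m"
  using * divc_Pxy by (intro Pxy_add Pxy_cmul) (auto simp: poly_family_def)
 then show ?thesis by (simp add: resT_def)
qed

lemma glam_nu:
 assumes "area2 a b c ~= 0"
 shows "- glam c a b = (1 / area2 a b c) *\<^sub>R nu a b"
proof -
 have "- vector [(a $ 2 - b $ 2) / D, (b $ 1 - a $ 1) / D] = (1 / D) *\<^sub>R (vector [(b - a) $ 2, - ((b - a) $ 1)] :: real^2)" for D
  by (simp add: vec_eq_iff forall_2 diff_divide_distrib)
 then show ?thesis by (simp only: glam_def nu_def area2_rot(2)[where a=a and b=b and c=c])
qed

lemma nu_antisym: "nu b a = - nu a b"
 by (simp add: nu_def vec_eq_iff forall_2)

lemma nu_nonzero: "a ~= b ==> nu a b ~= 0"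
 by (auto simp: nu_def vec_eq_iff forall_2)

lemma nu_norm: "norm (nu a b) = norm (b - a)"
proof -
 have "(norm (nu a b))\<^sup>2 = (norm (b - a))\<^sup>2"
  unfolding power2_norm_eq_inner by (simp add: nu_def inner_vec_def sum_2 algebra_simps)
 then show ?thesis by (rule power2_eq_imp_eq) auto
qed

lemma edge_pair:
 assumes pos: "area2 a b c > 0"
 shows "tint a b c (\<lambda>p. (Am W a b *v ((2 * lam a b c p * lam b c a p) *\<^sub>R glam a b c + (lam a b c p ^ 2) *\<^sub>R glam b c a)) \<bullet> rm \<alpha> \<beta> \<kappa> p)
  + tint a b c (\<lambda>p. (Am W b a *v ((2 * lam b c a p * lam a b c p) *\<^sub>R glam b c a + (lam b c a p ^ 2) *\<^sub>R glam a b c)) \<bullet> rm \<alpha> \<beta> \<kappa> p)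
  = Mom W a b \<bullet> rm \<alpha> \<beta> \<kappa> a - Mom W b a \<bullet> rm \<alpha> \<beta> \<kappa> b"
proof -
 have nz: "area2 a b c ~= 0" "area2 b a c ~= 0" using pos area2_rot(3)[where a=a and b=b and c=c] by auto
 have ne: "nu a b ~= 0" "nu b a ~= 0" using nu_nonzero area2_distinct(1)[OF nz(1)] by auto
 have D: "\<bar>area2 b a c\<bar> = area2 a b c" "\<bar>area2 a b c\<bar> = area2 a b c" using pos area2_rot(3)[where a=a and b=b and c=c] by auto
 let ?ra = "rm \<alpha> \<beta> \<kappa> a" and ?rb = "rm \<alpha> \<beta> \<kappa> b" and ?Mab = "Mom W a b" and ?Mba = "Mom W b a"
 have Aab: "Am W a b *v nu a b = 36 *\<^sub>R ?Mab + 24 *\<^sub>R ?Mba" unfolding Am_def by (rule symm_mult[OF ne(1)])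
 have Aba: "Am W b a *v nu a b = - (36 *\<^sub>R ?Mba + 24 *\<^sub>R ?Mab)"
 proof -
  have "Am W b a *v nu a b = - (Am W b a *v nu b a)"
   unfolding nu_antisym[of b a] using linear_neg[OF matrix_vector_mul_linear, of "Am W b a" "nu b a"] by (simp add: nu_antisym[of a b])
  also have "Am W b a *v nu b a = 36 *\<^sub>R ?Mba + 24 *\<^sub>R ?Mab" unfolding Am_def by (rule symm_mult[OF ne(2)])
  finally show ?thesis .
 qed
 have tr: "transpose (Am W x y) = Am W x y" for x y unfolding Am_def by (rule symm_transpose)
 have neg: "- ((A *v glam c a b) \<bullet> z) = (1 / area2 a b c) * ((A *v nu a b) \<bullet> z)" for A :: "real^2^2" and z
 proof -
  have "- ((A *v glam c a b) \<bullet> z) = (A *v (- glam c a b)) \<bullet> z"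
   using linear_neg[OF matrix_vector_mul_linear, of A "glam c a b"] by simp
  then show ?thesis unfolding glam_nu[OF nz(1)] by (simp add: matrix_vector_mult_scaleR)
 qed
 have 1: "tint a b c (\<lambda>p. (Am W a b *v ((2 * lam a b c p * lam b c a p) *\<^sub>R glam a b c + (lam a b c p ^ 2) *\<^sub>R glam b c a)) \<bullet> rm \<alpha> \<beta> \<kappa> p)
   = 1/2 * ((36 *\<^sub>R ?Mab + 24 *\<^sub>R ?Mba) \<bullet> ((1/10) *\<^sub>R ?ra + (1/15) *\<^sub>R ?rb))"
  unfolding edge_moment[OF nz(1) tr] neg Aab D using nz by simp
 have "tint b a c (\<lambda>p. (Am W b a *v ((2 * lam b a c p * lam a c b p) *\<^sub>R glam b a c + (lam b a c p ^ 2) *\<^sub>R glam a c b)) \<bullet> rm \<alpha> \<beta> \<kappa> p)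
   = area2 a b c / 2 * (- ((Am W b a *v glam c b a) \<bullet> ((1/10) *\<^sub>R ?rb + (1/15) *\<^sub>R ?ra)))"
  unfolding edge_moment[OF nz(2) tr] D ..
 also have "glam c b a = glam c a b" by (rule glam_swap)
 finally have 2: "tint a b c (\<lambda>p. (Am W b a *v ((2 * lam b c a p * lam a b c p) *\<^sub>R glam b c a + (lam b c a p ^ 2) *\<^sub>R glam a b c)) \<bullet> rm \<alpha> \<beta> \<kappa> p)
   = 1/2 * ((- (36 *\<^sub>R ?Mba + 24 *\<^sub>R ?Mab)) \<bullet> ((1/10) *\<^sub>R ?rb + (1/15) *\<^sub>R ?ra))"
  unfolding neg Aba tint_rot(3)[where a=a and b=b and c=c] 
   lam_swap[where a=b and b=c and c=a] lam_swap[where a=a and b=b and c=c] glam_swap[where a=b and b=c and c=a] glam_swap[where a=a and b=b and c=c]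
  using nz by simp
 show ?thesis unfolding 1 2
  by (simp add: inner_add_left inner_add_right inner_minus_left algebra_simps)
qed

lemma Mom_rm:
 assumes "poly_family m W"
 shows "Mom W a b \<bullet> rm \<alpha> \<beta> \<kappa> a - Mom W b a \<bullet> rm \<alpha> \<beta> \<kappa> b
  = (\<Sum>i\<in>UNIV. LINT p|lborel. pw W p $ i * (shadow (oth i) a b p * (rm \<alpha> \<beta> \<kappa> p $ i)))"
proof -
 have i: "integrable lborel (\<lambda>p. pw W p $ i * weight i a b p)" for i a b
  by (rule integrable_pw[OF assms weight_borel weight_le1])
 have "(LINT p|lborel. pw W p $ i * weight i a b p) * rm \<alpha> \<beta> \<kappa> a $ i - (LINT p|lborel. pw W p $ i * weight i b a p) * rm \<alpha> \<beta> \<kappa> b $ i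
   = (LINT p|lborel. pw W p $ i * (shadow (oth i) a b p * rm \<alpha> \<beta> \<kappa> p $ i))" for i
 proof -
  have "(LINT p|lborel. pw W p $ i * weight i a b p) * rm \<alpha> \<beta> \<kappa> a $ i - (LINT p|lborel. pw W p $ i * weight i b a p) * rm \<alpha> \<beta> \<kappa> b $ i
   = (LINT p|lborel. pw W p $ i * weight i a b p * rm \<alpha> \<beta> \<kappa> a $ i - pw W p $ i * weight i b a p * rm \<alpha> \<beta> \<kappa> b $ i)"
   using i[of i a b] i[of i b a] by simp
  also have "... = (LINT p|lborel. pw W p $ i * (shadow (oth i) a b p * rm \<alpha> \<beta> \<kappa> p $ i))"
   unfolding weight_rm[symmetric] by (simp add: right_diff_distrib mult.assoc)
  finally show ?thesis .
 qed
 then show ?thesis by (simp add: Mom_def inner_vec_def sum_subtractf[symmetric])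
qed

lemma cont_rm: "cont (rm \<alpha> \<beta> \<kappa>)"
 unfolding rm_def by (intro vec2_contI continuous_intros)

text \<open>Rigid motions interpolate between vertices, so the edge contributions integrate the data times the motion over the three
  shadows. These sum up to the triangle by \<open>shadow_sum\<close>, separately for either component.\<close>

lemma tri_moment:
 assumes W: "poly_family m W" and T: "T \<in> X"
 shows "(\<Sum>(a, b)\<in>{(vA T, vB T), (vB T, vC T), (vC T, vA T)}. Mom W a b \<bullet> rm \<alpha> \<beta> \<kappa> a - Mom W b a \<bullet> rm \<alpha> \<beta> \<kappa> b)
  = tint (vA T) (vB T) (vC T) (\<lambda>p. W T p \<bullet> rm \<alpha> \<beta> \<kappa> p)"
proof -
 let ?a = "vA T" and ?b = "vB T" and ?c = "vC T" and ?r = "rm \<alpha> \<beta> \<kappa>"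
 have pos: "area2 ?a ?b ?c > 0" using tv(1)[OF smp[OF T]] .
 have nz: "area2 ?a ?b ?c ~= 0" using pos by simp
 note ds = area2_distinct[OF nz]
 have msr: "(\<lambda>p. ?r p $ i) \<in> borel_measurable borel" for i
  by (rule vec_nth_borel[OF borel_measurable_continuous_onI[OF cont_rm]])
 obtain R where R: "!!p. p \<in> \<Union>X ==> norm (?r p) <= R"
 proof -
  have "compact (\<Union>X)" using fin smp T_compact(1) by (intro compact_Union) auto
  from compact_imp_bounded[OF compact_continuous_image[OF continuous_on_subset[OF cont_rm subset_UNIV] this]]
  obtain R where R: "\<forall>x\<in>?r ` \<Union>X. norm x <= R" unfolding bounded_iff by blast
  show ?thesis by (rule that[of R]) (use R in blast)
 qed
 have int: "integrable lborel (\<lambda>p. pw W p $ i * (shadow (oth i) a b p * ?r p $ i))" for a b i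
 proof -
  have "integrable lborel (\<lambda>p. pw W p $ i * (if p \<in> \<Union>X then shadow (oth i) a b p * ?r p $ i else 0))"
  proof (rule integrable_pw[OF W, where B="\<bar>R\<bar>"])
   show "(\<lambda>p. if p \<in> \<Union>X then shadow (oth i) a b p * ?r p $ i else 0) \<in> borel_measurable borel"
    using shadow_borel msr UX by (intro measurable_If_set borel_measurable_times) auto
   show "\<bar>if p \<in> \<Union>X then shadow (oth i) a b p * ?r p $ i else 0\<bar> <= \<bar>R\<bar>" for p
   proof (cases "p \<in> \<Union>X")
    case True
    have "\<bar>shadow (oth i) a b p\<bar> <= 1" using shadow_abs[of "oth i" a b p] by (auto split: if_splits)
    moreover have "\<bar>?r p $ i\<bar> <= \<bar>R\<bar>" using component_le_norm_cart[of "?r p" i] R[OF True] by linarith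
    ultimately have "\<bar>shadow (oth i) a b p\<bar> * \<bar>?r p $ i\<bar> <= 1 * \<bar>R\<bar>" by (intro mult_mono) auto
    then show ?thesis using True by (simp add: abs_mult)
   qed auto
  qed
  moreover have "(\<lambda>p. pw W p $ i * (if p \<in> \<Union>X then shadow (oth i) a b p * ?r p $ i else 0)) = (\<lambda>p. pw W p $ i * (shadow (oth i) a b p * ?r p $ i))"
   using pw_zero by fastforce
  ultimately show ?thesis by simp
 qed
 have comp: "(LINT p|lborel. pw W p $ i * (shadow (oth i) ?a ?b p * ?r p $ i)) + (LINT p|lborel. pw W p $ i * (shadow (oth i) ?b ?c p * ?r p $ i))
   + (LINT p|lborel. pw W p $ i * (shadow (oth i) ?c ?a p * ?r p $ i)) = (LINT p|lborel. indicator (tri ?a ?b ?c) p * (W T p $ i * ?r p $ i))" for i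
 proof -
  have "(LINT p|lborel. pw W p $ i * (shadow (oth i) ?a ?b p * ?r p $ i)) + (LINT p|lborel. pw W p $ i * (shadow (oth i) ?b ?c p * ?r p $ i))
   + (LINT p|lborel. pw W p $ i * (shadow (oth i) ?c ?a p * ?r p $ i)) =
   (LINT p|lborel. pw W p $ i * (shadow (oth i) ?a ?b p * ?r p $ i) + pw W p $ i * (shadow (oth i) ?b ?c p * ?r p $ i)
    + pw W p $ i * (shadow (oth i) ?c ?a p * ?r p $ i))"
   using int by simp
  also have "... = (LINT p|lborel. indicator (tri ?a ?b ?c) p * (W T p $ i * ?r p $ i))"
  proof (rule integral_cong_AE)
   show "(\<lambda>p. pw W p $ i * (shadow (oth i) ?a ?b p * ?r p $ i) + pw W p $ i * (shadow (oth i) ?b ?c p * ?r p $ i)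
    + pw W p $ i * (shadow (oth i) ?c ?a p * ?r p $ i)) \<in> borel_measurable lborel"
    using int by auto
   show "(\<lambda>p. indicator (tri ?a ?b ?c) p * (W T p $ i * ?r p $ i)) \<in> borel_measurable lborel"
    using msr vec_nth_borel[OF borel_measurable_continuous_onI[OF poly_family_cont[OF W T]]] tri_borel
    by (intro borel_measurable_times borel_measurable_indicator) auto
   have nz': "area2 ?b ?c ?a ~= 0" "area2 ?c ?a ?b ~= 0"
    using nz area2_rot(1)[where a="?a" and b="?b" and c="?c"] area2_rot(2)[where a="?a" and b="?b" and c="?c"] by simp_all
   show "AE p in lborel. pw W p $ i * (shadow (oth i) ?a ?b p * ?r p $ i) + pw W p $ i * (shadow (oth i) ?b ?c p * ?r p $ i)
    + pw W p $ i * (shadow (oth i) ?c ?a p * ?r p $ i) = indicator (tri ?a ?b ?c) p * (W T p $ i * ?r p $ i)"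
    using AE_lam_nonzero[OF nz] AE_lam_nonzero[OF nz'(1)] AE_lam_nonzero[OF nz'(2)]
     AE_oth[of i "oth i ?a"] AE_oth[of i "oth i ?b"] AE_oth[of i "oth i ?c"]
   proof eventually_elim
    case (elim p)
    have lin: "oth i (u *\<^sub>R ?a + v *\<^sub>R ?b + w *\<^sub>R ?c) = u * oth i ?a + v * oth i ?b + w * oth i ?c" for u v w
     by (simp add: oth_def)
    have s: "shadow (oth i) ?a ?b p + shadow (oth i) ?b ?c p + shadow (oth i) ?c ?a p = indicator (iT T) p"
     by (rule shadow_sum[OF pos lin]) (use elim in auto)
    have "pw W p $ i * (shadow (oth i) ?a ?b p * ?r p $ i) + pw W p $ i * (shadow (oth i) ?b ?c p * ?r p $ i)
      + pw W p $ i * (shadow (oth i) ?c ?a p * ?r p $ i) = pw W p $ i * ?r p $ i * indicator (iT T) p"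
     unfolding s[symmetric] by (simp add: algebra_simps)
    also have "... = indicator (tri ?a ?b ?c) p * (W T p $ i * ?r p $ i)"
    proof (cases "p \<in> iT T")
     case True
     then have "p \<in> tri ?a ?b ?c" using itri_sub by blast
     then show ?thesis using True pw_eq[OF T True] by simp
    next
     case False
     then have "p ~: tri ?a ?b ?c" using elim by (auto simp: itri_def tri_def)
     then show ?thesis using False by simp
    qed
    finally show ?case .
   qed
  qed
  finally show ?thesis .
 qed
 have "(\<Sum>(a, b)\<in>{(?a, ?b), (?b, ?c), (?c, ?a)}. Mom W a b \<bullet> ?r a - Mom W b a \<bullet> ?r b)
  = (\<Sum>i\<in>UNIV. (LINT p|lborel. pw W p $ i * (shadow (oth i) ?a ?b p * ?r p $ i)) + (LINT p|lborel. pw W p $ i * (shadow (oth i) ?b ?c p * ?r p $ i))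
   + (LINT p|lborel. pw W p $ i * (shadow (oth i) ?c ?a p * ?r p $ i)))"
  using ds unfolding Mom_rm[OF W] by (simp add: sum.distrib add.assoc)
 also have "... = (\<Sum>i\<in>UNIV. tint ?a ?b ?c (\<lambda>p. W T p $ i * ?r p $ i))" unfolding comp tint_def ..
 also have "... = tint ?a ?b ?c (\<lambda>p. \<Sum>i\<in>UNIV. W T p $ i * ?r p $ i)"
  using poly_family_cont[OF W T] cont_rm
  by (subst tint_sum[OF nz]) (auto intro!: continuous_intros)
 finally show ?thesis by (simp add: inner_vec_def)
qed

text \<open>This is what allows the bubbles to remove the residual of the edge fields.\<close>

lemma resT_orthogonal:
 assumes W: "poly_family m W" and T: "T \<in> X"
 shows "tint (vA T) (vB T) (vC T) (\<lambda>p. resT W T p \<bullet> rm \<alpha> \<beta> \<kappa> p) = 0"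
proof -
 let ?a = "vA T" and ?b = "vB T" and ?c = "vC T" and ?r = "rm \<alpha> \<beta> \<kappa>"
 have pos: "area2 ?a ?b ?c > 0" using tv(1)[OF smp[OF T]] .
 have nz: "area2 ?a ?b ?c ~= 0" using pos by simp
 have pos': "area2 ?b ?c ?a > 0" "area2 ?c ?a ?b > 0"
  using pos area2_rot(1)[where a="?a" and b="?b" and c="?c"] area2_rot(2)[where a="?a" and b="?b" and c="?c"] by simp_all
 note ds = area2_distinct[OF nz]
 define F where "F x y p = (Am W x y *v gq T x y p) \<bullet> ?r p" for x y p
 have cF: "cont (F x y)" for x y
 proof -
  have "cont (\<lambda>p. Am W x y *v gq T x y p)" using vec2_cont[OF gq_Pxy] by blast
  then show ?thesis unfolding F_def[abs_def] using cont_rm by (intro continuous_on_inner)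
 qed
 have "tint ?a ?b ?c (\<lambda>p. divc W T p \<bullet> ?r p) = tint ?a ?b ?c (\<lambda>p. \<Sum>x\<in>verts T. \<Sum>y\<in>verts T - {x}. F x y p)"
  by (simp add: divc_def F_def inner_sum_left)
 also have "... = (\<Sum>x\<in>verts T. \<Sum>y\<in>verts T - {x}. tint ?a ?b ?c (F x y))"
  using cF by (simp add: tint_sum[OF nz] verts_def continuous_on_sum)
 also have "... = (tint ?a ?b ?c (F ?a ?b) + tint ?a ?b ?c (F ?b ?a)) + (tint ?a ?b ?c (F ?b ?c) + tint ?a ?b ?c (F ?c ?b))
   + (tint ?a ?b ?c (F ?c ?a) + tint ?a ?b ?c (F ?a ?c))"
  unfolding sum_verts_pairs[OF smp[OF T]] by simp
 also have "tint ?a ?b ?c (F ?a ?b) + tint ?a ?b ?c (F ?b ?a) = Mom W ?a ?b \<bullet> ?r ?a - Mom W ?b ?a \<bullet> ?r ?b"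
  using edge_pair[OF pos] by (simp add: F_def[abs_def] gq_def lamT_simps[OF smp[OF T]])
 also have "tint ?a ?b ?c (F ?b ?c) + tint ?a ?b ?c (F ?c ?b) = Mom W ?b ?c \<bullet> ?r ?b - Mom W ?c ?b \<bullet> ?r ?c"
  using edge_pair[OF pos'(1)] unfolding tint_rot(1)[where a="?a" and b="?b" and c="?c"]
  by (simp add: F_def[abs_def] gq_def lamT_simps[OF smp[OF T]])
 also have "tint ?a ?b ?c (F ?c ?a) + tint ?a ?b ?c (F ?a ?c) = Mom W ?c ?a \<bullet> ?r ?c - Mom W ?a ?c \<bullet> ?r ?a"
 proof -
  have "tint ?c ?a ?b = tint ?a ?b ?c" using tint_rot(1)[where a="?c" and b="?a" and c="?b"] by simp
  then show ?thesis using edge_pair[OF pos'(2)] by (simp add: F_def[abs_def] gq_def lamT_simps[OF smp[OF T]])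
 qed
 also have "Mom W ?a ?b \<bullet> ?r ?a - Mom W ?b ?a \<bullet> ?r ?b + (Mom W ?b ?c \<bullet> ?r ?b - Mom W ?c ?b \<bullet> ?r ?c)
   + (Mom W ?c ?a \<bullet> ?r ?c - Mom W ?a ?c \<bullet> ?r ?a) = tint ?a ?b ?c (\<lambda>p. W T p \<bullet> ?r p)"
  using tri_moment[OF W T, of \<alpha> \<beta> \<kappa>] ds by simp
 finally have e: "tint ?a ?b ?c (\<lambda>p. divc W T p \<bullet> ?r p) = tint ?a ?b ?c (\<lambda>p. W T p \<bullet> ?r p)" .
 have c1: "cont (\<lambda>p. W T p \<bullet> ?r p)" using poly_family_cont[OF W T] cont_rm by (intro continuous_on_inner)
 have c2: "cont (\<lambda>p. divc W T p \<bullet> ?r p)" using vec2_cont[OF divc_Pxy[of 2]] cont_rm by (intro continuous_on_inner) auto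
 show ?thesis using tint_diff_cmul[OF nz c1 c2, of 1] e by (simp add: resT_def inner_diff_left)
qed

end

section \<open>Estimates for the edge fields\<close>

lemma quadratic_discriminant:
 fixes a b c :: real
 assumes q: "!!s. 0 <= a - 2 * s * b + s\<^sup>2 * c" and c: "c \<ge> 0"
 shows "b\<^sup>2 <= a * c"
proof (cases "c = 0")
 case True
 have "b = 0"
 proof (rule ccontr)
  assume n: "b ~= 0"
  show False using q[of "(a + 1) / (2 * b)"] True n by simp
 qed
 then show ?thesis using True by simp
next
 case False
 then have p: "c > 0" using c by simp
 have "0 <= c * (a - 2 * (b / c) * b + (b / c)\<^sup>2 * c)" using q[of "b / c"] p by simp
 also have "... = a * c - b\<^sup>2" using False by (simp add: power2_eq_square field_simps)
 finally show ?thesis by simp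
qed

lemma integral_Cauchy_Schwarz:
 fixes f g :: "'a => real"
 assumes i: "integrable M (\<lambda>x. (f x)\<^sup>2)" "integrable M (\<lambda>x. (g x)\<^sup>2)" "integrable M (\<lambda>x. f x * g x)"
 shows "(LINT x|M. f x * g x)\<^sup>2 <= (LINT x|M. (f x)\<^sup>2) * (LINT x|M. (g x)\<^sup>2)"
proof (rule quadratic_discriminant)
 fix s
 have "0 <= (LINT x|M. (f x - s * g x)\<^sup>2)" by (rule Bochner_Integration.integral_nonneg) simp
 also have "(\<lambda>x. (f x - s * g x)\<^sup>2) = (\<lambda>x. (f x)\<^sup>2 - (2 * s) * (f x * g x) + s\<^sup>2 * (g x)\<^sup>2)"
  by (simp add: power2_eq_square algebra_simps)
 also have "(LINT x|M. (f x)\<^sup>2 - (2 * s) * (f x * g x) + s\<^sup>2 * (g x)\<^sup>2) = (LINT x|M. (f x)\<^sup>2) - 2 * s * (LINT x|M. f x * g x) + s\<^sup>2 * (LINT x|M. (g x)\<^sup>2)"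
  using i by simp
 finally show "0 <= (LINT x|M. (f x)\<^sup>2) - 2 * s * (LINT x|M. f x * g x) + s\<^sup>2 * (LINT x|M. (g x)\<^sup>2)" .
qed (rule Bochner_Integration.integral_nonneg, simp)

lemma sum6_square: "(a + b + (c + d) + (e + f))\<^sup>2 <= 6 * (a\<^sup>2 + b\<^sup>2 + (c\<^sup>2 + d\<^sup>2) + (e\<^sup>2 + f\<^sup>2))" for a :: real
proof -
 have "0 <= (a-b)\<^sup>2 + (a-c)\<^sup>2 + (a-d)\<^sup>2 + (a-e)\<^sup>2 + (a-f)\<^sup>2 + (b-c)\<^sup>2 + (b-d)\<^sup>2 + (b-e)\<^sup>2 + (b-f)\<^sup>2
   + (c-d)\<^sup>2 + (c-e)\<^sup>2 + (c-f)\<^sup>2 + (d-e)\<^sup>2 + (d-f)\<^sup>2 + (e-f)\<^sup>2" by (intro add_nonneg_nonneg) auto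
 then show ?thesis by (simp add: power2_eq_square algebra_simps)
qed

lemma glam_norm: "norm (glam a b c) = norm (c - b) / \<bar>area2 a b c\<bar>"
proof -
 have "glam a b c = (1 / area2 a b c) *\<^sub>R vector [b $ 2 - c $ 2, c $ 1 - b $ 1]"
  by (simp add: glam_def vec_eq_iff forall_2)
 moreover have "norm (vector [b $ 2 - c $ 2, c $ 1 - b $ 1] :: real^2) = norm (c - b)"
 proof -
  have "(norm (vector [b $ 2 - c $ 2, c $ 1 - b $ 1] :: real^2))\<^sup>2 = (norm (c - b))\<^sup>2"
   unfolding power2_norm_eq_inner by (simp add: inner_vec_def sum_2 algebra_simps)
  then show ?thesis by (rule power2_eq_imp_eq) auto
 qed
 ultimately show ?thesis by (simp add: abs_divide)
qed

lemma norm_matrix_vector2: "norm ((A::real^2^2) *v w) <= norm A * norm w"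
proof -
 have "(norm (A *v w))\<^sup>2 <= (norm A * norm w)\<^sup>2"
 proof -
  have "(norm (A *v w))\<^sup>2 = (A $ 1 \<bullet> w)\<^sup>2 + (A $ 2 \<bullet> w)\<^sup>2"
   unfolding power2_norm_eq_inner by (simp add: matrix_vector_mul_component inner_vec_def[of "A *v w"] sum_2 power2_eq_square)
  also have "... <= (A $ 1 \<bullet> A $ 1) * (w \<bullet> w) + (A $ 2 \<bullet> A $ 2) * (w \<bullet> w)"
   by (intro add_mono Cauchy_Schwarz_ineq)
  also have "... = (norm A * norm w)\<^sup>2"
   unfolding power_mult_distrib power2_norm_eq_inner by (simp add: inner_vec_def[of A] sum_2 distrib_right)
  finally show ?thesis .
 qed
 then show ?thesis by (rule power2_le_imp_le) simp
qed

context mesh2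
begin

definition "dd = \<gamma> * h"
definition "\<rho> = 2 * \<gamma> ^ 4 / pi"

abbreviation "DT T \<equiv> area2 (vA T) (vB T) (vC T)"

lemma dd0: "dd > 0" using h0 \<gamma>0 by (simp add: dd_def)
lemma rho0: "\<rho> > 0" using \<gamma>0 by (simp add: \<rho>_def)

lemma verts_in: "T \<in> X ==> x \<in> verts T ==> x \<in> T"
 using verts_hull[OF smp] hull_subset[of "verts T" convex] by auto

lemma verts_diam: "T \<in> X ==> x \<in> verts T ==> y \<in> verts T ==> norm (x - y) <= dd"
 unfolding dd_def using dm[of T x y] verts_in by blast

lemma DT_pos: "T \<in> X ==> DT T > 0" using tv(1)[OF smp] .

lemma DT_measure: "T \<in> X ==> measure lborel T = DT T / 2"
proof -
 assume T: "T \<in> X"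
 have "tint (vA T) (vB T) (vC T) (\<lambda>_. 1) = measure lborel (tri (vA T) (vB T) (vC T))"
  using tri_borel by (simp add: tint_def)
 then show ?thesis using tint_1(1)[of "vA T" "vB T" "vC T"] DT_pos[OF T] tv(2)[OF smp[OF T]] by simp
qed

lemma dd_DT: "T \<in> X ==> dd\<^sup>2 <= \<rho> * DT T"
proof -
 assume T: "T \<in> X"
 obtain c where c: "cball c (h / (2 * \<gamma>)) \<subseteq> T" using bl[OF T] by blast
 have r: "h / (2 * \<gamma>) \<ge> 0" using h0 \<gamma>0 by simp
 have "measure lebesgue (cball c (h / (2 * \<gamma>))) <= measure lebesgue T"
  using c T_compact(1)[OF smp[OF T]] by (intro measure_mono_fmeasurable) (auto intro: lmeasurable_compact)
 also have "measure lebesgue T = DT T / 2"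
  using DT_measure[OF T] T_compact(2)[OF smp[OF T]] by simp
 also have "measure lebesgue (cball c (h / (2 * \<gamma>))) = pi * (h / (2 * \<gamma>))\<^sup>2"
  using r content_cball[OF r, of c] by (simp add: unit_ball_vol_2)
 finally have "pi * (h / (2 * \<gamma>))\<^sup>2 <= DT T / 2" .
 then have "(4 * \<gamma> ^ 4 / pi) * (pi * (h / (2 * \<gamma>))\<^sup>2) <= (4 * \<gamma> ^ 4 / pi) * (DT T / 2)"
  by (intro mult_left_mono) auto
 moreover have "(4 * \<gamma> ^ 4 / pi) * (pi * (h / (2 * \<gamma>))\<^sup>2) = dd\<^sup>2"
  using \<gamma>0 by (simp add: dd_def power2_eq_square power4_eq_xxxx)
 moreover have "(4 * \<gamma> ^ 4 / pi) * (DT T / 2) = \<rho> * DT T" by (simp add: \<rho>_def)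
 ultimately show ?thesis by simp
qed

lemma DT_le: "T \<in> X ==> DT T <= dd\<^sup>2"
proof -
 assume T: "T \<in> X"
 have "(DT T)\<^sup>2 <= (norm (vB T - vA T))\<^sup>2 * (norm (vC T - vA T))\<^sup>2" unfolding area2_def by (rule cr_bound)
 also have "... <= dd\<^sup>2 * dd\<^sup>2" using verts_diam[OF T] by (intro mult_mono power_mono) (auto simp: verts_def)
 finally have "(DT T)\<^sup>2 <= (dd\<^sup>2)\<^sup>2" by (simp add: power2_eq_square)
 then show ?thesis by (rule power2_le_imp_le) simp
qed

lemma edge_length: "T \<in> X ==> x \<in> verts T ==> y \<in> verts T ==> x ~= y ==> dd <= \<rho> * norm (y - x)"
proof -
 assume T: "T \<in> X" and xy: "x \<in> verts T" "y \<in> verts T" "x ~= y"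
 have "\<exists>z\<in>verts T. \<bar>area2 x y z\<bar> = DT T"
 proof -
  note r = area2_rot[where a="vA T" and b="vB T" and c="vC T"] area2_rot(3)[where a="vB T" and b="vC T" and c="vA T"] DT_pos[OF T]
  have 1: "\<bar>area2 (vA T) (vB T) (vC T)\<bar> = DT T" "\<bar>area2 (vB T) (vA T) (vC T)\<bar> = DT T"
   "\<bar>area2 (vB T) (vC T) (vA T)\<bar> = DT T" "\<bar>area2 (vC T) (vB T) (vA T)\<bar> = DT T"
   "\<bar>area2 (vC T) (vA T) (vB T)\<bar> = DT T" "\<bar>area2 (vA T) (vC T) (vB T)\<bar> = DT T"
   using DT_pos[OF T] by (simp_all add: cr_simps algebra_simps)
  have c: "(x = vA T \<and> y = vB T) \<or> (x = vB T \<and> y = vA T) \<or> (x = vB T \<and> y = vC T) \<or> (x = vC T \<and> y = vB T)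
   \<or> (x = vC T \<and> y = vA T) \<or> (x = vA T \<and> y = vC T)"
   using xy unfolding verts_def by blast
  have v: "vA T \<in> verts T" "vB T \<in> verts T" "vC T \<in> verts T" by (auto simp: verts_def)
  show ?thesis using c
   by (elim disjE conjE) (use 1 v in \<open>simp_all only:\<close>, (use 1 v in blast)+)
 qed
 then obtain z where z: "z \<in> verts T" "\<bar>area2 x y z\<bar> = DT T" by blast
 have "(DT T)\<^sup>2 <= (norm (y - x))\<^sup>2 * (norm (z - x))\<^sup>2" using cr_bound[of "y - x" "z - x"] by (simp add: z(2)[symmetric] area2_def[of x y z])
 also have "... <= (norm (y - x))\<^sup>2 * dd\<^sup>2" using verts_diam[OF T z(1) xy(1)] by (intro mult_left_mono power_mono) auto
 finally have "(DT T)\<^sup>2 <= (norm (y - x) * dd)\<^sup>2" by (simp add: power_mult_distrib)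
 then have "DT T <= norm (y - x) * dd" by (rule power2_le_imp_le) (use dd0 in simp)
 then have "\<rho> * DT T <= \<rho> * (norm (y - x) * dd)" using rho0 by simp
 then have "dd * dd <= dd * (\<rho> * norm (y - x))" using dd_DT[OF T] by (simp add: power2_eq_square mult_ac)
 then show ?thesis using dd0 by simp
qed

lemma dd_le: "X ~= {} ==> dd <= 2 * \<gamma>\<^sup>2 * L"
proof -
 assume "X ~= {}"
 then obtain T where T: "T \<in> X" by blast
 obtain c where c: "cball c (h / (2 * \<gamma>)) \<subseteq> T" using bl[OF T] by blast
 let ?r = "h / (2 * \<gamma>)"
 have r: "?r \<ge> 0" using h0 \<gamma>0 by simp
 have "c + ?r *\<^sub>R axis 1 1 \<in> cball c ?r" "c - ?r *\<^sub>R axis 1 1 \<in> cball c ?r" using r by (auto simp: dist_norm)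
 then have "\<bar>(c + ?r *\<^sub>R axis 1 1) $ 1\<bar> <= L" "\<bar>(c - ?r *\<^sub>R axis 1 1) $ 1\<bar> <= L" using c box[OF T] by blast+
 then have "?r <= L" by (simp add: axis_def)
 then have "(2 * \<gamma>\<^sup>2) * ?r <= (2 * \<gamma>\<^sup>2) * L" by (intro mult_left_mono) auto
 then show ?thesis using \<gamma>0 by (simp add: dd_def power2_eq_square)
qed

definition slab :: "2 => real => real => (real^2) set" where
 "slab i l u = {p. l <= oth i p \<and> oth i p <= u \<and> \<bar>p $ 1\<bar> <= L \<and> \<bar>p $ 2\<bar> <= L}"

lemma slab:
 assumes "l <= u"
 shows "slab i l u \<in> sets borel" "bounded (slab i l u)" "measure lborel (slab i l u) <= (u - l) * (2 * L)"
proof -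
 let ?bx = "if i = 1 then cbox (vector [-L, l]) (vector [L, u]) else cbox (vector [l, -L]) (vector [u, L :: real] :: real^2)"
 have sub: "slab i l u \<subseteq> ?bx"
  by (auto simp: slab_def oth_def mem_box_cart forall_2)
 note [measurable] = oth_borel
 have [measurable]: "(\<lambda>p::real^2. p $ j) \<in> borel_measurable borel" for j by (rule vec_nth_borel) simp
 show 1: "slab i l u \<in> sets borel" unfolding slab_def by measurable
 show "bounded (slab i l u)" by (rule bounded_subset[OF _ sub]) auto
 have "measure lborel (slab i l u) <= measure lborel ?bx"
  using sub 1 by (intro measure_mono_fmeasurable) (auto simp: fmeasurable_def emeasure_lborel_cbox_eq)
 also have "... = (u - l) * (2 * L)"
 proof -
  have "measure lborel (cbox (vector [-L, l]) (vector [L, u :: real] :: real^2)) = (u - l) * (2 * L)"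
   "measure lborel (cbox (vector [l, -L]) (vector [u, L :: real] :: real^2)) = (u - l) * (2 * L)"
  proof -
   have ne: "cbox (vector [-L, l]) (vector [L, u :: real] :: real^2) ~= {}" "cbox (vector [l, -L]) (vector [u, L :: real] :: real^2) ~= {}"
    using assms L0 by (simp_all add: interval_ne_empty_cart forall_2)
   show "measure lborel (cbox (vector [-L, l]) (vector [L, u :: real] :: real^2)) = (u - l) * (2 * L)"
    "measure lborel (cbox (vector [l, -L]) (vector [u, L :: real] :: real^2)) = (u - l) * (2 * L)"
    using ne by (simp_all add: content_cbox_if_cart UNIV_2)
  qed
  then show ?thesis by simp
 qed
 finally show "measure lborel (slab i l u) <= (u - l) * (2 * L)" .
qed

text \<open>Quasi-uniformity enters here: a line meets at most a multiple of \<open>1/h\<close> triangles.\<close>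

lemma line_count:
 "real (card {T\<in>X. \<exists>q\<in>T. oth i q = s}) * dd <= 8 * \<rho> * L"
proof -
 let ?Y = "{T\<in>X. \<exists>q\<in>T. oth i q = s}"
 have finY: "finite ?Y" using fin by simp
 let ?S = "slab i (s - dd) (s + dd)"
 have S: "?S \<in> sets borel" "bounded ?S" "measure lborel ?S <= (2 * dd) * (2 * L)"
  using slab[of "s - dd" "s + dd" i] dd0 by auto
 have sub: "iT T \<subseteq> ?S" if T: "T \<in> ?Y" for T
 proof
  fix p assume "p \<in> iT T"
  then have p: "p \<in> T" using iT_sub[OF smp] T by blast
  obtain q where q: "q \<in> T" "oth i q = s" using T by blast
  have "\<bar>oth i p - oth i q\<bar> <= norm (p - q)"
   using component_le_norm_cart[of "p - q" 1] component_le_norm_cart[of "p - q" 2] by (auto simp: oth_def)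
  also have "... <= dd" unfolding dd_def using dm T p q by blast
  finally show "p \<in> ?S" using q box[of T p] p T by (auto simp: slab_def)
 qed
 have mi: "measure lborel (iT T) = DT T / 2" if T: "T \<in> X" for T
 proof -
  have "measure lborel (iT T) = measure lborel T"
   using AE_iT1[OF smp[OF T]] iT_sub[OF smp[OF T]] T_compact(2)[OF smp[OF T]] itri_open
   by (intro measure_eq_AE) (auto elim!: eventually_mono)
  then show ?thesis using DT_measure[OF T] by simp
 qed
 have fm: "iT T \<in> fmeasurable lborel" if "T \<in> X" for T
 proof -
  have "bounded (iT T)" using bounded_subset[OF compact_imp_bounded[OF T_compact(1)[OF smp[OF that]]] iT_sub[OF smp[OF that]]] .
  then show ?thesis using itri_open emeasure_bounded_finite[of "iT T"] by (auto simp: fmeasurable_def)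
 qed
 have "real (card ?Y) * (dd\<^sup>2 / (2 * \<rho>)) = (\<Sum>T\<in>?Y. dd\<^sup>2 / (2 * \<rho>))" by simp
 also have "... <= (\<Sum>T\<in>?Y. measure lborel (iT T))"
 proof (rule sum_mono)
  fix T assume "T \<in> ?Y"
  then have T: "T \<in> X" by simp
  show "dd\<^sup>2 / (2 * \<rho>) <= measure lborel (iT T)"
   unfolding mi[OF T] using dd_DT[OF T] rho0 by (simp add: field_simps)
 qed
 also have "... = measure lborel (\<Union>T\<in>?Y. iT T)"
  using finY fm iT_disj by (intro measure_finite_Union[symmetric]) (auto simp: disjoint_family_on_def fmeasurable_def less_top)
 also have "... <= measure lborel ?S"
  using S sub finY itri_open emeasure_bounded_finite[OF S(2)] by (intro measure_mono_fmeasurable) (auto simp: fmeasurable_def)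
 also have "... <= (2 * dd) * (2 * L)" by (rule S(3))
 finally have "real (card ?Y) * (dd\<^sup>2 / (2 * \<rho>)) * (2 * \<rho> / dd) <= (2 * dd) * (2 * L) * (2 * \<rho> / dd)"
  using dd0 rho0 by (intro mult_right_mono) auto
 then show ?thesis using dd0 rho0 by (simp add: power2_eq_square mult_ac)
qed

definition mT :: "cell_field => (real^2) set => real" where
 "mT W T = (\<Sum>x\<in>verts T. \<Sum>y\<in>verts T - {x}. norm (Mom W x y))"

definition \<alpha>T :: "cell_field => (real^2) set => real" where
 "\<alpha>T W T = (\<Sum>x\<in>verts T. \<Sum>y\<in>verts T - {x}. norm (Am W x y))"

lemma \<alpha>T_nonneg: "0 <= \<alpha>T W T" unfolding \<alpha>T_def by (intro sum_nonneg) auto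

lemma \<alpha>T_bound:
 assumes T: "T \<in> X"
 shows "dd * \<alpha>T W T <= 180 * \<rho> * mT W T"
proof -
 have 1: "dd * norm (Am W x y) <= 3 * \<rho> * (36 * norm (Mom W x y) + 24 * norm (Mom W y x))"
  if xy: "x \<in> verts T" "y \<in> verts T" "x ~= y" for x y
 proof -
  let ?w = "36 *\<^sub>R Mom W x y + 24 *\<^sub>R Mom W y x"
  have n: "norm (y - x) > 0" using xy by simp
  have "norm (Am W x y) <= 3 * norm ?w / norm (y - x)"
   unfolding Am_def using symm_norm[OF nu_nonzero[OF xy(3)]] by (simp add: nu_norm)
  then have "dd * norm (Am W x y) <= dd * (3 * norm ?w / norm (y - x))" using dd0 by (intro mult_left_mono) auto
  also have "... <= (\<rho> * norm (y - x)) * (3 * norm ?w / norm (y - x))"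
   using edge_length[OF T xy] by (intro mult_right_mono) auto
  also have "... = 3 * \<rho> * norm ?w" using n by simp
  also have "... <= 3 * \<rho> * (36 * norm (Mom W x y) + 24 * norm (Mom W y x))"
   using rho0 norm_triangle_ineq[of "36 *\<^sub>R Mom W x y" "24 *\<^sub>R Mom W y x"] by (intro mult_left_mono) auto
  finally show ?thesis .
 qed
 have v: "vA T \<in> verts T" "vB T \<in> verts T" "vC T \<in> verts T" by (auto simp: verts_def)
 note ds = tv_distinct[OF smp[OF T]]
 have "dd * \<alpha>T W T <= 3 * \<rho> * (60 * mT W T)"
  unfolding \<alpha>T_def mT_def sum_verts_pairs[OF smp[OF T]] distrib_left
  using 1[OF v(1,2) ds(1)] 1[OF v(1,3) ds(3)] 1[OF v(2,3) ds(2)] 1[OF v(2,1) ds(1)[symmetric]] 1[OF v(3,1) ds(3)[symmetric]] 1[OF v(3,2) ds(2)[symmetric]]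
  by (simp add: algebra_simps)
 then show ?thesis by simp
qed

text \<open>By the Cauchy--Schwarz inequality, a contribution over a strip of width \<open>dd\<close> gains a factor \<open>dd\<close>.\<close>

lemma Mom_bound:
 assumes W: "poly_family m W" and xy: "norm (x - y) <= dd"
 shows "(norm (Mom W x y))\<^sup>2 <= 2 * L * dd * (\<Sum>i\<in>UNIV. LINT p|lborel. (pw W p $ i)\<^sup>2 * indicator (strip i x y) p)"
proof -
 have "(LINT p|lborel. pw W p $ i * weight i x y p)\<^sup>2 <= 2 * L * dd * (LINT p|lborel. (pw W p $ i)\<^sup>2 * indicator (strip i x y) p)" for i
 proof -
  let ?l = "min (oth i x) (oth i y)" and ?u = "max (oth i x) (oth i y)"
  let ?S = "slab i ?l ?u"
  have lu: "?l <= ?u" by simp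
  have "\<bar>oth i x - oth i y\<bar> <= norm (x - y)"
   using component_le_norm_cart[of "x - y" 1] component_le_norm_cart[of "x - y" 2] by (auto simp: oth_def)
  then have wd: "?u - ?l <= dd" using xy by linarith
  let ?f = "\<lambda>p. pw W p $ i * indicator (strip i x y) p" and ?g = "\<lambda>p. indicator ?S p * weight i x y p"
  have isq: "integrable lborel (\<lambda>p. (?g p)\<^sup>2)" and gS: "(LINT p|lborel. (?g p)\<^sup>2) <= measure lborel ?S"
  proof -
   have i: "integrable lborel (\<lambda>p. indicator ?S p :: real)"
    using slab[OF lu] emeasure_bounded_finite[of ?S] by (simp add: less_top)
   have le: "(?g p)\<^sup>2 <= indicator ?S p" for p
    using weight_le1[of i x y p] by (simp add: indicator_def power_mult_distrib abs_square_le_1)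
   show 1: "integrable lborel (\<lambda>p. (?g p)\<^sup>2)"
    using slab(1)[OF lu] weight_borel[of i x y] le
    by (intro Bochner_Integration.integrable_bound[OF i]) (auto intro!: borel_measurable_times borel_measurable_power)
   have "(LINT p|lborel. (?g p)\<^sup>2) <= (LINT p|lborel. indicator ?S p)"
    using le by (intro integral_mono 1 i)
   then show "(LINT p|lborel. (?g p)\<^sup>2) <= measure lborel ?S" using slab(1)[OF lu] by simp
  qed
  have fsq: "(?f p)\<^sup>2 = (pw W p $ i)\<^sup>2 * indicator (strip i x y) p" for p by (simp add: indicator_def)
  have if2: "integrable lborel (\<lambda>p. (pw W p $ i)\<^sup>2 * indicator (strip i x y) p)"
  proof -
   obtain B where B: "!!p. norm (pw W p) <= B" "B \<ge> 0" using pw_bounded[OF W] by blast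
   have "integrable lborel (\<lambda>p. pw W p $ i * (pw W p $ i * indicator (strip i x y) p))"
   proof (rule integrable_pw[OF W, where B=B])
    show "(\<lambda>p. pw W p $ i * indicator (strip i x y) p) \<in> borel_measurable borel"
     using vec_nth_borel[OF pw_borel[OF W]] strip_borel by (intro borel_measurable_times borel_measurable_indicator) auto
    show "\<bar>pw W p $ i * indicator (strip i x y) p\<bar> <= B" for p
     using order_trans[OF component_le_norm_cart[of "pw W p" i] B(1)] B(2) by (simp add: indicator_def)
   qed
   then show ?thesis by (simp add: power2_eq_square mult.assoc)
  qed
  have fg: "?f p * ?g p = pw W p $ i * weight i x y p" for p
  proof (cases "p \<in> \<Union>X")
   case True
   then have "\<bar>p $ 1\<bar> <= L" "\<bar>p $ 2\<bar> <= L" using box by auto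
   moreover have "weight i x y p = 0" if "p ~: strip i x y" using weight_abs[of i x y p] that by simp
   ultimately show ?thesis by (cases "p \<in> strip i x y") (auto simp: indicator_def slab_def strip_def)
  next
   case False
   then show ?thesis by (simp add: pw_zero)
  qed
  have ifg: "integrable lborel (\<lambda>p. ?f p * ?g p)"
   unfolding fg by (rule integrable_pw[OF W weight_borel weight_le1])
  have "(LINT p|lborel. ?f p * ?g p)\<^sup>2 <= (LINT p|lborel. (?f p)\<^sup>2) * (LINT p|lborel. (?g p)\<^sup>2)"
   using integral_Cauchy_Schwarz[of lborel ?f ?g] if2 isq ifg by (simp only: fsq)
  also have "... <= (LINT p|lborel. (?f p)\<^sup>2) * (2 * L * dd)"
  proof (rule mult_left_mono)
   have "(?u - ?l) * (2 * L) <= dd * (2 * L)" using wd L0 by (intro mult_right_mono) auto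
   then show "(LINT p|lborel. (?g p)\<^sup>2) <= 2 * L * dd" using gS slab(3)[OF lu, of i] by (simp add: mult_ac)
  qed (rule Bochner_Integration.integral_nonneg, simp)
  finally show ?thesis unfolding fg fsq by (simp add: mult.commute)
 qed
 then have "(\<Sum>i\<in>UNIV. (LINT p|lborel. pw W p $ i * weight i x y p)\<^sup>2) <= (\<Sum>i\<in>UNIV. 2 * L * dd * (LINT p|lborel. (pw W p $ i)\<^sup>2 * indicator (strip i x y) p))"
  by (rule sum_mono)
 moreover have "(norm (Mom W x y))\<^sup>2 = (\<Sum>i\<in>UNIV. (LINT p|lborel. pw W p $ i * weight i x y p)\<^sup>2)"
  unfolding power2_norm_eq_inner by (simp add: Mom_def inner_vec_def power2_eq_square)
 ultimately show ?thesis by (simp add: sum_distrib_left)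
qed

lemma integrable_pw_sq:
 assumes W: "poly_family m W"
 shows "integrable lborel (\<lambda>p. (pw W p $ i)\<^sup>2)" "integrable lborel (\<lambda>p. (norm (pw W p))\<^sup>2)"
proof -
 obtain B where B: "!!p. norm (pw W p) <= B" "B \<ge> 0" using pw_bounded[OF W] by blast
 have *: "integrable lborel (\<lambda>p. (pw W p $ i)\<^sup>2)" for i
  using integrable_pw[OF W vec_nth_borel[OF pw_borel[OF W]], of i B i] order_trans[OF component_le_norm_cart B(1)]
  by (simp add: power2_eq_square)
 show "integrable lborel (\<lambda>p. (pw W p $ i)\<^sup>2)" by (rule *)
 have "(norm (pw W p))\<^sup>2 = (pw W p $ 1)\<^sup>2 + (pw W p $ 2)\<^sup>2" for p
  unfolding power2_norm_eq_inner by (simp add: inner_vec_def sum_2 power2_eq_square)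
 then show "integrable lborel (\<lambda>p. (norm (pw W p))\<^sup>2)" using *[of 1] *[of 2] by simp
qed

lemma strip_sum: "(\<Sum>T\<in>X. \<Sum>x\<in>verts T. \<Sum>y\<in>verts T - {x}. indicator (strip i x y) p :: real) * dd <= 48 * \<rho> * L"
proof -
 let ?Y = "{T\<in>X. \<exists>q\<in>T. oth i q = oth i p}"
 have "(\<Sum>x\<in>verts T. \<Sum>y\<in>verts T - {x}. indicator (strip i x y) p :: real) <= (if T \<in> ?Y then 6 else 0)" if T: "T \<in> X" for T
 proof (cases "T \<in> ?Y")
  case True
  then show ?thesis unfolding sum_verts_pairs[OF smp[OF T]] by (auto simp: indicator_def)
 next
  case False
  have "indicator (strip i x y) p = (0::real)" if xy: "x \<in> verts T" "y \<in> verts T" for x y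
  proof -
   have "p ~: strip i x y"
   proof
    assume "p \<in> strip i x y"
    then have r: "min (oth i x) (oth i y) <= oth i p" "oth i p <= max (oth i x) (oth i y)" by (auto simp: strip_def)
    have "closed_segment x y \<subseteq> T"
     using verts_in[OF T] xy T_compact(3)[OF smp[OF T]] by (simp add: closed_segment_subset)
    moreover have "\<exists>q\<in>closed_segment x y. oth i q = oth i p"
    proof -
     have "connected (oth i ` closed_segment x y)"
      by (intro connected_continuous_image continuous_on_subset[OF oth_cont] connected_segment) auto
     then have "is_interval (oth i ` closed_segment x y)" by (simp add: is_interval_connected_1)
     moreover have "oth i x \<in> oth i ` closed_segment x y" "oth i y \<in> oth i ` closed_segment x y" by auto
     ultimately have "oth i p \<in> oth i ` closed_segment x y"
      using r unfolding is_interval_1 by (cases "oth i x <= oth i y") (auto simp: min_def max_def)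
     then show ?thesis by auto
    qed
    ultimately show False using False T by blast
   qed
   then show ?thesis by simp
  qed
  then show ?thesis using False by (auto intro!: sum_nonpos)
 qed
 then have "(\<Sum>T\<in>X. \<Sum>x\<in>verts T. \<Sum>y\<in>verts T - {x}. indicator (strip i x y) p :: real) <= (\<Sum>T\<in>X. if T \<in> ?Y then 6 else 0)"
  by (rule sum_mono)
 also have "... = 6 * real (card ?Y)"
 proof -
  have "X \<inter> {T. T \<in> ?Y} = ?Y" by blast
  then show ?thesis using sum.If_cases[OF fin, of "\<lambda>T. T \<in> ?Y" "\<lambda>_. 6::real" "\<lambda>_. 0"] by simp
 qed
 finally have "(\<Sum>T\<in>X. \<Sum>x\<in>verts T. \<Sum>y\<in>verts T - {x}. indicator (strip i x y) p :: real) * dd <= 6 * real (card ?Y) * dd"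
  using dd0 by (intro mult_right_mono) auto
 also have "... <= 48 * \<rho> * L" using mult_left_mono[OF line_count[of i "oth i p"], of 6] by (simp add: mult_ac)
 finally show ?thesis .
qed

text \<open>The factor gained in \<open>Mom_bound\<close> compensates for the overlap of the strips counted in \<open>strip_sum\<close>.\<close>

lemma mT_sum_bound:
 assumes W: "poly_family m W"
 shows "(\<Sum>T\<in>X. (mT W T)\<^sup>2) <= 576 * \<rho> * L\<^sup>2 * (LINT p|lborel. (norm (pw W p))\<^sup>2)"
proof -
 let ?I = "\<lambda>i x y. LINT p|lborel. (pw W p $ i)\<^sup>2 * indicator (strip i x y) p"
 have ii: "integrable lborel (\<lambda>p. (pw W p $ i)\<^sup>2 * indicator (strip i x y) p)" for i x y
  using integrable_real_mult_indicator[OF _ integrable_pw_sq(1)[OF W, of i], of "strip i x y"] strip_borel by (simp add: mult.commute)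
 have 1: "(mT W T)\<^sup>2 <= (\<Sum>x\<in>verts T. \<Sum>y\<in>verts T - {x}. 12 * L * dd * (\<Sum>i\<in>UNIV. ?I i x y))" if T: "T \<in> X" for T
 proof -
  have "(mT W T)\<^sup>2 <= (\<Sum>x\<in>verts T. \<Sum>y\<in>verts T - {x}. 6 * (norm (Mom W x y))\<^sup>2)"
   unfolding mT_def sum_verts_pairs[OF smp[OF T]] by (rule order_trans[OF sum6_square]) simp
  also have "... <= (\<Sum>x\<in>verts T. \<Sum>y\<in>verts T - {x}. 12 * L * dd * (\<Sum>i\<in>UNIV. ?I i x y))"
  proof (intro sum_mono)
   fix x y assume xy: "x \<in> verts T" "y \<in> verts T - {x}"
   show "6 * (norm (Mom W x y))\<^sup>2 <= 12 * L * dd * (\<Sum>i\<in>UNIV. ?I i x y)"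
    using Mom_bound[OF W, of x y] verts_diam[OF T, of x y] xy by simp
  qed
  finally show ?thesis .
 qed
 have "(\<Sum>T\<in>X. (mT W T)\<^sup>2) <= (\<Sum>T\<in>X. \<Sum>x\<in>verts T. \<Sum>y\<in>verts T - {x}. 12 * L * dd * (\<Sum>i\<in>UNIV. ?I i x y))"
  by (rule sum_mono[OF 1])
 also have "... = 12 * L * (\<Sum>i\<in>UNIV. \<Sum>T\<in>X. \<Sum>x\<in>verts T. \<Sum>y\<in>verts T - {x}. dd * ?I i x y)"
  by (simp add: sum_distrib_left sum_2 sum.distrib distrib_left mult_ac)
 also have "(\<Sum>i\<in>UNIV. \<Sum>T\<in>X. \<Sum>x\<in>verts T. \<Sum>y\<in>verts T - {x}. dd * ?I i x y)
   = (\<Sum>i\<in>UNIV. LINT p|lborel. (pw W p $ i)\<^sup>2 * ((\<Sum>T\<in>X. \<Sum>x\<in>verts T. \<Sum>y\<in>verts T - {x}. indicator (strip i x y) p) * dd))"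
  using ii by (simp add: sum_distrib_left sum_distrib_right mult_ac)
 also have "... <= (\<Sum>i\<in>UNIV. LINT p|lborel. (pw W p $ i)\<^sup>2 * (48 * \<rho> * L))"
 proof (intro sum_mono integral_mono)
  fix i :: 2
  have "integrable lborel (\<lambda>p. dd * (\<Sum>T\<in>X. \<Sum>x\<in>verts T. \<Sum>y\<in>verts T - {x}. (pw W p $ i)\<^sup>2 * indicator (strip i x y) p))"
   using ii by simp
  then show "integrable lborel (\<lambda>p. (pw W p $ i)\<^sup>2 * ((\<Sum>T\<in>X. \<Sum>x\<in>verts T. \<Sum>y\<in>verts T - {x}. indicator (strip i x y) p) * dd))"
   by (simp add: sum_distrib_left sum_distrib_right mult_ac)
  show "integrable lborel (\<lambda>p. (pw W p $ i)\<^sup>2 * (48 * \<rho> * L))" using integrable_pw_sq(1)[OF W, of i] by simp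
 qed (use strip_sum in \<open>auto intro!: mult_left_mono\<close>)
 also have "... = 48 * \<rho> * L * (LINT p|lborel. (norm (pw W p))\<^sup>2)"
 proof -
  have "(norm (pw W p))\<^sup>2 = (pw W p $ 1)\<^sup>2 + (pw W p $ 2)\<^sup>2" for p
   unfolding power2_norm_eq_inner by (simp add: inner_vec_def sum_2 power2_eq_square)
  then show ?thesis using integrable_pw_sq(1)[OF W] by (simp add: sum_2 distrib_left mult.commute)
 qed
 finally show ?thesis using L0 by (simp add: power2_eq_square mult_ac)
qed

end

section \<open>Sums of directional fields\<close>

text \<open>Borel functions that are bounded on a set; on a bounded set they are square-integrable.\<close>

definition bb :: "'a::euclidean_space set => ('a => 'b::euclidean_space) => bool" where
 "bb U f \<longleftrightarrow> f \<in> borel_measurable borel \<and> (\<exists>B. \<forall>x\<in>U. norm (f x) <= B)"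

lemma bbI: "f \<in> borel_measurable borel ==> (!!x. x \<in> U ==> norm (f x) <= B) ==> bb U f"
 unfolding bb_def by blast

lemma bb_borel: "bb U f ==> f \<in> borel_measurable borel"
 unfolding bb_def by blast

lemma bb_const: "bb U (\<lambda>_. c)"
 by (rule bbI[where B="norm c"]) auto

lemma bb_add: "bb U f ==> bb U g ==> bb U (\<lambda>x. f x + g x)"
proof -
 assume f: "bb U f" and g: "bb U g"
 obtain B B' where B: "!!x. x \<in> U ==> norm (f x) <= B" "!!x. x \<in> U ==> norm (g x) <= B'"
  using f g unfolding bb_def by blast
 show ?thesis
  using f g B by (intro bbI[where B="B + B'"] borel_measurable_add norm_triangle_mono) (auto simp: bb_def)
qed

lemma bb_scaleR: "bb U f ==> bb U g ==> bb U (\<lambda>x. f x *\<^sub>R g x)"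
proof -
 assume f: "bb U f" and g: "bb U g"
 obtain B B' where B: "!!x. x \<in> U ==> norm (f x) <= B" "!!x. x \<in> U ==> norm (g x) <= B'"
  using f g unfolding bb_def by blast
 show ?thesis
 proof (rule bbI[where B="B * B'"])
  show "(\<lambda>x. f x *\<^sub>R g x) \<in> borel_measurable borel"
   using f g by (intro borel_measurable_scaleR) (auto simp: bb_def)
  fix x assume x: "x \<in> U"
  have "0 <= B" using B(1)[OF x] norm_ge_zero[of "f x"] by linarith
  then show "norm (f x *\<^sub>R g x) <= B * B'" using B[OF x] by (simp add: mult_mono)
 qed
qed

lemma bb_mult: "bb U f ==> bb U g ==> bb U (\<lambda>x. f x * g x :: real)"
 using bb_scaleR[of U f g] by simp

lemma bb_sum: "(!!a. a \<in> A ==> bb U (f a)) ==> bb U (\<lambda>x. \<Sum>a\<in>A. f a x)"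
proof (induction A rule: infinite_finite_induct)
 case (insert a A)
 then show ?case using bb_add[of U "f a" "\<lambda>x. \<Sum>a\<in>A. f a x"] by simp
qed (simp_all add: bb_const)

lemma bb_L2: "bb U f ==> U \<in> sets borel ==> bounded U ==> f \<in> L2 U"
 unfolding bb_def using bounded_borel_L2 by blast

lemma dlip_bb: "dlip U t f D ==> bb U f" "dlip U t f D ==> bb U D"
 unfolding dlip_def bb_def by force+

lemma bb_vec_nth: "bb U f ==> bb U (\<lambda>x. f x $ i)" for f :: "_ => ('b::euclidean_space)^'n"
proof -
 assume f: "bb U f"
 obtain B where B: "!!x. x \<in> U ==> norm (f x) <= B" using f unfolding bb_def by blast
 show ?thesis
  using B order_trans[OF Finite_Cartesian_Product.norm_nth_le]
  by (intro bbI[where B=B] vec_nth_borel bb_borel[OF f]) blast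
qed

text \<open>Finite superpositions of directional fields: a field \<open>f p *\<^sub>R t\<close> along a fixed direction
  \<open>t\<close> has the divergence \<open>D\<close> if \<open>f\<close> is Lipschitz along \<open>t\<close> with derivative \<open>D\<close>. All fields constructed below are sums of such fields.\<close>

inductive flux :: "'a::euclidean_space set => ('a => 'a) => ('a => real) => bool" for U where
 flux_atom: "dlip U t f D ==> flux U (\<lambda>p. f p *\<^sub>R t) D"
| flux_zero: "flux U (\<lambda>_. 0) (\<lambda>_. 0)"
| flux_add: "flux U F g ==> flux U F' g' ==> flux U (\<lambda>p. F p + F' p) (\<lambda>p. g p + g' p)"

lemma flux_sum: "(!!a. a \<in> A ==> flux U (F a) (g a)) ==> flux U (\<lambda>p. \<Sum>a\<in>A. F a p) (\<lambda>p. \<Sum>a\<in>A. g a p)"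
proof (induction A rule: infinite_finite_induct)
 case (insert a A)
 then show ?case using flux_add[of U "F a" "g a" "\<lambda>x. \<Sum>a\<in>A. F a x" "\<lambda>x. \<Sum>a\<in>A. g a x"] by simp
qed (simp_all add: flux_zero)

lemma flux_bb: "flux U F g ==> bb U F" "flux U F g ==> bb U g"
 by (induction rule: flux.induct) (auto intro: bb_add bb_const bb_scaleR dlip_bb)

lemma flux_weak_derivative:
 assumes "flux U F g" "open U" "\<phi> \<in> test_functions U"
 shows "integrable lborel (\<lambda>x. indicator U x * (F x \<bullet> grad \<phi> x)) \<and> integrable lborel (\<lambda>x. indicator U x * (g x * \<phi> x))
  \<and> (LINT x|lborel. indicator U x * (F x \<bullet> grad \<phi> x)) = - (LINT x|lborel. indicator U x * (g x * \<phi> x))"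
 using assms(1)
proof (induction rule: flux.induct)
 case (flux_atom t f D)
 have "(f x *\<^sub>R t) \<bullet> grad \<phi> x = f x * (grad \<phi> x \<bullet> t)" for x
  by (simp add: inner_commute)
 then show ?case using dlip_weak_derivative[OF assms(2) flux_atom assms(3)] by (simp only: simp_thms)
next
 case (flux_add F g F' g')
 then show ?case by (simp add: inner_add_left distrib_left distrib_right)
qed simp

lemma test_function_borel:
 assumes "\<phi> \<in> test_functions U"
 shows "\<phi> \<in> borel_measurable borel" "grad \<phi> \<in> borel_measurable borel"
proof -
 have "continuous_on UNIV \<phi>" using test_function_C1(1)[OF assms]
  by (simp add: continuous_on_eq_continuous_at differentiable_imp_continuous_within)
 then show "\<phi> \<in> borel_measurable borel" by (rule borel_measurable_continuous_onI)
 have "continuous_on UNIV (grad \<phi>)" unfolding grad_def[abs_def]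
  using test_function_C1(2)[OF assms] by (intro continuous_on_sum continuous_on_scaleR continuous_on_const)
 then show "grad \<phi> \<in> borel_measurable borel" by (rule borel_measurable_continuous_onI)
qed

lemma flux_weak_div:
 assumes F: "flux U F g" and U: "open U" and g': "g' \<in> borel_measurable borel" "AE x in lborel. x \<in> U --> g x = g' x"
 shows "is_weak_div U F g'"
 unfolding is_weak_div_def
proof
 fix \<phi> assume \<phi>: "\<phi> \<in> test_functions U"
 note b = test_function_borel[OF \<phi>] bb_borel[OF flux_bb(1)[OF F]] bb_borel[OF flux_bb(2)[OF F]]
 have Ub: "U \<in> sets borel" using U by simp
 have m: "(\<lambda>x. F x \<bullet> grad \<phi> x) \<in> borel_measurable borel" "(\<lambda>x. g' x * \<phi> x) \<in> borel_measurable borel"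
  using b g' by (auto intro: borel_measurable_inner borel_measurable_times)
 have "(LINT x|lborel. indicator U x * (g x * \<phi> x)) = (LINT x|lborel. indicator U x * (g' x * \<phi> x))"
 proof (rule integral_cong_AE)
  show "(\<lambda>x. indicator U x * (g x * \<phi> x)) \<in> borel_measurable lborel" "(\<lambda>x. indicator U x * (g' x * \<phi> x)) \<in> borel_measurable lborel"
   using b g'(1) Ub by (auto intro!: borel_measurable_times borel_measurable_indicator)
  show "AE x in lborel. indicator U x * (g x * \<phi> x) = indicator U x * (g' x * \<phi> x)"
   using g'(2) by eventually_elim (simp add: indicator_def)
 qed
 then show "(LINT x|lebesgue_on U. F x \<bullet> grad \<phi> x) = - (LINT x|lebesgue_on U. g' x * \<phi> x)"
  using flux_weak_derivative[OF F U \<phi>] integral_lebesgue_on_borel(1)[OF m(1) Ub] integral_lebesgue_on_borel(1)[OF m(2) Ub] by simp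
qed

section \<open>A right inverse of the plane divergence\<close>

context
 fixes k C Q a b c
 assumes Q: "bubble_inverse k C Q" and nz: "area2 a b c ~= 0"
begin

private lemmas P = Q[unfolded bubble_inverse_def, THEN spec[where x=a], THEN spec[where x=b], THEN spec[where x=c], THEN mp, OF nz]

lemma bubble_inverse_poly: "Q a b c f i \<in> Pxy k"
 by (rule P[THEN conjunct1, THEN spec, THEN spec])

lemma bubble_inverse_div:
 assumes "!!i. (\<lambda>p. f p $ i) \<in> Pxy (k + 1)" "!!\<alpha> \<beta> \<kappa>. tint a b c (\<lambda>p. f p \<bullet> rm \<alpha> \<beta> \<kappa> p) = 0" "p \<in> itri a b c"
 shows "f p = dbub a b c (Q a b c f 1) p *\<^sub>R (b - a) + dbub a c b (Q a b c f 2) p *\<^sub>R (c - a) + dbub b c a (Q a b c f 3) p *\<^sub>R (c - b)"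
 by (rule P[THEN conjunct2, THEN conjunct1, THEN spec[where x=f], THEN mp, THEN mp, THEN bspec[where x=p]]; (intro allI)?; rule assms)

lemma bubble_inverse_lin:
 fixes J :: "'j set"
 assumes J: "finite J" "!!j. j \<in> J ==> cont (f j)"
 shows "Q a b c (\<lambda>p. \<Sum>j\<in>J. x j *\<^sub>R f j p) i p = (\<Sum>j\<in>J. x j * Q a b c (f j) i p)"
proof -
 obtain e where e: "bij_betw e {..<card J} J" using ex_bij_betw_nat_finite[OF J(1)] by (auto simp: lessThan_atLeast0)
 have 1: "(\<Sum>j\<in>J. x j *\<^sub>R f j p) = (\<Sum>n\<in>{..<card J}. x (e n) *\<^sub>R f (e n) p)" for p
  by (rule sum.reindex_bij_betw[OF e, symmetric])
 have ec: "\<forall>n\<in>{..<card J}. cont (f (e n))" using J(2) bij_betwE[OF e] by blast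
 have "Q a b c (\<lambda>p. \<Sum>n\<in>{..<card J}. x (e n) *\<^sub>R f (e n) p) i p = (\<Sum>n\<in>{..<card J}. x (e n) * Q a b c (f (e n)) i p)"
  by (rule P[THEN conjunct2, THEN conjunct2, THEN conjunct1, THEN spec[where x="{..<card J}"], THEN spec[where x="\<lambda>n. x (e n)"],
   THEN spec[where x="\<lambda>n. f (e n)"], THEN spec[where x=i], THEN spec[where x=p], THEN mp, THEN mp, OF finite_lessThan ec])
 also have "... = (\<Sum>j\<in>J. x j * Q a b c (f j) i p)" by (rule sum.reindex_bij_betw[OF e])
 finally show ?thesis unfolding 1 .
qed

lemma bubble_inverse_bound:
 assumes "p \<in> tri a b c" "cont f" "norm (b - a) <= d" "norm (c - a) <= d"
 shows "(Q a b c f i p)\<^sup>2 <= C * (d\<^sup>2 / \<bar>area2 a b c\<bar> ^ 3 * tint a b c (\<lambda>p. (norm (f p))\<^sup>2))"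
 by (rule P[THEN conjunct2, THEN conjunct2, THEN conjunct2, THEN spec[where x=f], THEN spec[where x=d], THEN spec[where x=i],
  THEN bspec[where x=p], THEN mp, THEN mp, THEN mp, OF assms])

end

locale bubble_mesh = mesh2 +
 fixes k :: nat and C :: real and Q :: "real^2 => real^2 => real^2 => (real^2 => real^2) => nat => real^2 => real"
 assumes k1: "k \<ge> 1" and C0: "C \<ge> 0" and Q: "bubble_inverse k C Q"
begin

definition QT :: "cell_field => (real^2) set => nat => real^2 => real" where
 "QT W T e = Q (vA T) (vB T) (vC T) (resT W T) e"

definition q3 :: "real^2 => real^2 => real^2 => real" where
 "q3 x y p = phi x p * phi x p * phi y p"

definition dq3 :: "real^2 => real^2 => real^2 => real^2 => real" where
 "dq3 t x y p = (dphi t x p * phi x p + phi x p * dphi t x p) * phi y p + phi x p * phi x p * dphi t y p"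

lemma dlip_q3: "dlip U t (q3 x y) (dq3 t x y)"
 unfolding q3_def[abs_def] dq3_def[abs_def] by (intro dlip_mult dlip_phi)

definition tauc :: "cell_field => real^2 => real^2^2" where
 "tauc W p = (\<Sum>x\<in>Vs. \<Sum>y\<in>Vs - {x}. q3 x y p *\<^sub>R Am W x y)"

definition bT :: "cell_field => (real^2) set => real^2 => real^2^2" where
 "bT W T p = bub (vA T) (vB T) (vC T) (QT W T 1) p *\<^sub>R outer (vB T - vA T)
   + bub (vA T) (vC T) (vB T) (QT W T 2) p *\<^sub>R outer (vC T - vA T)
   + bub (vB T) (vC T) (vA T) (QT W T 3) p *\<^sub>R outer (vC T - vB T)"

definition taub :: "cell_field => real^2 => real^2^2" where
 "taub W p = (\<Sum>T\<in>X. bT W T p)"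

text \<open>The right inverse: a continuous part that carries the rigid motion moments, and a bubble correction of the residual.\<close>

definition S :: "cell_field => real^2 => real^2^2" where
 "S W p = tauc W p + taub W p"

lemma nzT: "T \<in> X ==> area2 (vA T) (vB T) (vC T) ~= 0" "T \<in> X ==> area2 (vA T) (vC T) (vB T) ~= 0" "T \<in> X ==> area2 (vB T) (vC T) (vA T) ~= 0"
 using tv_nz[OF smp, of T] area2_rot[where a="vA T" and b="vB T" and c="vC T"] by auto

lemma triT: "T \<in> X ==> tri (vA T) (vB T) (vC T) = T" "T \<in> X ==> tri (vA T) (vC T) (vB T) = T" "T \<in> X ==> tri (vB T) (vC T) (vA T) = T"
 using tv(2)[OF smp, of T] tri_rot[where a="vA T" and b="vB T" and c="vC T"] by auto

lemma QT_Pxy: "T \<in> X ==> QT W T e \<in> Pxy k"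
 unfolding QT_def by (rule bubble_inverse_poly[OF Q nzT(1)])

lemma flux_tauc:
 "flux U (\<lambda>p. tauc W p $ i) (\<lambda>p. \<Sum>x\<in>Vs. \<Sum>y\<in>Vs - {x}. \<Sum>j\<in>UNIV. Am W x y $ i $ j * dq3 (axis j 1) x y p)"
proof -
 have "flux U (\<lambda>p. \<Sum>x\<in>Vs. \<Sum>y\<in>Vs - {x}. \<Sum>j\<in>UNIV. (Am W x y $ i $ j * q3 x y p) *\<^sub>R axis j 1)
   (\<lambda>p. \<Sum>x\<in>Vs. \<Sum>y\<in>Vs - {x}. \<Sum>j\<in>UNIV. Am W x y $ i $ j * dq3 (axis j 1) x y p)"
  by (intro flux_sum flux.flux_atom dlip_cmul dlip_q3)
 moreover have "(\<Sum>x\<in>Vs. \<Sum>y\<in>Vs - {x}. \<Sum>j\<in>UNIV. (Am W x y $ i $ j * q3 x y p) *\<^sub>R axis j 1) = tauc W p $ i" for p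
 proof -
  have "(\<Sum>j\<in>UNIV. (A $ i $ j * r) *\<^sub>R axis j 1) = (r *\<^sub>R A) $ i" for A :: "real^2^2" and r
   by (simp add: vec_eq_iff forall_2 sum_2 axis_def)
  then show ?thesis by (simp add: tauc_def)
 qed
 ultimately show ?thesis by simp
qed

lemma flux_bT:
 assumes T: "T \<in> X"
 shows "flux U (\<lambda>p. bT W T p $ i) (\<lambda>p. (vB T - vA T) $ i * (indicator T p * dbub (vA T) (vB T) (vC T) (QT W T 1) p)
   + (vC T - vA T) $ i * (indicator T p * dbub (vA T) (vC T) (vB T) (QT W T 2) p)
   + (vC T - vB T) $ i * (indicator T p * dbub (vB T) (vC T) (vA T) (QT W T 3) p))"
proof -
 have 1: "flux U (\<lambda>p. ((b - a) $ i * bub a b c g p) *\<^sub>R (b - a)) (\<lambda>p. (b - a) $ i * (indicator (tri a b c) p * dbub a b c g p))"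
  if "area2 a b c ~= 0" "g \<in> Pxy k" for a b c g
  by (intro flux.flux_atom dlip_cmul dlip_bub[OF that U(2)])
 have o: "outer t $ i = t $ i *\<^sub>R t" for t :: "real^2" by (simp add: outer_def vec_eq_iff)
 show ?thesis
  using flux.flux_add[OF flux.flux_add[OF 1[OF nzT(1)[OF T] QT_Pxy[OF T, of W 1]] 1[OF nzT(2)[OF T] QT_Pxy[OF T, of W 2]]] 1[OF nzT(3)[OF T] QT_Pxy[OF T, of W 3]]]
  by (simp add: bT_def o triT[OF T] mult.commute)
qed

lemma divc_eq:
 assumes T: "T \<in> X" and p: "p \<in> iT T"
 shows "(\<Sum>x\<in>Vs. \<Sum>y\<in>Vs - {x}. \<Sum>j\<in>UNIV. Am W x y $ i $ j * dq3 (axis j 1) x y p) = divc W T p $ i"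
proof -
 have pT: "p \<in> T" using p iT_sub[OF smp[OF T]] by blast
 have d: "dphi t x p = gT T x \<bullet> t" for t x
  using sum_iT[OF T p, of "\<lambda>T. gT T x \<bullet> t"] by (simp add: dphi_def)
 have z: "lamT T x p = 0" "gT T x = 0" if "x ~: verts T" for x
  using that by (auto simp: lamT_def gT_def verts_def)
 define F where "F x y = (\<Sum>j\<in>UNIV. Am W x y $ i $ j * dq3 (axis j 1) x y p)" for x y
 have F: "F x y = (Am W x y *v gq T x y p) $ i" for x y
  unfolding F_def dq3_def d phi_eq[OF T pT]
  by (simp add: gq_def matrix_vector_mult_def sum_2 inner_axis power2_eq_square algebra_simps)
 have sub: "verts T \<subseteq> Vs" using T by (auto simp: Vs_def)
 have F0: "F x y = 0" if "x ~: verts T \<or> y ~: verts T" for x y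
  using that z unfolding F by (auto simp: gq_def)
 have "(\<Sum>x\<in>Vs. \<Sum>y\<in>Vs - {x}. F x y) = (\<Sum>x\<in>verts T. \<Sum>y\<in>Vs - {x}. F x y)"
  using sub finVs F0 by (intro sum.mono_neutral_right) auto
 also have "... = (\<Sum>x\<in>verts T. \<Sum>y\<in>verts T - {x}. F x y)"
  using sub finVs F0 by (intro sum.cong refl sum.mono_neutral_right) auto
 finally show ?thesis unfolding F_def[symmetric] by (simp add: F divc_def)
qed

definition divS :: "cell_field => 2 => real^2 => real" where
 "divS W i p = (\<Sum>x\<in>Vs. \<Sum>y\<in>Vs - {x}. \<Sum>j\<in>UNIV. Am W x y $ i $ j * dq3 (axis j 1) x y p)
  + (\<Sum>T\<in>X. (vB T - vA T) $ i * (indicator T p * dbub (vA T) (vB T) (vC T) (QT W T 1) p)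
   + (vC T - vA T) $ i * (indicator T p * dbub (vA T) (vC T) (vB T) (QT W T 2) p)
   + (vC T - vB T) $ i * (indicator T p * dbub (vB T) (vC T) (vA T) (QT W T 3) p))"

lemma flux_S: "flux U (\<lambda>p. S W p $ i) (divS W i)"
proof -
 have "flux U (\<lambda>p. tauc W p $ i + (\<Sum>T\<in>X. bT W T p $ i)) (divS W i)"
  unfolding divS_def[abs_def] by (intro flux.flux_add flux_tauc flux_sum flux_bT)
 then show ?thesis by (simp add: S_def taub_def)
qed

lemma AE_only: "AE p in lborel. \<forall>T\<in>X. p \<in> T --> p \<in> iT T \<and> (\<forall>T'\<in>X. T' ~= T --> p ~: T')"
 using AE_iT
proof eventually_elim
 case (elim p)
 then show ?case using iT_disj by blast
qed

lemma sum_only: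
 fixes f :: "_ => 'v::comm_monoid_add"
 assumes "T \<in> X" "!!T'. T' \<in> X ==> T' ~= T ==> f T' = 0"
 shows "(\<Sum>T\<in>X. f T) = f T"
proof -
 have "(\<Sum>T\<in>X. f T) = (\<Sum>T'\<in>X. if T' = T then f T else 0)" using assms by (intro sum.cong) auto
 then show ?thesis using assms(1) fin by simp
qed

text \<open>Inside a triangle the edge fields contribute \<open>divc\<close>, and the bubbles contribute the residual by \<open>resT_orthogonal\<close>.\<close>

lemma divS_pw:
 assumes W: "poly_family (k + 1) W"
 shows "AE p in lborel. p \<in> U --> divS W i p = pw W p $ i"
 using AE_only
proof eventually_elim
 case (elim p)
 show ?case
 proof
  assume "p \<in> U"
  then obtain T where T: "T \<in> X" "p \<in> T" using U_sub by blast
  have p1: "p \<in> iT T" using elim T by blast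
  have p2: "p ~: T'" if "T' \<in> X" "T' ~= T" for T' using elim T that by blast
  note p = p1 p2
  let ?G = "\<lambda>T. (vB T - vA T) $ i * (indicator T p * dbub (vA T) (vB T) (vC T) (QT W T 1) p)
   + (vC T - vA T) $ i * (indicator T p * dbub (vA T) (vC T) (vB T) (QT W T 2) p)
   + (vC T - vB T) $ i * (indicator T p * dbub (vB T) (vC T) (vA T) (QT W T 3) p)"
  have "(\<Sum>T\<in>X. ?G T) = ?G T" by (rule sum_only[OF T(1)]) (simp add: p2)
  moreover have "resT W T p = dbub (vA T) (vB T) (vC T) (QT W T 1) p *\<^sub>R (vB T - vA T) + dbub (vA T) (vC T) (vB T) (QT W T 2) p *\<^sub>R (vC T - vA T)
    + dbub (vB T) (vC T) (vA T) (QT W T 3) p *\<^sub>R (vC T - vB T)"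
   unfolding QT_def
  proof (rule bubble_inverse_div[OF Q nzT(1)[OF T(1)] _ _ p1])
   show "(\<lambda>p. resT W T p $ i) \<in> Pxy (k + 1)" for i using k1 by (intro resT_Pxy[OF W _ T(1)]) simp
   show "tint (vA T) (vB T) (vC T) (\<lambda>p. resT W T p \<bullet> rm \<alpha> \<beta> \<kappa> p) = 0" for \<alpha> \<beta> \<kappa>
    by (rule resT_orthogonal[OF W T(1)])
  qed
  then have "?G T = resT W T p $ i" using T(2) by (simp add: mult.commute)
  ultimately show "divS W i p = pw W p $ i"
   unfolding divS_def divc_eq[OF T(1) p(1)] pw_eq[OF T(1) p(1)] by (simp add: resT_def)
 qed
qed

lemma tauc_eq:
 assumes T: "T \<in> X" and p: "p \<in> T"
 shows "tauc W p = (\<Sum>x\<in>verts T. \<Sum>y\<in>verts T - {x}. (lamT T x p * lamT T x p * lamT T y p) *\<^sub>R Am W x y)"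
proof -
 define F where "F x y = q3 x y p *\<^sub>R Am W x y" for x y
 have F: "F x y = (lamT T x p * lamT T x p * lamT T y p) *\<^sub>R Am W x y" for x y
  unfolding F_def q3_def phi_eq[OF T p] ..
 have sub: "verts T \<subseteq> Vs" using T by (auto simp: Vs_def)
 have F0: "F x y = 0" if "x ~: verts T \<or> y ~: verts T" for x y
  using that lamT_zero[OF smp[OF T]] unfolding F by auto
 have "(\<Sum>x\<in>Vs. \<Sum>y\<in>Vs - {x}. F x y) = (\<Sum>x\<in>verts T. \<Sum>y\<in>Vs - {x}. F x y)"
  using sub finVs F0 by (intro sum.mono_neutral_right) auto
 also have "... = (\<Sum>x\<in>verts T. \<Sum>y\<in>verts T - {x}. F x y)"
  using sub finVs F0 by (intro sum.cong refl sum.mono_neutral_right) auto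
 finally show ?thesis unfolding tauc_def F_def[symmetric] by (simp only: F)
qed

lemma Am_sym: "Am W x y $ i $ j = Am W x y $ j $ i"
 using arg_cong[OF symm_transpose, of "\<lambda>A. A $ i $ j"] by (simp add: Am_def transpose_def)

lemma outer_sym: "outer t $ i $ j = outer t $ j $ i" by (simp add: outer_def)

lemma tauc_sym: "tauc W p $ i $ j = tauc W p $ j $ i"
 by (simp add: tauc_def Am_sym[of W _ _ i j])

lemma S_sym: "S W p $ i $ j = S W p $ j $ i"
 by (simp add: S_def tauc_sym[of W p i j] taub_def bT_def outer_sym[of _ i j])

lemma U_borel: "U \<in> sets borel" using U by simp

lemma bb_tauc: "bb U (tauc W)"
 unfolding tauc_def[abs_def] by (intro bb_sum bb_scaleR bb_const dlip_bb(1)[OF dlip_q3[of 0]])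

lemma bb_bub: "area2 a b c ~= 0 ==> g \<in> Pxy m ==> bb V (bub a b c g)"
proof -
 assume g: "area2 a b c ~= 0" "g \<in> Pxy m"
 have "bounded (tri a b c)" using tri_compact[OF g(1)] compact_imp_bounded by blast
 then have "bb (tri a b c) (bub a b c g)" by (rule dlip_bb(1)[OF dlip_bub[OF g]])
 then obtain B where B: "bub a b c g \<in> borel_measurable borel" "!!p. p \<in> tri a b c ==> norm (bub a b c g p) <= B" unfolding bb_def by blast
 show ?thesis
 proof (rule bbI[OF B(1), where B="\<bar>B\<bar>"])
  fix p show "norm (bub a b c g p) <= \<bar>B\<bar>" using B(2)[of p] by (cases "p \<in> tri a b c") (auto simp: bub_def)
 qed
qed

lemma bb_bT: "T \<in> X ==> bb V (bT W T)"
 unfolding bT_def[abs_def] by (intro bb_add bb_scaleR bb_const bb_bub[OF nzT(1) QT_Pxy] bb_bub[OF nzT(2) QT_Pxy] bb_bub[OF nzT(3) QT_Pxy])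

lemma bb_phi: "bb V (phi x)"
 using phi01 by (intro bbI[OF phi_borel, where B=1]) simp

lemma bb_S: "bb V (S W)"
 unfolding S_def[abs_def] tauc_def taub_def q3_def by (intro bb_add bb_sum bb_scaleR bb_mult bb_const bb_phi bb_bT)

lemma S_zero: "p ~: \<Union>X ==> S W p = 0"
proof -
 assume p: "p ~: \<Union>X"
 have "phi x p = 0" for x using p by (auto simp: phi_def)
 moreover have "bT W T p = 0" if "T \<in> X" for T using p that triT[OF that] by (auto simp: bT_def bub_def)
 ultimately show ?thesis by (simp add: S_def tauc_def q3_def taub_def)
qed

lemma bb_pw: "poly_family m W ==> bb V (pw W)"
proof -
 assume W: "poly_family m W"
 obtain B where "!!p. norm (pw W p) <= B" using pw_bounded[OF W] by blast
 then show ?thesis using pw_borel[OF W] by (intro bbI)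
qed

lemma tauc_H1: "tauc W \<in> H1 U"
 unfolding H1_def
proof (intro CollectI conjI ballI)
 show "tauc W \<in> L2 U" by (rule bb_L2[OF bb_tauc U_borel U(2)])
 fix b :: "real^2" assume b: "b \<in> Basis"
 define g where "g p = (\<Sum>x\<in>Vs. \<Sum>y\<in>Vs - {x}. dq3 b x y p *\<^sub>R Am W x y)" for p
 have bg: "bb U g" unfolding g_def[abs_def] by (intro bb_sum bb_scaleR bb_const dlip_bb(2)[OF dlip_q3])
 have "is_weak_pd U b (tauc W) g"
 proof (rule dlip_weak_pd[OF U(1) b bb_borel[OF bb_tauc] bb_borel[OF bg]])
  fix c :: "real^2^2"
  have "dlip U b (\<lambda>p. \<Sum>x\<in>Vs. \<Sum>y\<in>Vs - {x}. (Am W x y \<bullet> c) * q3 x y p) (\<lambda>p. \<Sum>x\<in>Vs. \<Sum>y\<in>Vs - {x}. (Am W x y \<bullet> c) * dq3 b x y p)"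
   using finVs by (intro dlip_sum dlip_cmul dlip_q3) auto
  then show "dlip U b (\<lambda>p. tauc W p \<bullet> c) (\<lambda>p. g p \<bullet> c)"
   by (simp add: tauc_def g_def inner_sum_left mult.commute)
 qed
 then show "\<exists>g\<in>L2 U. is_weak_pd U b (tauc W) g" using bb_L2[OF bg U_borel U(2)] by blast
qed

lemma tauc_Pxy_sym: "T \<in> X ==> restricts_into (tauc W) T (Pxy_sym (k + 2))"
proof -
 assume T: "T \<in> X"
 define g where "g p = (\<Sum>x\<in>verts T. \<Sum>y\<in>verts T - {x}. (lamT T x p * lamT T x p * lamT T y p) *\<^sub>R Am W x y)" for p
 have l1: "lamT T x \<in> Pxy 1" for x using lamT_Pxy[of T x 0] by simp
 have "(\<lambda>p. lamT T x p * lamT T x p * lamT T y p) \<in> Pxy (1 + 1 + 1)" for x y by (intro Pxy_mult l1)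
 then have l3: "(\<lambda>p. lamT T x p * lamT T x p * lamT T y p) \<in> Pxy (k + 2)" for x y by (rule Pxy_mono) (use k1 in simp)
 have fv: "finite (verts T)" by (simp add: verts_def)
 have "(\<lambda>p. \<Sum>x\<in>verts T. \<Sum>y\<in>verts T - {x}. Am W x y $ i $ j * (lamT T x p * lamT T x p * lamT T y p)) \<in> Pxy (k + 2)" for i j
  using fv by (intro Pxy_sum Pxy_cmul l3) auto
 then have 1: "(\<lambda>p. g p $ i $ j) \<in> Pxy (k + 2)" for i j by (simp add: g_def mult.commute)
 have "g p $ i $ j = g p $ j $ i" for p i j by (simp add: g_def Am_sym[of W _ _ i j])
 then have "g \<in> Pxy_sym (k + 2)" using 1 unfolding Pxy_sym_def by (auto simp: transpose_def vec_eq_iff)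
 moreover have "AE p in lebesgue_on T. tauc W p = g p"
  using tauc_eq[OF T] T_compact(2)[OF smp[OF T]] by (subst AE_lebesgue_on_iff) (auto simp: g_def)
 ultimately show ?thesis unfolding restricts_into_def by blast
qed

lemma barycentric_T:
 assumes T: "T \<in> X"
 shows "barycentric (\<lambda>i. if i = 1 then vA T else if i = 2 then vB T else vC T)
  (\<lambda>i. if i = 1 then lam (vA T) (vB T) (vC T) else if i = 2 then lam (vB T) (vC T) (vA T) else lam (vC T) (vA T) (vB T))"
proof -
 have "{1..3::nat} = {1, 2, 3}" by auto
 then show ?thesis unfolding barycentric_def
  using lam_sum[OF nzT(1)[OF T]] lam_rep[OF nzT(1)[OF T]] by (simp add: add.assoc)
qed

lemma taub_bubbles: "T \<in> X ==> restricts_into (taub W) T (bubbles T (k + 2))"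
proof -
 assume T: "T \<in> X"
 let ?x = "\<lambda>i::nat. if i = 1 then vA T else if i = 2 then vB T else vC T"
 let ?m = "\<lambda>i::nat. if i = 1 then lam (vA T) (vB T) (vC T) else if i = 2 then lam (vB T) (vC T) (vA T) else lam (vC T) (vA T) (vB T)"
 let ?q = "\<lambda>i j::nat. if i = 1 \<and> j = 2 then QT W T 1 else if i = 1 then QT W T 2 else QT W T 3"
 define g where "g p = (\<Sum>i=1..3. \<Sum>j\<in>{i<..3}. (?m i p * ?m j p * ?q i j p) *\<^sub>R outer (?x j - ?x i))" for p
 have s: "{1..3::nat} = {1, 2, 3}" "{1<..3::nat} = {2, 3}" "{2<..3::nat} = {3}" "{3<..3::nat} = {}" by auto
 have g: "g p = (lam (vA T) (vB T) (vC T) p * lam (vB T) (vC T) (vA T) p * QT W T 1 p) *\<^sub>R outer (vB T - vA T)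
  + (lam (vA T) (vB T) (vC T) p * lam (vC T) (vA T) (vB T) p * QT W T 2 p) *\<^sub>R outer (vC T - vA T)
  + (lam (vB T) (vC T) (vA T) p * lam (vC T) (vA T) (vB T) p * QT W T 3 p) *\<^sub>R outer (vC T - vB T)" for p
 proof -
  have "{Suc 0<..3::nat} = {2, 3}" by auto
  then show ?thesis unfolding g_def s(1) by (simp add: s add.assoc)
 qed
 have "g \<in> bubbles T (k + 2)" unfolding bubbles_def
 proof (intro CollectI exI conjI)
  show "T = convex hull (?x ` {1..3})"
  proof -
   have "?x ` {1..3} = {vA T, vB T, vC T}" unfolding s(1) by auto
   then show ?thesis using tri_hull[OF nzT(1)[OF T]] triT(1)[OF T] by simp
  qed
  show "barycentric ?x ?m" by (rule barycentric_T[OF T])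
  show "\<forall>i j. ?q i j \<in> Pxy (k + 2 - 2)" using QT_Pxy[OF T] by simp
  show "\<forall>p. g p = (\<Sum>i=1..3. \<Sum>j\<in>{i<..3}. (?m i p * ?m j p * ?q i j p) *\<^sub>R outer (?x j - ?x i))" by (simp add: g_def)
 qed
 moreover have "AE p in lebesgue_on T. taub W p = g p"
  unfolding AE_lebesgue_on_iff[OF T_compact(2)[OF smp[OF T]]] using AE_only
 proof eventually_elim
  case (elim p)
  show ?case
  proof
   assume p: "p \<in> T"
   have "taub W p = bT W T p" unfolding taub_def
   proof (rule sum_only[OF T])
    fix T' assume T': "T' \<in> X" "T' ~= T"
    then have "p ~: T'" using elim T p by blast
    then show "bT W T' p = 0" using triT[OF T'(1)] by (simp add: bT_def bub_def)
   qed
   also have "bT W T p = g p"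
    unfolding bT_def bub_def g triT[OF T]
    using p lam_swap[where a="vA T" and b="vB T" and c="vC T"] lam_swap[where a="vC T" and b="vA T" and c="vB T"] lam_swap[where a="vB T" and b="vC T" and c="vA T"] by simp
   finally show "taub W p = g p" .
  qed
 qed
 ultimately show ?thesis unfolding restricts_into_def by blast
qed

lemma S_H_h:
 assumes W: "poly_family (k + 1) W"
 shows "S W \<in> H_h (k + 2) U X"
proof -
 have "is_weak_row_div U (S W) (pw W)"
  unfolding is_weak_row_div_def
  using flux_weak_div[OF flux_S U(1) bb_borel[OF bb_vec_nth[OF bb_pw[OF W, of U]]] divS_pw[OF W]] by blast
 moreover have "pw W \<in> L2 U" "S W \<in> L2 U" using bb_L2[OF _ U_borel U(2)] bb_pw[OF W] bb_S by blast+
 moreover have sv: "S W \<in> sym_valued U" "tauc W \<in> sym_valued U"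
  unfolding sym_valued_def using S_sym tauc_sym by (auto simp: transpose_def vec_eq_iff)
 ultimately have "S W \<in> Hdiv_sym U" unfolding Hdiv_sym_def by blast
 then show ?thesis unfolding H_h_def
  using tauc_H1 sv(2) tauc_Pxy_sym taub_bubbles S_def
  by (intro CollectI conjI exI[of _ "tauc W"] exI[of _ "taub W"]) auto
qed

end

section \<open>Polygons\<close>

lemma polyline_ends:
 "vs ~= [] ==> pathstart (polyline vs) = hd vs \<and> pathfinish (polyline vs) = last vs"
 by (induction vs rule: polyline.induct) auto

lemma negligible_closed_segment2: "negligible (closed_segment a b :: (real^2) set)"
 by (simp add: negligible_convex_interior interior_closed_segment_ge2)

lemma negligible_polyline: "negligible (path_image (polyline vs))"
proof (induction vs rule: polyline.induct)
 case (4 p q r vs)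
 have "path_image (polyline (p # q # r # vs)) \<subseteq> closed_segment p q \<union> path_image (polyline (q # r # vs))"
  using path_image_join_subset[of "linepath p q" "polyline (q # r # vs)"] by simp
 then show ?case using 4 negligible_closed_segment2 negligible_subset negligible_Un by metis
qed (auto simp: negligible_closed_segment2)

text \<open>The boundary of a polygon is a closed curve homeomorphic to a circle, so by the separation
  theorem of Jordan and Brouwer its complement is disconnected and the inside cannot be empty.\<close>

lemma polygon_props:
 assumes "polygon U"
 shows "open U" "bounded U" "negligible (frontier U)" "U ~= {}"
proof -
 obtain vs where s: "simple_path (polyline (vs @ [hd vs]))" and U: "U = inside (path_image (polyline (vs @ [hd vs])))"
  using assms unfolding polygon_def by blast
 let ?g = "polyline (vs @ [hd vs])"
 have c: "compact (path_image ?g)" using s by (simp add: compact_simple_path_image)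
 show "open U" unfolding U using c by (simp add: compact_imp_closed open_inside)
 show "bounded U" unfolding U using c by (simp add: compact_imp_bounded bounded_inside)
 show "negligible (frontier U)"
  using frontier_inside_subset[of "path_image ?g"] c negligible_polyline negligible_subset compact_imp_closed
  unfolding U by metis
 have cl: "pathfinish ?g = pathstart ?g"
  using polyline_ends[of "vs @ [hd vs]"] by (cases vs) auto
 have "path_image ?g homeomorphic sphere (0::complex) 1"
  using homeomorphic_simple_path_image_circle[OF s cl, of 1] by simp
 moreover have "sphere (0::complex) 1 homeomorphic sphere (0::real^2) 1"
  by (rule homeomorphic_spheres_gen) auto
 ultimately have "path_image ?g homeomorphic sphere (0::real^2) 1" by (rule homeomorphic_trans)
 then have nc: "\<not> connected (- path_image ?g)" by (rule Jordan_Brouwer_separation) auto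
 show "U ~= {}"
 proof
  assume "U = {}"
  then have "outside (path_image ?g) = - path_image ?g" using inside_Un_outside[of "path_image ?g"] U by simp
  moreover have "connected (outside (path_image ?g))"
   using c by (intro connected_outside) (auto simp: compact_imp_bounded)
  ultimately show False using nc by simp
 qed
qed

section \<open>Lifting from the plane to the cylinder\<close>

definition ext :: "real^2 => real => real^3" where "ext p z = vector [p $ 1, p $ 2, z]"

lemma ext_simps [simp]: "xy (ext p z) = p" "ext p z $ 1 = p $ 1" "ext p z $ 2 = p $ 2" "ext p z $ 3 = z" "ext (xy q) (q $ 3) = q"
 "xy q $ 1 = q $ 1" "xy q $ 2 = q $ 2"
 by (simp_all add: ext_def xy_def vec_eq_iff forall_2 forall_3)

lemma xy_linear: "xy (q + h *\<^sub>R t) = xy q + h *\<^sub>R xy t" "xy (q - t) = xy q - xy t"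
 by (simp_all add: vec_eq_iff forall_2)

lemma ext_cyl: "ext p z \<in> cyl A I \<longleftrightarrow> p \<in> A \<and> z \<in> I" by (simp add: cyl_def)

lemma cont_xy: "continuous_on S xy"
proof -
 have e: "xy = (\<lambda>q. q $ 1 *\<^sub>R axis 1 1 + q $ 2 *\<^sub>R axis 2 1)" by (auto simp: fun_eq_iff vec_eq_iff forall_2 axis_def)
 show ?thesis unfolding e by (intro continuous_intros)
qed

lemma cont_ext: "continuous_on S (\<lambda>(p, z). ext p z)"
proof -
 have "(\<lambda>(p, z). ext p z) = (\<lambda>x. fst x $ 1 *\<^sub>R axis 1 1 + fst x $ 2 *\<^sub>R axis 2 1 + snd x *\<^sub>R axis 3 1)"
  by (auto simp: fun_eq_iff vec_eq_iff forall_3 axis_def)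
 then show ?thesis by (simp only:) (intro continuous_intros)
qed

lemma xy_borel: "xy \<in> borel_measurable borel" "(\<lambda>q::real^3. q $ 3) \<in> borel_measurable borel"
 by (intro borel_measurable_continuous_onI cont_xy, intro vec_nth_borel) simp

lemma ext_borel: "(\<lambda>(p, z). ext p z) \<in> borel_measurable borel"
 by (intro borel_measurable_continuous_onI cont_ext)

lemma cyl_open: "open A ==> open I ==> open (cyl A I)"
proof -
 assume "open A" "open I"
 then have "open (xy -` A \<inter> (\<lambda>q. q $ 3) -` I)"
  by (intro open_Int open_vimage cont_xy continuous_intros)
 then show ?thesis by (simp add: cyl_def vimage_def Collect_conj_eq)
qed

lemma cyl_borel: "A \<in> sets borel ==> I \<in> sets borel ==> cyl A I \<in> sets borel"
proof -
 assume "A \<in> sets borel" "I \<in> sets borel"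
 then have "xy -` A \<inter> (\<lambda>q. q $ 3) -` I \<in> sets borel"
  using measurable_sets_borel[OF xy_borel(1)] measurable_sets_borel[OF xy_borel(2)] by blast
 then show ?thesis by (simp add: cyl_def vimage_def Collect_conj_eq)
qed

lemma norm_ext: "(norm (ext p z))\<^sup>2 = (norm p)\<^sup>2 + z\<^sup>2"
 unfolding power2_norm_eq_inner by (simp add: inner_vec_def sum_2 sum_3 power2_eq_square)

lemma cyl_bounded: "bounded A ==> bounded I ==> bounded (cyl A I)"
proof -
 assume "bounded A" "bounded I"
 then obtain M N where M: "!!p. p \<in> A ==> norm p <= M" "!!z. z \<in> I ==> norm z <= N" unfolding bounded_iff by blast
 have "norm q <= M + N" if q: "q \<in> cyl A I" for q
 proof -
  have 1: "norm (xy q) <= M" "\<bar>q $ 3\<bar> <= N" using q M by (auto simp: cyl_def)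
  have 0: "0 <= M" "0 <= N" using 1 norm_ge_zero[of "xy q"] by linarith+
  have "(norm q)\<^sup>2 = (norm (xy q))\<^sup>2 + \<bar>q $ 3\<bar>\<^sup>2" using norm_ext[of "xy q" "q $ 3"] by simp
  also have "... <= M\<^sup>2 + N\<^sup>2" using 1 by (intro add_mono power_mono) auto
  also have "... <= (M + N)\<^sup>2" using 0 by (simp add: power2_eq_square algebra_simps)
  finally show ?thesis by (rule power2_le_imp_le) (use 0 in simp)
 qed
 then show ?thesis unfolding bounded_iff by blast
qed

lemma prod_Basis_cart: "(\<Prod>b\<in>(Basis::(real^'n) set). x \<bullet> b) = (\<Prod>i\<in>UNIV. x $ i)"
proof -
 have B: "(Basis::(real^'n) set) = (\<lambda>i. axis i 1) ` UNIV" by (auto simp: Basis_vec_def)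
 have "inj (\<lambda>i. axis i (1::real) :: real^'n)" by (auto simp: inj_on_def axis_eq_axis)
 then show ?thesis unfolding B by (simp add: prod.reindex inner_axis)
qed

lemma lborel_ext: "(lborel :: (real^3) measure) = distr (lborel :: ((real^2) \<times> real) measure) borel (\<lambda>(p, z). ext p z)"
proof (rule lborel_eqI)
 fix l u :: "real^3" assume le: "!!b. b \<in> Basis ==> l \<bullet> b <= u \<bullet> b"
 have le': "l $ i <= u $ i" for i using le[of "axis i 1"] by (auto simp: inner_axis axis_in_Basis_iff)
 have le2: "xy l \<bullet> b <= xy u \<bullet> b" if bB: "b \<in> Basis" for b
 proof -
  obtain i where b: "b = axis i 1" using bB unfolding Basis_vec_def by auto
  have "xy l $ i <= xy u $ i" using exhaust_2[of i] le'[of 1] le'[of 2] by auto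
  then show ?thesis by (simp add: b inner_axis)
 qed
 have v: "(\<lambda>(p, z). ext p z) -` box l u = box (xy l) (xy u) \<times> {l $ 3<..<u $ 3}"
 proof (rule set_eqI)
  fix x :: "(real^2) \<times> real"
  obtain p z where x: "x = (p, z)" by (cases x)
  have "ext p z \<in> box l u \<longleftrightarrow> p \<in> box (xy l) (xy u) \<and> l $ 3 < z \<and> z < u $ 3"
   unfolding mem_box_cart forall_2 forall_3 ext_simps by blast
  then show "x \<in> (\<lambda>(p, z). ext p z) -` box l u \<longleftrightarrow> x \<in> box (xy l) (xy u) \<times> {l $ 3<..<u $ 3}" unfolding x by simp
 qed
 let ?A = "(u $ 1 - l $ 1) * (u $ 2 - l $ 2)"
 have A: "(\<Prod>b\<in>Basis. (xy u - xy l) \<bullet> b) = ?A" unfolding prod_Basis_cart UNIV_2 by simp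
 have B: "(\<Prod>b\<in>Basis. (u - l) \<bullet> b) = ?A * (u $ 3 - l $ 3)" unfolding prod_Basis_cart UNIV_3 by simp
 have A0: "0 <= ?A" using le'[of 1] le'[of 2] by simp
 have "emeasure (distr lborel borel (\<lambda>(p, z). ext p z)) (box l u) = emeasure lborel ((\<lambda>(p, z). ext p z) -` box l u)"
  using ext_borel by (subst emeasure_distr) simp_all
 also have "... = emeasure (lborel \<Otimes>\<^sub>M lborel) (box (xy l) (xy u) \<times> {l $ 3<..<u $ 3})"
  unfolding v lborel_prod ..
 also have "... = emeasure lborel (box (xy l) (xy u)) * emeasure lborel {l $ 3<..<u $ 3}"
  by (rule lborel.emeasure_pair_measure_Times) simp_all
 also have "... = ennreal ?A * ennreal (u $ 3 - l $ 3)"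
 proof -
  have "emeasure lborel (box (xy l) (xy u)) = ennreal ?A"
   using emeasure_lborel_box[of "xy l" "xy u"] le2 A by simp
  then show ?thesis unfolding emeasure_lborel_Ioo[OF le'] by simp
 qed
 also have "... = ennreal (\<Prod>b\<in>Basis. (u - l) \<bullet> b)"
  unfolding B by (rule ennreal_mult'[OF A0, symmetric])
 finally show "emeasure (distr lborel borel (\<lambda>(p, z). ext p z)) (box l u) = (\<Prod>b\<in>Basis. (u - l) \<bullet> b)" .
qed simp

lemma nn_integral_ext:
 assumes f: "f \<in> borel_measurable borel"
 shows "(\<integral>\<^sup>+q. f q \<partial>lborel) = (\<integral>\<^sup>+z. (\<integral>\<^sup>+p. f (ext p z) \<partial>lborel) \<partial>lborel)"
  and "(\<integral>\<^sup>+q. f q \<partial>lborel) = (\<integral>\<^sup>+p. (\<integral>\<^sup>+z. f (ext p z) \<partial>lborel) \<partial>lborel)"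
proof -
 have m: "(\<lambda>(p, z). f (ext p z)) \<in> borel_measurable (lborel \<Otimes>\<^sub>M lborel)"
  using measurable_compose[OF ext_borel f] unfolding lborel_prod by (simp add: case_prod_unfold)
 have e: "(\<integral>\<^sup>+q. f q \<partial>lborel) = (\<integral>\<^sup>+x. (\<lambda>(p, z). f (ext p z)) x \<partial>(lborel \<Otimes>\<^sub>M lborel))"
  unfolding lborel_prod using f ext_borel by (subst lborel_ext, subst nn_integral_distr) (auto simp: case_prod_unfold)
 show "(\<integral>\<^sup>+q. f q \<partial>lborel) = (\<integral>\<^sup>+z. (\<integral>\<^sup>+p. f (ext p z) \<partial>lborel) \<partial>lborel)"
  unfolding e using lborel_pair.nn_integral_snd[OF m] by simp
 show "(\<integral>\<^sup>+q. f q \<partial>lborel) = (\<integral>\<^sup>+p. (\<integral>\<^sup>+z. f (ext p z) \<partial>lborel) \<partial>lborel)"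
  unfolding e using lborel.nn_integral_fst[OF m] by simp
qed

lemma AE_xy:
 assumes "AE p in lborel. P p"
 shows "AE q in lborel. P (xy q)"
proof -
 obtain N where N: "{p. \<not> P p} \<subseteq> N" "N \<in> null_sets lborel" using assms by (auto elim: AE_E simp: null_sets_def)
 have Nb: "N \<in> sets borel" using N by auto
 have s: "xy -` N \<in> sets borel" using measurable_sets_borel[OF xy_borel(1) Nb] by simp
 have "emeasure lborel (xy -` N) = (\<integral>\<^sup>+q. indicator (xy -` N) q \<partial>lborel)" using s by simp
 also have "... = (\<integral>\<^sup>+z. (\<integral>\<^sup>+p. indicator N p \<partial>lborel) \<partial>(lborel :: real measure))"
 proof -
  have "indicator (xy -` N) (ext p z) = (indicator N p :: ennreal)" for p z by (simp add: indicator_def)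
  then show ?thesis using s nn_integral_ext(1)[of "indicator (xy -` N)"] by simp
 qed
 also have "... = 0" using N(2) Nb null_setsD1[OF N(2)] by simp
 finally have "xy -` N \<in> null_sets lborel" using s by auto
 then show ?thesis using N by (intro AE_I'[of "xy -` N"]) auto
qed

lemma AE_z:
 assumes "AE z in lborel. P z"
 shows "AE q in lborel. P ((q::real^3) $ 3)"
proof -
 obtain N where N: "{p. \<not> P p} \<subseteq> N" "N \<in> null_sets lborel" using assms by (auto elim: AE_E simp: null_sets_def)
 have Nb: "N \<in> sets borel" using N by auto
 let ?N = "(\<lambda>q::real^3. q $ 3) -` N"
 have s: "?N \<in> sets borel" using measurable_sets_borel[OF xy_borel(2) Nb] by simp
 have "emeasure lborel ?N = (\<integral>\<^sup>+q. indicator ?N q \<partial>lborel)" using s by simp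
 also have "... = (\<integral>\<^sup>+p. (\<integral>\<^sup>+z. indicator N z \<partial>lborel) \<partial>(lborel :: (real^2) measure))"
 proof -
  have "indicator ?N (ext p z) = (indicator N z :: ennreal)" for p z by (simp add: indicator_def)
  then show ?thesis using s nn_integral_ext(2)[of "indicator ?N"] by simp
 qed
 also have "... = 0" using N(2) Nb null_setsD1[OF N(2)] by simp
 finally have "?N \<in> null_sets lborel" using s by auto
 then show ?thesis using N by (intro AE_I'[of ?N]) auto
qed

lemma bb_lift:
 assumes "bb U f" "bb I b"
 shows "bb (cyl U I) (\<lambda>q. f (xy q))" "bb (cyl U I) (\<lambda>q. b (q $ 3))"
 using assms measurable_compose[OF xy_borel(1)] measurable_compose[OF xy_borel(2)]
 unfolding bb_def by (auto simp: cyl_def)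

lemma segment_lift:
 assumes "closed_segment q (q + h *\<^sub>R t) \<subseteq> cyl U I"
 shows "closed_segment (xy q) (xy q + h *\<^sub>R xy t) \<subseteq> U" "closed_segment (q $ 3) (q $ 3 + h * t $ 3) \<subseteq> I" "q \<in> cyl U I" "q + h *\<^sub>R t \<in> cyl U I"
proof -
 have m: "q + u *\<^sub>R (h *\<^sub>R t) \<in> cyl U I" if "0 <= u" "u <= 1" for u
  using assms that by (auto simp: in_segment subset_iff algebra_simps)
 have m': "xy q + u *\<^sub>R (h *\<^sub>R xy t) \<in> U" "q $ 3 + u * (h * t $ 3) \<in> I" if "0 <= u" "u <= 1" for u
  using m[OF that] by (simp_all add: cyl_def xy_linear mult.assoc)
 show "closed_segment (xy q) (xy q + h *\<^sub>R xy t) \<subseteq> U"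
 proof
  fix x assume "x \<in> closed_segment (xy q) (xy q + h *\<^sub>R xy t)"
  then obtain u where u: "0 <= u" "u <= 1" "x = (1 - u) *\<^sub>R xy q + u *\<^sub>R (xy q + h *\<^sub>R xy t)" by (auto simp: in_segment)
  then have "x = xy q + u *\<^sub>R (h *\<^sub>R xy t)" by (simp add: algebra_simps)
  then show "x \<in> U" using m'(1)[OF u(1,2)] by simp
 qed
 show "closed_segment (q $ 3) (q $ 3 + h * t $ 3) \<subseteq> I"
 proof
  fix x assume "x \<in> closed_segment (q $ 3) (q $ 3 + h * t $ 3)"
  then obtain u where u: "0 <= u" "u <= 1" "x = (1 - u) *\<^sub>R (q $ 3) + u *\<^sub>R (q $ 3 + h * t $ 3)" by (auto simp: in_segment)
  then have "x = q $ 3 + u * (h * t $ 3)" by (simp add: algebra_simps)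
  then show "x \<in> I" using m'(2)[OF u(1,2)] by simp
 qed
 show "q \<in> cyl U I" "q + h *\<^sub>R t \<in> cyl U I" using assms by auto
qed

lemma dlip_lift:
 assumes d: "dlip U t f D" and b: "bb I b"
 shows "dlip (cyl U I) (ext t 0) (\<lambda>q. b (q $ 3) * f (xy q)) (\<lambda>q. b (q $ 3) * D (xy q))"
proof -
 obtain B L where B: "!!x. x \<in> U ==> \<bar>f x\<bar> <= B" "!!x. x \<in> U ==> \<bar>D x\<bar> <= B" "B \<ge> 0" "L \<ge> 0"
  and fm: "f \<in> borel_measurable borel" "D \<in> borel_measurable borel"
  and lip: "!!x h. closed_segment x (x + h *\<^sub>R t) \<subseteq> U ==> \<bar>f (x + h *\<^sub>R t) - f x\<bar> <= L * \<bar>h\<bar>"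
  and der: "AE x in lborel. x \<in> U --> ((\<lambda>h. f (x + h *\<^sub>R t)) has_real_derivative D x) (at 0)"
  by (rule dlipE[OF d], rule that; assumption)
 obtain N where N: "!!z. z \<in> I ==> \<bar>b z\<bar> <= N" and bm: "b \<in> borel_measurable borel" using b unfolding bb_def by auto
 have N': "\<bar>b z\<bar> <= \<bar>N\<bar>" if "z \<in> I" for z using N[OF that] by linarith
 show ?thesis
 proof (rule dlipI[of _ _ _ "\<bar>N\<bar> * B" "\<bar>N\<bar> * B" "\<bar>N\<bar> * L"])
  show "(\<lambda>q. b (q $ 3) * f (xy q)) \<in> borel_measurable borel" "(\<lambda>q. b (q $ 3) * D (xy q)) \<in> borel_measurable borel"
   using measurable_compose[OF xy_borel(1) fm(1)] measurable_compose[OF xy_borel(1) fm(2)] measurable_compose[OF xy_borel(2) bm]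
   by (auto intro: borel_measurable_times)
  show "\<bar>b (q $ 3) * f (xy q)\<bar> <= \<bar>N\<bar> * B" "\<bar>b (q $ 3) * D (xy q)\<bar> <= \<bar>N\<bar> * B" if "q \<in> cyl U I" for q
   using that N' B unfolding abs_mult by (auto simp: cyl_def intro!: mult_mono)
  show "0 <= \<bar>N\<bar> * L" using B by simp
  show "\<bar>b ((q + h *\<^sub>R ext t 0) $ 3) * f (xy (q + h *\<^sub>R ext t 0)) - b (q $ 3) * f (xy q)\<bar> <= \<bar>N\<bar> * L * \<bar>h\<bar>"
   if s: "closed_segment q (q + h *\<^sub>R ext t 0) \<subseteq> cyl U I" for q h
  proof -
   have "\<bar>b (q $ 3) * (f (xy q + h *\<^sub>R t) - f (xy q))\<bar> <= \<bar>N\<bar> * (L * \<bar>h\<bar>)"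
    unfolding abs_mult using segment_lift[OF s] N' B(4) by (intro mult_mono lip) (auto simp: cyl_def)
   then show ?thesis by (simp add: xy_linear right_diff_distrib mult.assoc)
  qed
  show "AE q in lborel. q \<in> cyl U I --> ((\<lambda>h. b ((q + h *\<^sub>R ext t 0) $ 3) * f (xy (q + h *\<^sub>R ext t 0))) has_real_derivative b (q $ 3) * D (xy q)) (at 0)"
   using AE_xy[OF der]
  proof eventually_elim
   case (elim q)
   then show ?case by (auto simp: xy_linear cyl_def intro!: DERIV_cmult)
  qed
 qed
qed

lemma dlip_lift_z:
 assumes d: "dlip I 1 f D" and b: "bb U b"
 shows "dlip (cyl U I) (axis 3 1) (\<lambda>q. f (q $ 3) * b (xy q)) (\<lambda>q. D (q $ 3) * b (xy q))"
proof -
 have t: "xy (axis 3 1) = 0" "(axis 3 1 :: real^3) $ 3 = 1" by (simp_all add: vec_eq_iff forall_2 axis_def)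
 obtain B L where B: "!!x. x \<in> I ==> \<bar>f x\<bar> <= B" "!!x. x \<in> I ==> \<bar>D x\<bar> <= B" "B \<ge> 0" "L \<ge> 0"
  and fm: "f \<in> borel_measurable borel" "D \<in> borel_measurable borel"
  and lip: "!!x h. closed_segment x (x + h *\<^sub>R 1) \<subseteq> I ==> \<bar>f (x + h *\<^sub>R 1) - f x\<bar> <= L * \<bar>h\<bar>"
  and der: "AE x in lborel. x \<in> I --> ((\<lambda>h. f (x + h *\<^sub>R 1)) has_real_derivative D x) (at 0)"
  by (rule dlipE[OF d], rule that; assumption)
 obtain N where N: "!!z. z \<in> U ==> \<bar>b z\<bar> <= N" and bm: "b \<in> borel_measurable borel" using b unfolding bb_def by auto
 have N': "\<bar>b z\<bar> <= \<bar>N\<bar>" if "z \<in> U" for z using N[OF that] by linarith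
 show ?thesis
 proof (rule dlipI[of _ _ _ "B * \<bar>N\<bar>" "B * \<bar>N\<bar>" "L * \<bar>N\<bar>"])
  show "(\<lambda>q. f (q $ 3) * b (xy q)) \<in> borel_measurable borel" "(\<lambda>q. D (q $ 3) * b (xy q)) \<in> borel_measurable borel"
   using measurable_compose[OF xy_borel(2) fm(1)] measurable_compose[OF xy_borel(2) fm(2)] measurable_compose[OF xy_borel(1) bm]
   by (auto intro: borel_measurable_times)
  show "\<bar>f (q $ 3) * b (xy q)\<bar> <= B * \<bar>N\<bar>" "\<bar>D (q $ 3) * b (xy q)\<bar> <= B * \<bar>N\<bar>" if "q \<in> cyl U I" for q
   using that N' B unfolding abs_mult by (auto simp: cyl_def intro!: mult_mono)
  show "0 <= L * \<bar>N\<bar>" using B by simp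
  show "\<bar>f ((q + h *\<^sub>R axis 3 1) $ 3) * b (xy (q + h *\<^sub>R axis 3 1)) - f (q $ 3) * b (xy q)\<bar> <= L * \<bar>N\<bar> * \<bar>h\<bar>"
   if s: "closed_segment q (q + h *\<^sub>R axis 3 1) \<subseteq> cyl U I" for q h
  proof -
   have "\<bar>(f (q $ 3 + h) - f (q $ 3)) * b (xy q)\<bar> <= (L * \<bar>h\<bar>) * \<bar>N\<bar>"
    unfolding abs_mult using segment_lift[OF s] t N' B(4) lip[of "q $ 3" h] by (intro mult_mono) (auto simp: cyl_def)
   then show ?thesis using t by (simp add: xy_linear algebra_simps)
  qed
  show "AE q in lborel. q \<in> cyl U I --> ((\<lambda>h. f ((q + h *\<^sub>R axis 3 1) $ 3) * b (xy (q + h *\<^sub>R axis 3 1))) has_real_derivative D (q $ 3) * b (xy q)) (at 0)"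
   using AE_z[OF der]
  proof eventually_elim
   case (elim q)
   then show ?case using t by (auto simp: xy_linear cyl_def intro!: DERIV_cmult_right)
  qed
 qed
qed

text \<open>A plane field keeps its structure when multiplied by a function of the height that may jump: the height is constant along
  all horizontal directions.\<close>

lemma flux_lift:
 assumes "flux U F g" and b: "bb I b"
 shows "flux (cyl U I) (\<lambda>q. b (q $ 3) *\<^sub>R ext (F (xy q)) 0) (\<lambda>q. b (q $ 3) * g (xy q))"
 using assms(1)
proof (induction rule: flux.induct)
 case (flux_atom t f D)
 have "(\<lambda>q. b (q $ 3) *\<^sub>R ext (f (xy q) *\<^sub>R t) 0) = (\<lambda>q. (b (q $ 3) * f (xy q)) *\<^sub>R ext t 0)"
  by (simp add: fun_eq_iff vec_eq_iff forall_3)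
 then show ?case using flux.flux_atom[OF dlip_lift[OF flux_atom b]] by simp
next
 case flux_zero
 have "(\<lambda>q::real^3. b (q $ 3) *\<^sub>R ext 0 0) = (\<lambda>q. 0)" by (simp add: fun_eq_iff vec_eq_iff forall_3)
 then show ?case using flux.flux_zero by simp
next
 case (flux_add F g F' g')
 have "(\<lambda>q. b (q $ 3) *\<^sub>R ext (F (xy q) + F' (xy q)) 0) = (\<lambda>q. b (q $ 3) *\<^sub>R ext (F (xy q)) 0 + b (q $ 3) *\<^sub>R ext (F' (xy q)) 0)"
  by (simp add: fun_eq_iff vec_eq_iff forall_3 distrib_left)
 then show ?case using flux.flux_add[OF flux_add.IH] by (simp add: distrib_left)
qed

lemma tensorI:
 assumes "finite J" "!!j. j \<in> J ==> a j \<in> A" "!!j. j \<in> J ==> b j \<in> B"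
  "AE p in lebesgue_on D. f p = (\<Sum>j\<in>J. b j (p $ 3) *\<^sub>R a j (xy p))"
 shows "f \<in> tensor D A B"
proof -
 obtain e where e: "bij_betw e {..<card J} J" using ex_bij_betw_nat_finite[OF assms(1)] by (auto simp: lessThan_atLeast0)
 have "(\<Sum>j\<in>J. b j (p $ 3) *\<^sub>R a j (xy p)) = (\<Sum>i<card J. b (e i) (p $ 3) *\<^sub>R a (e i) (xy p))" for p
  by (rule sum.reindex_bij_betw[OF e, symmetric])
 then show ?thesis unfolding tensor_def using assms e bij_betwE[OF e]
  by (intro CollectI exI[of _ "card J"] exI[of _ "\<lambda>i. a (e i)"] exI[of _ "\<lambda>i. b (e i)"]) auto
qed

lemma tensor_poly:
 assumes "f \<in> tensor D (Pxy m) (Pz n)"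
 shows "\<exists>w. (\<forall>j. w j \<in> Pxy m) \<and> (AE p in lebesgue_on D. f p = (\<Sum>j\<le>n. p $ 3 ^ j * w j (xy p)))"
proof -
 obtain N :: nat and a b where ab: "\<forall>i<N. a i \<in> Pxy m \<and> b i \<in> Pz n" and f: "AE p in lebesgue_on D. f p = (\<Sum>i<N. b i (p $ 3) *\<^sub>R a i (xy p))"
  using assms unfolding tensor_def by blast
 have "\<forall>i\<in>{..<N}. \<exists>q. b i = poly q \<and> degree q <= n" using ab unfolding Pz_def by auto
 then obtain q where q: "\<forall>i\<in>{..<N}. b i = poly (q i) \<and> degree (q i) <= n" by metis
 define w where "w j p = (\<Sum>i<N. coeff (q i) j * a i p)" for j p
 have bq: "b i z = (\<Sum>j\<le>n. coeff (q i) j * z ^ j)" if "i < N" for i z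
 proof -
  have qi: "b i = poly (q i)" "degree (q i) <= n" using q that by auto
  have "poly (q i) z = (\<Sum>j\<le>degree (q i). coeff (q i) j * z ^ j)" by (rule poly_altdef)
  also have "... = (\<Sum>j\<le>n. coeff (q i) j * z ^ j)"
   using qi(2) by (intro sum.mono_neutral_left) (auto simp: coeff_eq_0)
  finally show ?thesis by (simp add: qi(1))
 qed
 have "(\<Sum>i<N. b i z *\<^sub>R a i x) = (\<Sum>j\<le>n. z ^ j * w j x)" for z x
 proof -
  have "(\<Sum>i<N. b i z *\<^sub>R a i x) = (\<Sum>i<N. \<Sum>j\<le>n. z ^ j * (coeff (q i) j * a i x))"
  proof (rule sum.cong[OF refl])
   fix i assume "i \<in> {..<N}"
   then have "b i z = (\<Sum>j\<le>n. coeff (q i) j * z ^ j)" using bq by blast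
   then show "b i z *\<^sub>R a i x = (\<Sum>j\<le>n. z ^ j * (coeff (q i) j * a i x))" by (simp add: sum_distrib_left mult_ac)
  qed
  also have "... = (\<Sum>j\<le>n. z ^ j * w j x)" unfolding w_def sum_distrib_left by (rule sum.swap)
  finally show ?thesis .
 qed
 moreover have "w j \<in> Pxy m" for j unfolding w_def[abs_def] using ab by (intro Pxy_sum Pxy_cmul) auto
 ultimately show ?thesis using f by (intro exI[of _ w]) simp
qed

text \<open>The antiderivative of the monomial on \<open>[c, d]\<close> that vanishes at \<open>c\<close>, continued by constants. Its derivative \<open>dpsi\<close>
  is the monomial cut off outside the interval.\<close>

definition psi :: "real => real => nat => real => real" where
 "psi c d j z = (max c (min d z) ^ Suc j - c ^ Suc j) / Suc j"

definition dpsi :: "real => real => nat => real => real" where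
 "dpsi c d j z = indicator {c<..<d} z * z ^ j"

lemma dpsi_borel: "dpsi c d j \<in> borel_measurable borel"
 unfolding dpsi_def[abs_def] by (intro borel_measurable_times borel_measurable_indicator) auto

lemma dpsi_bound: "c < d ==> \<bar>dpsi c d j z\<bar> <= max \<bar>c\<bar> \<bar>d\<bar> ^ j"
 by (auto simp: dpsi_def indicator_def power_abs intro!: power_mono)

lemma dlip_psi:
 assumes cd: "c < d"
 shows "dlip I 1 (psi c d j) (dpsi c d j)"
proof -
 let ?M = "max \<bar>c\<bar> \<bar>d\<bar> ^ j"
 let ?P = "\<lambda>x::real. (x ^ Suc j - c ^ Suc j) / Suc j"
 have dP: "(?P has_real_derivative x ^ j) (at x within S)" for x S
  by (rule derivative_eq_intros refl | simp)+
 have cl: "max c (min d z) \<in> {c..d}" for z using cd by auto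
 have lipP: "\<bar>?P x - ?P y\<bar> <= ?M * \<bar>x - y\<bar>" if "x \<in> {c..d}" "y \<in> {c..d}" for x y
 proof -
  have "norm (?P x - ?P y) <= ?M * norm (x - y)"
  proof (rule field_differentiable_bound[where S="{c..d}" and f'="\<lambda>x. x ^ j"])
   show "(?P has_field_derivative z ^ j) (at z within {c..d})" for z by (rule dP)
   show "norm (z ^ j) <= ?M" if "z \<in> {c..d}" for z using that by (auto simp: power_abs intro!: power_mono)
  qed (use that in auto)
  then show ?thesis by (simp only: real_norm_def)
 qed
 have lip: "\<bar>psi c d j x - psi c d j y\<bar> <= ?M * \<bar>x - y\<bar>" for x y
 proof -
  have "\<bar>psi c d j x - psi c d j y\<bar> <= ?M * \<bar>max c (min d x) - max c (min d y)\<bar>"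
   unfolding psi_def by (rule lipP[OF cl cl])
  also have "... <= ?M * \<bar>x - y\<bar>" by (intro mult_left_mono) auto
  finally show ?thesis .
 qed
 show ?thesis
 proof (rule dlipI[of _ _ _ "?M * \<bar>d - c\<bar>" ?M ?M])
  have "continuous_on UNIV (psi c d j)" unfolding psi_def[abs_def] by (intro continuous_intros) auto
  then show "psi c d j \<in> borel_measurable borel" by (rule borel_measurable_continuous_onI)
  show "dpsi c d j \<in> borel_measurable borel" by (rule dpsi_borel)
  show "\<bar>psi c d j x\<bar> <= ?M * \<bar>d - c\<bar>" for x
  proof -
   have "\<bar>psi c d j x\<bar> <= ?M * \<bar>max c (min d x) - c\<bar>" unfolding psi_def using lipP[OF cl, of c x] cd by simp
   also have "... <= ?M * \<bar>d - c\<bar>" using cd by (intro mult_left_mono) auto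
   finally show ?thesis .
  qed
  show "\<bar>dpsi c d j x\<bar> <= ?M" for x by (rule dpsi_bound[OF cd])
  show "0 <= ?M" by simp
  show "\<bar>psi c d j (x + h *\<^sub>R 1) - psi c d j x\<bar> <= ?M * \<bar>h\<bar>" for x h using lip[of "x + h" x] by simp
  have "AE x::real in lborel. x ~= c" "AE x::real in lborel. x ~= d" by (rule AE_lborel_singleton)+
  then show "AE x in lborel. x \<in> I --> ((\<lambda>h. psi c d j (x + h *\<^sub>R 1)) has_real_derivative dpsi c d j x) (at 0)"
  proof eventually_elim
   case (elim x)
   have "(psi c d j has_real_derivative dpsi c d j x) (at x)"
   proof (cases "x \<in> {c<..<d}")
    case True
    have "(psi c d j has_real_derivative x ^ j) (at x)"
     by (rule has_field_derivative_transform_within_open[OF dP open_greaterThanLessThan True]) (auto simp: psi_def)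
    then show ?thesis using True by (simp add: dpsi_def)
   next
    case False
    then have "x < c \<or> d < x" using elim by auto
    then have "(psi c d j has_real_derivative 0) (at x)"
    proof
     assume x: "x < c"
     show ?thesis
      by (rule has_field_derivative_transform_within_open[OF DERIV_const[of 0] open_lessThan[of c]])
       (use x cd in \<open>auto simp: psi_def min_def max_def\<close>)
    next
     assume x: "d < x"
     show ?thesis
      by (rule has_field_derivative_transform_within_open[OF DERIV_const[of "?P d"] open_greaterThan[of d]])
       (use x cd in \<open>auto simp: psi_def min_def max_def\<close>)
    qed
    then show ?thesis using False by (simp add: dpsi_def)
   qed
   then have "((\<lambda>h. psi c d j (h + x)) has_real_derivative dpsi c d j x) (at 0)"
    using DERIV_shift[of "psi c d j" "dpsi c d j x" 0 x] by simp
   then show ?case by (simp add: add.commute)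
  qed
 qed
qed

lemma psi_integral:
 assumes "c < d" "a <= c"
 shows "psi c d j z = (LINT s|lborel. indicator {a..z} s * dpsi c d j s)"
proof (cases "z <= c")
 case True
 have 0: "(\<lambda>s. indicator {a..z} s * dpsi c d j s) = (\<lambda>_. 0)" using True by (auto simp: dpsi_def indicator_def fun_eq_iff)
 have "max c (min d z) = c" using True by auto
 then show ?thesis unfolding 0 by (simp add: psi_def)
next
 case False
 have "(LINT s|lborel. indicator {a..z} s * dpsi c d j s) = (LINT s|lborel. s ^ j * indicator {c..min d z} s)"
 proof (rule integral_cong_AE)
  show "(\<lambda>s. indicator {a..z} s * dpsi c d j s) \<in> borel_measurable lborel" using dpsi_borel[of c d j] by simp
  show "(\<lambda>s. s ^ j * indicator {c..min d z} s) \<in> borel_measurable lborel" by simp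
  have "AE x::real in lborel. x ~= c" "AE x::real in lborel. x ~= d" by (rule AE_lborel_singleton)+
  then show "AE s in lborel. indicator {a..z} s * dpsi c d j s = s ^ j * indicator {c..min d z} s"
   by eventually_elim (use assms in \<open>auto simp: dpsi_def indicator_def\<close>)
 qed
 also have "... = psi c d j z" using False assms by (subst integral_power) (auto simp: psi_def)
 finally show ?thesis by simp
qed

section \<open>Linearity and boundedness of the right inverse\<close>

lemma sum_swap3: "(\<Sum>x\<in>A. \<Sum>y\<in>B x. \<Sum>j\<in>J. F x y j) = (\<Sum>j\<in>J. \<Sum>x\<in>A. \<Sum>y\<in>B x. F x y j)"
proof -
 have "(\<Sum>x\<in>A. \<Sum>y\<in>B x. \<Sum>j\<in>J. F x y j) = (\<Sum>x\<in>A. \<Sum>j\<in>J. \<Sum>y\<in>B x. F x y j)"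
  by (intro sum.cong refl sum.swap)
 also have "... = (\<Sum>j\<in>J. \<Sum>x\<in>A. \<Sum>y\<in>B x. F x y j)" by (rule sum.swap)
 finally show ?thesis .
qed

lemma linear_combination: "linear f ==> f (\<Sum>j\<in>J. x j *\<^sub>R w j) = (\<Sum>j\<in>J. x j *\<^sub>R f (w j))"
 by (simp add: linear_sum linear_scale)

lemma linear_symm: "linear (symm \<nu>)"
 by (rule linearI) (simp_all add: symm_def vec_eq_iff inner_add_left add_divide_distrib algebra_simps)

lemma linear_matrix_vector: "linear (\<lambda>A. A *v (g::real^2) :: real^2)"
 by (rule linearI) (simp_all add: matrix_vector_mult_def vec_eq_iff sum_2 algebra_simps)

lemma bub_lin: "bub a b c (\<lambda>p. \<Sum>j\<in>J. x j * g j p) p = (\<Sum>j\<in>J. x j * bub a b c (g j) p)"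
 by (simp add: bub_def sum_distrib_left mult_ac)

lemma bub_abs:
 assumes "area2 a b c ~= 0" "p \<in> tri a b c"
 shows "\<bar>bub a b c g p\<bar> <= \<bar>g p\<bar>"
proof -
 have l: "0 <= lam a b c p" "0 <= lam b c a p" "0 <= lam c a b p" using assms(2) by (auto simp: tri_def)
 have "lam a b c p <= 1" "lam b c a p <= 1" using l lam_sum[OF assms(1), of p] by linarith+
 then have "\<bar>lam a b c p * lam b c a p\<bar> <= 1" using l by (simp add: mult_le_one)
 then have "\<bar>lam a b c p * lam b c a p\<bar> * \<bar>g p\<bar> <= 1 * \<bar>g p\<bar>" by (rule mult_right_mono) simp
 then show ?thesis using assms(2) by (simp add: bub_def abs_mult)
qed

lemma tint_mono:
 assumes "area2 a b c ~= 0" "cont f" "cont g" "!!p. p \<in> tri a b c ==> f p <= g p"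
 shows "tint a b c f <= tint a b c g"
 unfolding tint_def using assms
 by (intro integral_mono tint_integrable) (auto simp: indicator_def)

context bubble_mesh
begin

definition lc :: "'j set => ('j => real) => ('j => (real^2) set => real^2 => real^2) => (real^2) set => real^2 => real^2" where
 "lc J x W T p = (\<Sum>j\<in>J. x j *\<^sub>R W j T p)"

lemma pw_lc: "pw (lc J x W) p = (\<Sum>j\<in>J. x j *\<^sub>R pw (W j) p)"
 unfolding pw_def lc_def scaleR_sum_right by (subst sum.swap) (simp add: mult.commute)

lemma poly_family_lc: "finite J ==> (!!j. j \<in> J ==> poly_family m (W j)) ==> poly_family m (lc J x W)"
 unfolding poly_family_def lc_def by (auto intro!: Pxy_sum Pxy_cmul)

context
 fixes J :: "'j set" and W
 assumes J: "finite J" and W: "!!j. j \<in> J ==> poly_family (k + 1) (W j)"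
begin

lemma Mom_lc: "Mom (lc J x W) a b = (\<Sum>j\<in>J. x j *\<^sub>R Mom (W j) a b)"
proof -
 have "(LINT p|lborel. (\<Sum>j\<in>J. x j *\<^sub>R pw (W j) p) $ i * weight i a b p) = (\<Sum>j\<in>J. x j * (LINT p|lborel. pw (W j) p $ i * weight i a b p))" for i
 proof -
  have "(\<Sum>j\<in>J. x j *\<^sub>R pw (W j) p) $ i * weight i a b p = (\<Sum>j\<in>J. x j * (pw (W j) p $ i * weight i a b p))" for p
   by (simp add: sum_distrib_right mult.assoc)
  then show ?thesis using integrable_pw[OF W weight_borel weight_le1] by simp
 qed
 then show ?thesis by (simp add: Mom_def pw_lc vec_eq_iff)
qed

lemma Am_lc: "Am (lc J x W) a b = (\<Sum>j\<in>J. x j *\<^sub>R Am (W j) a b)"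
proof -
 have "36 *\<^sub>R (\<Sum>j\<in>J. x j *\<^sub>R Mom (W j) a b) + 24 *\<^sub>R (\<Sum>j\<in>J. x j *\<^sub>R Mom (W j) b a)
  = (\<Sum>j\<in>J. x j *\<^sub>R (36 *\<^sub>R Mom (W j) a b + 24 *\<^sub>R Mom (W j) b a))"
  by (simp add: scaleR_sum_right sum.distrib scaleR_add_right mult.commute)
 then show ?thesis unfolding Am_def Mom_lc by (simp add: linear_combination[OF linear_symm])
qed

lemma divc_lc: "divc (lc J x W) T p = (\<Sum>j\<in>J. x j *\<^sub>R divc (W j) T p)"
 unfolding divc_def Am_lc linear_combination[OF linear_matrix_vector] sum_swap3 by (simp add: scaleR_sum_right)

lemma resT_lc: "resT (lc J x W) T = (\<lambda>p. \<Sum>j\<in>J. x j *\<^sub>R resT (W j) T p)"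
 by (simp add: fun_eq_iff resT_def divc_lc sum_subtractf scaleR_diff_right) (simp add: lc_def)

lemma QT_lc: "T \<in> X ==> QT (lc J x W) T e = (\<lambda>p. \<Sum>j\<in>J. x j * QT (W j) T e p)"
proof
 fix p assume T: "T \<in> X"
 have "cont (resT (W j) T)" if "j \<in> J" for j
  using resT_Pxy[OF W[OF that] _ T] k1 vec2_cont[of "resT (W j) T" "k + 1"] by simp
 then show "QT (lc J x W) T e p = (\<Sum>j\<in>J. x j * QT (W j) T e p)"
  unfolding QT_def resT_lc by (rule bubble_inverse_lin[OF Q nzT(1)[OF T] J])
qed

lemma S_lc: "S (lc J x W) p = (\<Sum>j\<in>J. x j *\<^sub>R S (W j) p)"
proof -
 have "tauc (lc J x W) p = (\<Sum>j\<in>J. x j *\<^sub>R tauc (W j) p)"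
 proof -
  have "tauc (lc J x W) p = (\<Sum>u\<in>Vs. \<Sum>y\<in>Vs - {u}. \<Sum>j\<in>J. x j *\<^sub>R (q3 u y p *\<^sub>R Am (W j) u y))"
   unfolding tauc_def Am_lc scaleR_sum_right by (simp add: mult.commute)
  then show ?thesis unfolding sum_swap3 tauc_def by (simp add: scaleR_sum_right)
 qed
 moreover have "bT (lc J x W) T p = (\<Sum>j\<in>J. x j *\<^sub>R bT (W j) T p)" if "T \<in> X" for T
  unfolding bT_def QT_lc[OF that] bub_lin by (simp add: scaleR_sum_left scaleR_add_right sum.distrib)
 then have "taub (lc J x W) p = (\<Sum>j\<in>J. x j *\<^sub>R taub (W j) p)"
  unfolding taub_def scaleR_sum_right by (subst sum.swap) simp
 ultimately show ?thesis by (simp add: S_def scaleR_add_right sum.distrib)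
qed

end

text \<open>The first summand comes from the edge fields and their share in the residual, the second one from the data in the residual.\<close>

definition Kc :: real where
 "Kc = (1 + 81 * C * \<rho> ^ 3) * ((180 * \<rho>)\<^sup>2 * (576 * \<rho> * L\<^sup>2)) + 18 * C * \<rho>\<^sup>2 * (2 * \<gamma>\<^sup>2 * L)\<^sup>2"

lemma Kc0: "Kc \<ge> 0" using C0 rho0 by (simp add: Kc_def)

lemma tauc_norm: "T \<in> X ==> p \<in> T ==> norm (tauc W p) <= \<alpha>T W T"
proof -
 assume T: "T \<in> X" and p: "p \<in> T"
 have l: "0 <= lamT T x p" "lamT T x p <= 1" for x using lamT_nonneg[OF smp[OF T] p] lamT_le1[OF smp[OF T] p] by auto
 have "norm (lamT T x p * lamT T x p * lamT T y p) <= 1" for x y using l by (simp add: mult_le_one)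
 then have "norm ((lamT T x p * lamT T x p * lamT T y p) *\<^sub>R A) <= norm A" for x y and A :: "real^2^2"
  unfolding norm_scaleR using mult_right_mono[of _ 1 "norm A"] by simp
 then show ?thesis unfolding tauc_eq[OF T p] \<alpha>T_def
  by (intro order_trans[OF norm_sum] sum_mono)
qed

lemma gT_norm: "T \<in> X ==> norm (gT T x) <= dd / DT T"
proof -
 assume T: "T \<in> X"
 have v: "vA T \<in> verts T" "vB T \<in> verts T" "vC T \<in> verts T" by (auto simp: verts_def)
 have D: "area2 (vB T) (vC T) (vA T) = DT T" "area2 (vC T) (vA T) (vB T) = DT T"
  using area2_rot[where a="vA T" and b="vB T" and c="vC T"] by auto
 note dT = verts_diam[OF T v(3) v(2)] verts_diam[OF T v(1) v(3)] verts_diam[OF T v(2) v(1)]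
 have "norm (glam (vA T) (vB T) (vC T)) <= dd / DT T" "norm (glam (vB T) (vC T) (vA T)) <= dd / DT T" "norm (glam (vC T) (vA T) (vB T)) <= dd / DT T"
  unfolding glam_norm D using dT DT_pos[OF T] by (simp_all add: divide_right_mono)
 moreover have "0 <= dd / DT T" using dd0 DT_pos[OF T] by simp
 ultimately show ?thesis by (simp add: gT_def)
qed

lemma divc_norm: "T \<in> X ==> p \<in> T ==> norm (divc W T p) <= 3 * \<alpha>T W T * dd / DT T"
proof -
 assume T: "T \<in> X" and p: "p \<in> T"
 have l: "0 <= lamT T x p" "lamT T x p <= 1" for x using lamT_nonneg[OF smp[OF T] p] lamT_le1[OF smp[OF T] p] by auto
 have g: "norm (gq T x y p) <= 3 * (dd / DT T)" for x y
 proof -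
  have l2: "\<bar>2 * lamT T x p * lamT T y p\<bar> <= 2" "\<bar>lamT T x p ^ 2\<bar> <= 1"
   using l mult_le_one[of "lamT T x p" "lamT T y p"] by (simp_all add: abs_mult power_le_one mult.assoc)
  have "0 <= dd / DT T" using dd0 DT_pos[OF T] by simp
  then have "norm ((2 * lamT T x p * lamT T y p) *\<^sub>R gT T x) <= 2 * (dd / DT T)" "norm ((lamT T x p ^ 2) *\<^sub>R gT T y) <= 1 * (dd / DT T)"
   unfolding norm_scaleR real_norm_def using l2 gT_norm[OF T] by (intro mult_mono; simp)+
  then have "norm (gq T x y p) <= 2 * (dd / DT T) + 1 * (dd / DT T)" unfolding gq_def by (rule norm_triangle_mono)
  then show ?thesis by simp
 qed
 have "norm (divc W T p) <= (\<Sum>x\<in>verts T. \<Sum>y\<in>verts T - {x}. norm (Am W x y) * (3 * (dd / DT T)))"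
  unfolding divc_def
  by (intro order_trans[OF norm_sum] sum_mono order_trans[OF norm_matrix_vector2] mult_left_mono g) simp
 then show ?thesis by (simp add: \<alpha>T_def sum_distrib_left sum_distrib_right sum_divide_distrib mult_ac)
qed

lemma tint_divc:
 assumes T: "T \<in> X"
 shows "tint (vA T) (vB T) (vC T) (\<lambda>p. (norm (divc W T p))\<^sup>2) <= 9 * (\<alpha>T W T)\<^sup>2 * dd\<^sup>2 / (2 * DT T)"
proof -
 let ?c = "(3 * \<alpha>T W T * dd / DT T)\<^sup>2"
 have "cont (divc W T)" using divc_Pxy[of 2] vec2_cont[of "divc W T" 2] by simp
 then have c: "cont (\<lambda>p. (norm (divc W T p))\<^sup>2)" by (intro continuous_intros)
 have "tint (vA T) (vB T) (vC T) (\<lambda>p. (norm (divc W T p))\<^sup>2) <= tint (vA T) (vB T) (vC T) (\<lambda>p. ?c * 1)"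
  using divc_norm[OF T] c unfolding triT[OF T]
  by (intro tint_mono nzT(1)[OF T]) (auto intro!: power_mono simp: triT[OF T])
 also have "... = ?c * (DT T / 2)" unfolding tint_cmul tint_1(1)[OF nzT(1)[OF T]] using DT_pos[OF T] by simp
 also have "... = 9 * (\<alpha>T W T)\<^sup>2 * dd\<^sup>2 / (2 * DT T)"
  using DT_pos[OF T] by (simp add: power2_eq_square field_simps)
 finally show ?thesis .
qed

definition tW :: "cell_field => (real^2) set => real" where
 "tW W T = tint (vA T) (vB T) (vC T) (\<lambda>p. (norm (W T p))\<^sup>2)"

lemma tint_resT:
 assumes W: "poly_family (k + 1) W" and T: "T \<in> X"
 shows "tint (vA T) (vB T) (vC T) (\<lambda>p. (norm (resT W T p))\<^sup>2) <= 2 * tW W T + 9 * (\<alpha>T W T)\<^sup>2 * \<rho>"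
proof -
 have "cont (divc W T)" using divc_Pxy[of 2] vec2_cont[of "divc W T" 2] by simp
 then have c1: "cont (\<lambda>p. 2 * (norm (divc W T p))\<^sup>2)" by (intro continuous_intros)
 have cW: "cont (W T)" by (rule poly_family_cont[OF W T])
 then have c2: "cont (\<lambda>p. 2 * (norm (W T p))\<^sup>2)" by (intro continuous_intros)
 have c3: "cont (\<lambda>p. (norm (resT W T p))\<^sup>2)" unfolding resT_def using cW \<open>cont (divc W T)\<close> by (intro continuous_intros)
 have "(norm (u - w))\<^sup>2 <= 2 * (norm u)\<^sup>2 + 2 * (norm w)\<^sup>2" for u w :: "real^2"
 proof -
  have "(norm (u - w))\<^sup>2 <= (norm u + norm w)\<^sup>2" by (intro power_mono norm_triangle_ineq4) simp
  also have "... <= 2 * (norm u)\<^sup>2 + 2 * (norm w)\<^sup>2"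
   using sum_squares_bound[of "norm u" "norm w"] by (simp add: power2_eq_square algebra_simps)
  finally show ?thesis .
 qed
 then have "tint (vA T) (vB T) (vC T) (\<lambda>p. (norm (resT W T p))\<^sup>2) <= tint (vA T) (vB T) (vC T) (\<lambda>p. 2 * (norm (W T p))\<^sup>2 + 2 * (norm (divc W T p))\<^sup>2)"
  using c1 c2 by (intro tint_mono nzT(1)[OF T] c3 continuous_on_add) (auto simp: resT_def)
 also have "... = 2 * tW W T + 2 * tint (vA T) (vB T) (vC T) (\<lambda>p. (norm (divc W T p))\<^sup>2)"
  unfolding tint_add[OF nzT(1)[OF T] c2 c1] tint_cmul tW_def ..
 also have "2 * tint (vA T) (vB T) (vC T) (\<lambda>p. (norm (divc W T p))\<^sup>2) <= 9 * (\<alpha>T W T)\<^sup>2 * \<rho>"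
 proof -
  have "2 * tint (vA T) (vB T) (vC T) (\<lambda>p. (norm (divc W T p))\<^sup>2) <= 9 * (\<alpha>T W T)\<^sup>2 * (dd\<^sup>2 / DT T)"
   using tint_divc[OF T, of W] by (simp add: field_simps)
  also have "... <= 9 * (\<alpha>T W T)\<^sup>2 * \<rho>"
   using dd_DT[OF T] DT_pos[OF T] by (intro mult_left_mono) (simp_all add: pos_divide_le_eq)
  finally show ?thesis .
 qed
 finally show ?thesis by simp
qed

definition cT :: "cell_field => (real^2) set => real" where
 "cT W T = 2 * (\<alpha>T W T)\<^sup>2 + 18 * dd ^ 4 * (C * (dd\<^sup>2 / DT T ^ 3 * tint (vA T) (vB T) (vC T) (\<lambda>p. (norm (resT W T p))\<^sup>2)))"

lemma S_pointwise:
 assumes W: "poly_family (k + 1) W" and T: "T \<in> X" and p: "p \<in> T"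
 shows "(norm (tauc W p + bT W T p))\<^sup>2 <= cT W T"
proof -
 let ?q = "\<lambda>e. \<bar>QT W T e p\<bar>"
 let ?M = "C * (dd\<^sup>2 / DT T ^ 3 * tint (vA T) (vB T) (vC T) (\<lambda>p. (norm (resT W T p))\<^sup>2))"
 have v: "vA T \<in> verts T" "vB T \<in> verts T" "vC T \<in> verts T" by (auto simp: verts_def)
 have cr: "cont (resT W T)" using resT_Pxy[OF W _ T] k1 vec2_cont[of "resT W T" "k + 1"] by simp
 have q: "(?q e)\<^sup>2 <= ?M" for e
  using bubble_inverse_bound[OF Q nzT(1)[OF T] _ cr verts_diam[OF T v(2) v(1)] verts_diam[OF T v(3) v(1)], of p e] p DT_pos[OF T]
  by (simp add: triT[OF T] QT_def)
 have o: "norm (outer (x - y)) <= dd\<^sup>2" if "x \<in> verts T" "y \<in> verts T" for x y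
  unfolding outer_norm using verts_diam[OF T that] by (intro power_mono) auto
 have "norm (bT W T p) <= ?q 1 * dd\<^sup>2 + ?q 2 * dd\<^sup>2 + ?q 3 * dd\<^sup>2"
  unfolding bT_def using bub_abs[OF nzT(1)[OF T], of p] bub_abs[OF nzT(2)[OF T], of p] bub_abs[OF nzT(3)[OF T], of p] p o v
  by (intro norm_triangle_mono) (auto simp: triT[OF T] intro!: mult_mono)
 also have "... = dd\<^sup>2 * (?q 1 + ?q 2 + ?q 3)" by (simp add: algebra_simps)
 finally have "(norm (bT W T p))\<^sup>2 <= (dd\<^sup>2 * (?q 1 + ?q 2 + ?q 3))\<^sup>2" by (intro power_mono) auto
 also have "... = dd ^ 4 * (?q 1 + ?q 2 + ?q 3)\<^sup>2" by (simp add: power_mult_distrib)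
 also have "... <= dd ^ 4 * (3 * ((?q 1)\<^sup>2 + (?q 2)\<^sup>2 + (?q 3)\<^sup>2))"
 proof (intro mult_left_mono)
  have "(x + y + z)\<^sup>2 <= 3 * (x\<^sup>2 + y\<^sup>2 + z\<^sup>2)" for x y z :: real
   using sum_squares_bound[of x y] sum_squares_bound[of x z] sum_squares_bound[of y z]
   by (simp add: power2_eq_square algebra_simps)
  then show "(?q 1 + ?q 2 + ?q 3)\<^sup>2 <= 3 * ((?q 1)\<^sup>2 + (?q 2)\<^sup>2 + (?q 3)\<^sup>2)" .
 qed (use dd0 in simp)
 also have "... <= dd ^ 4 * (9 * ?M)" using q[of 1] q[of 2] q[of 3] dd0 by (intro mult_left_mono) auto
 finally have b: "(norm (bT W T p))\<^sup>2 <= 9 * dd ^ 4 * ?M" by (simp add: mult_ac)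
 have t: "(norm (tauc W p))\<^sup>2 <= (\<alpha>T W T)\<^sup>2" using tauc_norm[OF T p] by (intro power_mono) auto
 have "(norm (tauc W p + bT W T p))\<^sup>2 <= (norm (tauc W p) + norm (bT W T p))\<^sup>2"
  by (intro power_mono norm_triangle_ineq) simp
 also have "... <= 2 * (norm (tauc W p))\<^sup>2 + 2 * (norm (bT W T p))\<^sup>2"
  using sum_squares_bound[of "norm (tauc W p)" "norm (bT W T p)"] by (simp add: power2_eq_square algebra_simps)
 also have "... <= cT W T" using b t by (simp add: cT_def)
 finally show ?thesis .
qed

lemma cT_bound:
 assumes W: "poly_family (k + 1) W" and T: "T \<in> X"
 shows "cT W T * (DT T / 2) <= (1 + 81 * C * \<rho> ^ 3) * (180 * \<rho>)\<^sup>2 * (mT W T)\<^sup>2 + 18 * C * \<rho>\<^sup>2 * (2 * \<gamma>\<^sup>2 * L)\<^sup>2 * tW W T"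
proof -
 let ?J = "tint (vA T) (vB T) (vC T) (\<lambda>p. (norm (resT W T p))\<^sup>2)" and ?D = "DT T" and ?a = "\<alpha>T W T"
 have D: "?D > 0" by (rule DT_pos[OF T])
 have tp: "0 <= tint (vA T) (vB T) (vC T) (\<lambda>p. (norm (f p))\<^sup>2)" for f :: "real^2 => real^2"
  unfolding tint_def by (rule Bochner_Integration.integral_nonneg) simp
 have J0: "?J \<ge> 0" and t0: "tW W T \<ge> 0" unfolding tW_def by (rule tp)+
 have r: "dd\<^sup>2 / ?D <= \<rho>" "0 <= dd\<^sup>2 / ?D" using dd_DT[OF T] D by (simp_all add: pos_divide_le_eq)
 have "cT W T * (?D / 2) = ?a\<^sup>2 * ?D + 9 * C * dd\<^sup>2 * (dd\<^sup>2 / ?D)\<^sup>2 * ?J"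
  using D by (simp add: cT_def field_simps power2_eq_square power3_eq_cube power4_eq_xxxx)
 also have "... <= ?a\<^sup>2 * dd\<^sup>2 + 9 * C * dd\<^sup>2 * \<rho>\<^sup>2 * (2 * tW W T + 9 * ?a\<^sup>2 * \<rho>)"
  using DT_le[OF T] r C0 J0 tint_resT[OF W T] \<alpha>T_nonneg[of W T] D dd0 rho0
  by (intro add_mono mult_mono power_mono mult_nonneg_nonneg) auto
 also have "... = (1 + 81 * C * \<rho> ^ 3) * (dd * ?a)\<^sup>2 + 18 * C * \<rho>\<^sup>2 * dd\<^sup>2 * tW W T"
  by (simp add: power2_eq_square power3_eq_cube algebra_simps)
 also have "... <= (1 + 81 * C * \<rho> ^ 3) * (180 * \<rho> * mT W T)\<^sup>2 + 18 * C * \<rho>\<^sup>2 * (2 * \<gamma>\<^sup>2 * L)\<^sup>2 * tW W T"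
 proof (intro add_mono mult_left_mono mult_right_mono power_mono)
  show "dd * ?a <= 180 * \<rho> * mT W T" by (rule \<alpha>T_bound[OF T])
  show "0 <= dd * ?a" using dd0 \<alpha>T_nonneg by simp
  show "dd <= 2 * \<gamma>\<^sup>2 * L" using dd_le T by blast
 qed (use C0 rho0 dd0 t0 in auto)
 finally show ?thesis by (simp add: power_mult_distrib mult_ac)
qed

lemma sum_tW:
 assumes W: "poly_family (k + 1) W"
 shows "(\<Sum>T\<in>X. tW W T) = (LINT p|lborel. (norm (pw W p))\<^sup>2)"
proof -
 have i: "integrable lborel (\<lambda>p. indicator T p * (norm (W T p))\<^sup>2)" if T: "T \<in> X" for T
  using tint_integrable[OF nzT(1)[OF T], of "\<lambda>p. (norm (W T p))\<^sup>2"] poly_family_cont[OF W T]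
  by (simp add: triT[OF T] continuous_on_power continuous_on_norm)
 have "(\<Sum>T\<in>X. tW W T) = (\<Sum>T\<in>X. (LINT p|lborel. indicator T p * (norm (W T p))\<^sup>2))"
  by (intro sum.cong refl) (simp add: tW_def tint_def triT)
 also have "... = (LINT p|lborel. (\<Sum>T\<in>X. indicator T p * (norm (W T p))\<^sup>2))" using i by simp
 also have "... = (LINT p|lborel. (norm (pw W p))\<^sup>2)"
 proof (rule integral_cong_AE)
  show "(\<lambda>p. \<Sum>T\<in>X. indicator T p * (norm (W T p))\<^sup>2) \<in> borel_measurable lborel" using i by (intro borel_measurable_sum) auto
  show "(\<lambda>p. (norm (pw W p))\<^sup>2) \<in> borel_measurable lborel" using pw_borel[OF W] by simp
  show "AE p in lborel. (\<Sum>T\<in>X. indicator T p * (norm (W T p))\<^sup>2) = (norm (pw W p))\<^sup>2"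
   using AE_only
  proof eventually_elim
   case (elim p)
   show ?case
   proof (cases "p \<in> \<Union>X")
    case True
    then obtain T where T: "T \<in> X" "p \<in> T" by blast
    have p1: "p \<in> iT T" using elim T by blast
    have "(\<Sum>T\<in>X. indicator T p * (norm (W T p))\<^sup>2) = indicator T p * (norm (W T p))\<^sup>2"
    proof (rule sum_only[OF T(1)])
     fix T' assume "T' \<in> X" "T' ~= T"
     then have "p ~: T'" using elim T by blast
     then show "indicator T' p * (norm (W T' p))\<^sup>2 = 0" by simp
    qed
    then show ?thesis using T pw_eq[OF T(1) p1] by simp
   next
    case False
    have "(\<Sum>T\<in>X. indicator T p * (norm (W T p))\<^sup>2) = 0" by (rule sum.neutral) (use False in auto)
    then show ?thesis using pw_zero[OF False, of W] by simp
   qed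
  qed
 qed
 finally show ?thesis .
qed

text \<open>All norms are compared on one triangle with constants that depend on its shape only, see \<open>cT_bound\<close>; the sum over the triangles
  is then controlled by \<open>mT_sum_bound\<close>.\<close>

lemma S_bound:
 assumes W: "poly_family (k + 1) W"
 shows "integrable lborel (\<lambda>p. (norm (S W p))\<^sup>2)" "(LINT p|lborel. (norm (S W p))\<^sup>2) <= Kc * (LINT p|lborel. (norm (pw W p))\<^sup>2)"
proof -
 have c0: "0 <= cT W T" if "T \<in> X" for T
 proof -
  have "T ~= {}" using DT_pos[OF that] verts_in[OF that, of "vA T"] by (auto simp: verts_def)
  then obtain p where "p \<in> T" by blast
  from S_pointwise[OF W that this] show ?thesis using zero_le_power2 order_trans by blast
 qed
 have iT': "integrable lborel (\<lambda>p. indicator T p * cT W T)" "(LINT p|lborel. indicator T p * cT W T) = cT W T * (DT T / 2)" if T: "T \<in> X" for T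
 proof -
  have "emeasure lborel T < \<infinity>" using T_compact(1)[OF smp[OF T]] by (intro emeasure_bounded_finite compact_imp_bounded)
  then show "integrable lborel (\<lambda>p. indicator T p * cT W T)" using T_compact(2)[OF smp[OF T]] by simp
  show "(LINT p|lborel. indicator T p * cT W T) = cT W T * (DT T / 2)" using DT_measure[OF T] by simp
 qed
 have ae: "AE p in lborel. (norm (S W p))\<^sup>2 <= (\<Sum>T\<in>X. indicator T p * cT W T)"
  using AE_only
 proof eventually_elim
  case (elim p)
  show ?case
  proof (cases "p \<in> \<Union>X")
   case True
   then obtain T where T: "T \<in> X" "p \<in> T" by blast
   have "taub W p = bT W T p" unfolding taub_def
   proof (rule sum_only[OF T(1)])
    fix T' assume T': "T' \<in> X" "T' ~= T"
    then have "p ~: T'" using elim T by blast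
    then show "bT W T' p = 0" using triT[OF T'(1)] by (simp add: bT_def bub_def)
   qed
   then have "(norm (S W p))\<^sup>2 <= cT W T" using S_pointwise[OF W T] by (simp add: S_def)
   also have "... = indicator T p * cT W T" using T by simp
   also have "... <= (\<Sum>T\<in>X. indicator T p * cT W T)"
    using fin T c0 by (intro member_le_sum[of T X "\<lambda>T. indicator T p * cT W T"]) auto
   finally show ?thesis .
  next
   case False
   then show ?thesis using c0 by (simp add: S_zero sum_nonneg)
  qed
 qed
 have isum: "integrable lborel (\<lambda>p. \<Sum>T\<in>X. indicator T p * cT W T)" using iT'(1) by (intro Bochner_Integration.integrable_sum)
 show 1: "integrable lborel (\<lambda>p. (norm (S W p))\<^sup>2)"
 proof (rule Bochner_Integration.integrable_bound[OF isum])
  show "(\<lambda>p. (norm (S W p))\<^sup>2) \<in> borel_measurable lborel" using bb_borel[OF bb_S] by simp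
  show "AE p in lborel. norm ((norm (S W p))\<^sup>2) <= norm (\<Sum>T\<in>X. indicator T p * cT W T)"
   using ae by eventually_elim simp
 qed
 have "(LINT p|lborel. (norm (S W p))\<^sup>2) <= (LINT p|lborel. (\<Sum>T\<in>X. indicator T p * cT W T))"
  by (rule integral_mono_AE[OF 1 isum ae])
 also have "... = (\<Sum>T\<in>X. (LINT p|lborel. indicator T p * cT W T))"
  by (rule Bochner_Integration.integral_sum) (rule iT'(1))
 also have "... = (\<Sum>T\<in>X. cT W T * (DT T / 2))" by (intro sum.cong refl iT'(2))
 also have "... <= (\<Sum>T\<in>X. (1 + 81 * C * \<rho> ^ 3) * (180 * \<rho>)\<^sup>2 * (mT W T)\<^sup>2 + 18 * C * \<rho>\<^sup>2 * (2 * \<gamma>\<^sup>2 * L)\<^sup>2 * tW W T)"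
  by (rule sum_mono[OF cT_bound[OF W]])
 also have "... = (1 + 81 * C * \<rho> ^ 3) * (180 * \<rho>)\<^sup>2 * (\<Sum>T\<in>X. (mT W T)\<^sup>2) + 18 * C * \<rho>\<^sup>2 * (2 * \<gamma>\<^sup>2 * L)\<^sup>2 * (LINT p|lborel. (norm (pw W p))\<^sup>2)"
  unfolding sum_tW[OF W, symmetric] by (simp only: sum.distrib sum_distrib_left)
 also have "... <= (1 + 81 * C * \<rho> ^ 3) * (180 * \<rho>)\<^sup>2 * (576 * \<rho> * L\<^sup>2 * (LINT p|lborel. (norm (pw W p))\<^sup>2)) + 18 * C * \<rho>\<^sup>2 * (2 * \<gamma>\<^sup>2 * L)\<^sup>2 * (LINT p|lborel. (norm (pw W p))\<^sup>2)"
  using mT_sum_bound[OF W] C0 rho0 by (intro add_right_mono mult_left_mono) auto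
 also have "... = Kc * (LINT p|lborel. (norm (pw W p))\<^sup>2)"
 proof -
  have "A * B * (E * N) + F * N = (A * (B * E) + F) * N" for A B E F N :: real by (simp add: algebra_simps)
  then show ?thesis unfolding Kc_def by blast
 qed
 finally show "(LINT p|lborel. (norm (S W p))\<^sup>2) <= Kc * (LINT p|lborel. (norm (pw W p))\<^sup>2)" .
qed

end

section \<open>Quasi-uniformity of the plane mesh\<close>

lemma ext_diff: "norm (ext p z - ext q z) = norm (p - q)"
proof -
 have "ext p z - ext q z = ext (p - q) 0" by (simp add: vec_eq_iff forall_3)
 then have "(norm (ext p z - ext q z))\<^sup>2 = (norm (p - q))\<^sup>2" by (simp add: norm_ext)
 then show ?thesis by (rule power2_eq_imp_eq) auto
qed

text \<open>Because every triangle is combined with every interval, shape regularity of the prisms forces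
  all triangles to be comparable with any single interval of the vertical partition: the plane mesh is quasi-uniform.\<close>

lemma prism_mesh_mesh2:
 assumes pm: "prism_mesh \<gamma> U {a<..<b} X Z" and ab: "a < b" and U: "open U" "bounded U" "negligible (frontier U)"
  and L: "L > 0" "!!p i. p \<in> closure U ==> \<bar>p $ i\<bar> <= L"
 obtains h where "mesh2 X U h (max \<gamma> 1) L"
proof -
 let ?g = "max \<gamma> 1"
 have X: "finite X" "\<Union>X = closure U" "pairwise (\<lambda>S T. interior S \<inter> interior T = {}) X" "!!T. T \<in> X ==> 2 simplex T"
  and Z: "\<Union>Z = closure {a<..<b}" "\<forall>I\<in>Z. \<exists>c d. c < d \<and> I = {c..d}"
  and cf: "conforming (prisms X Z)" and sr: "shape_regular \<gamma> (prisms X Z)"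
  using pm unfolding prism_mesh_def partition_into_def by auto
 have "Z ~= {}" using Z(1) ab by auto
 then obtain I where I: "I \<in> Z" by blast
 then obtain c d where cd: "c < d" "I = {c..d}" using Z(2) by blast
 have K: "cyl T I \<in> prisms X Z" if "T \<in> X" for T unfolding prisms_def using that I by blast
 have r: "\<exists>q r. 0 < r \<and> cball q r \<subseteq> cyl T I \<and> diameter (cyl T I) <= ?g * (2 * r) \<and> 2 * r <= d - c" if T: "T \<in> X" for T
 proof -
  obtain q r where qr: "0 < r" "cball q r \<subseteq> cyl T I" "diameter (cyl T I) <= \<gamma> * (2 * r)"
   using sr K[OF T] unfolding shape_regular_def by blast
  have 1: "diameter (cyl T I) <= ?g * (2 * r)" using qr by (intro order_trans[OF qr(3)] mult_right_mono) auto
  have "q + r *\<^sub>R axis 3 1 \<in> cyl T I" "q - r *\<^sub>R axis 3 1 \<in> cyl T I"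
   using qr by (auto simp: dist_norm intro!: subsetD[OF qr(2)])
  then have "2 * r <= d - c" using cd by (auto simp: cyl_def axis_def)
  then show ?thesis using qr(1,2) 1 by blast
 qed
 have cT: "compact T" if "T \<in> X" for T using T_compact(1)[OF X(4)[OF that]] .
 have dia: "norm (p - q) <= diameter (cyl T I)" if "T \<in> X" "p \<in> cyl T I" "q \<in> cyl T I" for T p q
  using diameter_bounded_bound[OF cyl_bounded[OF compact_imp_bounded[OF cT[OF that(1)]], of I] that(2,3)] cd by (simp add: dist_norm)
 have "mesh2 X U (d - c) ?g L"
 proof
  show "finite X" "open U" "bounded U" "negligible (frontier U)" "\<Union>X = closure U" "0 < L" "0 < d - c" "0 < ?g"
   using X U L cd by auto
  show "2 simplex T" if "T \<in> X" for T using X that by blast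
  show "interior T \<inter> interior T' = {}" if "T \<in> X" "T' \<in> X" "T ~= T'" for T T'
   using X(3) that unfolding pairwise_def by blast
  show "\<bar>p $ i\<bar> <= L" if "T \<in> X" "p \<in> T" for T p i using L X(2) that by blast
  show "norm (p - q) <= ?g * (d - c)" if T: "T \<in> X" and p: "p \<in> T" "q \<in> T" for T p q
  proof -
   obtain o' r where q: "0 < r" "diameter (cyl T I) <= ?g * (2 * r)" "2 * r <= d - c" using r[OF T] by blast
   have "norm (p - q) <= diameter (cyl T I)"
    using dia[OF T, of "ext p c" "ext q c"] p cd by (simp add: ext_diff ext_cyl)
   also have "... <= ?g * (2 * r)" by (rule q(2))
   also have "... <= ?g * (d - c)" using q(3) by (intro mult_left_mono) auto
   finally show ?thesis .
  qed
  show "\<exists>o'. cball o' ((d - c) / (2 * ?g)) \<subseteq> T" if T: "T \<in> X" for T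
  proof -
   obtain q r where q: "0 < r" "cball q r \<subseteq> cyl T I" "diameter (cyl T I) <= ?g * (2 * r)" using r[OF T] by blast
   have qK: "q \<in> cyl T I" using q by auto
   have "norm (ext (xy q) d - ext (xy q) c) <= diameter (cyl T I)"
    by (rule dia[OF T]) (use qK cd in \<open>auto simp: ext_cyl cyl_def\<close>)
   moreover have "norm (ext (xy q) d - ext (xy q) c) \<ge> d - c"
    using component_le_norm_cart[of "ext (xy q) d - ext (xy q) c" 3] by simp
   ultimately have "d - c <= r * (2 * ?g)" using q(3) by (simp add: mult_ac)
   then have le: "(d - c) / (2 * ?g) <= r" by (simp add: pos_divide_le_eq)
   have "cball (xy q) ((d - c) / (2 * ?g)) \<subseteq> T"
   proof
    fix p assume "p \<in> cball (xy q) ((d - c) / (2 * ?g))"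
    then have "norm (xy q - p) <= r" using le by (simp add: dist_norm)
    then have "ext p (q $ 3) \<in> cball q r" using ext_diff[of "xy q" "q $ 3" p] by (simp add: dist_norm)
    then show "p \<in> T" using q(2) ext_cyl by blast
   qed
   then show ?thesis by blast
  qed
  show "(T \<inter> T') face_of T \<and> (T \<inter> T') face_of T'" if T: "T \<in> X" "T' \<in> X" "T ~= T'" "T \<inter> T' ~= {}" for T T'
  proof -
   have c: "c \<in> I" using cd by simp
   have ne: "cyl T I ~= cyl T' I"
   proof
    assume "cyl T I = cyl T' I"
    then have "p \<in> T \<longleftrightarrow> p \<in> T'" for p using ext_cyl[of p c T I] ext_cyl[of p c T' I] c by simp
    then show False using T(3) by blast
   qed
   have int: "cyl T I \<inter> cyl T' I = cyl (T \<inter> T') I" by (auto simp: cyl_def)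
   have "cyl (T \<inter> T') I ~= {}" using T(4) c ext_cyl by blast
   then have F: "cyl (T \<inter> T') I face_of cyl T I" "cyl (T \<inter> T') I face_of cyl T' I"
    using cf K[OF T(1)] K[OF T(2)] ne unfolding conforming_def int[symmetric] by blast+
   have "(T \<inter> T') face_of S" if S: "cyl (T \<inter> T') I face_of cyl S I" "T \<inter> T' \<subseteq> S" for S
    unfolding face_of_def
   proof (intro conjI ballI impI)
    show "T \<inter> T' \<subseteq> S" by (rule S(2))
    show "convex (T \<inter> T')" using T X(4) by (intro convex_Int) (auto intro: convex_simplex)
    fix p q x assume p: "p \<in> S" "q \<in> S" "x \<in> T \<inter> T'" "x \<in> open_segment p q"
    obtain u where u: "p ~= q" "0 < u" "u < 1" "x = (1 - u) *\<^sub>R p + u *\<^sub>R q" using p(4) by (auto simp: in_segment)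
    have "ext p c ~= ext q c" using u(1) by (metis ext_simps(1))
    moreover have "ext x c = (1 - u) *\<^sub>R ext p c + u *\<^sub>R ext q c"
     unfolding u(4) by (simp add: vec_eq_iff forall_3 algebra_simps)
    ultimately have "ext x c \<in> open_segment (ext p c) (ext q c)" using u by (auto simp: in_segment)
    moreover have "ext p c \<in> cyl S I" "ext q c \<in> cyl S I" "ext x c \<in> cyl (T \<inter> T') I"
     using p(1-3) c unfolding ext_cyl by blast+
    moreover have "\<forall>a\<in>cyl S I. \<forall>b\<in>cyl S I. \<forall>x\<in>cyl (T \<inter> T') I. x \<in> open_segment a b --> a \<in> cyl (T \<inter> T') I \<and> b \<in> cyl (T \<inter> T') I"
     using S(1) unfolding face_of_def by blast
    ultimately have "ext p c \<in> cyl (T \<inter> T') I \<and> ext q c \<in> cyl (T \<inter> T') I" by blast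
    then show "p \<in> T \<inter> T'" "q \<in> T \<inter> T'" by (auto simp: ext_cyl)
   qed
   then show ?thesis using F by blast
  qed
 qed
 then show thesis by (rule that)
qed

section \<open>Weak divergences and the vertical partition\<close>

lemma bb_vecI:
 fixes F :: "'a::euclidean_space => ('b::euclidean_space)^'n"
 assumes F: "!!i. bb U (\<lambda>x. F x $ i)"
 shows "bb U F"
proof -
 have "\<forall>i. \<exists>B. \<forall>x\<in>U. norm (F x $ i) <= B" using F unfolding bb_def by blast
 then obtain B where B: "!!i x. x \<in> U ==> norm (F x $ i) <= B i" by metis
 show ?thesis
 proof (rule bbI[where B="\<Sum>i\<in>UNIV. B i"])
  show "F \<in> borel_measurable borel"
  proof (subst borel_measurable_euclidean_space, rule ballI)
   fix c :: "'b^'n" assume c: "c \<in> Basis"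
   then obtain i u where iu: "c = axis i u" unfolding Basis_vec_def by auto
   show "(\<lambda>x. F x \<bullet> c) \<in> borel_measurable borel"
    unfolding iu inner_axis using bb_borel[OF F[of i]] by (intro borel_measurable_inner borel_measurable_const)
  qed
  fix x assume x: "x \<in> U"
  have "norm (F x) <= (\<Sum>i\<in>UNIV. norm (F x $ i))" unfolding norm_vec_def by (rule L2_set_le_sum) simp
  also have "... <= (\<Sum>i\<in>UNIV. B i)" using B[OF x] by (rule sum_mono)
  finally show "norm (F x) <= (\<Sum>i\<in>UNIV. B i)" .
 qed
qed

lemma L2_component_integrable:
 fixes g :: "'a::euclidean_space => real^'n"
 assumes g: "g \<in> L2 U" and U: "open U" "bounded U"
 shows "integrable (lebesgue_on U) (\<lambda>x. g x $ i)"
proof -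
 have Ub: "U \<in> sets borel" using U by simp
 have "integrable (lebesgue_on U) (\<lambda>x. 1::real)"
  unfolding integral_lebesgue_on_borel(2)[of "\<lambda>_. 1::real", OF borel_measurable_const Ub]
  by (rule bounded_borel_integrable[OF _ Ub U(2), where B=1]) auto
 moreover have "integrable (lebesgue_on U) (\<lambda>x. (norm (g x))\<^sup>2)" using g unfolding L2_def by blast
 ultimately have i: "integrable (lebesgue_on U) (\<lambda>x. 1 + (norm (g x))\<^sup>2)" by (rule Bochner_Integration.integrable_add)
 show ?thesis
 proof (rule Bochner_Integration.integrable_bound[OF i])
  show "(\<lambda>x. g x $ i) \<in> borel_measurable (lebesgue_on U)" using g unfolding L2_def by (intro vec_nth_borel) blast
  have "norm (g x $ i) <= norm (1 + (norm (g x))\<^sup>2)" for x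
  proof -
   have "norm (g x $ i) <= norm (g x)" by (simp add: component_le_norm_cart)
   also have "... <= 1 + (norm (g x))\<^sup>2"
   proof -
    have "2 * norm (g x) <= (norm (g x))\<^sup>2 + 1" using sum_squares_bound[of "norm (g x)" 1] by simp
    then show ?thesis using norm_ge_zero[of "g x"] by linarith
   qed
   finally show ?thesis by simp
  qed
  then show "AE x in lebesgue_on U. norm (g x $ i) <= norm (1 + (norm (g x))\<^sup>2)" by simp
 qed
qed

text \<open>Components of square-integrable fields on bounded sets are integrable, so \<open>AE_zero_if_orthogonal_test_functions\<close> applies to the
  difference.\<close>

lemma weak_row_div_unique:
 assumes U: "open U" "bounded U" and g: "g \<in> L2 U" "g' \<in> L2 U" and w: "is_weak_row_div U \<tau> g" "is_weak_row_div U \<tau> g'"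
 shows "AE x in lebesgue_on U. g x = g' x"
proof -
 have i: "AE x in lebesgue_on U. g x $ i - g' x $ i = 0" for i
 proof (rule AE_zero_if_orthogonal_test_functions[OF U(1)])
  note ig = L2_component_integrable[OF g(1) U, of i] L2_component_integrable[OF g(2) U, of i]
  show "integrable (lebesgue_on U) (\<lambda>x. g x $ i - g' x $ i)" by (intro Bochner_Integration.integrable_diff ig)
  fix \<phi> assume \<phi>: "\<phi> \<in> test_functions U"
  obtain B where B: "!!x. \<bar>\<phi> x\<bar> <= B" by (rule test_function_bounds[OF \<phi>, where t=0]) blast
  have m: "\<phi> \<in> borel_measurable (lebesgue_on U)"
   using test_function_borel(1)[OF \<phi>] by (intro measurable_restrict_space1 measurable_completion) simp
  have im: "integrable (lebesgue_on U) (\<lambda>x. f x * \<phi> x)" if f: "integrable (lebesgue_on U) f" for f :: "_ => real"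
  proof (rule Bochner_Integration.integrable_bound)
   show "integrable (lebesgue_on U) (\<lambda>x. B * norm (f x))" using f by simp
   show "(\<lambda>x. f x * \<phi> x) \<in> borel_measurable (lebesgue_on U)" using f m by (intro borel_measurable_times) auto
   have "norm (f x * \<phi> x) <= norm (B * norm (f x))" for x
   proof -
    have "\<bar>f x\<bar> * \<bar>\<phi> x\<bar> <= \<bar>f x\<bar> * \<bar>B\<bar>" using B[of x] by (intro mult_left_mono) auto
    then show ?thesis by (simp add: abs_mult mult.commute)
   qed
   then show "AE x in lebesgue_on U. norm (f x * \<phi> x) <= norm (B * norm (f x))" by simp
  qed
  have "(LINT x|lebesgue_on U. g x $ i * \<phi> x) = (LINT x|lebesgue_on U. g' x $ i * \<phi> x)"
  proof -
   have "is_weak_div U (\<lambda>x. \<tau> x $ i) (\<lambda>x. g x $ i)" "is_weak_div U (\<lambda>x. \<tau> x $ i) (\<lambda>x. g' x $ i)"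
    using w unfolding is_weak_row_div_def by blast+
   then have "(LINT x|lebesgue_on U. \<tau> x $ i \<bullet> grad \<phi> x) = - (LINT x|lebesgue_on U. g x $ i * \<phi> x)"
    "(LINT x|lebesgue_on U. \<tau> x $ i \<bullet> grad \<phi> x) = - (LINT x|lebesgue_on U. g' x $ i * \<phi> x)"
    using \<phi> unfolding is_weak_div_def by blast+
   then show ?thesis by simp
  qed
  then show "(LINT x|lebesgue_on U. (g x $ i - g' x $ i) * \<phi> x) = 0"
   using im[OF ig(1)] im[OF ig(2)] by (simp add: left_diff_distrib)
 qed
 have "AE x in lebesgue_on U. \<forall>i\<in>UNIV. g x $ i - g' x $ i = 0"
  by (subst AE_finite_all) (use i in auto)
 then show ?thesis by eventually_elim (simp add: vec_eq_iff)
qed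

lemma row_div_eq:
 assumes "open U" "bounded U" "g \<in> L2 U" "is_weak_row_div U \<tau> g"
 shows "AE x in lebesgue_on U. row_div U \<tau> x = g x" "row_div U \<tau> \<in> L2 U"
proof -
 have r: "row_div U \<tau> \<in> L2 U \<and> is_weak_row_div U \<tau> (row_div U \<tau>)"
  unfolding row_div_def by (rule someI[of "\<lambda>g. g \<in> L2 U \<and> is_weak_row_div U \<tau> g" g]) (use assms in blast)
 then show "row_div U \<tau> \<in> L2 U" by blast
 show "AE x in lebesgue_on U. row_div U \<tau> x = g x" using weak_row_div_unique[OF assms(1,2) _ assms(3) _ assms(4)] r by blast
qed

lemma L2_norm_sq:
 assumes f: "bb U f" and U: "open U" "bounded U"
 shows "ennreal ((L2_norm U f)\<^sup>2) = (\<integral>\<^sup>+q. indicator U q * ennreal ((norm (f q))\<^sup>2) \<partial>lborel)"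
proof -
 have Ub: "U \<in> sets borel" using U by simp
 have m: "(\<lambda>q. (norm (f q))\<^sup>2) \<in> borel_measurable borel" using bb_borel[OF f] by simp
 have L: "f \<in> L2 U" by (rule bb_L2[OF f Ub U(2)])
 have i: "integrable lborel (\<lambda>q. indicator U q *\<^sub>R (norm (f q))\<^sup>2)"
 proof (rule integral_lebesgue_on_borel(2)[OF m Ub, THEN iffD1])
  show "integrable (lebesgue_on U) (\<lambda>q. (norm (f q))\<^sup>2)" using L by (simp add: L2_def)
 qed
 have "(L2_norm U f)\<^sup>2 = (LINT q|lebesgue_on U. (norm (f q))\<^sup>2)"
  unfolding L2_norm_def by (rule real_sqrt_pow2) (rule Bochner_Integration.integral_nonneg, simp)
 also have "... = (LINT q|lborel. indicator U q *\<^sub>R (norm (f q))\<^sup>2)" by (rule integral_lebesgue_on_borel(1)[OF m Ub])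
 finally have "ennreal ((L2_norm U f)\<^sup>2) = (\<integral>\<^sup>+q. ennreal (indicator U q *\<^sub>R (norm (f q))\<^sup>2) \<partial>lborel)"
  using nn_integral_eq_integral[OF i] by simp
 also have "... = (\<integral>\<^sup>+q. indicator U q * ennreal ((norm (f q))\<^sup>2) \<partial>lborel)"
  by (intro nn_integral_cong) (simp add: indicator_def)
 finally show ?thesis .
qed

locale mesh3 = bubble_mesh +
 fixes Z :: "real set set" and a b :: real
 assumes ab: "a < b" and Zfin: "finite Z" and Zcov: "\<Union>Z = closure {a<..<b}"
  and Zint: "!!I. I \<in> Z ==> \<exists>c d. c < d \<and> I = {c..d}" and Zdisj: "pairwise (\<lambda>S T. interior S \<inter> interior T = {}) Z"
begin

abbreviation "Om \<equiv> cyl U {a<..<b}"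

definition "lo I = (Inf I :: real)"
definition "hi I = (Sup I :: real)"

lemma lohi: "I \<in> Z ==> lo I < hi I" "I \<in> Z ==> I = {lo I..hi I}" "I \<in> Z ==> a <= lo I" "I \<in> Z ==> hi I <= b"
proof -
 have *: "lo I < hi I \<and> I = {lo I..hi I} \<and> a <= lo I \<and> hi I <= b" if I: "I \<in> Z"
 proof -
  obtain c d where cd: "c < d" "I = {c..d}" using Zint[OF I] by blast
  have "I \<subseteq> {a..b}" using I Zcov ab by auto
  then show ?thesis using cd by (auto simp: lo_def hi_def)
 qed
 show "I \<in> Z ==> lo I < hi I" "I \<in> Z ==> I = {lo I..hi I}" "I \<in> Z ==> a <= lo I" "I \<in> Z ==> hi I <= b"
  using * by auto
qed

lemma in_interval: "I \<in> Z ==> z \<in> I \<longleftrightarrow> lo I <= z \<and> z <= hi I"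
 by (subst lohi(2)) auto

lemma other_interval: "I \<in> Z ==> I' \<in> Z ==> I ~= I' ==> z \<in> I' ==> z ~: {lo I<..<hi I}"
proof
 assume I: "I \<in> Z" "I' \<in> Z" "I ~= I'" and z: "z \<in> I'" "z \<in> {lo I<..<hi I}"
 have "interior I \<inter> interior I' = {}" using Zdisj I unfolding pairwise_def by blast
 then have "interior {lo I..hi I} \<inter> interior {lo I'..hi I'} = {}"
  by (simp only: lohi(2)[OF I(1), symmetric] lohi(2)[OF I(2), symmetric])
 then have 0: "{lo I<..<hi I} \<inter> {lo I'<..<hi I'} = {}" by simp
 have z': "lo I' <= z" "z <= hi I'" using z(1) in_interval[OF I(2)] by blast+
 define l u where "l = max (lo I) (lo I')" and "u = min (hi I) (hi I')"
 have "l < u" using z' z(2) lohi(1)[OF I(1)] lohi(1)[OF I(2)] by (auto simp: l_def u_def)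
 then have "(l + u) / 2 \<in> {lo I<..<hi I} \<inter> {lo I'<..<hi I'}" by (auto simp: l_def u_def)
 then show False using 0 by blast
qed

lemma AE_Z: "AE z in lborel. \<forall>I\<in>Z. z \<in> I --> z \<in> {lo I<..<hi I}"
proof (subst AE_finite_all[OF Zfin], rule ballI)
 fix I assume I: "I \<in> Z"
 have "AE z::real in lborel. z ~= lo I" "AE z::real in lborel. z ~= hi I" by (rule AE_lborel_singleton)+
 then show "AE z in lborel. z \<in> I --> z \<in> {lo I<..<hi I}"
 proof eventually_elim
  case (elim z)
  then show ?case using in_interval[OF I, of z] by auto
 qed
qed

definition dB :: "real set \<times> nat => real => real" where "dB i = dpsi (lo (fst i)) (hi (fst i)) (snd i)"
definition pB :: "real set \<times> nat => real => real" where "pB i = psi (lo (fst i)) (hi (fst i)) (snd i)"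

lemma bb_dB: "fst i \<in> Z ==> bb V (dB i)"
 unfolding dB_def using dpsi_bound[OF lohi(1), of "fst i"] by (intro bbI[OF dpsi_borel]) auto

lemma dlip_pB: "fst i \<in> Z ==> dlip V 1 (pB i) (dB i)"
 unfolding dB_def pB_def by (intro dlip_psi lohi)

text \<open>At a given height only the interval containing it contributes.\<close>

lemma dB_sum:
 fixes F :: "_ => 'v::real_vector"
 assumes I: "I \<in> Z" and z: "z \<in> {lo I<..<hi I}" and B: "finite B"
 shows "(\<Sum>i\<in>Z \<times> B. dB i z *\<^sub>R F i) = (\<Sum>j\<in>B. z ^ j *\<^sub>R F (I, j))"
proof -
 have zI: "z \<in> I" using z in_interval[OF I, of z] by auto
 have "(\<Sum>i\<in>Z \<times> B. dB i z *\<^sub>R F i) = (\<Sum>i\<in>{I} \<times> B. dB i z *\<^sub>R F i)"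
 proof (rule sum.mono_neutral_right)
  show "\<forall>i\<in>Z \<times> B - {I} \<times> B. dB i z *\<^sub>R F i = 0"
  proof
   fix i assume "i \<in> Z \<times> B - {I} \<times> B"
   then have "fst i \<in> Z" "fst i ~= I" by auto
   then have "z ~: {lo (fst i)<..<hi (fst i)}" using other_interval[OF _ I _ zI] by blast
   then show "dB i z *\<^sub>R F i = 0" by (simp add: dB_def dpsi_def)
  qed
 qed (use I B Zfin in auto)
 also have "{I} \<times> B = (\<lambda>j. (I, j)) ` B" by auto
 also have "(\<Sum>i\<in>(\<lambda>j. (I, j)) ` B. dB i z *\<^sub>R F i) = (\<Sum>j\<in>B. dB (I, j) z *\<^sub>R F (I, j))"
  by (subst sum.reindex) (auto simp: inj_on_def)
 also have "... = (\<Sum>j\<in>B. z ^ j *\<^sub>R F (I, j))" using z by (simp add: dB_def dpsi_def)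
 finally show ?thesis .
qed

lemma dB_outside: "fst i \<in> Z ==> z ~: {a<..<b} ==> dB i z = 0"
 using lohi[of "fst i"] by (auto simp: dB_def dpsi_def indicator_def)

lemma Uz: "({a<..<b}::real set) \<in> sets borel" "bounded {a<..<b}" "open {a<..<b}" by auto

lemma I_borel: "I \<in> Z ==> I \<in> sets borel" using Zint[of I] by auto

lemma dB_piecewise:
 assumes i: "i \<in> Z \<times> {..k}"
 shows "dB i \<in> piecewise (L2 {a<..<b}) Z (Pz k)"
proof -
 have fi: "fst i \<in> Z" "snd i <= k" using i by auto
 have "restricts_into (dB i) I (Pz k)" if I: "I \<in> Z" for I
 proof (cases "I = fst i")
  case True
  have "poly (monom 1 (snd i)) \<in> Pz k" unfolding Pz_def using fi(2) degree_monom_le[of "1::real" "snd i"] by (auto intro: order_trans)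
  moreover have "AE z in lebesgue_on I. dB i z = poly (monom 1 (snd i)) z"
   unfolding AE_lebesgue_on_iff[OF I_borel[OF I]] using AE_Z
   by eventually_elim (use I True in \<open>auto simp: dB_def dpsi_def poly_monom\<close>)
  ultimately show ?thesis unfolding restricts_into_def by blast
 next
  case False
  have "poly 0 \<in> Pz k" unfolding Pz_def by fastforce
  moreover have "AE z in lebesgue_on I. dB i z = poly 0 z"
   unfolding AE_lebesgue_on_iff[OF I_borel[OF I]]
   using other_interval[OF fi(1) I False[symmetric]] by (auto simp: dB_def dpsi_def)
  ultimately show ?thesis unfolding restricts_into_def by blast
 qed
 then show ?thesis unfolding piecewise_def using bb_L2[OF bb_dB[OF fi(1)] Uz(1,2)] by blast
qed

lemma pB_piecewise:
 assumes i: "i \<in> Z \<times> {..k + 1}"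
 shows "pB i \<in> piecewise (H1 {a<..<b}) Z (Pz (k + 2))"
proof -
 have fi: "fst i \<in> Z" "snd i <= k + 1" using i by auto
 note d = dlip_pB[OF fi(1), of "{a<..<b}"]
 have "is_weak_pd {a<..<b} 1 (pB i) (dB i)"
  by (rule dlip_weak_pd[OF Uz(3) _ bb_borel[OF dlip_bb(1)[OF d]] bb_borel[OF dlip_bb(2)[OF d]]]) (use d in auto)
 then have H: "pB i \<in> H1 {a<..<b}" unfolding H1_def using bb_L2[OF dlip_bb(1)[OF d] Uz(1,2)] bb_L2[OF dlip_bb(2)[OF d] Uz(1,2)] by auto
 let ?l = "lo (fst i)" and ?u = "hi (fst i)" and ?j = "snd i"
 have "restricts_into (pB i) I (Pz (k + 2))" if I: "I \<in> Z" for I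
 proof -
  have "\<exists>q. degree q <= k + 2 \<and> (\<forall>z\<in>I. pB i z = poly q z)"
  proof (cases "I = fst i")
   case True
   let ?q = "smult (1 / real (Suc ?j)) (monom 1 (Suc ?j) - [:?l ^ Suc ?j:])"
   have "degree (monom (1::real) (Suc ?j) - [:?l ^ Suc ?j:]) <= Suc ?j"
    by (rule degree_diff_le) (auto simp: degree_monom_le)
   then have "degree ?q <= k + 2" using degree_smult_le[of "1 / real (Suc ?j)" "monom 1 (Suc ?j) - [:?l ^ Suc ?j:]"] fi(2) by linarith
   moreover have "pB i z = poly ?q z" if "z \<in> I" for z
   proof -
    have "?l <= z" "z <= ?u" using that in_interval[OF I, of z] unfolding True by auto
    then have "max ?l (min ?u z) = z" by auto
    then show ?thesis by (simp add: pB_def psi_def poly_monom)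
   qed
   ultimately show ?thesis by blast
  next
   case False
   have o: "z <= ?l \<or> ?u <= z" if "z \<in> I" for z using other_interval[OF fi(1) I False[symmetric] that] by auto
   have lu: "?l < ?u" by (rule lohi(1)[OF fi(1)])
   have "(\<forall>z\<in>I. z <= ?l) \<or> (\<forall>z\<in>I. ?u <= z)"
   proof (rule ccontr)
    assume "\<not> ?thesis"
    then obtain x y where xy: "x \<in> I" "x > ?l" "y \<in> I" "y < ?u" by (auto simp: not_le)
    then have "?u <= x" "y <= ?l" using o by force+
    moreover have "(?l + ?u) / 2 \<in> I"
     using \<open>?u <= x\<close> \<open>y <= ?l\<close> lu xy(1,3) in_interval[OF I, of x] in_interval[OF I, of y] in_interval[OF I, of "(?l + ?u) / 2"] by auto
    ultimately show False using o[of "(?l + ?u) / 2"] lu by auto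
   qed
   then show ?thesis
   proof
    assume h: "\<forall>z\<in>I. z <= ?l"
    have "pB i z = poly 0 z" if "z \<in> I" for z
    proof -
     have "max ?l (min ?u z) = ?l" using h that by auto
     then show ?thesis by (simp add: pB_def psi_def)
    qed
    then show ?thesis by (intro exI[of _ 0]) auto
   next
    assume h: "\<forall>z\<in>I. ?u <= z"
    have "pB i z = poly [:pB i ?u:] z" if "z \<in> I" for z
    proof -
     have "max ?l (min ?u z) = max ?l (min ?u ?u)" using h that by auto
     then show ?thesis by (simp add: pB_def psi_def)
    qed
    then show ?thesis by (intro exI[of _ "[:pB i ?u:]"]) auto
   qed
  qed
  then obtain q where "degree q <= k + 2" "\<forall>z\<in>I. pB i z = poly q z" by blast
  then show ?thesis unfolding restricts_into_def Pz_def
   by (intro bexI[of _ "poly q"]) (auto simp: AE_lebesgue_on_iff[OF I_borel[OF I]])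
 qed
 then show ?thesis unfolding piecewise_def using H by blast
qed

end

section \<open>A stress field with prescribed divergence\<close>

context mesh3
begin

definition "Jn m = Z \<times> {..m::nat}"

lemma Jn: "finite (Jn m)" "i \<in> Jn m ==> fst i \<in> Z"
 using Zfin by (auto simp: Jn_def)

lemma Om: "open Om" "bounded Om" "Om \<in> sets borel"
 using cyl_open[OF U(1) Uz(3)] cyl_bounded[OF U(2) Uz(2)] by (auto intro: borel_open)

lemma bb_ext: "bb V f ==> bb V g ==> bb V (\<lambda>q. ext (f q) (g q))"
proof -
 assume f: "bb V f" and g: "bb V g"
 show ?thesis
 proof (rule bb_vecI)
  fix i :: 3
  show "bb V (\<lambda>x. ext (f x) (g x) $ i)"
   using exhaust_3[of i] bb_vec_nth[OF f, of 1] bb_vec_nth[OF f, of 2] g by auto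
 qed
qed

lemma ind_ext: "indicator Om (ext p z) = (indicator U p * indicator {a<..<b} z :: ennreal)"
 by (simp add: indicator_def ext_cyl)

lemma sq_meas: "bb Om f ==> (\<lambda>q. indicator Om q * ennreal ((norm (f q))\<^sup>2)) \<in> borel_measurable borel"
proof -
 assume f: "bb Om f"
 have "(\<lambda>q. ennreal ((norm (f q))\<^sup>2)) \<in> borel_measurable borel"
  using bb_borel[OF f] by (intro measurable_compose[OF _ measurable_ennreal]) simp
 then show ?thesis using Om(3) by (intro borel_measurable_times_ennreal borel_measurable_indicator) auto
qed

lemma AE_pw_U:
 assumes "poly_family m w"
 shows "AE p in lborel. p ~: U --> pw w p = 0"
 using negligible_AE_lborel[OF fr]
proof eventually_elim
 case (elim p)
 show ?case
 proof
  assume "p ~: U"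
  then have "p ~: closure U" using elim U(1) by (simp add: frontier_def interior_open)
  then show "pw w p = 0" using cov pw_zero[of p w] by simp
 qed
qed

definition K3 :: real where "K3 = max Kc ((b - a)\<^sup>2)"

context
 fixes W :: "real set \<times> nat => (real^2) set => real^2 => real^2"
  and w3 :: "real set \<times> nat => (real^2) set => real^2 => real"
 assumes W: "!!i. fst i \<in> Z ==> poly_family (k + 1) (W i)"
  and w3: "!!i T. fst i \<in> Z ==> T \<in> X ==> w3 i T \<in> Pxy k"
begin

definition gg :: "real set \<times> nat => real^2 => real" where
 "gg i p = (\<Sum>T\<in>X. indicator (iT T) p * w3 i T p)"

definition Pf :: "real^3 => real^2^2" where
 "Pf q = (\<Sum>i\<in>Jn k. dB i (q $ 3) *\<^sub>R S (W i) (xy q))"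

definition t33 :: "real^3 => real" where
 "t33 q = (\<Sum>i\<in>Jn (k + 1). pB i (q $ 3) * gg i (xy q))"

text \<open>A pair \<open>i\<close> consists of an interval and a power of the height. \<open>W\<close> and \<open>w3\<close> are the plane coefficients of the data, and \<open>vt\<close>
  is a Borel version of the data assembled from them.\<close>

definition vt :: "real^3 => real^3" where
 "vt q = ext (\<Sum>i\<in>Jn k. dB i (q $ 3) *\<^sub>R pw (W i) (xy q)) (\<Sum>i\<in>Jn (k + 1). dB i (q $ 3) * gg i (xy q))"

definition tau :: "real^3 => real^3^3" where
 "tau q = vector [ext (Pf q $ 1) 0, ext (Pf q $ 2) 0, ext 0 (t33 q)]"

lemma vt_eq:
 assumes "T \<in> X" "p \<in> iT T" "I \<in> Z" "z \<in> {lo I<..<hi I}"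
 shows "vt (ext p z) = ext (\<Sum>j\<le>k. z ^ j *\<^sub>R W (I, j) T p) (\<Sum>j\<le>k + 1. z ^ j * w3 (I, j) T p)"
proof -
 have g: "gg i p = w3 i T p" for i using sum_iT[OF assms(1,2), of "\<lambda>T. w3 i T p"] by (simp add: gg_def)
 have "(\<Sum>i\<in>Jn (k + 1). dB i z *\<^sub>R gg i p) = (\<Sum>j\<le>k + 1. z ^ j *\<^sub>R gg (I, j) p)"
  unfolding Jn_def by (rule dB_sum[OF assms(3,4)]) simp
 moreover have "(\<Sum>i\<in>Jn k. dB i z *\<^sub>R pw (W i) p) = (\<Sum>j\<le>k. z ^ j *\<^sub>R pw (W (I, j)) p)"
  unfolding Jn_def by (rule dB_sum[OF assms(3,4)]) simp
 ultimately show ?thesis unfolding vt_def by (simp only: ext_simps g pw_eq[OF assms(1,2)] real_scaleR_def)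
qed

lemma gg_bb: "fst i \<in> Z ==> bb U (gg i)"
 unfolding gg_def[abs_def]
 by (intro bb_sum bb_mult bbI[where B=1] borel_measurable_indicator dlip_bb(1)[OF dlip_Pxy[OF w3 U(2), of _ _ 0]])
  (auto simp: indicator_def intro: borel_open itri_open)

lemma gg_piecewise: "fst i \<in> Z ==> gg i \<in> piecewise (L2 U) X (Pxy k)"
proof -
 assume i: "fst i \<in> Z"
 have "restricts_into (gg i) T (Pxy k)" if T: "T \<in> X" for T
 proof -
  have "AE p in lebesgue_on T. gg i p = w3 i T p"
   unfolding AE_lebesgue_on_iff[OF T_compact(2)[OF smp[OF T]]] using AE_iT
  proof eventually_elim
   case (elim p)
   show ?case
   proof
    assume "p \<in> T"
    then have "p \<in> iT T" using elim T by blast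
    then show "gg i p = w3 i T p" using sum_iT[OF T, of p "\<lambda>T. w3 i T p"] by (simp add: gg_def)
   qed
  qed
  then show ?thesis unfolding restricts_into_def using w3[OF i T] by blast
 qed
 then show ?thesis unfolding piecewise_def using bb_L2[OF gg_bb[OF i] U_borel U(2)] by blast
qed

lemma bb_Pf: "bb Om Pf"
 unfolding Pf_def[abs_def] using Jn(2)
 by (intro bb_sum bb_scaleR bb_lift(2)[OF _ bb_dB, where f="\<lambda>_::real^2. 0::real"] bb_lift(1)[OF bb_S bb_const[of _ "0::real"]] bb_const)

lemma bb_t33: "bb Om t33"
 unfolding t33_def[abs_def] using Jn(2)
 by (intro bb_sum bb_mult bb_lift(2)[OF _ dlip_bb(1)[OF dlip_pB], where f="\<lambda>_::real^2. 0::real"] bb_lift(1)[OF gg_bb bb_const[of _ "0::real"]] bb_const)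

lemma bb_vt: "bb Om vt"
proof -
 have "bb Om (\<lambda>q. \<Sum>i\<in>Jn k. dB i (q $ 3) *\<^sub>R pw (W i) (xy q))" using Jn(2)
  by (intro bb_sum bb_scaleR bb_lift(2)[OF _ bb_dB, where f="\<lambda>_::real^2. 0::real"] bb_lift(1)[OF bb_pw[OF W] bb_const[of _ "0::real"]] bb_const)
 moreover have "bb Om (\<lambda>q. \<Sum>i\<in>Jn (k + 1). dB i (q $ 3) * gg i (xy q))" using Jn(2)
  by (intro bb_sum bb_mult bb_lift(2)[OF _ bb_dB, where f="\<lambda>_::real^2. 0::real"] bb_lift(1)[OF gg_bb bb_const[of _ "0::real"]] bb_const)
 ultimately show ?thesis unfolding vt_def[abs_def] by (rule bb_ext)
qed

lemma tau_simps: "tau q $ 1 = ext (Pf q $ 1) 0" "tau q $ 2 = ext (Pf q $ 2) 0" "tau q $ 3 = ext 0 (t33 q)"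
 by (simp_all add: tau_def)

lemma bb_tau: "bb Om tau"
proof (rule bb_vecI)
 fix i :: 3
 show "bb Om (\<lambda>x. tau x $ i)"
  using exhaust_3[of i] bb_ext[OF bb_vec_nth[OF bb_Pf, of 1] bb_const[of _ "0::real"]] bb_ext[OF bb_vec_nth[OF bb_Pf, of 2] bb_const[of _ "0::real"]]
   bb_ext[OF bb_const[of _ "0::real^2"] bb_t33] by (auto simp: tau_simps)
qed

lemma tau_row:
 "\<exists>g. flux Om (\<lambda>q. tau q $ i) g \<and> (AE q in lborel. q \<in> Om --> g q = vt q $ i)"
proof -
 have pl: "\<exists>g. flux Om (\<lambda>q. ext (Pf q $ l) 0) g \<and> (AE q in lborel. q \<in> Om --> g q = (\<Sum>i\<in>Jn k. dB i (q $ 3) * pw (W i) (xy q) $ l))" for l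
 proof (intro exI conjI)
  let ?g = "\<lambda>q::real^3. \<Sum>i\<in>Jn k. dB i (q $ 3) * divS (W i) l (xy q)"
  have "flux Om (\<lambda>q. \<Sum>i\<in>Jn k. dB i (q $ 3) *\<^sub>R ext (S (W i) (xy q) $ l) 0) ?g"
   using Jn(2) by (intro flux_sum flux_lift[OF flux_S bb_dB])
  moreover have "(\<Sum>i\<in>Jn k. dB i (q $ 3) *\<^sub>R ext (S (W i) (xy q) $ l) 0) = ext (Pf q $ l) 0" for q
   by (simp add: vec_eq_iff forall_3 Pf_def)
  ultimately show "flux Om (\<lambda>q. ext (Pf q $ l) 0) ?g" by simp
  have "AE p in lborel. \<forall>i\<in>Jn k. p \<in> U --> divS (W i) l p = pw (W i) p $ l"
   using Jn divS_pw[OF W] by (subst AE_finite_all) auto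
  from AE_xy[OF this] show "AE q in lborel. q \<in> Om --> ?g q = (\<Sum>i\<in>Jn k. dB i (q $ 3) * pw (W i) (xy q) $ l)"
   by eventually_elim (auto simp: cyl_def intro!: sum.cong)
 qed
 have vp: "vt q $ 1 = (\<Sum>i\<in>Jn k. dB i (q $ 3) * pw (W i) (xy q) $ 1)" "vt q $ 2 = (\<Sum>i\<in>Jn k. dB i (q $ 3) * pw (W i) (xy q) $ 2)" for q
  by (simp_all add: vt_def)
 have e3: "flux Om (\<lambda>q. ext 0 (t33 q)) (\<lambda>q. vt q $ 3)"
 proof -
  have "flux Om (\<lambda>q. \<Sum>i\<in>Jn (k + 1). (pB i (q $ 3) * gg i (xy q)) *\<^sub>R axis 3 1) (\<lambda>q. \<Sum>i\<in>Jn (k + 1). dB i (q $ 3) * gg i (xy q))"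
   using Jn(2) by (intro flux_sum flux.flux_atom dlip_lift_z[OF dlip_pB gg_bb])
  moreover have "(\<Sum>i\<in>Jn (k + 1). (pB i (q $ 3) * gg i (xy q)) *\<^sub>R axis 3 1) = ext 0 (t33 q)" for q
   by (simp add: vec_eq_iff forall_3 t33_def axis_def)
  ultimately show ?thesis by (simp add: vt_def)
 qed
 show ?thesis using exhaust_3[of i]
 proof (elim disjE)
  assume "i = 1" then show ?thesis using pl[of 1] by (simp add: tau_simps vp)
 next
  assume "i = 2" then show ?thesis using pl[of 2] by (simp add: tau_simps vp)
 next
  assume "i = 3" then show ?thesis using e3 by (auto simp: tau_simps)
 qed
qed

lemma tau_div: "is_weak_row_div Om tau vt"
 unfolding is_weak_row_div_def
proof
 fix i
 obtain g where "flux Om (\<lambda>q. tau q $ i) g" "AE q in lborel. q \<in> Om --> g q = vt q $ i" using tau_row[of i] by blast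
 then show "is_weak_div Om (\<lambda>q. tau q $ i) (\<lambda>q. vt q $ i)"
  by (intro flux_weak_div[OF _ Om(1) bb_borel[OF bb_vec_nth[OF bb_vt]]])
qed

lemma tau_Sigma: "tau \<in> Sigma_h k U {a<..<b} X Z"
proof -
 have "transpose (tau q) = tau q" for q
  using Pf_def S_sym
  by (simp add: transpose_def vec_eq_iff forall_3 tau_simps Pf_def S_sym[of _ _ 2 1])
 then have sv: "tau \<in> sym_valued Om" unfolding sym_valued_def by simp
 have plane: "(\<lambda>p. vector [vector [tau p $ 1 $ 1, tau p $ 1 $ 2], vector [tau p $ 2 $ 1, tau p $ 2 $ 2]])
    \<in> tensor Om (H_h (k + 2) U X) (piecewise (L2 {a<..<b}) Z (Pz k))"
 proof (rule tensorI[where J="Jn k" and a="\<lambda>i. S (W i)" and b=dB])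
  have "vector [vector [tau p $ 1 $ 1, tau p $ 1 $ 2], vector [tau p $ 2 $ 1, tau p $ 2 $ 2]] = Pf p" for p
   by (simp add: vec_eq_iff forall_2 tau_simps)
  then show "AE p in lebesgue_on Om. vector [vector [tau p $ 1 $ 1, tau p $ 1 $ 2], vector [tau p $ 2 $ 1, tau p $ 2 $ 2]]
   = (\<Sum>i\<in>Jn k. dB i (p $ 3) *\<^sub>R S (W i) (xy p))" by (simp add: Pf_def)
  show "S (W i) \<in> H_h (k + 2) U X" if "i \<in> Jn k" for i using S_H_h[OF W] Jn(2)[OF that] by blast
  show "dB i \<in> piecewise (L2 {a<..<b}) Z (Pz k)" if "i \<in> Jn k" for i using dB_piecewise that unfolding Jn_def by blast
 qed (rule Jn)
 have mixed: "(\<lambda>p. vector [tau p $ 1 $ 3, tau p $ 2 $ 3]) \<in> tensor Om (BDM (k + 1) U X) (piecewise (H1 {a<..<b}) Z (Pz (k + 1)))"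
 proof (rule tensorI[where J="{} :: nat set" and a="\<lambda>_ _. 0" and b="\<lambda>_ _. 0"])
  have "vector [tau p $ 1 $ 3, tau p $ 2 $ 3] = (0 :: real^2)" for p
   by (simp add: vec_eq_iff forall_2 tau_simps)
  then show "AE p in lebesgue_on Om. (vector [tau p $ 1 $ 3, tau p $ 2 $ 3] :: real^2) = (\<Sum>i\<in>({}::nat set). (\<lambda>_ _. 0::real) i (p $ 3) *\<^sub>R (\<lambda>_ _. 0) i (xy p))" by simp
 qed auto
 have vert: "(\<lambda>p. tau p $ 3 $ 3) \<in> tensor Om (piecewise (L2 U) X (Pxy k)) (piecewise (H1 {a<..<b}) Z (Pz (k + 2)))"
 proof (rule tensorI[where J="Jn (k + 1)" and a=gg and b=pB])
  show "AE p in lebesgue_on Om. tau p $ 3 $ 3 = (\<Sum>i\<in>Jn (k + 1). pB i (p $ 3) *\<^sub>R gg i (xy p))" by (simp add: tau_simps t33_def)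
  show "gg i \<in> piecewise (L2 U) X (Pxy k)" if "i \<in> Jn (k + 1)" for i using gg_piecewise Jn(2)[OF that] by blast
  show "pB i \<in> piecewise (H1 {a<..<b}) Z (Pz (k + 2))" if "i \<in> Jn (k + 1)" for i using pB_piecewise that unfolding Jn_def by blast
 qed (rule Jn)
 show ?thesis unfolding Sigma_h_def
  using bb_L2[OF bb_tau Om(3,2)] sv plane mixed vert by (intro CollectI conjI IntI)
qed

text \<open>At a fixed height the block is the image under \<open>S\<close> of the horizontal data at that height, by linearity. The plane estimate is
  integrated over the height.\<close>

lemma Pf_bound:
 "(\<integral>\<^sup>+q. indicator Om q * ennreal ((norm (Pf q))\<^sup>2) \<partial>lborel) <= ennreal Kc * (\<integral>\<^sup>+q. indicator Om q * ennreal ((norm (xy (vt q)))\<^sup>2) \<partial>lborel)"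
proof -
 have bx: "bb Om (\<lambda>q. xy (vt q))"
 proof (rule bb_vecI)
  fix i :: 2 show "bb Om (\<lambda>q. xy (vt q) $ i)"
   using exhaust_2[of i] bb_vec_nth[OF bb_vt, of 1] bb_vec_nth[OF bb_vt, of 2] by auto
 qed
 note m1 = sq_meas[OF bb_Pf] and m2 = sq_meas[OF bx]
 have m3: "(\<lambda>q. ennreal Kc * (indicator Om q * ennreal ((norm (xy (vt q)))\<^sup>2))) \<in> borel_measurable borel"
  by (rule borel_measurable_times_ennreal[OF borel_measurable_const m2])
 have "(\<integral>\<^sup>+q. indicator Om q * ennreal ((norm (Pf q))\<^sup>2) \<partial>lborel)
   = (\<integral>\<^sup>+z. (\<integral>\<^sup>+p. indicator Om (ext p z) * ennreal ((norm (Pf (ext p z)))\<^sup>2) \<partial>lborel) \<partial>lborel)"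
  by (rule nn_integral_ext(1)[OF m1])
 also have "... <= (\<integral>\<^sup>+z. (\<integral>\<^sup>+p. ennreal Kc * (indicator Om (ext p z) * ennreal ((norm (xy (vt (ext p z))))\<^sup>2)) \<partial>lborel) \<partial>lborel)"
 proof (rule nn_integral_mono)
  fix z :: real
  show "(\<integral>\<^sup>+p. indicator Om (ext p z) * ennreal ((norm (Pf (ext p z)))\<^sup>2) \<partial>lborel)
    <= (\<integral>\<^sup>+p. ennreal Kc * (indicator Om (ext p z) * ennreal ((norm (xy (vt (ext p z))))\<^sup>2)) \<partial>lborel)"
  proof (cases "z \<in> {a<..<b}")
   case False
   then show ?thesis by (simp add: ind_ext)
  next
   case True
   let ?w = "lc (Jn k) (\<lambda>i. dB i z) W"
   have Wi: "poly_family (k + 1) (W i)" if "i \<in> Jn k" for i using W Jn(2)[OF that] by blast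
   have pf: "poly_family (k + 1) ?w" by (rule poly_family_lc[OF Jn(1) Wi])
   have s: "Pf (ext p z) = S ?w p" for p
   proof -
    have "Pf (ext p z) = (\<Sum>i\<in>Jn k. dB i z *\<^sub>R S (W i) p)" by (simp add: Pf_def)
    also have "... = S ?w p" by (rule S_lc[where J="Jn k" and W=W, OF Jn(1), symmetric]) (rule Wi)
    finally show ?thesis .
   qed
   have v: "xy (vt (ext p z)) = pw ?w p" for p unfolding vt_def pw_lc by simp
   note ipw = integrable_pw_sq(2)[OF pf] and isb = S_bound(1)[OF pf]
   have "(\<integral>\<^sup>+p. indicator Om (ext p z) * ennreal ((norm (Pf (ext p z)))\<^sup>2) \<partial>lborel) <= (\<integral>\<^sup>+p. ennreal ((norm (S ?w p))\<^sup>2) \<partial>lborel)"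
    unfolding s by (intro nn_integral_mono) (simp add: indicator_def)
   also have "... = ennreal (LINT p|lborel. (norm (S ?w p))\<^sup>2)" by (rule nn_integral_eq_integral[OF isb]) simp
   also have "... <= ennreal (LINT p|lborel. Kc * (norm (pw ?w p))\<^sup>2)" using S_bound(2)[OF pf] by (intro ennreal_leI) simp
   also have "... = (\<integral>\<^sup>+p. ennreal (Kc * (norm (pw ?w p))\<^sup>2) \<partial>lborel)"
    using ipw Kc0 by (intro nn_integral_eq_integral[symmetric]) auto
   also have "... = (\<integral>\<^sup>+p. ennreal Kc * (indicator Om (ext p z) * ennreal ((norm (xy (vt (ext p z))))\<^sup>2)) \<partial>lborel)"
   proof (rule nn_integral_cong_AE)
    show "AE p in lborel. ennreal (Kc * (norm (pw ?w p))\<^sup>2) = ennreal Kc * (indicator Om (ext p z) * ennreal ((norm (xy (vt (ext p z))))\<^sup>2))"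
     using AE_pw_U[OF pf]
    proof eventually_elim
     case (elim p)
     then show ?case unfolding v ind_ext using True Kc0 by (cases "p \<in> U") (simp_all add: ennreal_mult)
    qed
   qed
   finally show ?thesis .
  qed
 qed
 also have "... = (\<integral>\<^sup>+q. ennreal Kc * (indicator Om q * ennreal ((norm (xy (vt q)))\<^sup>2)) \<partial>lborel)"
  by (rule nn_integral_ext(1)[OF m3, symmetric])
 also have "... = ennreal Kc * (\<integral>\<^sup>+q. indicator Om q * ennreal ((norm (xy (vt q)))\<^sup>2) \<partial>lborel)"
  using m2 by (intro nn_integral_cmult) simp
 finally show ?thesis .
qed

text \<open>On each vertical line \<open>t33\<close> is the integral of the vertical data from the bottom, so the Cauchy--Schwarz inequality on an interval of
  length \<open>b - a\<close> applies.\<close>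

lemma t33_bound:
 "(\<integral>\<^sup>+q. indicator Om q * ennreal ((norm (t33 q))\<^sup>2) \<partial>lborel) <= ennreal ((b - a)\<^sup>2) * (\<integral>\<^sup>+q. indicator Om q * ennreal ((norm (vt q $ 3))\<^sup>2) \<partial>lborel)"
proof -
 note m1 = sq_meas[OF bb_t33] and m2 = sq_meas[OF bb_vec_nth[OF bb_vt, of 3]]
 have m3: "(\<lambda>q. ennreal ((b - a)\<^sup>2) * (indicator Om q * ennreal ((norm (vt q $ 3))\<^sup>2))) \<in> borel_measurable borel"
  by (rule borel_measurable_times_ennreal[OF borel_measurable_const m2])
 have "(\<integral>\<^sup>+q. indicator Om q * ennreal ((norm (t33 q))\<^sup>2) \<partial>lborel)
   = (\<integral>\<^sup>+p. (\<integral>\<^sup>+z. indicator Om (ext p z) * ennreal ((norm (t33 (ext p z)))\<^sup>2) \<partial>lborel) \<partial>lborel)"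
  by (rule nn_integral_ext(2)[OF m1])
 also have "... <= (\<integral>\<^sup>+p. (\<integral>\<^sup>+z. ennreal ((b - a)\<^sup>2) * (indicator Om (ext p z) * ennreal ((norm (vt (ext p z) $ 3))\<^sup>2)) \<partial>lborel) \<partial>lborel)"
 proof (rule nn_integral_mono)
  fix p :: "real^2"
  show "(\<integral>\<^sup>+z. indicator Om (ext p z) * ennreal ((norm (t33 (ext p z)))\<^sup>2) \<partial>lborel)
   <= (\<integral>\<^sup>+z. ennreal ((b - a)\<^sup>2) * (indicator Om (ext p z) * ennreal ((norm (vt (ext p z) $ 3))\<^sup>2)) \<partial>lborel)"
  proof (cases "p \<in> U")
   case False
   then show ?thesis by (simp add: ind_ext)
  next
   case True
   define f where "f s = (\<Sum>i\<in>Jn (k + 1). dB i s * gg i p)" for s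
   have v: "vt (ext p z) $ 3 = f z" for z by (simp add: vt_def f_def)
   have fb: "bb UNIV f" unfolding f_def[abs_def] using Jn(2) by (intro bb_sum bb_mult bb_dB bb_const)
   then obtain B where B: "!!s. \<bar>f s\<bar> <= B" and fm: "f \<in> borel_measurable borel" unfolding bb_def by auto
   have f0: "f s = 0" if "s ~: {a<..<b}" for s using that Jn(2) dB_outside by (simp add: f_def)
   have if1: "integrable lborel (\<lambda>s. g s * f s)" if g: "g \<in> borel_measurable borel" "!!s. \<bar>g s\<bar> <= B'" for g :: "real => real" and B'
   proof -
    have "integrable lborel (\<lambda>s. indicator {a<..<b} s *\<^sub>R (g s * f s))"
    proof (rule bounded_borel_integrable[OF _ Uz(1,2), where B="B' * B"])
     show "(\<lambda>s. g s * f s) \<in> borel_measurable borel" using g(1) fm by (intro borel_measurable_times)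
     show "norm (g s * f s) <= B' * B" for s
      using g(2)[of s] B[of s] by (simp add: abs_mult mult_mono)
    qed
    moreover have "(\<lambda>s. indicator {a<..<b} s *\<^sub>R (g s * f s)) = (\<lambda>s. g s * f s)" using f0 by (auto simp: indicator_def fun_eq_iff)
    ultimately show ?thesis by simp
   qed
   have f2: "integrable lborel (\<lambda>s. (f s)\<^sup>2)" using if1[OF fm B] by (simp add: power2_eq_square)
   let ?F = "LINT s|lborel. (f s)\<^sup>2"
   have F0: "0 <= ?F" by (rule Bochner_Integration.integral_nonneg) simp
   have t: "(t33 (ext p z))\<^sup>2 <= (b - a) * ?F" if z: "z \<in> {a<..<b}" for z
   proof -
    let ?u = "indicator {a..z} :: real => real"
    have ipd: "integrable lborel (\<lambda>s. ?u s * (dB i s * gg i p))" if i: "i \<in> Jn (k + 1)" for i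
    proof -
     have fi: "fst i \<in> Z" using Jn(2)[OF i] .
     obtain N where N: "!!s. \<bar>dB i s\<bar> <= N" "dB i \<in> borel_measurable borel" using bb_dB[OF fi, of UNIV] unfolding bb_def by auto
     have "integrable lborel (\<lambda>s. indicator {a..z} s *\<^sub>R (dB i s * gg i p))"
     proof (rule bounded_borel_integrable[where B="N * \<bar>gg i p\<bar>"])
      show "(\<lambda>s. dB i s * gg i p) \<in> borel_measurable borel" using N(2) by simp
      show "norm (dB i s * gg i p) <= N * \<bar>gg i p\<bar>" for s using N(1)[of s] by (simp add: abs_mult mult_right_mono)
     qed auto
     then show ?thesis by simp
    qed
    have "t33 (ext p z) = (\<Sum>i\<in>Jn (k + 1). LINT s|lborel. ?u s * (dB i s * gg i p))"
     unfolding t33_def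
    proof (intro sum.cong refl)
     fix i assume i: "i \<in> Jn (k + 1)"
     have "pB i z = (LINT s|lborel. ?u s * dB i s)"
      unfolding pB_def dB_def using lohi[OF Jn(2)[OF i]] by (intro psi_integral)
     then show "pB i (ext p z $ 3) * gg i (xy (ext p z)) = (LINT s|lborel. ?u s * (dB i s * gg i p))"
      by (simp flip: mult.assoc)
    qed
    also have "... = (LINT s|lborel. (\<Sum>i\<in>Jn (k + 1). ?u s * (dB i s * gg i p)))"
     using ipd by (rule Bochner_Integration.integral_sum[symmetric])
    also have "... = (LINT s|lborel. ?u s * f s)" by (simp add: f_def sum_distrib_left)
    finally have t: "t33 (ext p z) = (LINT s|lborel. ?u s * f s)" .
    have usq: "(?u s)\<^sup>2 = ?u s" for s by (simp add: indicator_def)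
    have iu: "integrable lborel ?u"
     using bounded_borel_integrable[of "\<lambda>_. 1::real" "{a..z}" 1] by simp
    have "(LINT s|lborel. ?u s * f s)\<^sup>2 <= (LINT s|lborel. (?u s)\<^sup>2) * ?F"
    proof (rule integral_Cauchy_Schwarz)
     show "integrable lborel (\<lambda>s. (?u s)\<^sup>2)" unfolding usq by (rule iu)
     show "integrable lborel (\<lambda>s. ?u s * f s)" by (rule if1[where B'=1]) (auto simp: indicator_def)
    qed (rule f2)
    also have "(LINT s|lborel. (?u s)\<^sup>2) = z - a" unfolding usq using z by simp
    also have "(z - a) * ?F <= (b - a) * ?F" using z F0 by (intro mult_right_mono) auto
    finally show ?thesis unfolding t .
   qed
   have "(\<integral>\<^sup>+z. indicator Om (ext p z) * ennreal ((norm (t33 (ext p z)))\<^sup>2) \<partial>lborel) <= (\<integral>\<^sup>+z. ennreal ((b - a) * ?F) * indicator {a<..<b} z \<partial>lborel)"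
   proof (rule nn_integral_mono)
    fix z :: real
    show "indicator Om (ext p z) * ennreal ((norm (t33 (ext p z)))\<^sup>2) <= ennreal ((b - a) * ?F) * indicator {a<..<b} z"
     using t[of z] True by (cases "z \<in> {a<..<b}") (simp_all add: ind_ext ennreal_leI)
   qed
   also have "... = ennreal ((b - a) * ?F) * ennreal (b - a)" using ab by (subst nn_integral_cmult_indicator) auto
   also have "... = ennreal ((b - a)\<^sup>2) * ennreal ?F"
    using ab F0 by (simp add: ennreal_mult power2_eq_square mult_ac)
   also have "ennreal ?F = (\<integral>\<^sup>+z. ennreal ((f z)\<^sup>2) \<partial>lborel)" by (rule nn_integral_eq_integral[OF f2, symmetric]) simp
   also have "ennreal ((b - a)\<^sup>2) * (\<integral>\<^sup>+z. ennreal ((f z)\<^sup>2) \<partial>lborel) = (\<integral>\<^sup>+z. ennreal ((b - a)\<^sup>2) * ennreal ((f z)\<^sup>2) \<partial>lborel)"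
    using fm by (intro nn_integral_cmult[symmetric]) simp
   also have "... = (\<integral>\<^sup>+z. ennreal ((b - a)\<^sup>2) * (indicator Om (ext p z) * ennreal ((norm (vt (ext p z) $ 3))\<^sup>2)) \<partial>lborel)"
   proof (rule nn_integral_cong)
    fix z :: real
    show "ennreal ((b - a)\<^sup>2) * ennreal ((f z)\<^sup>2) = ennreal ((b - a)\<^sup>2) * (indicator Om (ext p z) * ennreal ((norm (vt (ext p z) $ 3))\<^sup>2))"
     using f0[of z] True by (cases "z \<in> {a<..<b}") (simp_all add: ind_ext v)
   qed
   finally show ?thesis .
  qed
 qed
 also have "... = (\<integral>\<^sup>+q. ennreal ((b - a)\<^sup>2) * (indicator Om q * ennreal ((norm (vt q $ 3))\<^sup>2)) \<partial>lborel)"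
  by (rule nn_integral_ext(2)[OF m3, symmetric])
 also have "... = ennreal ((b - a)\<^sup>2) * (\<integral>\<^sup>+q. indicator Om q * ennreal ((norm (vt q $ 3))\<^sup>2) \<partial>lborel)"
  using m2 by (intro nn_integral_cmult) simp
 finally show ?thesis .
qed

lemma tau_norm: "(L2_norm Om tau)\<^sup>2 <= K3 * (L2_norm Om vt)\<^sup>2"
proof -
 have K: "0 <= K3" using Kc0 by (simp add: K3_def)
 have bx: "bb Om (\<lambda>q. xy (vt q))"
 proof (rule bb_vecI)
  fix i :: 2 show "bb Om (\<lambda>q. xy (vt q) $ i)"
   using exhaust_2[of i] bb_vec_nth[OF bb_vt, of 1] bb_vec_nth[OF bb_vt, of 2] by auto
 qed
 have nt: "(norm (tau q))\<^sup>2 = (norm (Pf q))\<^sup>2 + (norm (t33 q))\<^sup>2" for q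
  unfolding power2_norm_eq_inner by (simp add: inner_vec_def[of "tau q"] sum_3 tau_simps inner_vec_def[of "Pf q"] sum_2 inner_vec_def[of "ext _ _"] inner_vec_def[of "Pf q $ _"])
 have nv: "(norm (vt q))\<^sup>2 = (norm (xy (vt q)))\<^sup>2 + (norm (vt q $ 3))\<^sup>2" for q
  using norm_ext[of "xy (vt q)" "vt q $ 3"] by simp
 let ?I = "\<lambda>f::real^3 => real. \<integral>\<^sup>+q. indicator Om q * ennreal ((f q)\<^sup>2) \<partial>lborel"
 have split: "(\<integral>\<^sup>+q. indicator Om q * ennreal ((norm (f q))\<^sup>2 + (norm (g q))\<^sup>2) \<partial>lborel) = ?I (\<lambda>q. norm (f q)) + ?I (\<lambda>q. norm (g q))"
  if "bb Om f" "bb Om g" for f :: "real^3 => 'x::euclidean_space" and g :: "real^3 => 'y::euclidean_space"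
  using sq_meas[OF that(1)] sq_meas[OF that(2)] by (simp add: distrib_left nn_integral_add)
 have "ennreal ((L2_norm Om tau)\<^sup>2) = ?I (\<lambda>q. norm (Pf q)) + ?I (\<lambda>q. norm (t33 q))"
  unfolding L2_norm_sq[OF bb_tau Om(1,2)] nt by (rule split[OF bb_Pf bb_t33])
 also have "... <= ennreal Kc * ?I (\<lambda>q. norm (xy (vt q))) + ennreal ((b - a)\<^sup>2) * ?I (\<lambda>q. norm (vt q $ 3))"
  by (intro add_mono Pf_bound t33_bound)
 also have "... <= ennreal K3 * ?I (\<lambda>q. norm (xy (vt q))) + ennreal K3 * ?I (\<lambda>q. norm (vt q $ 3))"
  by (intro add_mono mult_right_mono ennreal_leI) (auto simp: K3_def)
 also have "... = ennreal K3 * (\<integral>\<^sup>+q. indicator Om q * ennreal ((norm (vt q))\<^sup>2) \<partial>lborel)"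
  unfolding nv split[OF bx bb_vec_nth[OF bb_vt, of 3]] by (simp add: distrib_left)
 also have "... = ennreal (K3 * (L2_norm Om vt)\<^sup>2)"
  unfolding L2_norm_sq[OF bb_vt Om(1,2), symmetric] using K by (simp add: ennreal_mult)
 finally show ?thesis using K by (subst (asm) ennreal_le_iff) auto
qed

end

end

section \<open>The inf-sup condition\<close>

lemma choice2: "\<forall>x\<in>A. \<forall>y\<in>B. \<exists>w. R x y w ==> \<exists>f. \<forall>x\<in>A. \<forall>y\<in>B. R x y (f x y)"
 by metis

lemma L2_norm_cong:
 assumes "f \<in> L2 U" "g \<in> L2 U" "AE x in lebesgue_on U. f x = g x"
 shows "L2_norm U f = L2_norm U g"
proof -
 have "(LINT x|lebesgue_on U. (norm (f x))\<^sup>2) = (LINT x|lebesgue_on U. (norm (g x))\<^sup>2)"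
 proof (rule integral_cong_AE)
  show "(\<lambda>x. (norm (f x))\<^sup>2) \<in> borel_measurable (lebesgue_on U)" "(\<lambda>x. (norm (g x))\<^sup>2) \<in> borel_measurable (lebesgue_on U)"
   using assms(1,2) by (auto simp: L2_def)
  show "AE x in lebesgue_on U. (norm (f x))\<^sup>2 = (norm (g x))\<^sup>2" using assms(3) by eventually_elim simp
 qed
 then show ?thesis by (simp add: L2_norm_def)
qed

lemma L2_norm_square: "(L2_norm U f)\<^sup>2 = (LINT x|lebesgue_on U. (norm (f x))\<^sup>2)"
 unfolding L2_norm_def by (rule real_sqrt_pow2) (rule Bochner_Integration.integral_nonneg, simp)

lemma L2_norm_nonneg: "0 <= L2_norm U f"
 unfolding L2_norm_def by (rule real_sqrt_ge_zero) (rule Bochner_Integration.integral_nonneg, simp)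

lemma L2_norm_zero_iff:
 assumes "f \<in> L2 U"
 shows "L2_norm U f = 0 \<longleftrightarrow> (AE x in lebesgue_on U. f x = 0)"
proof -
 have i: "integrable (lebesgue_on U) (\<lambda>x. (norm (f x))\<^sup>2)" using assms by (simp add: L2_def)
 have "L2_norm U f = 0 \<longleftrightarrow> (LINT x|lebesgue_on U. (norm (f x))\<^sup>2) = 0" by (simp add: L2_norm_def)
 also have "... \<longleftrightarrow> (AE x in lebesgue_on U. (norm (f x))\<^sup>2 = 0)" by (rule integral_nonneg_eq_0_iff_AE[OF i]) simp
 finally show ?thesis by simp
qed

text \<open>Guarantees that a field whose divergence does not vanish is itself admissible in the supremum.\<close>

lemma row_div_zero:
 assumes U: "open U" "bounded U" and z: "AE x in lebesgue_on U. \<tau> x = 0"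
 shows "AE x in lebesgue_on U. row_div U \<tau> x = 0"
proof -
 have w: "is_weak_row_div U \<tau> (\<lambda>_. 0)"
  unfolding is_weak_row_div_def is_weak_div_def
 proof (intro allI ballI)
  fix i \<phi>
  have "(LINT x|lebesgue_on U. \<tau> x $ i \<bullet> grad \<phi> x) = 0"
   by (rule integral_eq_zero_AE) (use z in eventually_elim, simp)
  then show "(LINT x|lebesgue_on U. \<tau> x $ i \<bullet> grad \<phi> x) = - (LINT x|lebesgue_on U. (0::real^'a) $ i * \<phi> x)" by simp
 qed
 show ?thesis using row_div_eq(1)[OF U bb_L2[OF bb_const borel_open[OF U(1)] U(2)] w] by simp
qed

text \<open>On every prism the data are expanded in powers of the height. The coefficients are plane polynomials, to which the
  construction of \<open>tau\<close> applies.\<close>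

lemma (in mesh3) V_h_solution:
 assumes v: "v \<in> V_h k U {a<..<b} X Z"
 shows "\<exists>\<tau>\<in>Sigma_h k U {a<..<b} X Z. row_div Om \<tau> \<in> L2 Om \<and> (AE x in lebesgue_on Om. row_div Om \<tau> x = v x)
  \<and> (L2_norm Om \<tau>)\<^sup>2 <= K3 * (L2_norm Om v)\<^sup>2"
proof -
 have vL: "v \<in> L2 Om" using v unfolding V_h_def by blast
 have t: "(\<lambda>p. v p $ 1) \<in> tensor (cyl T I) (Pxy (k + 1)) (Pz k)" "(\<lambda>p. v p $ 2) \<in> tensor (cyl T I) (Pxy (k + 1)) (Pz k)"
  "(\<lambda>p. v p $ 3) \<in> tensor (cyl T I) (Pxy k) (Pz (k + 1))" if "T \<in> X" "I \<in> Z" for T I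
 proof -
  have "cyl T I \<in> prisms X Z" unfolding prisms_def using that by blast
  then show "(\<lambda>p. v p $ 1) \<in> tensor (cyl T I) (Pxy (k + 1)) (Pz k)" "(\<lambda>p. v p $ 2) \<in> tensor (cyl T I) (Pxy (k + 1)) (Pz k)"
   "(\<lambda>p. v p $ 3) \<in> tensor (cyl T I) (Pxy k) (Pz (k + 1))" using v unfolding V_h_def by blast+
 qed
 obtain w1 where w1: "\<forall>T\<in>X. \<forall>I\<in>Z. (\<forall>j. w1 T I j \<in> Pxy (k + 1)) \<and> (AE p in lebesgue_on (cyl T I). v p $ 1 = (\<Sum>j\<le>k. p $ 3 ^ j * w1 T I j (xy p)))"
  using choice2[of X Z "\<lambda>T I w. (\<forall>j. w j \<in> Pxy (k + 1)) \<and> (AE p in lebesgue_on (cyl T I). v p $ 1 = (\<Sum>j\<le>k. p $ 3 ^ j * w j (xy p)))"]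
   tensor_poly[OF t(1)] by blast
 obtain w2 where w2: "\<forall>T\<in>X. \<forall>I\<in>Z. (\<forall>j. w2 T I j \<in> Pxy (k + 1)) \<and> (AE p in lebesgue_on (cyl T I). v p $ 2 = (\<Sum>j\<le>k. p $ 3 ^ j * w2 T I j (xy p)))"
  using choice2[of X Z "\<lambda>T I w. (\<forall>j. w j \<in> Pxy (k + 1)) \<and> (AE p in lebesgue_on (cyl T I). v p $ 2 = (\<Sum>j\<le>k. p $ 3 ^ j * w j (xy p)))"]
   tensor_poly[OF t(2)] by blast
 obtain w4 where w4: "\<forall>T\<in>X. \<forall>I\<in>Z. (\<forall>j. w4 T I j \<in> Pxy k) \<and> (AE p in lebesgue_on (cyl T I). v p $ 3 = (\<Sum>j\<le>k + 1. p $ 3 ^ j * w4 T I j (xy p)))"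
  using choice2[of X Z "\<lambda>T I w. (\<forall>j. w j \<in> Pxy k) \<and> (AE p in lebesgue_on (cyl T I). v p $ 3 = (\<Sum>j\<le>k + 1. p $ 3 ^ j * w j (xy p)))"]
   tensor_poly[OF t(3)] by blast
 define W :: "real set \<times> nat => (real^2) set => real^2 => real^2" where "W i T p = vector [w1 T (fst i) (snd i) p, w2 T (fst i) (snd i) p]" for i T p
 define w3 where "w3 i T = w4 T (fst i) (snd i)" for i :: "real set \<times> nat" and T
 have W: "poly_family (k + 1) (W i)" if "fst i \<in> Z" for i
  unfolding poly_family_def
 proof (intro ballI allI)
  fix T l assume T: "T \<in> X"
  show "(\<lambda>p. W i T p $ l) \<in> Pxy (k + 1)" using exhaust_2[of l] w1 w2 T that by (auto simp: W_def)
 qed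
 have w3: "w3 i T \<in> Pxy k" if "fst i \<in> Z" "T \<in> X" for i T using w4 that by (simp add: w3_def)
 note cx = W w3
 have ae3: "AE q in lborel. \<forall>T\<in>X. \<forall>I\<in>Z. q \<in> cyl T I --> v q $ 1 = (\<Sum>j\<le>k. q $ 3 ^ j * w1 T I j (xy q))
   \<and> v q $ 2 = (\<Sum>j\<le>k. q $ 3 ^ j * w2 T I j (xy q)) \<and> v q $ 3 = (\<Sum>j\<le>k + 1. q $ 3 ^ j * w4 T I j (xy q))"
 proof (subst AE_finite_all[OF fin], rule ballI, subst AE_finite_all[OF Zfin], rule ballI)
  fix T I assume TI: "T \<in> X" "I \<in> Z"
  have cb: "cyl T I \<in> sets borel" by (rule cyl_borel[OF T_compact(2)[OF smp[OF TI(1)]] I_borel[OF TI(2)]])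
  have "AE q in lborel. q \<in> cyl T I --> v q $ 1 = (\<Sum>j\<le>k. q $ 3 ^ j * w1 T I j (xy q))"
   "AE q in lborel. q \<in> cyl T I --> v q $ 2 = (\<Sum>j\<le>k. q $ 3 ^ j * w2 T I j (xy q))"
   "AE q in lborel. q \<in> cyl T I --> v q $ 3 = (\<Sum>j\<le>k + 1. q $ 3 ^ j * w4 T I j (xy q))"
   unfolding AE_lebesgue_on_iff[OF cb, symmetric] using w1 w2 w4 TI by blast+
  then show "AE q in lborel. q \<in> cyl T I --> v q $ 1 = (\<Sum>j\<le>k. q $ 3 ^ j * w1 T I j (xy q))
   \<and> v q $ 2 = (\<Sum>j\<le>k. q $ 3 ^ j * w2 T I j (xy q)) \<and> v q $ 3 = (\<Sum>j\<le>k + 1. q $ 3 ^ j * w4 T I j (xy q))"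
   by eventually_elim blast
 qed
 have "AE q in lborel. q \<in> Om --> v q = vt W w3 q"
  using AE_xy[OF AE_iT] AE_z[OF AE_Z] ae3
 proof eventually_elim
  case (elim q)
  show ?case
  proof
   assume q: "q \<in> Om"
   obtain T where T: "T \<in> X" "xy q \<in> T" using q U_sub by (auto simp: cyl_def)
   have "q $ 3 \<in> \<Union>Z" using q Zcov closure_subset[of "{a<..<b}"] by (auto simp: cyl_def)
   then obtain I where I: "I \<in> Z" "q $ 3 \<in> I" by blast
   have i: "xy q \<in> iT T" "q $ 3 \<in> {lo I<..<hi I}" using elim(1,2) T I by blast+
   have "q \<in> cyl T I" using T I by (simp add: cyl_def)
   then have vq: "v q $ 1 = (\<Sum>j\<le>k. q $ 3 ^ j * w1 T I j (xy q))" "v q $ 2 = (\<Sum>j\<le>k. q $ 3 ^ j * w2 T I j (xy q))"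
    "v q $ 3 = (\<Sum>j\<le>k + 1. q $ 3 ^ j * w4 T I j (xy q))" using elim(3) T(1) I(1) by blast+
   have "vt W w3 (ext (xy q) (q $ 3)) = ext (\<Sum>j\<le>k. (q $ 3) ^ j *\<^sub>R W (I, j) T (xy q)) (\<Sum>j\<le>k + 1. (q $ 3) ^ j * w3 (I, j) T (xy q))"
    by (rule vt_eq[OF cx T(1) i(1) I(1) i(2)])
   then show "v q = vt W w3 q" using vq by (simp add: vec_eq_iff forall_3 W_def w3_def)
  qed
 qed
 then have ae: "AE q in lebesgue_on Om. v q = vt W w3 q" unfolding AE_lebesgue_on_iff[OF Om(3)] .
 have bv: "bb Om (vt W w3)" by (rule bb_vt[OF cx])
 have vtL: "vt W w3 \<in> L2 Om" by (rule bb_L2[OF bv Om(3,2)])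
 have wd: "is_weak_row_div Om (tau W w3) (vt W w3)" by (rule tau_div[OF cx])
 note r = row_div_eq[OF Om(1,2) vtL wd]
 have "AE x in lebesgue_on Om. row_div Om (tau W w3) x = v x" using r(1) ae by eventually_elim simp
 moreover have "(L2_norm Om (tau W w3))\<^sup>2 <= K3 * (L2_norm Om v)\<^sup>2"
  using tau_norm[OF cx] L2_norm_cong[OF vL vtL ae] by simp
 moreover have "tau W w3 \<in> Sigma_h k U {a<..<b} X Z" by (rule tau_Sigma[OF cx])
 ultimately show ?thesis using r(2) by blast
qed

theorem theorem3p4:
  fixes k :: nat and Uxy :: "(real^2) set" and a b \<gamma> :: real
  assumes "k \<ge> 1" and "polygon Uxy" and "a < b"
  defines "Uz \<equiv> {a<..<b}"
  defines "\<Omega> \<equiv> cyl Uxy Uz"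
  shows "\<exists>C>0. \<forall>X Z. prism_mesh \<gamma> Uxy Uz X Z \<longrightarrow>
    (\<forall>v\<in>V_h k Uxy Uz X Z.
      (SUP \<tau>\<in>{\<tau> \<in> Sigma_h k Uxy Uz X Z. \<not> (AE p in lebesgue_on \<Omega>. \<tau> p = 0)}.
        ereal (L2_inner \<Omega> (row_div \<Omega> \<tau>) v / Hdiv_norm \<Omega> \<tau>))
      \<ge> ereal (C * L2_norm \<Omega> v))"
proof -
 note P = polygon_props[OF assms(2)]
 obtain C Q where C: "C \<ge> 0" and Q: "bubble_inverse k C Q" using bubble_inverse_exists by blast
 obtain L where L: "L > 0" "!!p i. p \<in> closure Uxy ==> \<bar>p $ i\<bar> <= L"
 proof -
  obtain B where B: "B > 0" "\<forall>p\<in>closure Uxy. norm p <= B"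
   using bounded_closure[OF P(2)] unfolding bounded_pos by blast
  show thesis by (rule that[of B]) (use B component_le_norm_cart order_trans in blast)+
 qed
 let ?K = "max (mesh3.K3 (max \<gamma> 1) L C a b) 0"
 let ?c = "1 / sqrt (?K + 1)"
 have c: "?c > 0" by (simp add: add_nonneg_pos)
 have Om: "open \<Omega>" "bounded \<Omega>" "\<Omega> ~= {}"
 proof -
  show "open \<Omega>" "bounded \<Omega>" unfolding \<Omega>_def Uz_def using P by (auto intro: cyl_open cyl_bounded)
  obtain p where "p \<in> Uxy" using P(4) by blast
  then have "ext p ((a + b) / 2) \<in> \<Omega>" using assms(3) by (simp add: \<Omega>_def Uz_def ext_cyl)
  then show "\<Omega> ~= {}" by blast
 qed
 have Ob: "\<Omega> \<in> sets borel" using Om by simp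
 have "ereal (?c * L2_norm \<Omega> v) <= (SUP \<tau>\<in>{\<tau> \<in> Sigma_h k Uxy Uz X Z. \<not> (AE p in lebesgue_on \<Omega>. \<tau> p = 0)}.
    ereal (L2_inner \<Omega> (row_div \<Omega> \<tau>) v / Hdiv_norm \<Omega> \<tau>))"
  if pm: "prism_mesh \<gamma> Uxy Uz X Z" and v: "v \<in> V_h k Uxy Uz X Z" for X Z v
 proof -
  obtain h where m2: "mesh2 X Uxy h (max \<gamma> 1) L"
   using prism_mesh_mesh2[OF pm[unfolded Uz_def] assms(3) P(1-3) L] by blast
  have m3: "mesh3 X Uxy h (max \<gamma> 1) L k C Q Z a b"
   using pm assms(1,3) C Q m2
   by (intro mesh3.intro bubble_mesh.intro mesh3_axioms.intro bubble_mesh_axioms.intro)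
    (auto simp: prism_mesh_def partition_into_def Uz_def)
  have sol: "\<exists>\<tau>\<in>Sigma_h k Uxy Uz X Z. row_div \<Omega> \<tau> \<in> L2 \<Omega> \<and> (AE x in lebesgue_on \<Omega>. row_div \<Omega> \<tau> x = v x)
   \<and> (L2_norm \<Omega> \<tau>)\<^sup>2 <= mesh3.K3 (max \<gamma> 1) L C a b * (L2_norm \<Omega> v)\<^sup>2" if "v \<in> V_h k Uxy Uz X Z" for v
   using mesh3.V_h_solution[OF m3] that unfolding \<Omega>_def Uz_def by blast
  have vL: "v \<in> L2 \<Omega>" using v unfolding V_h_def \<Omega>_def by blast
  let ?N = "L2_norm \<Omega> v"
  show ?thesis
  proof (cases "?N = 0")
   case False
   then have N: "?N > 0" using L2_norm_nonneg[of \<Omega> v] by simp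
   obtain \<tau> where \<tau>: "\<tau> \<in> Sigma_h k Uxy Uz X Z" "row_div \<Omega> \<tau> \<in> L2 \<Omega>" "AE x in lebesgue_on \<Omega>. row_div \<Omega> \<tau> x = v x"
    and bd: "(L2_norm \<Omega> \<tau>)\<^sup>2 <= mesh3.K3 (max \<gamma> 1) L C a b * ?N\<^sup>2" using sol[OF v] by blast
   have nz: "\<not> (AE p in lebesgue_on \<Omega>. \<tau> p = 0)"
   proof
    assume "AE p in lebesgue_on \<Omega>. \<tau> p = 0"
    from row_div_zero[OF Om(1,2) this] \<tau>(3) have "AE x in lebesgue_on \<Omega>. v x = 0" by eventually_elim simp
    then show False using L2_norm_zero_iff[OF vL] False by blast
   qed
   have inn: "L2_inner \<Omega> (row_div \<Omega> \<tau>) v = ?N\<^sup>2"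
    unfolding L2_inner_def L2_norm_square
   proof (rule integral_cong_AE)
    show "(\<lambda>x. row_div \<Omega> \<tau> x \<bullet> v x) \<in> borel_measurable (lebesgue_on \<Omega>)" using \<tau>(2) vL by (auto simp: L2_def)
    show "(\<lambda>x. (norm (v x))\<^sup>2) \<in> borel_measurable (lebesgue_on \<Omega>)" using vL by (auto simp: L2_def)
    show "AE x in lebesgue_on \<Omega>. row_div \<Omega> \<tau> x \<bullet> v x = (norm (v x))\<^sup>2"
     using \<tau>(3) by eventually_elim (simp add: power2_norm_eq_inner)
   qed
   have rn: "L2_norm \<Omega> (row_div \<Omega> \<tau>) = ?N" by (rule L2_norm_cong[OF \<tau>(2) vL \<tau>(3)])
   have "(L2_norm \<Omega> \<tau>)\<^sup>2 + ?N\<^sup>2 <= (?K + 1) * ?N\<^sup>2"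
    using bd mult_right_mono[of "mesh3.K3 (max \<gamma> 1) L C a b" ?K "?N\<^sup>2"] by (simp add: distrib_right)
   then have "Hdiv_norm \<Omega> \<tau> <= sqrt ((?K + 1) * ?N\<^sup>2)" unfolding Hdiv_norm_def rn by (rule real_sqrt_le_mono)
   also have "... = sqrt (?K + 1) * ?N" using N by (simp add: real_sqrt_mult)
   finally have H: "Hdiv_norm \<Omega> \<tau> <= sqrt (?K + 1) * ?N" .
   have "sqrt (?N\<^sup>2) <= Hdiv_norm \<Omega> \<tau>" unfolding Hdiv_norm_def rn by (rule real_sqrt_le_mono) simp
   then have H0: "Hdiv_norm \<Omega> \<tau> > 0" using N by simp
   have s: "sqrt (?K + 1) > 0" by (simp add: add_nonneg_pos)
   have "?c * ?N = ?N\<^sup>2 / (sqrt (?K + 1) * ?N)" using N s by (simp add: power2_eq_square)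
   also have "... <= ?N\<^sup>2 / Hdiv_norm \<Omega> \<tau>" using H H0 by (intro divide_left_mono) (auto intro: mult_pos_pos N s)
   finally have "ereal (?c * ?N) <= ereal (L2_inner \<Omega> (row_div \<Omega> \<tau>) v / Hdiv_norm \<Omega> \<tau>)" unfolding inn by simp
   then show ?thesis using \<tau>(1) nz by (intro SUP_upper2[of \<tau>]) auto
  next
   case True
   \<comment> \<open>If \<open>v\<close> vanishes, so does the quotient for every field; solving for the constant unit field along the last axis supplies one that is admissible.\<close>
   let ?e = "\<lambda>_::real^3. axis 3 1 :: real^3"
   have "?e \<in> V_h k Uxy Uz X Z" unfolding V_h_def
   proof (intro CollectI conjI ballI)
    show "?e \<in> L2 (cyl Uxy Uz)" using bb_L2[OF bb_const Ob Om(2)] unfolding \<Omega>_def .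
    fix K
    show "(\<lambda>p. ?e p $ 1) \<in> tensor K (Pxy (k + 1)) (Pz k)" "(\<lambda>p. ?e p $ 2) \<in> tensor K (Pxy (k + 1)) (Pz k)"
     by (rule tensorI[where J="{} :: nat set" and a="\<lambda>_ _. 0" and b="\<lambda>_ _. 0"]; simp add: axis_def)+
    have "poly 1 \<in> Pz (k + 1)" unfolding Pz_def by fastforce
    then have "(\<lambda>_. 1) \<in> Pz (k + 1)" by (simp add: poly_1[abs_def] fun_eq_iff)
    then show "(\<lambda>p. ?e p $ 3) \<in> tensor K (Pxy k) (Pz (k + 1))"
     by (intro tensorI[where J="{0} :: nat set" and a="\<lambda>_ _. 1" and b="\<lambda>_ _. 1"]) (simp_all add: axis_def Pxy_const)
   qed
   from sol[OF this] obtain \<tau> where \<tau>: "\<tau> \<in> Sigma_h k Uxy Uz X Z" "AE x in lebesgue_on \<Omega>. row_div \<Omega> \<tau> x = ?e x" by blast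
   have nz: "\<not> (AE p in lebesgue_on \<Omega>. \<tau> p = 0)"
   proof
    assume "AE p in lebesgue_on \<Omega>. \<tau> p = 0"
    from row_div_zero[OF Om(1,2) this] \<tau>(2) have "AE x in lebesgue_on \<Omega>. False"
     by eventually_elim (simp add: axis_eq_0_iff)
    then have "AE x in lborel. x ~: \<Omega>" unfolding AE_lebesgue_on_iff[OF Ob] by simp
    then have "\<Omega> \<in> null_sets lborel" using Ob by (simp add: AE_iff_null_sets)
    then have "negligible \<Omega>" by (simp add: negligible_iff_null_sets null_sets_completionI)
    then show False using open_not_negligible Om by blast
   qed
   have "AE x in lebesgue_on \<Omega>. v x = 0" using L2_norm_zero_iff[OF vL] True by blast
   then have "AE x in lebesgue_on \<Omega>. row_div \<Omega> \<tau> x \<bullet> v x = 0" by eventually_elim simp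
   then have "L2_inner \<Omega> (row_div \<Omega> \<tau>) v = 0" unfolding L2_inner_def by (rule integral_eq_zero_AE)
   then show ?thesis using \<tau>(1) nz True by (intro SUP_upper2[of \<tau>]) auto
  qed
 qed
 then show ?thesis using c by (intro exI[of _ ?c]) blast
qed

end
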